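(* Assume the standing setting below and the condition (SS$_\kappa$) below for some $\kappa\ge C_{2C}$ (the constant of the Lipschitz assumption on $H_\theta$ with $R=2C$). Assume moreover that one of the following two sets of hypotheses holds: (A) $p\mapsto H_\theta(x,p)$ is convex for all $x\in\mathbb T^N$, $\theta\in\Theta$, and for all $x\in\Sigma$, $0<\lambda<1$, $p\ne q$: $\inf_{\theta}\{\lambda H_\theta(x,p)+(1-\lambda)H_\theta(x,q)-H_\theta(x,\lambda p+(1-\lambda)q)\}>0$; (B) there exists $\mu_0>1$ such that, with $c$ the ergodic constant, $H_\theta(x,\mu p)-\mu H_\theta(x,p)\ge(1-\mu)c$ for all $(x,p)$, $\theta$, $1<\mu<\mu_0$; and there is a (possibly empty) compact $K\subset\Sigma$ with $H_\theta(x,p)\ge c$ on $K\times\mathbb R^N$ for all $\theta$, and $\inf_\theta\{H_\theta(x,\mu p)-\mu H_\theta(x,p)\}>(1-\mu)c$ for all $x\in\Sigma$ with $\operatorname{dist}(x,K)\neq0$, all $p\ne0$, all $1<\mu\le\mu_0$. Then $u(\cdot,t)+ct$ converges uniformly on $\mathbb T^N$, as $t\to+\infty$, to a viscosity solution of (S).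
   Context: Standing setting. $\mathbb T^N=\mathbb R^N/\mathbb Z^N$ is the flat torus, $\Theta$ is a metric space and $C>0$ is a fixed constant. For every $\theta\in\Theta$: $\sigma_\theta\in W^{1,\infty}(\mathbb T^N;\mathcal M_N)$ with $|\sigma_\theta|,|D\sigma_\theta|\le C$, and $A_\theta=\sigma_\theta\sigma_\theta^T$; $H_\theta\in W^{1,\infty}_{\rm loc}(\mathbb T^N\times\mathbb R^N)$ with $|H_\theta(x,0)|\le C$, and for every $R>0$ there is $C_R>0$ independent of $\theta$ with $|H_\theta(x,p)-H_\theta(y,q)|\le C_R(|x-y|+|p-q|)$ for $x,y\in\mathbb T^N$, $|p|,|q|\le R$. Consider (E) $u_t+\sup_{\theta\in\Theta}\{-\mathrm{tr}(A_\theta(x)D^2u)+H_\theta(x,Du)\}=0$ in $\mathbb T^N\times(0,\infty)$, $u(x,0)=u_0(x)$; (E$_\lambda$) $\lambda v_\lambda+\sup_{\theta}\{-\mathrm{tr}(A_\theta(x)D^2v_\lambda)+H_\theta(x,Dv_\lambda)\}=0$ in $\mathbb T^N$, $\lambda>0$; (S) $\sup_{\theta}\{-\mathrm{tr}(A_\theta(x)D^2v)+H_\theta(x,Dv)\}=c$ in $\mathbb T^N$. It is assumed that there exist viscosity solutions $u\in C(\mathbb T^N\times[0,\infty))$ of (E) and $v_\lambda\in C(\mathbb T^N)$ of (E$_\lambda$) for all $\lambda>0$ with $|u(x,t)-u(y,t)|,|v_\lambda(x)-v_\lambda(y)|\le C|x-y|$ for all $x,y,t,\lambda$. Under this assumption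 a comparison principle holds, there is a unique constant $c\in\mathbb R$ (the ergodic constant) for which (S) has a solution $v\in W^{1,\infty}(\mathbb T^N)$ (with Lipschitz constant at most $C$), and $u+ct$ is bounded. All solutions are viscosity solutions. $\Sigma:=\{x\in\mathbb T^N: A_\theta(x)=0\text{ for all }\theta\in\Theta\}$. Lifts: $\pi:\mathbb R^N\to\mathbb T^N$ is the projection; $\tilde\Sigma=\pi^{-1}(\Sigma)$, $\tilde\sigma_\theta=\sigma_\theta\circ\pi$, $\tilde A_\theta=\tilde\sigma_\theta\tilde\sigma_\theta^T$, $\tilde\Sigma_\delta=\{\tilde x\in\mathbb R^N:\operatorname{dist}(\tilde x,\tilde\Sigma)\le\delta\}$. Condition (SS$_\kappa$): for every $\delta>0$ there exist $\tilde\psi_\delta\in C^2(\mathbb R^N)$ and a bounded open set $\Omega_\delta\subset\mathbb R^N$ with $[0,1]^N\subset\Omega_\delta$, $\tilde\psi_\delta\le0$ in $\Omega_\delta$, $\tilde\psi_\delta\ge0$ in $\mathbb R^N\setminus\Omega_\delta$, and $\inf_{\theta\in\Theta}\{-\mathrm{tr}(\tilde A_\theta(\tilde x)D^2\tilde\psi_\delta(\tilde x))\}-\kappa|D\tilde\psi_\delta(\tilde x)|>0$ for all $\tilde x\in\tilde\Sigma_\delta^C\cap\Omega_\delta$. *)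

theory Defs
  imports "HOL-Analysis.Analysis"
begin

text \<open>The torus T^N is represented through Z^N-periodic lifts to R^N = real^'n
  (N = CARD('n)). All objects below are lifts.\<close>

definition int_vec :: "real^'n \<Rightarrow> bool" where
  "int_vec k \<longleftrightarrow> (\<forall>i. k $ i \<in> \<int>)"

definition periodic_fun :: "(real^'n \<Rightarrow> 'b) \<Rightarrow> bool" where
  "periodic_fun f \<longleftrightarrow> (\<forall>x k. int_vec k \<longrightarrow> f (x + k) = f x)"

definition periodic_set :: "(real^'n) set \<Rightarrow> bool" where
  "periodic_set S \<longleftrightarrow> (\<forall>x k. int_vec k \<longrightarrow> (x + k \<in> S \<longleftrightarrow> x \<in> S))"

definition C2_fun :: "(real^'n \<Rightarrow> real) \<Rightarrow> (real^'n \<Rightarrow> real^'n) \<Rightarrow> (real^'n \<Rightarrow> real^'n^'n) \<Rightarrow> bool" where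
  "C2_fun phi Dphi D2phi \<longleftrightarrow>
     (\<forall>x. (phi has_derivative (\<lambda>h. Dphi x \<bullet> h)) (at x)) \<and>
     (\<forall>x. (Dphi has_derivative (\<lambda>h. D2phi x *v h)) (at x)) \<and>
     continuous_on UNIV D2phi"

definition C21_fun :: "(real^'n \<Rightarrow> real \<Rightarrow> real) \<Rightarrow> (real^'n \<Rightarrow> real \<Rightarrow> real)
     \<Rightarrow> (real^'n \<Rightarrow> real \<Rightarrow> real^'n) \<Rightarrow> (real^'n \<Rightarrow> real \<Rightarrow> real^'n^'n) \<Rightarrow> bool" where
  "C21_fun phi phit Dphi D2phi \<longleftrightarrow>
     (\<forall>x t. ((\<lambda>(y, s). phi y s) has_derivative (\<lambda>(h, r). Dphi x t \<bullet> h + phit x t * r)) (at (x, t))) \<and>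
     continuous_on UNIV (\<lambda>(x, t). phit x t) \<and>
     continuous_on UNIV (\<lambda>(x, t). Dphi x t) \<and>
     (\<forall>x t. ((\<lambda>y. Dphi y t) has_derivative (\<lambda>h. D2phi x t *v h)) (at x)) \<and>
     continuous_on UNIV (\<lambda>(x, t). D2phi x t)"

definition visc_sol :: "(real^'n \<Rightarrow> real \<Rightarrow> real^'n \<Rightarrow> real^'n^'n \<Rightarrow> real) \<Rightarrow> (real^'n \<Rightarrow> real) \<Rightarrow> bool" where
  "visc_sol F v \<longleftrightarrow> continuous_on UNIV v \<and>
     (\<forall>phi Dphi D2phi x0. C2_fun phi Dphi D2phi \<longrightarrow>
        (\<exists>e>0. \<forall>y\<in>ball x0 e. v y - phi y \<le> v x0 - phi x0) \<longrightarrow>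
        F x0 (v x0) (Dphi x0) (D2phi x0) \<le> 0) \<and>
     (\<forall>phi Dphi D2phi x0. C2_fun phi Dphi D2phi \<longrightarrow>
        (\<exists>e>0. \<forall>y\<in>ball x0 e. v y - phi y \<ge> v x0 - phi x0) \<longrightarrow>
        F x0 (v x0) (Dphi x0) (D2phi x0) \<ge> 0)"

definition visc_sol_evol :: "(real^'n \<Rightarrow> real^'n \<Rightarrow> real^'n^'n \<Rightarrow> real) \<Rightarrow> (real^'n \<Rightarrow> real \<Rightarrow> real) \<Rightarrow> bool" where
  "visc_sol_evol F u \<longleftrightarrow> continuous_on (UNIV \<times> {0<..}) (\<lambda>(x, t). u x t) \<and>
     (\<forall>phi phit Dphi D2phi x0 t0. C21_fun phi phit Dphi D2phi \<longrightarrow> t0 > 0 \<longrightarrow>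
        (\<exists>e>0. \<forall>y s. dist (y, s) (x0, t0) < e \<longrightarrow> s > 0 \<longrightarrow> u y s - phi y s \<le> u x0 t0 - phi x0 t0) \<longrightarrow>
        phit x0 t0 + F x0 (Dphi x0 t0) (D2phi x0 t0) \<le> 0) \<and>
     (\<forall>phi phit Dphi D2phi x0 t0. C21_fun phi phit Dphi D2phi \<longrightarrow> t0 > 0 \<longrightarrow>
        (\<exists>e>0. \<forall>y s. dist (y, s) (x0, t0) < e \<longrightarrow> s > 0 \<longrightarrow> u y s - phi y s \<ge> u x0 t0 - phi x0 t0) \<longrightarrow>
        phit x0 t0 + F x0 (Dphi x0 t0) (D2phi x0 t0) \<ge> 0)"

definition diffmat :: "('th \<Rightarrow> real^'n \<Rightarrow> real^'n^'n) \<Rightarrow> 'th \<Rightarrow> real^'n \<Rightarrow> real^'n^'n" where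
  "diffmat \<sigma> \<theta> x = \<sigma> \<theta> x ** transpose (\<sigma> \<theta> x)"

definition bellman :: "('th \<Rightarrow> real^'n \<Rightarrow> real^'n^'n) \<Rightarrow> ('th \<Rightarrow> real^'n \<Rightarrow> real^'n \<Rightarrow> real)
     \<Rightarrow> real^'n \<Rightarrow> real^'n \<Rightarrow> real^'n^'n \<Rightarrow> real" where
  "bellman \<sigma> H x p X = (SUP \<theta>. - trace (diffmat \<sigma> \<theta> x ** X) + H \<theta> x p)"

definition degen_set :: "('th \<Rightarrow> real^'n \<Rightarrow> real^'n^'n) \<Rightarrow> (real^'n) set" where
  "degen_set \<sigma> = {x. \<forall>\<theta>. diffmat \<sigma> \<theta> x = 0}"

text \<open>Sigma~_delta = {x. dist(x, Sigma~) <= delta}, with dist to the empty set = +oo.\<close>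
definition degen_nbhd :: "('th \<Rightarrow> real^'n \<Rightarrow> real^'n^'n) \<Rightarrow> real \<Rightarrow> (real^'n) set" where
  "degen_nbhd \<sigma> \<delta> = {x. degen_set \<sigma> \<noteq> {} \<and> infdist x (degen_set \<sigma>) \<le> \<delta>}"

definition SS_cond :: "('th \<Rightarrow> real^'n \<Rightarrow> real^'n^'n) \<Rightarrow> real \<Rightarrow> bool" where
  "SS_cond \<sigma> \<kappa> \<longleftrightarrow> (\<forall>\<delta>>0. \<exists>\<psi> D\<psi> D2\<psi> (\<Omega>::(real^'n) set).
      C2_fun \<psi> D\<psi> D2\<psi> \<and> open \<Omega> \<and> bounded \<Omega> \<and>
      {x. \<forall>i. 0 \<le> x $ i \<and> x $ i \<le> 1} \<subseteq> \<Omega> \<and>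
      (\<forall>x\<in>\<Omega>. \<psi> x \<le> 0) \<and> (\<forall>x\<in>- \<Omega>. \<psi> x \<ge> 0) \<and>
      (\<forall>x\<in>- degen_nbhd \<sigma> \<delta> \<inter> \<Omega>.
         (INF \<theta>. - trace (diffmat \<sigma> \<theta> x ** D2\<psi> x)) - \<kappa> * norm (D\<psi> x) > 0))"

end

theory Submission
  imports Defs "HOL-Complex_Analysis.Great_Picard"
begin

text \<open>
  Put \<open>U x t = u x t + c * t\<close>. Comparison with a stationary solution makes \<open>U\<close> bounded and shows that the distance
  of \<open>U\<close> to a stationary solution does not increase, so it suffices to find times along which \<open>U\<close> is nearly
  stationary on a fixed time window: by compactness a limit there is a stationary solution, which then attracts \<open>U\<close>.
  Such times exist as soon as \<open>U\<close> is almost nonincreasing in time over bounded time spans.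

  Almost monotonicity is read off from the upper limit \<open>M x\<close>, as \<open>s \<ge> t\<close> tend to infinity, of
  \<open>U x t - \<mu> * U x s + (\<mu> - 1) * v x - \<eta> * (s - t)\<close>, where \<open>\<mu> > 1\<close> is close to 1 and \<open>v\<close> is the upper limit of \<open>U\<close> in
  case (A) and \<open>0\<close> in case (B). By (SS) a large maximum of \<open>M\<close> would be attained on the degenerate set; there the
  equation is first order after a strong localization, and the strictness of \<open>H\<close> (or, on \<open>K\<close>, the monotonicity of
  \<open>U\<close> in time) rules it out.

  The doubling of variables needs second-order jets at a maximum. Alexandrov's theorem is avoided: the second
  differences of a Lipschitz map are small in energy, so it is nearly affine at some small scale near some point of
  each bounded nonnegligible set. Applied to the proximal map of a semiconvex function this gives an approximate
  second-order expansion at a single scale, which a small quadratic correction turns into exact one-sided jets.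
\<close>

section \<open>Second differences of Lipschitz maps\<close>

text \<open>The factor \<open>\<mu> > 1\<close> is what lets the structure of \<open>H\<close> act.
  At a maximum the gradients are related by \<open>P = \<mu> Q - (\<mu> - 1) q\<close>, with
  \<open>Q\<close> from the later time and \<open>q\<close> from \<open>v\<close>: under convexity
  \<open>Q\<close> lies on the segment from \<open>P\<close> to \<open>q\<close>, and in case (B)
  \<open>q = 0\<close> and \<open>P = \<mu> Q\<close>. All jets have gradients bounded by
  \<open>C\<close>, so \<open>\<mu> \<le> 3/2\<close> bounds the combination by \<open>2C\<close>;
  this is how the Lipschitz constant of \<open>H\<close> for radius \<open>2C\<close> meets the
  gradient term in (SS). On the diagonal \<open>s = t\<close> the quantity under the upper limit is
  only of size \<open>\<mu> - 1\<close>. A maximum above this threshold lies at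
  \<open>s > t\<close>, where both equations can be used; the threshold disappears as \<mu> tends to
  1. The term with \<eta> confines \<open>s - t\<close> to a bounded interval and supplies the
  strictness when \<open>Q = q\<close>, where strict convexity says nothing. At a degenerate point
  two penalties compete: a strong one ties the points together, a weaker one ties them to that
  point. Diffusion and additional gradient both vanish if the weaker one also tends to infinity, but
  more slowly.\<close>

lemma integrable_compact_support:
  fixes g :: "'a::euclidean_space => real"
  assumes "continuous_on UNIV g" "\<And>x. norm x \<ge> K ==> g x = 0"
  shows "integrable lborel g"
proof -
  have "integrable lborel (\<lambda>x. indicator (cball 0 K) x *\<^sub>R g x)"
    by (rule borel_integrable_compact) (use assms(1) in \<open>auto intro: continuous_on_subset\<close>)
  moreover have "(\<lambda>x. indicator (cball 0 K) x *\<^sub>R g x) = g"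
    using assms(2) by (auto simp: indicator_def fun_eq_iff)
  ultimately show ?thesis by simp
qed

lemma integral_lborel_translation:
  fixes g :: "'a::euclidean_space => real"
  assumes "continuous_on UNIV g"
  shows "integral\<^sup>L lborel (\<lambda>x. g (x + a)) = integral\<^sup>L lborel g"
proof -
  have "integral\<^sup>L lborel g = integral\<^sup>L (distr lborel borel ((+) a)) g" by (simp add: lborel_distr_plus)
  also have "\<dots> = integral\<^sup>L lborel (\<lambda>x. g (a + x))"
    using assms by (intro integral_distr) (auto intro: borel_measurable_continuous_onI)
  finally show ?thesis by (simp add: add.commute)
qed

text \<open>By the parallelogram law the mean square difference quotient \<open>N h\<close>
  satisfies \<open>N (2 * h) = N h - S h / (4 * h\<^sup>2)\<close>. Along dyadic scales it is
  therefore monotone, and the Lipschitz bound makes it bounded; its increments, which up to the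
  factor 4 are the energies in question, tend to 0.\<close>

lemma second_difference_energy:
  fixes F :: "'a::euclidean_space => 'b::real_inner"
  assumes lip: "\<And>x y. norm (F x - F y) \<le> L * norm (x - y)"
    and supp: "\<And>x. norm x \<ge> K ==> F x = 0"
  shows "(\<lambda>k. (\<integral>x. (norm (F (x + (2 * (1/2)^k) *\<^sub>R v) - 2 *\<^sub>R F (x + ((1/2)^k) *\<^sub>R v) + F x))\<^sup>2 \<partial>lborel)
            / ((1/2)^k)\<^sup>2) \<longlonglongrightarrow> 0"
proof -
  have cF: "continuous_on UNIV F"
  proof -
    have "L * norm (x - y) \<le> \<bar>L\<bar> * dist x y" for x y :: 'a by (simp add: dist_norm mult_right_mono)
    then have "\<bar>L\<bar>-lipschitz_on UNIV F" by (intro lipschitz_onI) (use order_trans[OF lip] in \<open>auto simp: dist_norm\<close>)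
    then show ?thesis by (rule lipschitz_on_continuous_on)
  qed
  have cF2: "continuous_on UNIV (\<lambda>x. F (x + a))" for a by (rule continuous_on_compose2[OF cF]) (auto intro!: continuous_intros)
  define D where "D h = (\<lambda>x. F (x + h *\<^sub>R v) - F x)" for h
  define N where "N h = (\<integral>x. (norm (D h x))\<^sup>2 \<partial>lborel) / h\<^sup>2" for h
  define S where "S h = (\<integral>x. (norm (F (x + (2 * h) *\<^sub>R v) - 2 *\<^sub>R F (x + h *\<^sub>R v) + F x))\<^sup>2 \<partial>lborel)" for h
  have cD: "continuous_on UNIV (\<lambda>x. D h (x + a))" for h a
    unfolding D_def using cF2[of "a + h *\<^sub>R v"] cF2[of a] by (auto intro!: continuous_intros simp: add.assoc)
  have suppD: "D h x = 0" if "norm x \<ge> K + \<bar>h\<bar> * norm v" for h x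
  proof -
    have "norm x \<le> norm (x + h *\<^sub>R v) + norm (h *\<^sub>R v)"
      using norm_triangle_ineq4[of "x + h *\<^sub>R v" "h *\<^sub>R v"] by simp
    then have "norm (x + h *\<^sub>R v) \<ge> K" using that by simp
    moreover have "0 \<le> \<bar>h\<bar> * norm v" by simp
    with that have "norm x \<ge> K" by linarith
    ultimately show ?thesis by (simp add: D_def supp)
  qed
  have intD: "integrable lborel (\<lambda>x. (norm (D h (x + a)))\<^sup>2)" for h a
  proof (rule integrable_compact_support)
    show "continuous_on UNIV (\<lambda>x. (norm (D h (x + a)))\<^sup>2)"
      using cD[of h a] by (intro continuous_intros)
    show "(norm (D h (x + a)))\<^sup>2 = 0" if "norm x \<ge> K + \<bar>h\<bar> * norm v + norm a" for x
    proof -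
      have "norm x \<le> norm (x + a) + norm a" using norm_triangle_ineq4[of "x + a" a] by simp
      then show ?thesis using that suppD[of h "x + a"] by simp
    qed
  qed
  have split: "N (2 * h) = N h - S h / (4 * h\<^sup>2)" if "h \<noteq> 0" for h
  proof -
    define p where "p = D h"
    define q where "q = (\<lambda>x. D h (x + h *\<^sub>R v))"
    have sum: "D (2 * h) x = p x + q x" for x
      unfolding p_def q_def D_def by (simp add: add.assoc scaleR_add_left[symmetric])
    have diff: "F (x + (2 * h) *\<^sub>R v) - 2 *\<^sub>R F (x + h *\<^sub>R v) + F x = q x - p x" for x
      unfolding p_def q_def D_def by (simp add: add.assoc scaleR_add_left[symmetric] scaleR_2)
    have par: "(norm (q x - p x))\<^sup>2 = 2 * (norm (p x))\<^sup>2 + 2 * (norm (q x))\<^sup>2 - (norm (p x + q x))\<^sup>2" for x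
      by (simp add: power2_norm_eq_inner inner_diff inner_add inner_commute algebra_simps)
    have ip: "integrable lborel (\<lambda>x. (norm (p x))\<^sup>2)" using intD[of h 0] by (simp add: p_def)
    have iq: "integrable lborel (\<lambda>x. (norm (q x))\<^sup>2)" using intD[of h "h *\<^sub>R v"] by (simp add: q_def)
    have ipq: "integrable lborel (\<lambda>x. (norm (p x + q x))\<^sup>2)"
      using intD[of "2*h" 0] by (simp add: sum[symmetric])
    have tr: "(\<integral>x. (norm (q x))\<^sup>2 \<partial>lborel) = (\<integral>x. (norm (p x))\<^sup>2 \<partial>lborel)"
      unfolding p_def q_def by (rule integral_lborel_translation[of "\<lambda>x. (norm (D h x))\<^sup>2"])
         (use cD[of h 0] in \<open>auto intro!: continuous_intros\<close>)
    have "S h = 2 * (\<integral>x. (norm (p x))\<^sup>2 \<partial>lborel) + 2 * (\<integral>x. (norm (q x))\<^sup>2 \<partial>lborel)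
                 - (\<integral>x. (norm (p x + q x))\<^sup>2 \<partial>lborel)"
      unfolding S_def diff par using ip iq ipq by simp
    moreover have "(\<integral>x. (norm (p x))\<^sup>2 \<partial>lborel) = h\<^sup>2 * N h"
      using that by (simp add: N_def p_def)
    moreover have "(\<integral>x. (norm (p x + q x))\<^sup>2 \<partial>lborel) = 4 * h\<^sup>2 * N (2 * h)"
      using that by (simp add: N_def sum power_mult_distrib)
    ultimately have "S h = 4 * h\<^sup>2 * N h - 4 * h\<^sup>2 * N (2 * h)"
      using tr by simp
    then show ?thesis using that by (simp add: field_simps)
  qed
  define a where "a k = N ((1/2)^k)" for k :: nat
  have S0: "S h \<ge> 0" for h unfolding S_def by simp
  have mono: "incseq a"
  proof (rule incseq_SucI)
    fix k :: nat
    have "a k = N (2 * (1/2)^Suc k)" by (simp add: a_def)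
    also have "\<dots> = a (Suc k) - S ((1/2)^Suc k) / (4 * ((1/2)^Suc k)\<^sup>2)"
      using split[of "(1/2)^Suc k"] by (simp add: a_def)
    finally show "a k \<le> a (Suc k)" using S0[of "(1/2)^Suc k"] by simp
  qed
  define B where "B = (\<integral>x. indicator (cball (0::'a) (K + norm v)) x * (\<bar>L\<bar> * norm v)\<^sup>2 \<partial>lborel)"
  have bound: "a k \<le> B" for k
  proof -
    define h :: real where "h = (1/2)^k"
    have h: "0 < h" "h \<le> 1" by (auto simp: h_def power_le_one)
    have pw: "(norm (D h x))\<^sup>2 \<le> indicator (cball (0::'a) (K + norm v)) x * (\<bar>L\<bar> * norm v)\<^sup>2 * h\<^sup>2" for x
    proof (cases "norm x \<le> K + norm v")
      case True
      have "norm (D h x) \<le> \<bar>L\<bar> * norm v * h"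
      proof -
        have "norm (D h x) \<le> L * (h * norm v)"
          using lip[of "x + h *\<^sub>R v" x] h unfolding D_def by simp
        also have "\<dots> \<le> \<bar>L\<bar> * (h * norm v)" using h by (intro mult_right_mono) auto
        finally show ?thesis by (simp add: mult_ac)
      qed
      then have "(norm (D h x))\<^sup>2 \<le> (\<bar>L\<bar> * norm v * h)\<^sup>2" by (intro power_mono) auto
      then show ?thesis using True by (simp add: power_mult_distrib)
    next
      case False
      have "h * norm v \<le> norm v" using h by (simp add: mult_left_le_one_le)
      with False h have "D h x = 0" by (intro suppD) auto
      then show ?thesis by simp
    qed
    have ii: "integrable lborel (\<lambda>x. indicator (cball (0::'a) (K + norm v)) x * (\<bar>L\<bar> * norm v)\<^sup>2)"
      using borel_integrable_compact[of "cball (0::'a) (K + norm v)" "\<lambda>_. (\<bar>L\<bar> * norm v)\<^sup>2"] by simp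
    have "(\<integral>x. (norm (D h x))\<^sup>2 \<partial>lborel) \<le> B * h\<^sup>2"
      unfolding B_def integral_mult_left_zero[symmetric] by (rule integral_mono) (use intD[of h 0] ii pw in auto)
    moreover have "a k = (\<integral>x. (norm (D h x))\<^sup>2 \<partial>lborel) / h\<^sup>2"
      unfolding a_def N_def h_def ..
    ultimately show ?thesis using h by (simp add: pos_divide_le_eq)
  qed
  obtain l where l: "a \<longlonglongrightarrow> l"
    using incseq_convergent[OF mono] bound by blast
  \<comment> \<open>The recursion looks one dyadic step up, so at \<open>k = 0\<close> the
    predecessor is the quotient at scale 2, which is not a value of \<open>a\<close>.\<close>
  have "(\<lambda>k. 4 * (a k - (if k = 0 then N 2 else a (k - 1)))) \<longlonglongrightarrow> 0"
  proof -
    have "(\<lambda>k. 4 * (a (Suc k) - a k)) \<longlonglongrightarrow> 4 * (l - l)"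
      using LIMSEQ_Suc[OF l] l by (intro tendsto_intros)
    then show ?thesis by (subst filterlim_sequentially_Suc[symmetric]) simp
  qed
  moreover have "4 * (a k - (if k = 0 then N 2 else a (k - 1))) = S ((1/2)^k) / ((1/2)^k)\<^sup>2" for k
  proof -
    have e: "N (2 * (1/2)^k) = (if k = 0 then N 2 else a (k - 1))" by (cases k) (auto simp: a_def)
    show ?thesis using split[of "(1/2)^k"] unfolding e[symmetric] by (simp add: a_def)
  qed
  ultimately have "(\<lambda>k. S ((1/2)^k) / ((1/2)^k)\<^sup>2) \<longlonglongrightarrow> 0" by simp
  then show ?thesis unfolding S_def .
qed

lemma lipschitz_bound_continuous:
  fixes F :: "'a::real_normed_vector => 'b::real_normed_vector"
  assumes lip: "\<And>x y. norm (F x - F y) \<le> L * norm (x - y)"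
  shows "continuous_on A F"
proof -
  have "L * norm (x - y) \<le> \<bar>L\<bar> * dist x y" for x y :: 'a by (simp add: dist_norm mult_right_mono)
  then have "\<bar>L\<bar>-lipschitz_on A F" by (intro lipschitz_onI) (use order_trans[OF lip] in \<open>auto simp: dist_norm\<close>)
  then show ?thesis by (rule lipschitz_on_continuous_on)
qed

lemma continuous_shift:
  fixes F :: "'a::real_normed_vector => 'b::topological_space"
  assumes "continuous_on UNIV F" shows "continuous_on UNIV (\<lambda>x. F (x + a))"
  by (rule continuous_on_compose2[OF assms]) (auto intro!: continuous_intros)

lemma mixed_difference_integrable:
  fixes F :: "'a::euclidean_space => 'b::real_inner"
  assumes lip: "\<And>x y. norm (F x - F y) \<le> L * norm (x - y)"
    and supp: "\<And>x. norm x \<ge> K ==> F x = 0"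
  shows "integrable lborel (\<lambda>x. (norm (F (x + a) - F (x + b) - F (x + c) + F (x + d)))\<^sup>2)"
proof (rule integrable_compact_support)
  have cF: "continuous_on UNIV (\<lambda>x. F (x + e))" for e by (rule continuous_shift) (rule lipschitz_bound_continuous[OF lip])
  show "continuous_on UNIV (\<lambda>x. (norm (F (x + a) - F (x + b) - F (x + c) + F (x + d)))\<^sup>2)"
    using cF by (intro continuous_intros)
  show "(norm (F (x + a) - F (x + b) - F (x + c) + F (x + d)))\<^sup>2 = 0"
    if "norm x \<ge> K + norm a + norm b + norm c + norm d" for x
  proof -
    have *: "F (x + e) = 0" if e: "norm x \<ge> K + norm e" for e
    proof -
      have "norm x \<le> norm (x + e) + norm e" using norm_triangle_ineq4[of "x + e" e] by simp
      then show ?thesis using e by (intro supp) simp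
    qed
    have "norm x \<ge> K + norm a" "norm x \<ge> K + norm b" "norm x \<ge> K + norm c" "norm x \<ge> K + norm d"
      using that norm_ge_zero[of a] norm_ge_zero[of b] norm_ge_zero[of c] norm_ge_zero[of d] by linarith+
    then show ?thesis using * by simp
  qed
qed

text \<open>Polarization: twice the mixed difference along \<open>a\<close> and \<open>b\<close> is
  the second difference along \<open>a\<close> plus the one along \<open>b\<close> minus the one
  along \<open>b - a\<close> based at \<open>x + 2ha\<close>. Translation invariance of the integral
  makes the displaced term as small as the others.\<close>

lemma mixed_difference_energy:
  fixes F :: "'a::euclidean_space => 'b::real_inner"
  assumes lip: "\<And>x y. norm (F x - F y) \<le> L * norm (x - y)"
    and supp: "\<And>x. norm x \<ge> K ==> F x = 0"
  shows "(\<lambda>k. (\<integral>x. (norm (F (x + ((1/2)^k) *\<^sub>R (a + b)) - F (x + ((1/2)^k) *\<^sub>R a)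
              - F (x + ((1/2)^k) *\<^sub>R b) + F x))\<^sup>2 \<partial>lborel) / ((1/2)^k)\<^sup>2) \<longlonglongrightarrow> 0"
proof -
  define d where "d h v = (\<lambda>x. F (x + (2 * h) *\<^sub>R v) - 2 *\<^sub>R F (x + h *\<^sub>R v) + F x)" for h :: real and v
  define A where "A h = (\<lambda>x. F (x + h *\<^sub>R (a + b)) - F (x + h *\<^sub>R a) - F (x + h *\<^sub>R b) + F x)" for h :: real
  define E where "E h v = (\<integral>x. (norm (d h v x))\<^sup>2 \<partial>lborel)" for h v
  have cF: "continuous_on UNIV (\<lambda>x. F (x + e))" for e by (rule continuous_shift) (rule lipschitz_bound_continuous[OF lip])
  have cd: "continuous_on UNIV (\<lambda>x. (norm (d h v x))\<^sup>2)" for h v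
    unfolding d_def using cF[of "(2 * h) *\<^sub>R v"] cF[of "h *\<^sub>R v"] cF[of 0] by (intro continuous_intros) auto
  have id0: "integrable lborel (\<lambda>x. (norm (d h v (x + e)))\<^sup>2)" for h v e
    using mixed_difference_integrable[where F = F and a = "e + (2 * h) *\<^sub>R v" and b = "e + h *\<^sub>R v" and c = "e + h *\<^sub>R v" and d = e, OF lip supp]
    by (simp add: d_def scaleR_2 add.assoc diff_diff_eq)
  have iA: "integrable lborel (\<lambda>x. (norm (A h x))\<^sup>2)" for h
    using mixed_difference_integrable[where F = F and a = "h *\<^sub>R (a + b)" and b = "h *\<^sub>R a" and c = "h *\<^sub>R b" and d = 0, OF lip supp]
    by (simp add: A_def)
  have key: "(\<integral>x. (norm (A h x))\<^sup>2 \<partial>lborel) \<le> E h a + E h b + E h (b - a)" for h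
  proof -
    have pt: "(norm (A h x))\<^sup>2 \<le> (norm (d h a x))\<^sup>2 + (norm (d h b x))\<^sup>2 + (norm (d h (b - a) (x + (2 * h) *\<^sub>R a)))\<^sup>2" for x
    proof -
      define p q s where "p = d h a x" and "q = d h b x" and "s = d h (b - a) (x + (2 * h) *\<^sub>R a)"
      have e1: "x + (2 * h) *\<^sub>R a + (2 * h) *\<^sub>R (b - a) = x + (2 * h) *\<^sub>R b" by (simp add: algebra_simps)
      have e2: "x + (2 * h) *\<^sub>R a + h *\<^sub>R (b - a) = x + h *\<^sub>R (a + b)" by (simp add: algebra_simps scaleR_2[symmetric])
      have "2 *\<^sub>R A h x = p + q - s"
        unfolding p_def q_def s_def A_def d_def e1 e2 by (simp add: algebra_simps scaleR_2)
      then have "2 * norm (A h x) = norm (p + q - s)" by (metis abs_numeral norm_scaleR)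
      also have "\<dots> \<le> norm p + norm q + norm s" by (meson norm_triangle_ineq norm_triangle_ineq4 order_trans add_right_mono)
      finally have n: "2 * norm (A h x) \<le> norm p + norm q + norm s" .
      have "4 * (norm (A h x))\<^sup>2 = (2 * norm (A h x))\<^sup>2" by (simp add: power_mult_distrib)
      also have "\<dots> \<le> (norm p + norm q + norm s)\<^sup>2" by (rule power_mono[OF n]) simp
      also have "\<dots> \<le> 4 * ((norm p)\<^sup>2 + (norm q)\<^sup>2 + (norm s)\<^sup>2)"
      proof -
        have "(a + b + c)\<^sup>2 = a\<^sup>2 + b\<^sup>2 + c\<^sup>2 + 2 * a * b + 2 * a * c + 2 * b * c" for a b c :: real
          by (simp add: power2_eq_square algebra_simps)
        then show ?thesis
          using sum_squares_bound[of "norm p" "norm q"] sum_squares_bound[of "norm p" "norm s"]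
            sum_squares_bound[of "norm q" "norm s"] zero_le_power2[of "norm p"] zero_le_power2[of "norm q"]
            zero_le_power2[of "norm s"] by smt
      qed
      finally show ?thesis by (simp add: p_def q_def s_def)
    qed
    have "(\<integral>x. (norm (A h x))\<^sup>2 \<partial>lborel) \<le> (\<integral>x. (norm (d h a x))\<^sup>2 + (norm (d h b x))\<^sup>2
              + (norm (d h (b - a) (x + (2 * h) *\<^sub>R a)))\<^sup>2 \<partial>lborel)"
      by (rule integral_mono) (use iA id0[of h a 0] id0[of h b 0] id0 pt in auto)
    also have "\<dots> = E h a + E h b + (\<integral>x. (norm (d h (b - a) (x + (2 * h) *\<^sub>R a)))\<^sup>2 \<partial>lborel)"
      unfolding E_def using id0[of h a 0] id0[of h b 0] id0 by simp
    also have "(\<integral>x. (norm (d h (b - a) (x + (2 * h) *\<^sub>R a)))\<^sup>2 \<partial>lborel) = E h (b - a)"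
      unfolding E_def by (rule integral_lborel_translation[OF cd])
    finally show ?thesis .
  qed
  have lim: "(\<lambda>k. E ((1/2)^k) v / ((1/2)^k)\<^sup>2) \<longlonglongrightarrow> 0" for v
    unfolding E_def d_def by (rule second_difference_energy[OF lip supp])
  have "(\<lambda>k. (\<integral>x. (norm (A ((1/2)^k) x))\<^sup>2 \<partial>lborel) / ((1/2)^k)\<^sup>2) \<longlonglongrightarrow> 0"
  proof (rule tendsto_sandwich[of "\<lambda>_. 0" _ _ "\<lambda>k. E ((1/2)^k) a / ((1/2)^k)\<^sup>2 + E ((1/2)^k) b / ((1/2)^k)\<^sup>2 + E ((1/2)^k) (b - a) / ((1/2)^k)\<^sup>2"])
    show "(\<lambda>k. E ((1/2)^k) a / ((1/2)^k)\<^sup>2 + E ((1/2)^k) b / ((1/2)^k)\<^sup>2 + E ((1/2)^k) (b - a) / ((1/2)^k)\<^sup>2) \<longlonglongrightarrow> 0"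
      using tendsto_add[OF tendsto_add[OF lim[of a] lim[of b]] lim[of "b - a"]] by simp
    show "\<forall>\<^sub>F k in sequentially. (\<integral>x. (norm (A ((1/2)^k) x))\<^sup>2 \<partial>lborel) / ((1/2)^k)\<^sup>2
       \<le> E ((1/2)^k) a / ((1/2)^k)\<^sup>2 + E ((1/2)^k) b / ((1/2)^k)\<^sup>2 + E ((1/2)^k) (b - a) / ((1/2)^k)\<^sup>2"
      unfolding add_divide_distrib[symmetric] by (intro always_eventually allI divide_right_mono key) simp
  qed auto
  then show ?thesis unfolding A_def .
qed

lemma markov_lborel:
  fixes g :: "'a::euclidean_space => real"
  assumes i: "integrable lborel g" and c: "continuous_on UNIV g" and nn: "\<And>x. g x \<ge> 0" and e: "e > 0"
  shows "{x. g x \<ge> e} \<in> lmeasurable" "measure lebesgue {x. g x \<ge> e} \<le> (\<integral>x. g x \<partial>lborel) / e"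
proof -
  have cl: "closed {x. g x \<ge> e}"
    using c by (intro closed_Collect_le) auto
  have m: "measure lborel {x\<in>UNIV. g x \<ge> e} \<le> (\<integral>x. g x \<partial>lborel) / e"
    using integral_Markov_inequality_measure[OF i, of UNIV e] nn e by simp
  have "emeasure lborel {x\<in>UNIV. g x \<ge> e} \<le> ennreal ((\<integral>x. g x \<partial>lborel) / e)"
    using integral_Markov_inequality[OF i, of e] nn e by simp
  then have "emeasure lborel {x. g x \<ge> e} < \<infinity>" using le_less_trans by (simp; blast intro: ennreal_less_top le_less_trans)
  then show "{x. g x \<ge> e} \<in> lmeasurable" using cl by (auto simp: fmeasurable_def)
  show "measure lebesgue {x. g x \<ge> e} \<le> (\<integral>x. g x \<partial>lborel) / e" using m cl by simp
qed

text \<open>If every point of \<open>Y\<close> were bad at every fine scale, Markov's inequality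
  would cover \<open>Y\<close> by sets whose measure is at most the energy divided by
  \<open>(e * h)\<^sup>2\<close>, which tends to 0. The set \<open>Y\<close> may be nonmeasurable:
  negligibility is verified through outer measure.\<close>

lemma small_additivity_defect:
  fixes F :: "'a::euclidean_space => 'b::real_inner"
  assumes lip: "\<And>x y. norm (F x - F y) \<le> L * norm (x - y)"
    and supp: "\<And>x. norm x \<ge> K ==> F x = 0"
    and Y: "\<not> negligible Y" and V: "finite V" and e: "e > 0"
  obtains k y where "k \<ge> k0" "y \<in> Y"
    "\<And>a b. a \<in> V ==> b \<in> V ==> norm (F (y + ((1/2)^k) *\<^sub>R (a + b)) - F (y + ((1/2)^k) *\<^sub>R a)
              - F (y + ((1/2)^k) *\<^sub>R b) + F y) \<le> e * (1/2)^k"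
proof (rule ccontr)
  define A where "A h a b = (\<lambda>x. F (x + h *\<^sub>R (a + b)) - F (x + h *\<^sub>R a) - F (x + h *\<^sub>R b) + F x)" for h :: real and a b
  define G where "G h = (\<lambda>x. \<Sum>p\<in>V \<times> V. (norm (A h (fst p) (snd p) x))\<^sup>2)" for h
  note th = that
  assume neg: "\<not> thesis"
  have bad: "\<exists>a\<in>V. \<exists>b\<in>V. norm (A ((1/2)^k) a b y) > e * (1/2)^k" if "k \<ge> k0" "y \<in> Y" for k y
    using neg th that unfolding A_def by (meson not_le)
  have cF: "continuous_on UNIV (\<lambda>x. F (x + e))" for e by (rule continuous_shift) (rule lipschitz_bound_continuous[OF lip])
  have iA: "integrable lborel (\<lambda>x. (norm (A h a b x))\<^sup>2)" for h a b
    using mixed_difference_integrable[where F = F and a = "h *\<^sub>R (a + b)" and b = "h *\<^sub>R a" and c = "h *\<^sub>R b" and d = 0, OF lip supp]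
    by (simp add: A_def)
  have cA: "continuous_on UNIV (\<lambda>x. (norm (A h a b x))\<^sup>2)" for h a b
    unfolding A_def using cF[of 0] cF by (intro continuous_intros) auto
  have iG: "integrable lborel (G h)" and cG: "continuous_on UNIV (G h)" for h
    unfolding G_def using iA by (auto intro: continuous_on_sum cA)
  have nG: "G h x \<ge> 0" for h x unfolding G_def by (auto intro: sum_nonneg)
  have limG: "(\<lambda>k. (\<integral>x. G ((1/2)^k) x \<partial>lborel) / ((1/2)^k)\<^sup>2) \<longlonglongrightarrow> 0"
  proof -
    have "(\<lambda>k. \<Sum>p\<in>V \<times> V. (\<integral>x. (norm (A ((1/2)^k) (fst p) (snd p) x))\<^sup>2 \<partial>lborel) / ((1/2)^k)\<^sup>2) \<longlonglongrightarrow> (\<Sum>p\<in>V \<times> V. 0)"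
      unfolding A_def by (intro tendsto_sum mixed_difference_energy[OF lip supp])
    moreover have "(\<Sum>p\<in>V \<times> V. (\<integral>x. (norm (A ((1/2)^k) (fst p) (snd p) x))\<^sup>2 \<partial>lborel) / ((1/2)^k)\<^sup>2)
        = (\<integral>x. G ((1/2)^k) x \<partial>lborel) / ((1/2)^k)\<^sup>2" for k
      unfolding G_def using iA by (simp add: sum_divide_distrib[symmetric])
    ultimately show ?thesis by simp
  qed
  have "negligible Y"
    unfolding negligible_outer_le
  proof (intro allI impI)
    fix d :: real assume d: "d > 0"
    have "\<forall>\<^sub>F k in sequentially. (\<integral>x. G ((1/2)^k) x \<partial>lborel) / ((1/2)^k)\<^sup>2 < d * e\<^sup>2"
      using order_tendstoD(2)[OF limG, of "d * e\<^sup>2"] d e by simp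
    moreover have "\<forall>\<^sub>F k in sequentially. k \<ge> k0" by (rule eventually_ge_at_top)
    ultimately obtain k where k: "k \<ge> k0" "(\<integral>x. G ((1/2)^k) x \<partial>lborel) / ((1/2)^k)\<^sup>2 < d * e\<^sup>2"
      using eventually_conj eventually_happens' sequentially_bot by (metis (mono_tags, lifting))
    define h :: real where "h = (1/2)^k"
    have h: "h > 0" by (simp add: h_def)
    have sub: "Y \<subseteq> {x. G h x \<ge> (e * h)\<^sup>2}"
    proof
      fix y assume "y \<in> Y"
      then obtain a b where ab: "a \<in> V" "b \<in> V" "norm (A h a b y) > e * h"
        using bad[OF k(1)] unfolding h_def by blast
      have "(e * h)\<^sup>2 \<le> (norm (A h a b y))\<^sup>2" using ab e h by (intro power_mono) auto
      also have "\<dots> \<le> G h y"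
        unfolding G_def using member_le_sum[of "(a, b)" "V \<times> V" "\<lambda>p. (norm (A h (fst p) (snd p) y))\<^sup>2"] ab V by simp
      finally show "y \<in> {x. G h x \<ge> (e * h)\<^sup>2}" by simp
    qed
    have "(\<integral>x. G h x \<partial>lborel) / (e * h)\<^sup>2 \<le> d"
      using k(2) e h unfolding h_def[symmetric] by (simp add: field_simps)
    with markov_lborel[OF iG cG nG, of "(e * h)\<^sup>2" h] e h sub
    show "\<exists>T. Y \<subseteq> T \<and> T \<in> lmeasurable \<and> measure lebesgue T \<le> d"
      by (intro exI[of _ "{x. G h x \<ge> (e * h)\<^sup>2}"]) (auto intro: order_trans)
  qed
  with Y show False by simp
qed

section \<open>From near additivity on a lattice to an affine approximation at one scale\<close>

lemma finite_integer_lattice_box: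
  "finite {c::'a::euclidean_space. \<forall>b\<in>Basis. c \<bullet> b \<in> \<int> \<and> \<bar>c \<bullet> b\<bar> \<le> R}"
proof -
  have fin: "finite {x::real. x \<in> \<int> \<and> \<bar>x\<bar> \<le> R}" by (rule finite_abs_int_segment)
  let ?A = "{c::'a. \<forall>b\<in>Basis. c \<bullet> b \<in> \<int> \<and> \<bar>c \<bullet> b\<bar> \<le> R}"
  let ?f = "\<lambda>c::'a. restrict (\<lambda>b. c \<bullet> b) Basis"
  have "inj_on ?f ?A"
  proof (rule inj_onI, rule euclidean_eqI)
    fix x y b :: 'a assume "?f x = ?f y" and b: "b \<in> Basis"
    from fun_cong[OF this(1), of b] b show "x \<bullet> b = y \<bullet> b" by simp
  qed
  moreover have "?f ` ?A \<subseteq> Basis \<rightarrow>\<^sub>E {x::real. x \<in> \<int> \<and> \<bar>x\<bar> \<le> R}" by auto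
  then have "finite (?f ` ?A)" by (rule finite_subset) (intro finite_PiE finite_Basis fin)
  ultimately show ?thesis by (rule finite_imageD[rotated])
qed

text \<open>Induction on the l1 norm of the lattice point. Removing one unit vector costs one defect
  \<open>e\<close>, and possibly a second one when that vector enters with a minus sign. Additivity
  is available only for summands in the box, so the path to the origin has to stay inside
  it.\<close>

lemma nearly_additive_lattice:
  fixes g :: "'a::euclidean_space => 'b::real_normed_vector" and R :: nat
  defines "V \<equiv> {c::'a. \<forall>b\<in>Basis. c \<bullet> b \<in> \<int> \<and> \<bar>c \<bullet> b\<bar> \<le> real R}"
  assumes add: "\<And>a b. a \<in> V ==> b \<in> V ==> norm (g (a + b) - g a - g b) \<le> e"
    and R: "R \<ge> 1" and g0: "g 0 = 0" and c: "c \<in> V"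
  shows "norm (g c - (\<Sum>b\<in>Basis. (c \<bullet> b) *\<^sub>R g b)) \<le> 2 * e * (\<Sum>b\<in>Basis. \<bar>c \<bullet> b\<bar>)"
proof -
  have "\<exists>n::nat. (\<Sum>b\<in>Basis. \<bar>c \<bullet> b\<bar>) = real n" if "c \<in> V" for c
  proof -
    have "(\<Sum>b\<in>Basis. \<bar>c \<bullet> b\<bar>) \<in> \<int>" using that by (intro Ints_sum) (auto simp: V_def)
    moreover have "(\<Sum>b\<in>Basis. \<bar>c \<bullet> b\<bar>) \<ge> 0" by (intro sum_nonneg) auto
    ultimately show ?thesis by (metis Ints_cases of_int_of_nat_eq of_int_0_le_iff zero_le_imp_eq_int)
  qed
  then obtain n where n: "(\<Sum>b\<in>Basis. \<bar>c \<bullet> b\<bar>) = real n" using c by blast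
  have "0 \<in> V" by (simp add: V_def)
  then have e0: "e \<ge> 0" using add[of 0 0] norm_ge_zero order_trans by blast
  have bV: "b \<in> V" "- b \<in> V" if "b \<in> Basis" for b
    using R that by (auto simp: V_def inner_Basis)
  have neg: "norm (g (- b) + g b) \<le> e" if "b \<in> Basis" for b
    using add[OF bV(1)[OF that] bV(2)[OF that]] by (simp add: g0 norm_minus_commute add.commute norm_minus_cancel[of "g b + g (-b)", symmetric] del: norm_minus_cancel)
  show ?thesis using n c
  proof (induction n arbitrary: c)
    case 0
    then have "\<forall>b\<in>Basis. \<bar>c \<bullet> b\<bar> = 0"
      using sum_nonneg_eq_0_iff[of Basis "\<lambda>b. \<bar>c \<bullet> b\<bar>"] by simp
    then have "c = 0" using euclidean_all_zero_iff[of c] by simp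
    then show ?case by (simp add: g0)
  next
    case (Suc n)
    have "\<exists>b\<in>Basis. c \<bullet> b \<noteq> 0"
    proof (rule ccontr)
      assume "\<not> ?thesis" then have "(\<Sum>b\<in>Basis. \<bar>c \<bullet> b\<bar>) = 0" by simp
      with Suc.prems show False by simp
    qed
    then obtain b where b: "b \<in> Basis" "c \<bullet> b \<noteq> 0" by blast
    define s where "s = sgn (c \<bullet> b)"
    define c' where "c' = c - s *\<^sub>R b"
    have s: "s = 1 \<or> s = -1" using b by (auto simp: s_def sgn_real_def)
    have cb: "\<bar>c \<bullet> b\<bar> \<ge> 1" using b Suc.prems(2) by (auto simp: V_def intro: Ints_nonzero_abs_ge1)
    have c'b: "c' \<bullet> b' = (if b' = b then c \<bullet> b - s else c \<bullet> b')" if "b' \<in> Basis" for b'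
      using b that by (auto simp: c'_def inner_diff_left inner_Basis)
    have sb: "\<bar>c \<bullet> b - s\<bar> = \<bar>c \<bullet> b\<bar> - 1" using cb unfolding s_def sgn_real_def by auto
    have c'V: "c' \<in> V"
    proof -
      have "c' \<bullet> b' \<in> \<int> \<and> \<bar>c' \<bullet> b'\<bar> \<le> R" if b': "b' \<in> Basis" for b'
      proof (cases "b' = b")
        case True
        have "c \<bullet> b \<in> \<int>" "\<bar>c \<bullet> b\<bar> \<le> R" using Suc.prems(2) b by (auto simp: V_def)
        then show ?thesis using True s sb b by (auto simp: c'b)
      next
        case False
        then show ?thesis using Suc.prems(2) b' by (auto simp: c'b V_def)
      qed
      then show ?thesis by (auto simp: V_def)
    qed
    have "(\<Sum>b\<in>Basis. \<bar>c' \<bullet> b\<bar>) = (\<Sum>b'\<in>Basis. \<bar>c \<bullet> b'\<bar> - (if b' = b then 1 else 0))"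
      by (rule sum.cong) (auto simp: c'b sb)
    also have "\<dots> = real n" using Suc.prems(1) b by (simp add: sum_subtractf)
    finally have n': "(\<Sum>b\<in>Basis. \<bar>c' \<bullet> b\<bar>) = real n" .
    have IH: "norm (g c' - (\<Sum>b\<in>Basis. (c' \<bullet> b) *\<^sub>R g b)) \<le> 2 * e * real n"
      using Suc.IH[OF n' c'V] n' by simp
    have 1: "norm (g c - g c' - g (s *\<^sub>R b)) \<le> e"
      using add[OF c'V, of "s *\<^sub>R b"] bV[OF b(1)] s by (auto simp: c'_def)
    have 2: "norm (g (s *\<^sub>R b) - s *\<^sub>R g b) \<le> e"
      using s neg[OF b(1)] e0 by auto
    have "(\<Sum>b'\<in>Basis. (c \<bullet> b') *\<^sub>R g b') = (\<Sum>b'\<in>Basis. (c' \<bullet> b') *\<^sub>R g b' + (if b' = b then s *\<^sub>R g b else 0))"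
      by (rule sum.cong) (auto simp: c'b scaleR_diff_left)
    also have "\<dots> = (\<Sum>b'\<in>Basis. (c' \<bullet> b') *\<^sub>R g b') + s *\<^sub>R g b"
      using b by (simp add: sum.distrib)
    finally have "g c - (\<Sum>b\<in>Basis. (c \<bullet> b) *\<^sub>R g b) = (g c - g c' - g (s *\<^sub>R b)) + (g (s *\<^sub>R b) - s *\<^sub>R g b)
         + (g c' - (\<Sum>b\<in>Basis. (c' \<bullet> b) *\<^sub>R g b))" by simp
    then have "norm (g c - (\<Sum>b\<in>Basis. (c \<bullet> b) *\<^sub>R g b)) \<le> e + e + 2 * e * real n"
      using 1 2 IH by (metis (no_types, lifting) add_mono norm_triangle_mono)
    then show ?case using Suc.prems(1) by (simp add: algebra_simps)
  qed
qed

text \<open>A one-scale substitute for differentiability: the error \<open>\<eta> * r\<close> is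
  obtained for a single radius, found together with the point. The map \<open>T\<close> interpolates
  the increments along the basis vectors at the fine step \<open>h\<close>; near additivity controls
  the lattice points, the Lipschitz bound the rounding to the lattice.\<close>

lemma approx_affine_compact_support:
  fixes F :: "'a::euclidean_space => 'b::real_inner"
  assumes lip: "\<And>x y. norm (F x - F y) \<le> L * norm (x - y)"
    and supp: "\<And>x. norm x \<ge> K ==> F x = 0"
    and Y: "\<not> negligible Y" and \<eta>: "\<eta> > 0" and r0: "r0 > 0"
  obtains y r T where "y \<in> Y" "0 < r" "r < r0" "linear T"
    "\<And>k. norm k \<le> r ==> norm (F (y + k) - F y - T k) \<le> \<eta> * r"
proof -
  define D where "D = real (DIM('a))"
  have D1: "D \<ge> 1" by (simp add: D_def Suc_le_eq)
  have L0: "L \<ge> 0"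
  proof -
    obtain b :: 'a where b: "b \<in> Basis" using nonempty_Basis by blast
    have "0 \<le> L * norm (b - 0)" using lip[of b 0] norm_ge_zero order_trans by blast
    then show ?thesis using b by simp
  qed
  \<comment> \<open>The final radius is \<open>h * R\<close>. Rounding to the lattice costs
    \<open>L * (D + D\<^sup>2) * h\<close>, and \<open>R\<close> is so large that this is at most
    half of \<open>\<eta> * (h * R)\<close>; the defect \<open>e\<close> chosen below spends the
    other half.\<close>
  define R where "R = nat \<lceil>1 + 2 * L * (D + D\<^sup>2) / \<eta>\<rceil>"
  have R: "real R \<ge> 1 + 2 * L * (D + D\<^sup>2) / \<eta>" unfolding R_def by linarith
  have "2 * L * (D + D\<^sup>2) / \<eta> \<ge> 0" using L0 D1 \<eta> by simp
  then have R1: "R \<ge> 1" using R by linarith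
  have R2: "L * (D + D\<^sup>2) \<le> \<eta> * R / 2"
  proof -
    have "2 * L * (D + D\<^sup>2) / \<eta> \<le> R" using R by linarith
    then show ?thesis using \<eta> by (simp add: divide_simps mult.commute)
  qed
  define V where "V = {c::'a. \<forall>b\<in>Basis. c \<bullet> b \<in> \<int> \<and> \<bar>c \<bullet> b\<bar> \<le> real R}"
  have finV: "finite V" unfolding V_def by (rule finite_integer_lattice_box)
  define e where "e = \<eta> / (4 * D)"
  have e: "e > 0" using \<eta> D1 by (simp add: e_def)
  have "\<exists>k0::nat. (1/2)^k0 < r0 / real R"
    using r0 R1 by (intro real_arch_pow_inv) auto
  then obtain k0 where k0: "(1/2::real)^k0 < r0 / real R" by blast
  obtain k y where ky: "k \<ge> k0" "y \<in> Y"
    "\<And>a b. a \<in> V ==> b \<in> V ==> norm (F (y + ((1/2)^k) *\<^sub>R (a + b)) - F (y + ((1/2)^k) *\<^sub>R a)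
              - F (y + ((1/2)^k) *\<^sub>R b) + F y) \<le> e * (1/2)^k"
    using small_additivity_defect[OF lip supp Y finV e, where ?k0.0 = k0] by blast
  define h :: real where "h = (1/2)^k"
  have h: "h > 0" by (simp add: h_def)
  have "h \<le> (1/2)^k0" unfolding h_def using ky(1) by (intro power_decreasing) auto
  then have "h * R \<le> (1/2)^k0 * R" by (rule mult_right_mono) simp
  also have "\<dots> < r0" using k0 R1 by (simp add: pos_less_divide_eq)
  finally have hR: "h * R < r0" .
  define g where "g c = F (y + h *\<^sub>R c) - F y" for c
  have gadd: "norm (g (a + b) - g a - g b) \<le> e * h" if "a \<in> V" "b \<in> V" for a b
    using ky(3)[OF that] by (simp add: g_def h_def algebra_simps)
  have glat: "norm (g c - (\<Sum>b\<in>Basis. (c \<bullet> b) *\<^sub>R g b)) \<le> 2 * (e * h) * (\<Sum>b\<in>Basis. \<bar>c \<bullet> b\<bar>)" if "c \<in> V" for c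
    using nearly_additive_lattice[of R g "e * h" c] gadd R1 that by (simp add: V_def[symmetric] g_def)
  define T where "T k = (\<Sum>b\<in>Basis. ((k \<bullet> b) / h) *\<^sub>R g b)" for k
  have linT: "linear T"
    unfolding T_def by (intro linearI) (auto simp: inner_add_left add_divide_distrib scaleR_add_left sum.distrib scaleR_sum_right)
  have gb: "norm (g b) \<le> L * h" if "b \<in> Basis" for b
    using lip[of "y + h *\<^sub>R b" y] that h by (simp add: g_def)
  have normT: "norm (T k) \<le> D * L * norm k" for k
  proof -
    have "norm (T k) \<le> (\<Sum>b\<in>(Basis::'a set). norm k * L)"
      unfolding T_def
    proof (rule order_trans[OF norm_sum sum_mono])
      fix b :: 'a assume b: "b \<in> Basis"
      have "norm ((k \<bullet> b / h) *\<^sub>R g b) = \<bar>k \<bullet> b\<bar> / h * norm (g b)" using h by simp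
      also have "\<dots> \<le> norm k / h * (L * h)"
        using gb[OF b] Basis_le_norm[OF b, of k] h L0 by (intro mult_mono divide_right_mono) auto
      finally show "norm ((k \<bullet> b / h) *\<^sub>R g b) \<le> norm k * L" using h by simp
    qed
    then show ?thesis by (simp add: D_def mult_ac)
  qed
  have fin: "norm (F (y + k) - F y - T k) \<le> \<eta> * (h * R)" if k: "norm k \<le> h * R" for k
  proof -
    define c where "c = (\<Sum>b\<in>Basis. real_of_int \<lfloor>(k \<bullet> b) / h\<rfloor> *\<^sub>R b)"
    have cb: "c \<bullet> b = \<lfloor>(k \<bullet> b) / h\<rfloor>" if "b \<in> Basis" for b
      unfolding c_def using that by simp
    have kb: "\<bar>(k \<bullet> b) / h\<bar> \<le> R" if "b \<in> Basis" for b
      using Basis_le_norm[OF that, of k] k h by (simp add: field_simps)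
    have fl: "\<bar>real_of_int \<lfloor>x\<rfloor>\<bar> \<le> R" if "\<bar>x\<bar> \<le> R" for x :: real
    proof -
      have "- int R \<le> \<lfloor>x\<rfloor>" using that by (simp add: le_floor_iff)
      moreover have "real_of_int \<lfloor>x\<rfloor> \<le> R" using that by linarith
      ultimately show ?thesis by linarith
    qed
    have cV: "c \<in> V" unfolding V_def using kb fl by (auto simp: cb)
    have nk: "norm (k - h *\<^sub>R c) \<le> D * h"
    proof -
      have "norm (k - h *\<^sub>R c) \<le> (\<Sum>b\<in>Basis. \<bar>(k - h *\<^sub>R c) \<bullet> b\<bar>)" by (rule norm_le_l1)
      also have "\<dots> \<le> (\<Sum>b\<in>(Basis::'a set). h)"
      proof (rule sum_mono)
        fix b :: 'a assume b: "b \<in> Basis"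
        have "(k - h *\<^sub>R c) \<bullet> b = h * (k \<bullet> b / h - \<lfloor>k \<bullet> b / h\<rfloor>)"
          using h b by (simp add: inner_diff_left cb algebra_simps)
        moreover have "\<bar>k \<bullet> b / h - \<lfloor>k \<bullet> b / h\<rfloor>\<bar> \<le> 1" by linarith
        ultimately show "\<bar>(k - h *\<^sub>R c) \<bullet> b\<bar> \<le> h"
          using h by (simp add: abs_mult mult_left_le)
      qed
      finally show ?thesis by (simp add: D_def)
    qed
    have 1: "norm (F (y + k) - F (y + h *\<^sub>R c)) \<le> L * (D * h)"
      using lip[of "y + k" "y + h *\<^sub>R c"] mult_left_mono[OF nk L0] by simp
    have 2: "norm (g c - T (h *\<^sub>R c)) \<le> 2 * (e * h) * (D * R)"
    proof -
      have "(\<Sum>b\<in>(Basis::'a set). \<bar>c \<bullet> b\<bar>) \<le> (\<Sum>b\<in>(Basis::'a set). real R)"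
        using cV by (intro sum_mono) (auto simp: V_def)
      then have "2 * (e * h) * (\<Sum>b\<in>(Basis::'a set). \<bar>c \<bullet> b\<bar>) \<le> 2 * (e * h) * (D * R)"
        using e h by (intro mult_left_mono) (auto simp: D_def)
      moreover have "T (h *\<^sub>R c) = (\<Sum>b\<in>Basis. (c \<bullet> b) *\<^sub>R g b)" using h by (simp add: T_def)
      ultimately show ?thesis using glat[OF cV] by simp
    qed
    have 3: "norm (T (h *\<^sub>R c) - T k) \<le> D * L * (D * h)"
    proof -
      have "norm (T (h *\<^sub>R c) - T k) = norm (T (k - h *\<^sub>R c))"
        using linear_diff[OF linT] by (simp add: norm_minus_commute)
      also have "\<dots> \<le> D * L * norm (k - h *\<^sub>R c)" by (rule normT)
      also have "\<dots> \<le> D * L * (D * h)" using nk D1 L0 by (intro mult_left_mono) auto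
      finally show ?thesis .
    qed
    have "F (y + k) - F y - T k = (F (y + k) - F (y + h *\<^sub>R c)) + (g c - T (h *\<^sub>R c)) + (T (h *\<^sub>R c) - T k)" by (simp add: g_def)
    then have "norm (F (y + k) - F y - T k) \<le> L * (D * h) + 2 * (e * h) * (D * R) + D * L * (D * h)"
      using 1 2 3 by (metis (no_types, lifting) add_mono norm_triangle_mono)
    also have "\<dots> = h * (L * (D + D\<^sup>2)) + h * R * (2 * D * e)" by (simp add: algebra_simps power2_eq_square)
    also have "\<dots> \<le> h * (\<eta> * R / 2) + h * R * (\<eta> / 2)"
    proof (rule add_mono)
      show "h * (L * (D + D\<^sup>2)) \<le> h * (\<eta> * R / 2)" using R2 h by (intro mult_left_mono) auto
      show "h * R * (2 * D * e) \<le> h * R * (\<eta> / 2)" using D1 by (simp add: e_def)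
    qed
    finally show ?thesis by (simp add: algebra_simps)
  qed
  show thesis by (rule that[OF ky(2) _ hR linT fin]) (use h R1 in auto)
qed

text \<open>A cutoff equal to 1 on a ball exceeding the bound of \<open>Y\<close> by 1 reduces the
  claim to compact support; asking for \<open>r < 1\<close> keeps \<open>y + k\<close> where the
  cutoff changes nothing.\<close>

lemma approx_affine:
  fixes F :: "'a::euclidean_space => 'b::real_inner"
  assumes lip: "\<And>x y. norm (F x - F y) \<le> L * norm (x - y)"
    and Y: "\<not> negligible Y" "bounded Y" and \<eta>: "\<eta> > 0" and r0: "r0 > 0"
  obtains y r T where "y \<in> Y" "0 < r" "r < r0" "linear T"
    "\<And>k. norm k \<le> r ==> norm (F (y + k) - F y - T k) \<le> \<eta> * r"
proof -
  have L0: "L \<ge> 0"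
  proof -
    obtain b :: 'a where b: "b \<in> Basis" using nonempty_Basis by blast
    have "0 \<le> L * norm (b - 0)" using lip[of b 0] norm_ge_zero order_trans by blast
    then show ?thesis using b by simp
  qed
  obtain K0 where K0: "\<And>y. y \<in> Y ==> norm y \<le> K0" using Y(2) bounded_iff by blast
  define K where "K = \<bar>K0\<bar> + 1"
  define cut where "cut x = max 0 (min 1 (K + 1 - norm x))" for x :: 'a
  define B where "B = norm (F 0) + L * (K + 1)"
  define G where "G x = cut x *\<^sub>R F x" for x
  have B0: "B \<ge> 0" using L0 by (simp add: B_def K_def)
  have FB: "norm (F x) \<le> B" if "norm x \<le> K + 1" for x
  proof -
    have "norm (F x) \<le> norm (F 0) + norm (F x - F 0)" by norm
    also have "norm (F x - F 0) \<le> L * norm x" using lip[of x 0] by simp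
    also have "L * norm x \<le> L * (K + 1)" using that L0 by (rule mult_left_mono)
    finally show ?thesis by (simp add: B_def)
  qed
  have chi: "\<bar>cut x - cut y\<bar> \<le> norm (x - y)" for x y
  proof -
    have "\<bar>norm x - norm y\<bar> \<le> norm (x - y)" by (rule norm_triangle_ineq3)
    then show ?thesis unfolding cut_def by linarith
  qed
  have chi1: "0 \<le> cut x" "cut x \<le> 1" for x by (auto simp: cut_def)
  have lipG1: "norm (G x - G y) \<le> (L + B) * norm (x - y)" if "norm x \<le> K + 1" for x y
  proof -
    have "G x - G y = (cut x - cut y) *\<^sub>R F x + cut y *\<^sub>R (F x - F y)" by (simp add: G_def algebra_simps)
    then have "norm (G x - G y) \<le> \<bar>cut x - cut y\<bar> * norm (F x) + \<bar>cut y\<bar> * norm (F x - F y)"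
      by (metis norm_scaleR norm_triangle_ineq)
    also have "\<dots> \<le> norm (x - y) * B + 1 * (L * norm (x - y))"
      using chi chi1[of y] FB[OF that] lip by (intro add_mono mult_mono) auto
    finally show ?thesis by (simp add: algebra_simps)
  qed
  have G0: "G x = 0" if "norm x \<ge> K + 1" for x using that by (simp add: G_def cut_def)
  have lipG: "norm (G x - G y) \<le> (L + B) * norm (x - y)" for x y
  proof (cases "norm x \<le> K + 1")
    case True then show ?thesis by (rule lipG1)
  next
    case False
    show ?thesis
    proof (cases "norm y \<le> K + 1")
      case True
      then show ?thesis using lipG1[of y x] by (simp add: norm_minus_commute)
    next
      case F: False
      with False show ?thesis using G0[of x] G0[of y] L0 B0 by simp
    qed
  qed
  obtain y r T where *: "y \<in> Y" "0 < r" "r < min r0 1" "linear T"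
    "\<And>k. norm k \<le> r ==> norm (G (y + k) - G y - T k) \<le> \<eta> * r"
    using approx_affine_compact_support[OF lipG G0 Y(1) \<eta>, where ?r0.0 = "min r0 1" and K = "K + 1"] r0 by auto
  have GF: "G x = F x" if "norm x \<le> K" for x using that by (simp add: G_def cut_def)
  have "norm (F (y + k) - F y - T k) \<le> \<eta> * r" if k: "norm k \<le> r" for k
  proof -
    have "norm y \<le> \<bar>K0\<bar>" using K0[OF *(1)] by linarith
    moreover have "norm (y + k) \<le> norm y + norm k" by (rule norm_triangle_ineq)
    ultimately have "norm (y + k) \<le> K" "norm y \<le> K" using k *(3) by (auto simp: K_def)
    then show ?thesis using *(5)[OF k] GF by simp
  qed
  then show thesis using that *(1-4) by auto
qed

lemma nonneg_if_eventually_perturbed: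
  fixes a b :: real
  assumes "\<And>t. 0 < t ==> t \<le> 1 ==> a + t * b \<ge> 0"
  shows "a \<ge> 0"
proof (rule ccontr)
  assume "\<not> a \<ge> 0"
  then have a: "a < 0" by simp
  define t where "t = min 1 (- a / (2 * (\<bar>b\<bar> + 1)))"
  have t: "0 < t" "t \<le> 1" using a by (auto simp: t_def divide_pos_pos intro!: divide_neg_pos)
  have "t \<le> - a / (2 * (\<bar>b\<bar> + 1))" by (simp add: t_def)
  then have "2 * t * (\<bar>b\<bar> + 1) \<le> - a" by (simp add: field_simps)
  moreover have "t * b \<le> t * (\<bar>b\<bar> + 1)" using t by (intro mult_left_mono) auto
  ultimately have "a + t * b < 0" using a by linarith
  then show False using assms[OF t] by simp
qed

text \<open>Inserting small multiples of \<open>n\<close> itself makes the linear side win over the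
  quadratic one. This identifies a subgradient at a point where a smooth function touches from
  above.\<close>

lemma zero_if_inner_le_square:
  fixes n :: "'a::real_inner"
  assumes le: "\<And>d. norm d \<le> r ==> n \<bullet> d \<le> M / 2 * (norm d)\<^sup>2" and r: "r > 0"
  shows "n = 0"
proof -
  define s where "s = r / (norm n + 1)"
  have s: "s > 0" unfolding s_def using r by (intro divide_pos_pos) (auto intro: add_nonneg_pos)
  have "norm n * r \<le> r * (norm n + 1)" using r by (simp add: algebra_simps)
  then have sn: "s * norm n \<le> r" by (simp add: s_def divide_simps mult.commute) (smt (verit) norm_ge_zero)
  have "0 \<le> - (norm n)\<^sup>2 + t * (M / 2 * s * (norm n)\<^sup>2)" if t: "0 < t" "t \<le> 1" for t
  proof -
    have "norm ((t * s) *\<^sub>R n) \<le> r"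
      using t s sn mult_mono[of t 1 "s * norm n" r] by (simp add: abs_mult mult.assoc)
    from le[OF this] have "(t * s) * (norm n)\<^sup>2 \<le> (t * s) * (t * (M / 2 * s * (norm n)\<^sup>2))"
      using t s by (simp add: power2_norm_eq_inner[symmetric] power_mult_distrib abs_mult) (simp add: power2_eq_square mult_ac)
    then show ?thesis using t s by simp
  qed
  then have "- (norm n)\<^sup>2 \<ge> 0" by (rule nonneg_if_eventually_perturbed)
  then show ?thesis by simp
qed

section \<open>Second-order expansions of convex functions\<close>

text \<open>Finite convex functions, described in the form in which they arise here: a
  sup-convolution plus a quadratic is a supremum of affine functions attained at each point, so a
  subgradient is at hand everywhere.\<close>

locale subdifferentiable =
  fixes f :: "'a::euclidean_space => real"
  assumes ex_subgradient: "\<And>z. \<exists>\<xi>. \<forall>z'. f z' \<ge> f z + \<xi> \<bullet> (z' - z)"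
begin

lemma convex: "convex_on UNIV f"
proof (rule convex_onI)
  fix t :: real and x y :: 'a assume t: "0 < t" "t < 1"
  define z where "z = (1 - t) *\<^sub>R x + t *\<^sub>R y"
  obtain \<xi> where \<xi>: "\<And>z'. f z' \<ge> f z + \<xi> \<bullet> (z' - z)" using ex_subgradient by blast
  have "(1 - t) * (f z + \<xi> \<bullet> (x - z)) + t * (f z + \<xi> \<bullet> (y - z)) \<le> (1 - t) * f x + t * f y"
    using t by (intro add_mono mult_left_mono \<xi>) auto
  moreover have "(1 - t) * (f z + \<xi> \<bullet> (x - z)) + t * (f z + \<xi> \<bullet> (y - z)) = f z + \<xi> \<bullet> ((1 - t) *\<^sub>R (x - z) + t *\<^sub>R (y - z))"
    by (simp add: inner_add_right algebra_simps)
  moreover have "(1 - t) *\<^sub>R (x - z) + t *\<^sub>R (y - z) = 0" by (simp add: z_def algebra_simps)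
  ultimately show "f ((1 - t) *\<^sub>R x + t *\<^sub>R y) \<le> (1 - t) * f x + t * f y" by (simp add: z_def)
qed simp

lemma continuous: "continuous_on A f"
  using convex_on_continuous[OF open_UNIV convex] continuous_on_subset by blast

text \<open>A subgradient \<xi> at \<open>y\<close> makes the quadratic dominate outside the ball of
  radius \<open>2 * norm \<xi>\<close>, so \<open>f + |z - y|^2 / 2\<close> has a minimizer.
  Comparing it with points on the segment towards \<open>z'\<close> and letting the parameter tend
  to 0 yields the subgradient inequality at the minimizer.\<close>

lemma ex_prox: "\<exists>z. \<forall>z'. f z' \<ge> f z + (y - z) \<bullet> (z' - z)"
proof -
  obtain \<xi> where \<xi>: "\<And>z'. f z' \<ge> f y + \<xi> \<bullet> (z' - y)" using ex_subgradient by blast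
  define g where "g z = f z + (norm (z - y))\<^sup>2 / 2" for z
  have "continuous_on (cball y (2 * norm \<xi>)) g"
    unfolding g_def by (intro continuous_intros continuous) auto
  then obtain z where z: "z \<in> cball y (2 * norm \<xi>)" "\<And>z'. z' \<in> cball y (2 * norm \<xi>) ==> g z \<le> g z'"
    using continuous_attains_inf[of "cball y (2 * norm \<xi>)" g] by auto
  have min: "g z \<le> g z'" for z'
  proof (cases "z' \<in> cball y (2 * norm \<xi>)")
    case False
    define n where "n = norm (z' - y)"
    have n: "n > 2 * norm \<xi>" using False by (simp add: n_def dist_norm norm_minus_commute)
    have "\<xi> \<bullet> (z' - y) \<ge> - (norm \<xi> * n)"
      unfolding n_def using norm_cauchy_schwarz[of "- \<xi>" "z' - y"] by simp
    moreover have "n * (2 * norm \<xi>) \<le> n * n" using n by (intro mult_left_mono) (auto simp: n_def)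
    ultimately have "f y \<le> g z'"
      using \<xi>[of z'] by (simp add: g_def n_def[symmetric] power2_eq_square mult_ac)
    moreover have "g z \<le> f y" using z(2)[of y] by (simp add: g_def)
    ultimately show ?thesis by simp
  qed (use z in auto)
  show ?thesis
  proof (intro exI allI)
    fix z'
    have "f z' - f z - (y - z) \<bullet> (z' - z) \<ge> 0"
    proof (rule nonneg_if_eventually_perturbed)
      fix t :: real assume t: "0 < t" "t \<le> 1"
      define w where "w = z + t *\<^sub>R (z' - z)"
      have w: "w = (1 - t) *\<^sub>R z + t *\<^sub>R z'" by (simp add: w_def algebra_simps)
      have "f w \<le> (1 - t) * f z + t * f z'"
        using convex_onD[OF convex, of t z z'] t unfolding w by simp
      moreover have "(norm (w - y))\<^sup>2 = (norm (z - y))\<^sup>2 - 2 * t * ((y - z) \<bullet> (z' - z)) + t\<^sup>2 * (norm (z' - z))\<^sup>2"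
        unfolding w_def power2_norm_eq_inner by (simp add: inner_add inner_diff algebra_simps power2_eq_square inner_commute)
      ultimately have "0 \<le> t * (f z' - f z - (y - z) \<bullet> (z' - z) + t * ((norm (z' - z))\<^sup>2 / 2))"
        using min[of w] by (simp add: g_def algebra_simps power2_eq_square)
      then show "0 \<le> f z' - f z - (y - z) \<bullet> (z' - z) + t * ((norm (z' - z))\<^sup>2 / 2)"
        using t(1) by (simp add: zero_le_mult_iff)
    qed
    then show "f z + (y - z) \<bullet> (z' - z) \<le> f z'" by simp
  qed
qed

definition prox :: "'a => 'a" where
  "prox y = (SOME z. \<forall>z'. f z' \<ge> f z + (y - z) \<bullet> (z' - z))"

lemma prox: "f z' \<ge> f (prox y) + (y - prox y) \<bullet> (z' - prox y)"
  using someI_ex[OF ex_prox[of y]] unfolding prox_def by blast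

text \<open>Adding the two subgradient inequalities gives monotonicity of the subdifferential, and a
  resolvent of a monotone operator is 1-Lipschitz. The case \<open>y1 = y2\<close> also gives
  uniqueness of the proximal point.\<close>

lemma monotone_nonexpansive:
  assumes "\<And>z'. f z' \<ge> f z1 + (y1 - z1) \<bullet> (z' - z1)" "\<And>z'. f z' \<ge> f z2 + (y2 - z2) \<bullet> (z' - z2)"
  shows "norm (z1 - z2) \<le> norm (y1 - y2)"
proof -
  have "(y1 - z1) \<bullet> (z2 - z1) + (y2 - z2) \<bullet> (z1 - z2) \<le> 0"
    using assms(1)[of z2] assms(2)[of z1] by linarith
  then have "(norm (z1 - z2))\<^sup>2 \<le> (y1 - y2) \<bullet> (z1 - z2)" by (simp add: power2_norm_eq_inner inner_diff algebra_simps inner_commute)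
  also have "\<dots> \<le> norm (y1 - y2) * norm (z1 - z2)" by (rule norm_cauchy_schwarz)
  finally show ?thesis by (cases "norm (z1 - z2) = 0") (simp, simp add: power2_eq_square)
qed

lemma prox_nonexpansive: "norm (prox y1 - prox y2) \<le> norm (y1 - y2)" by (rule monotone_nonexpansive) (rule prox)+

lemma prox_eq:
  assumes "\<And>z'. f z' \<ge> f z + \<xi> \<bullet> (z' - z)"
  shows "prox (z + \<xi>) = z"
proof -
  have "norm (prox (z + \<xi>) - z) \<le> norm ((z + \<xi>) - (z + \<xi>))" by (rule monotone_nonexpansive[OF prox]) (use assms in simp)
  then show ?thesis by simp
qed

text \<open>The Moreau envelope. Its gradient is \<open>y - prox y\<close>, so information about the
  Lipschitz map \<open>prox\<close> becomes second-order information about a function.\<close>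

definition envelope :: "'a => real" where
  "envelope y = f (prox y) + (norm (prox y - y))\<^sup>2 / 2"

lemma envelope_le: "envelope y \<le> f z + (norm (z - y))\<^sup>2 / 2"
proof -
  have "(norm (z - y))\<^sup>2 = (norm (prox y - y))\<^sup>2 - 2 * ((y - prox y) \<bullet> (z - prox y)) + (norm (z - prox y))\<^sup>2"
    by (simp add: power2_norm_eq_inner inner_add inner_diff algebra_simps inner_commute)
  moreover have "(norm (z - prox y))\<^sup>2 \<ge> 0" by simp
  ultimately show ?thesis using prox[of y z] unfolding envelope_def by linarith
qed

text \<open>For the upper half the point \<open>prox y\<close> competes in the envelope at
  \<open>y'\<close>; for the lower half the subgradient inequality at \<open>prox y\<close> is
  combined with completing a square.\<close>

lemma envelope_diff_bound:
  "\<bar>envelope y' - envelope y - (y - prox y) \<bullet> (y' - y)\<bar> \<le> (norm (y' - y))\<^sup>2 / 2"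
proof -
  have "(norm (prox y - y'))\<^sup>2 = (norm (prox y - y))\<^sup>2 + 2 * ((y - prox y) \<bullet> (y' - y)) + (norm (y' - y))\<^sup>2"
    by (simp add: power2_norm_eq_inner inner_add inner_diff algebra_simps inner_commute)
  then have 1: "envelope y' - envelope y - (y - prox y) \<bullet> (y' - y) \<le> (norm (y' - y))\<^sup>2 / 2"
    using envelope_le[of y' "prox y"] unfolding envelope_def[of y] by linarith
  define z' where "z' = prox y'"
  define \<xi> where "\<xi> = y - prox y"
  have "(norm (z' - y' + \<xi>))\<^sup>2 \<ge> 0" by simp
  then have "(norm (z' - y'))\<^sup>2 \<ge> - 2 * (\<xi> \<bullet> (z' - y')) - (norm \<xi>)\<^sup>2"
    by (simp add: power2_norm_eq_inner inner_add algebra_simps inner_commute)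
  moreover have "f z' \<ge> f (prox y) + \<xi> \<bullet> (z' - prox y)" unfolding \<xi>_def by (rule prox)
  moreover have "\<xi> \<bullet> (z' - prox y) = \<xi> \<bullet> (z' - y') + \<xi> \<bullet> (y' - y) + (norm \<xi>)\<^sup>2"
    by (simp add: \<xi>_def power2_norm_eq_inner inner_diff algebra_simps)
  moreover have "(norm \<xi>)\<^sup>2 = (norm (prox y - y))\<^sup>2" by (simp add: \<xi>_def norm_minus_commute)
  ultimately have "envelope y' \<ge> envelope y + \<xi> \<bullet> (y' - y)" by (simp add: envelope_def z'_def[symmetric] algebra_simps)
  then show ?thesis using 1 using zero_le_power2[of "norm (y' - y)"] by (simp add: \<xi>_def abs_le_iff del: zero_le_power2)
qed

lemma envelope_has_derivative: "(envelope has_derivative (\<lambda>h. (y - prox y) \<bullet> h)) (at y)"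
  unfolding has_derivative_iff_norm
proof
  show "bounded_linear (\<lambda>h. (y - prox y) \<bullet> h)" by (rule bounded_linear_inner_right)
  show "((\<lambda>y'. norm (envelope y' - envelope y - (y - prox y) \<bullet> (y' - y)) / norm (y' - y)) \<longlongrightarrow> 0) (at y)"
  proof (rule Lim_null_comparison)
    show "\<forall>\<^sub>F y' in at y. norm (norm (envelope y' - envelope y - (y - prox y) \<bullet> (y' - y)) / norm (y' - y)) \<le> norm (y' - y) / 2"
    proof (rule always_eventually, rule allI)
      fix y'
      show "norm (norm (envelope y' - envelope y - (y - prox y) \<bullet> (y' - y)) / norm (y' - y)) \<le> norm (y' - y) / 2"
        using envelope_diff_bound[of y' y] by (cases "y' = y") (simp_all add: divide_simps power2_eq_square)
    qed
    have "((\<lambda>y'. norm (y' - y) / 2) \<longlongrightarrow> norm (y - y) / 2) (at y)" by (intro tendsto_intros) auto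
    then show "((\<lambda>y'. norm (y' - y) / 2) \<longlongrightarrow> 0) (at y)" by simp
  qed
qed

text \<open>An affine approximation of \<open>prox\<close> on a ball is one of the gradient of the
  envelope; the mean value theorem along a ray turns it into a quadratic expansion whose error is
  \<open>\<eta> * r\<^sup>2\<close>.\<close>

lemma envelope_expansion:
  assumes T: "linear T" and \<eta>: "\<And>k. norm k \<le> r ==> norm (prox (y + k) - prox y - T k) \<le> \<eta> * r"
    and k: "norm k \<le> r"
  shows "\<bar>envelope (y + k) - envelope y - (y - prox y) \<bullet> k - (k - T k) \<bullet> k / 2\<bar> \<le> \<eta> * r\<^sup>2"
proof -
  define \<xi> where "\<xi> = y - prox y"
  define g where "g s = envelope (y + s *\<^sub>R k) - s * (\<xi> \<bullet> k) - s\<^sup>2 / 2 * ((k - T k) \<bullet> k)" for s :: real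
  define g' where "g' s = (y + s *\<^sub>R k - prox (y + s *\<^sub>R k)) \<bullet> k - \<xi> \<bullet> k - s * ((k - T k) \<bullet> k)" for s :: real
  have der: "(g has_real_derivative g' s) (at s)" for s
  proof -
    have "((\<lambda>s. y + s *\<^sub>R k) has_derivative (\<lambda>h. h *\<^sub>R k)) (at s)" by (auto intro!: derivative_eq_intros)
    from diff_chain_at[OF this envelope_has_derivative]
    have "((\<lambda>s. envelope (y + s *\<^sub>R k)) has_derivative (\<lambda>h. (y + s *\<^sub>R k - prox (y + s *\<^sub>R k)) \<bullet> (h *\<^sub>R k))) (at s)"
      by (simp add: o_def)
    then have "((\<lambda>s. envelope (y + s *\<^sub>R k)) has_real_derivative ((y + s *\<^sub>R k - prox (y + s *\<^sub>R k)) \<bullet> k)) (at s)"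
      by (simp add: has_field_derivative_def mult_commute_abs)
    then show ?thesis unfolding g_def g'_def by (auto intro!: derivative_eq_intros)
  qed
  have g': "\<bar>g' s\<bar> \<le> \<eta> * r\<^sup>2" if s: "0 \<le> s" "s \<le> 1" for s
  proof -
    have ns: "norm (s *\<^sub>R k) \<le> r" using s k mult_mono[of s 1 "norm k" r] by simp
    have "g' s = - ((prox (y + s *\<^sub>R k) - prox y - T (s *\<^sub>R k)) \<bullet> k)"
      by (simp add: g'_def \<xi>_def inner_diff inner_add linear_scale[OF T] algebra_simps)
    then have "\<bar>g' s\<bar> \<le> norm (prox (y + s *\<^sub>R k) - prox y - T (s *\<^sub>R k)) * norm k"
      using Cauchy_Schwarz_ineq2 by simp
    also have "\<dots> \<le> (\<eta> * r) * r"
      using \<eta>[OF ns] k norm_ge_zero order_trans by (intro mult_mono) (auto intro: order_trans[OF norm_ge_zero])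
    finally show ?thesis by (simp add: power2_eq_square mult_ac)
  qed
  obtain s where s: "0 < s" "s < 1" "g 1 - g 0 = (1 - 0) * g' s"
    using MVT2[of 0 1 g g'] der by auto
  then have "\<bar>g 1 - g 0\<bar> \<le> \<eta> * r\<^sup>2" using g'[of s] by simp
  moreover have "g 1 - g 0 = envelope (y + k) - envelope y - (y - prox y) \<bullet> k - (k - T k) \<bullet> k / 2" by (simp add: g_def \<xi>_def)
  ultimately show ?thesis by simp
qed

text \<open>Carries the expansion from the envelope back to \<open>f\<close>. The envelope has
  approximate Hessian \<open>I - P\<close> with \<open>P\<close> the symmetric part of
  \<open>T\<close>, and the corresponding Hessian of \<open>f\<close> is the inverse of
  \<open>P\<close> minus \<open>I\<close>. The quadratic upper bound on \<open>f\<close> is what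
  makes \<open>P\<close> coercive, hence invertible with a controlled inverse.\<close>

lemma prox_expansion:
  assumes \<xi>: "\<xi> = y - prox y" and z: "z = prox y" and M: "M \<ge> 0"
    and up: "\<And>d. norm d \<le> r1 ==> f (z + d) \<le> f z + \<xi> \<bullet> d + M / 2 * (norm d)\<^sup>2"
    and r: "0 < r" "r \<le> r1" and T: "linear T"
    and T\<eta>: "\<And>k. norm k \<le> r ==> norm (prox (y + k) - prox y - T k) \<le> \<eta> * r"
    and \<eta>: "\<eta> \<le> 1 / (4 * (1 + M))"
  shows "\<exists>B. linear B \<and> (\<forall>a b. B a \<bullet> b = a \<bullet> B b) \<and> (\<forall>a. norm (B a) \<le> (3 + 2 * M) * norm a) \<and>
     (\<forall>d. norm d \<le> r / (2 * (1 + M)) --> \<bar>f (z + d) - f z - \<xi> \<bullet> d - B d \<bullet> d / 2\<bar> \<le> \<eta> * r\<^sup>2)"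
proof -
  \<comment> \<open>\<open>c0\<close> serves as coercivity constant of \<open>P\<close> and also as
    the factor by which the radius shrinks, so that each \<open>k\<close> attached to an admissible
    \<open>d\<close> stays within radius \<open>r\<close>.\<close>
  define c0 where "c0 = 1 / (2 * (1 + M))"
  have c0: "c0 > 0" "c0 \<le> 1/2" using M by (auto simp: c0_def divide_simps)
  define P where "P k = (1/2) *\<^sub>R (T k + adjoint T k)" for k
  have adj: "adjoint T a \<bullet> b = a \<bullet> T b" "a \<bullet> adjoint T b = T a \<bullet> b" for a b
    using adjoint_clauses[OF T] by auto
  have linP: "linear P" unfolding P_def
    using T adjoint_linear[OF T] by (intro linear_compose_scale_right linear_compose_add)
  have symP: "P a \<bullet> b = a \<bullet> P b" for a b by (simp add: P_def inner_add adj)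
  have PT: "P k \<bullet> k = T k \<bullet> k" for k by (simp add: P_def inner_add adj inner_commute)
  have ez: "envelope y = f z + (norm \<xi>)\<^sup>2 / 2" by (simp add: envelope_def z \<xi> norm_minus_commute)
  have sq: "(norm (z + d - (y + k)))\<^sup>2 = (norm \<xi>)\<^sup>2 - 2 * (\<xi> \<bullet> (d - k)) + (norm d)\<^sup>2 - 2 * (k \<bullet> d) + (norm k)\<^sup>2" for d k
  proof -
    have eq: "z + d - (y + k) = d - k - \<xi>" by (simp add: \<xi> z algebra_simps)
    show ?thesis unfolding eq by (simp add: power2_norm_eq_inner inner_diff algebra_simps inner_commute)
  qed
  have val: "\<bar>envelope (y + k) - (norm (z + d - (y + k)))\<^sup>2 / 2 - (f z + \<xi> \<bullet> d - P k \<bullet> k / 2 + k \<bullet> d - (norm d)\<^sup>2 / 2)\<bar> \<le> \<eta> * r\<^sup>2"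
    if "norm k \<le> r" for k d
    using envelope_expansion[OF T T\<eta> that] unfolding sq ez \<xi>[symmetric] PT
    by (simp add: inner_diff power2_norm_eq_inner algebra_simps add_divide_distrib diff_divide_distrib)
  have low: "f (z + d) \<ge> f z + \<xi> \<bullet> d - P k \<bullet> k / 2 + k \<bullet> d - (norm d)\<^sup>2 / 2 - \<eta> * r\<^sup>2" if "norm k \<le> r" for k d
    using val[OF that, of d] envelope_le[of "y + k" "z + d"] by linarith
  \<comment> \<open>The choice \<open>d = k / (1 + M)\<close> maximizes the gain
    \<open>k \<bullet> d - (1 + M) / 2 * |d|^2\<close>; the bound on \<eta> lets the error consume
    at most half of that gain.\<close>
  have coer_r: "P k \<bullet> k \<ge> c0 * r\<^sup>2" if k: "norm k = r" for k
  proof -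
    define d where "d = (1 / (1 + M)) *\<^sub>R k"
    have nd: "norm d = r / (1 + M)" using M k by (simp add: d_def)
    also have "\<dots> \<le> r" using M r by (simp add: divide_simps mult_left_mono)
    finally have "norm d \<le> r1" using r by simp
    moreover have "(1 + M) / 2 * (norm d)\<^sup>2 = (norm d)\<^sup>2 / 2 + M / 2 * (norm d)\<^sup>2" by (simp add: field_simps)
    ultimately have "P k \<bullet> k / 2 \<ge> k \<bullet> d - (1 + M) / 2 * (norm d)\<^sup>2 - \<eta> * r\<^sup>2"
      using up[of d] low[of k d] k by linarith
    define Y where "Y = r\<^sup>2 / (1 + M)"
    have "k \<bullet> d = Y" using k by (simp add: Y_def d_def power2_norm_eq_inner[symmetric])
    moreover have "(1 + M) / 2 * (norm d)\<^sup>2 = Y / 2"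
      unfolding nd using M by (simp add: Y_def power_divide power2_eq_square divide_simps)
    moreover have "\<eta> * r\<^sup>2 \<le> Y / 4"
    proof -
      have "\<eta> * r\<^sup>2 \<le> 1 / (4 * (1 + M)) * r\<^sup>2" using \<eta> by (rule mult_right_mono) simp
      then show ?thesis by (simp add: Y_def algebra_simps)
    qed
    moreover have "c0 * r\<^sup>2 = Y / 2" by (simp add: Y_def c0_def)
    ultimately show ?thesis using \<open>k \<bullet> d - (1 + M) / 2 * (norm d)\<^sup>2 - \<eta> * r\<^sup>2 \<le> P k \<bullet> k / 2\<close> by linarith
  qed
  have coer: "P k \<bullet> k \<ge> c0 * (norm k)\<^sup>2" for k
  proof (cases "k = 0")
    case True then show ?thesis by simp
  next
    case False
    define t where "t = r / norm k"
    have t: "t > 0" using False r by (simp add: t_def)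
    have "norm (t *\<^sub>R k) = r" using False r by (simp add: t_def)
    from coer_r[OF this] have "t\<^sup>2 * (P k \<bullet> k) \<ge> c0 * r\<^sup>2" by (simp add: linear_scale[OF linP] power2_eq_square)
    moreover have "r = t * norm k" using False by (simp add: t_def)
    ultimately have "t\<^sup>2 * (c0 * (norm k)\<^sup>2) \<le> t\<^sup>2 * (P k \<bullet> k)" by (simp add: power_mult_distrib mult_ac)
    then show ?thesis using t by simp
  qed
  have "inj P"
  proof (rule linear_injective_0[OF linP, THEN iffD2], intro allI impI)
    fix x assume "P x = 0" then show "x = 0" using coer[of x] c0 by (simp add: mult_le_0_iff)
  qed
  then obtain R where R: "linear R" "\<And>x. R (P x) = x" "\<And>x. P (R x) = x"
    using linear_injective_isomorphism[OF linP] by blast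
  have symR: "R a \<bullet> b = a \<bullet> R b" for a b
    using symP[of "R a" "R b"] by (simp add: R)
  have nR: "norm (R a) \<le> norm a / c0" for a
  proof -
    have "c0 * (norm (R a))\<^sup>2 \<le> a \<bullet> R a" using coer[of "R a"] by (simp add: R)
    also have "\<dots> \<le> norm a * norm (R a)" by (rule norm_cauchy_schwarz)
    finally have "norm (R a) * (c0 * norm (R a)) \<le> norm (R a) * norm a" by (simp add: power2_eq_square mult_ac)
    then have "c0 * norm (R a) \<le> norm a"
      using c0 by (cases "R a = 0") auto
    then show ?thesis using c0 by (simp add: pos_le_divide_eq mult.commute)
  qed
  define B where "B d = R d - d" for d
  have linB: "linear B" unfolding B_def using R(1) by (intro linear_compose_sub linear_ident)
  have symB: "B a \<bullet> b = a \<bullet> B b" for a b by (simp add: B_def inner_diff symR)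
  have nB: "norm (B a) \<le> (3 + 2 * M) * norm a" for a
  proof -
    have "norm (B a) \<le> norm (R a) + norm a" unfolding B_def by (rule norm_triangle_ineq4)
    also have "norm (R a) \<le> 2 * (1 + M) * norm a" using nR[of a] by (simp add: c0_def mult_ac)
    finally show ?thesis by (simp add: algebra_simps)
  qed
  have main: "\<bar>f (z + d) - f z - \<xi> \<bullet> d - B d \<bullet> d / 2\<bar> \<le> \<eta> * r\<^sup>2" if d: "norm d \<le> r / (2 * (1 + M))" for d
  proof -
    have d': "norm d \<le> c0 * r" using d by (simp add: c0_def)
    have "norm d / c0 \<le> r" using d' c0 by (simp add: field_simps)
    then have nk: "norm (R d) \<le> r" using nR[of d] by linarith
    \<comment> \<open>The lower bound for \<open>f (z + d)\<close> holds for every \<open>k\<close>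
      of norm at most \<open>r\<close>; the choice \<open>k = R d\<close> maximizes it.\<close>
    have "P (R d) \<bullet> R d = d \<bullet> R d" by (simp add: R)
    then have lower: "f (z + d) \<ge> f z + \<xi> \<bullet> d + B d \<bullet> d / 2 - \<eta> * r\<^sup>2"
      using low[OF nk, of d] by (simp add: B_def inner_diff power2_norm_eq_inner inner_commute field_simps)
    \<comment> \<open>For the upper bound the envelope is evaluated at the one \<open>k\<close> for
      which \<open>z + d\<close> is the proximal point, and coercivity of \<open>P\<close> then
      replaces this \<open>k\<close> by \<open>R d\<close>. The bound \<open>up\<close> at distance
      \<open>2 * norm d\<close> limits how far the subgradient at \<open>z + d\<close> can be from
      \<xi>, and so the size of that \<open>k\<close>.\<close>
    obtain \<xi>2 where \<xi>2: "\<And>z'. f z' \<ge> f (z + d) + \<xi>2 \<bullet> (z' - (z + d))" using ex_subgradient by blast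
    define n where "n = \<xi>2 - \<xi>"
    have nn: "norm n \<le> 2 * M * norm d"
    proof (cases "n = 0 \<or> d = 0")
      case True
      have "n = 0" if "d = 0"
      proof (rule zero_if_inner_le_square)
        fix h :: 'a assume "norm h \<le> r1"
        from up[OF this] \<xi>2[of "z + h"] that show "n \<bullet> h \<le> M / 2 * (norm h)\<^sup>2" by (simp add: n_def inner_diff)
      qed (use r in simp)
      then show ?thesis using True M by auto
    next
      case False
      define h where "h = (2 * norm d / norm n) *\<^sub>R n"
      have nh: "norm h = 2 * norm d" using False by (simp add: h_def)
      have nhd: "n \<bullet> h = 2 * norm d * norm n" using False by (simp add: h_def power2_norm_eq_inner[symmetric] power2_eq_square)
      have "2 * norm d \<le> 2 * (c0 * r)" using d' by simp
      also have "\<dots> \<le> r" using c0 r by simp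
      finally have "norm h \<le> r1" using nh r by simp
      then have "f (z + h) \<le> f z + \<xi> \<bullet> h + M / 2 * (2 * norm d)\<^sup>2" using up[of h] nh by simp
      moreover have "f (z + h) \<ge> f (z + d) + \<xi>2 \<bullet> (h - d)" using \<xi>2[of "z + h"] by (simp add: algebra_simps)
      moreover have "f (z + d) \<ge> f z + \<xi> \<bullet> d" using prox[of y "z + d"] by (simp add: \<xi> z)
      ultimately have "n \<bullet> h \<le> n \<bullet> d + 2 * M * (norm d)\<^sup>2" by (simp add: n_def inner_diff power_mult_distrib)
      also have "n \<bullet> d \<le> norm n * norm d" by (rule norm_cauchy_schwarz)
      finally have "norm d * norm n \<le> norm d * (2 * M * norm d)"
        unfolding nhd by (simp add: power2_eq_square mult_ac)
      then show ?thesis using False by simp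
    qed
    define k where "k = d + n"
    have "norm k \<le> norm d + norm n" unfolding k_def by (rule norm_triangle_ineq)
    also have "\<dots> \<le> (1 + 2 * M) * norm d" using nn by (simp add: algebra_simps)
    also have "\<dots> \<le> (1 + 2 * M) * (c0 * r)" using d' M by (intro mult_left_mono) auto
    also have "\<dots> \<le> r" using M r by (simp add: c0_def divide_simps)
    finally have nk2: "norm k \<le> r" .
    have yk: "y + k = (z + d) + \<xi>2" by (simp add: k_def n_def \<xi> z)
    have "prox (y + k) = z + d" unfolding yk by (rule prox_eq[OF \<xi>2])
    then have "f (z + d) = envelope (y + k) - (norm (z + d - (y + k)))\<^sup>2 / 2" by (simp add: envelope_def)
    then have "f (z + d) \<le> f z + \<xi> \<bullet> d - P k \<bullet> k / 2 + k \<bullet> d - (norm d)\<^sup>2 / 2 + \<eta> * r\<^sup>2"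
      using val[OF nk2, of d] by linarith
    moreover have "P (k - R d) \<bullet> (k - R d) \<ge> 0"
      using coer[of "k - R d"] c0 by (meson mult_nonneg_nonneg order_less_imp_le order_trans zero_le_power2)
    then have "- P k \<bullet> k / 2 + k \<bullet> d \<le> d \<bullet> R d / 2"
      using symP[of k "R d"] by (simp add: linear_diff[OF linP] R inner_diff inner_commute)
    ultimately have "f (z + d) \<le> f z + \<xi> \<bullet> d + B d \<bullet> d / 2 + \<eta> * r\<^sup>2"
      by (simp add: B_def inner_diff power2_norm_eq_inner inner_commute field_simps)
    then show ?thesis using lower by linarith
  qed
  show ?thesis using linB symB nB main by blast
qed

end

text \<open>The part of \<open>K\<close> outside its interior is compact, so \<open>g\<close> has a
  maximum there, strictly below \<open>m\<close>. The resulting gap leaves room for the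
  perturbations of \<open>g\<close> made later.\<close>

lemma compact_interior_gap:
  fixes g :: "'a::topological_space => real"
  assumes K: "compact K" and cg: "continuous_on K g"
    and int: "\<And>z. z \<in> K ==> g z \<ge> m ==> z \<in> interior K"
  obtains \<beta> where "\<beta> > 0" "\<And>z. z \<in> K ==> g z \<ge> m - \<beta> ==> z \<in> interior K"
proof (cases "K - interior K = {}")
  case True then show ?thesis by (intro that[of 1]) auto
next
  case False
  have "compact (K - interior K)" using K by (intro compact_diff) auto
  moreover have "continuous_on (K - interior K) g" using cg by (rule continuous_on_subset) auto
  ultimately obtain w where w: "w \<in> K - interior K" "\<And>z. z \<in> K - interior K ==> g z \<le> g w"
    using continuous_attains_sup[of "K - interior K" g] False by blast
  have gw: "g w < m" using w(1) int[of w] by force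
  have "z \<in> interior K" if "z \<in> K" "g z \<ge> m - (m - g w) / 2" for z
  proof (rule ccontr)
    assume "z \<notin> interior K"
    then have "g z \<le> g w" using w(2)[of z] that by blast
    then show False using that gw by (simp add: field_simps)
  qed
  then show ?thesis using gw by (intro that[of "(m - g w) / 2"]) auto
qed

section \<open>Second-order expansions at perturbed maxima\<close>

context subdifferentiable
begin

text \<open>Jensen's argument: as the linear perturbation \<open>p\<close> ranges over a small ball,
  the points \<open>z + (D\<phi> z + p)\<close> belonging to perturbed maxima form a set that a
  Lipschitz map sends onto the ball, so the set is not negligible. The proximal map is nearly affine
  near one of its points, and the expansion holds at the corresponding maximum.\<close>

proposition jensen_expansion:
  assumes K: "compact K" and z0: "z0 \<in> K"
    and int: "\<And>z. z \<in> K ==> f z - \<phi> z \<ge> f z0 - \<phi> z0 ==> z \<in> interior K"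
    and cont: "continuous_on K \<phi>" and M: "M \<ge> 0"
    and Dlip: "\<And>z z'. z \<in> K ==> z' \<in> K ==> norm (D\<phi> z - D\<phi> z') \<le> M * norm (z - z')"
    and up: "\<And>z z'. z \<in> K ==> z' \<in> K ==> \<phi> z' \<le> \<phi> z + D\<phi> z \<bullet> (z' - z) + M / 2 * (norm (z' - z))\<^sup>2"
    and \<delta>: "\<delta> > 0" and \<eta>: "\<eta> > 0"
  obtains z p r B where "0 < r" "r < \<delta>" "norm p \<le> \<delta>" "cball z r \<subseteq> K" "f z - \<phi> z \<ge> f z0 - \<phi> z0 - \<delta>"
    "\<And>z'. z' \<in> K ==> f z' - \<phi> z' - p \<bullet> z' \<le> f z - \<phi> z - p \<bullet> z"
    "linear B" "\<And>a b. B a \<bullet> b = a \<bullet> B b" "\<And>a. norm (B a) \<le> (3 + 2 * M) * norm a"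
    "\<And>d. norm d \<le> r ==> \<bar>f (z + d) - f z - (D\<phi> z + p) \<bullet> d - B d \<bullet> d / 2\<bar> \<le> \<eta> * r\<^sup>2"
proof -
  define g where "g z = f z - \<phi> z" for z
  have cg: "continuous_on K g" unfolding g_def by (intro continuous_intros cont continuous)
  obtain \<beta> where \<beta>: "\<beta> > 0" "\<And>z. z \<in> K ==> g z \<ge> g z0 - \<beta> ==> z \<in> interior K"
    using compact_interior_gap[OF K cg, of "g z0"] int unfolding g_def by blast
  define K' where "K' = {z \<in> K. g z \<ge> g z0 - \<beta>}"
  have "compact K'"
  proof -
    have "closedin (top_of_set K) (K \<inter> g -` {g z0 - \<beta>..})" by (intro continuous_closedin_preimage cg) auto
    then have "compact (K \<inter> g -` {g z0 - \<beta>..})" using K closedin_compact by blast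
    moreover have "K \<inter> g -` {g z0 - \<beta>..} = K'" by (auto simp: K'_def)
    ultimately show ?thesis by simp
  qed
  moreover have "K' \<subseteq> interior K" using \<beta>(2) by (auto simp: K'_def)
  ultimately obtain r1 where r1: "r1 > 0" "(\<Union>x\<in>K'. cball x r1) \<subseteq> interior K"
    using compact_subset_open_imp_cball_epsilon_subset[of K' "interior K"] by auto
  have r1K: "cball z r1 \<subseteq> K" if "z \<in> K" "g z \<ge> g z0 - \<beta>" for z
    using r1(2) that interior_subset[of K] by (auto simp: K'_def)
  obtain Rk where Rk: "\<And>z. z \<in> K ==> norm z \<le> Rk" using compact_imp_bounded[OF K] bounded_iff by blast
  have Rk0: "Rk \<ge> 0" using Rk[OF z0] norm_ge_zero order_trans by blast
  \<comment> \<open>So small that the linear term changes differences of values on \<open>K\<close>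
    by at most \<open>min \<beta> \<delta>\<close>: perturbed maxima stay interior and lose at most
    \<delta>.\<close>
  define \<delta>' where "\<delta>' = min \<delta> (min \<beta> \<delta> / (2 * (Rk + 1)))"
  have \<delta>': "\<delta>' > 0" using \<delta> \<beta>(1) Rk0 by (simp add: \<delta>'_def)
  have \<delta>'R: "2 * \<delta>' * Rk \<le> min \<beta> \<delta>"
  proof -
    have "\<delta>' \<le> min \<beta> \<delta> / (2 * (Rk + 1))" by (simp add: \<delta>'_def)
    then have "2 * \<delta>' * (Rk + 1) \<le> min \<beta> \<delta>" using Rk0 by (simp add: pos_le_divide_eq mult_ac)
    moreover have "2 * \<delta>' * Rk \<le> 2 * \<delta>' * (Rk + 1)" using \<delta>' by (intro mult_left_mono) auto
    ultimately show ?thesis by linarith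
  qed
  define mx where "mx p z \<longleftrightarrow> z \<in> K \<and> (\<forall>z'\<in>K. g z' - p \<bullet> z' \<le> g z - p \<bullet> z)" for p z
  have ex_mx: "\<exists>z. mx p z" for p
  proof -
    have "continuous_on K (\<lambda>z. g z - p \<bullet> z)" by (intro continuous_intros cg)
    then show ?thesis using continuous_attains_sup[OF K, of "\<lambda>z. g z - p \<bullet> z"] z0 unfolding mx_def by blast
  qed
  have mx_val: "g z \<ge> g z0 - min \<beta> \<delta>" if "mx p z" "norm p \<le> \<delta>'" for p z
  proof -
    have "g z0 - p \<bullet> z0 \<le> g z - p \<bullet> z" using that z0 by (auto simp: mx_def)
    moreover have "p \<bullet> z0 - p \<bullet> z \<le> norm p * norm (z0 - z)" by (metis inner_diff_right norm_cauchy_schwarz)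
    moreover have "norm p * norm (z0 - z) \<le> \<delta>' * (2 * Rk)"
    proof (rule mult_mono)
      have "norm (z0 - z) \<le> norm z0 + norm z" by (rule norm_triangle_ineq4)
      then show "norm (z0 - z) \<le> 2 * Rk" using Rk[OF z0] Rk[of z] that by (auto simp: mx_def)
    qed (use that \<delta>' in auto)
    ultimately show ?thesis using \<delta>'R by linarith
  qed
  have mx_ball: "cball z r1 \<subseteq> K" if "mx p z" "norm p \<le> \<delta>'" for p z
    using mx_val[OF that] that r1K[of z] by (auto simp: mx_def)
  have mx_up: "f (z + d) \<le> f z + (D\<phi> z + p) \<bullet> d + M / 2 * (norm d)\<^sup>2"
    if "mx p z" "norm p \<le> \<delta>'" "norm d \<le> r1" for p z d
  proof -
    have "z + d \<in> cball z r1" using that by (simp add: dist_norm)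
    then have zd: "z + d \<in> K" using mx_ball[OF that(1,2)] by blast
    then have "g (z + d) - p \<bullet> (z + d) \<le> g z - p \<bullet> z" using that by (auto simp: mx_def)
    moreover have "\<phi> (z + d) \<le> \<phi> z + D\<phi> z \<bullet> d + M / 2 * (norm d)\<^sup>2"
      using up[of z "z + d"] zd that(1) by (simp add: mx_def)
    ultimately show ?thesis by (simp add: g_def inner_add)
  qed
  \<comment> \<open>At a perturbed maximum \<open>f\<close> lies locally below a quadratic that
    touches it, so its only subgradient there is \<open>D\<phi> z + p\<close>.\<close>
  have mx_prox: "prox (z + (D\<phi> z + p)) = z" if "mx p z" "norm p \<le> \<delta>'" for p z
  proof -
    obtain \<xi> where \<xi>: "\<And>z'. f z' \<ge> f z + \<xi> \<bullet> (z' - z)" using ex_subgradient by blast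
    have "\<xi> - (D\<phi> z + p) = 0"
    proof (rule zero_if_inner_le_square[OF _ r1(1)])
      fix d :: 'a assume "norm d \<le> r1"
      from mx_up[OF that this] \<xi>[of "z + d"] show "(\<xi> - (D\<phi> z + p)) \<bullet> d \<le> M / 2 * (norm d)\<^sup>2" by (simp add: inner_diff)
    qed
    then have "\<xi> = D\<phi> z + p" by simp
    then show ?thesis using prox_eq[OF \<xi>] by simp
  qed
  define Y where "Y = {z + (D\<phi> z + p) | z p. mx p z \<and> norm p < \<delta>'}"
  have Ybd: "bounded Y"
  proof -
    have "norm (z + (D\<phi> z + p)) \<le> Rk + (norm (D\<phi> z0) + M * (2 * Rk)) + \<delta>'" if "mx p z" "norm p < \<delta>'" for z p
    proof -
      have zK: "z \<in> K" using that by (simp add: mx_def)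
      have "norm (D\<phi> z) \<le> norm (D\<phi> z0) + norm (D\<phi> z - D\<phi> z0)" by norm
      also have "norm (D\<phi> z - D\<phi> z0) \<le> M * norm (z - z0)" by (rule Dlip[OF zK z0])
      also have "M * norm (z - z0) \<le> M * (2 * Rk)"
        using norm_triangle_ineq4[of z z0] Rk[OF z0] Rk[OF zK] M by (intro mult_left_mono) auto
      finally have "norm (D\<phi> z) \<le> norm (D\<phi> z0) + M * (2 * Rk)" by simp
      moreover have "norm (z + (D\<phi> z + p)) \<le> norm z + (norm (D\<phi> z) + norm p)" by (meson add_left_mono norm_triangle_ineq order_trans)
      ultimately show ?thesis using Rk[OF zK] that by linarith
    qed
    then show ?thesis unfolding bounded_iff Y_def by blast
  qed
  have Yneg: "\<not> negligible Y"
  proof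
    assume neg: "negligible Y"
    \<comment> \<open>Recovers \<open>p\<close> from \<open>z + (D\<phi> z + p)\<close>. It is
      Lipschitz on \<open>Y\<close> because \<open>prox\<close> is nonexpansive and
      \<open>D\<phi>\<close> is Lipschitz on \<open>K\<close>.\<close>
    define \<pi> where "\<pi> y = y - prox y - D\<phi> (prox y)" for y
    have prY: "prox y \<in> K" if "y \<in> Y" for y
      using that mx_prox unfolding Y_def mx_def by auto
    have "negligible (\<pi> ` Y)"
    proof (rule negligible_locally_Lipschitz_image[OF order_refl neg])
      fix y assume y: "y \<in> Y"
      have "norm (\<pi> y' - \<pi> y) \<le> (2 + M) * norm (y' - y)" if y': "y' \<in> Y" for y'
      proof -
        have "norm (\<pi> y' - \<pi> y) \<le> norm (y' - y) + norm (prox y' - prox y) + norm (D\<phi> (prox y') - D\<phi> (prox y))"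
          unfolding \<pi>_def by norm
        also have "norm (D\<phi> (prox y') - D\<phi> (prox y)) \<le> M * norm (prox y' - prox y)"
          using Dlip prY y y' by blast
        also have "M * norm (prox y' - prox y) \<le> M * norm (y' - y)"
          using prox_nonexpansive M by (intro mult_left_mono)
        finally show ?thesis using prox_nonexpansive[of y' y] by (simp add: algebra_simps)
      qed
      then show "\<exists>T B. open T \<and> y \<in> T \<and> (\<forall>y'\<in>Y \<inter> T. norm (\<pi> y' - \<pi> y) \<le> B * norm (y' - y))"
        by (intro exI[of _ UNIV] exI[of _ "2 + M"]) auto
    qed
    moreover have "ball 0 \<delta>' \<subseteq> \<pi> ` Y"
    proof
      fix p :: 'a assume "p \<in> ball 0 \<delta>'"
      then have p: "norm p < \<delta>'" by simp
      obtain z where z: "mx p z" using ex_mx by blast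
      have "\<pi> (z + (D\<phi> z + p)) = p" using mx_prox[OF z] p by (simp add: \<pi>_def)
      moreover have "z + (D\<phi> z + p) \<in> Y" using z p by (auto simp: Y_def)
      ultimately show "p \<in> \<pi> ` Y" by (metis image_eqI)
    qed
    ultimately have "negligible (ball (0::'a) \<delta>')" by (rule negligible_subset)
    then show False using open_not_negligible[of "ball (0::'a) \<delta>'"] \<delta>' by auto
  qed
  \<comment> \<open>The first bound pays for the shrinking of the radius by
    \<open>2 * (1 + M)\<close>, which enters squared; the second is the smallness used for
    coercivity.\<close>
  define \<eta>' where "\<eta>' = min (\<eta> / (4 * (1 + M)\<^sup>2)) (1 / (4 * (1 + M)))"
  have \<eta>': "\<eta>' > 0" using \<eta> M by (simp add: \<eta>'_def)
  have lip1: "norm (prox x - prox y) \<le> 1 * norm (x - y)" for x y using prox_nonexpansive by simp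
  have rpos: "min r1 \<delta> > 0" using r1(1) \<delta> by simp
  obtain y \<rho> T where y: "y \<in> Y" and \<rho>: "0 < \<rho>" "\<rho> < min r1 \<delta>" and T: "linear T"
    "\<And>k. norm k \<le> \<rho> ==> norm (prox (y + k) - prox y - T k) \<le> \<eta>' * \<rho>"
    using approx_affine[OF lip1 Yneg Ybd \<eta>' rpos] by blast
  obtain z p where zp: "mx p z" "norm p < \<delta>'" "y = z + (D\<phi> z + p)" using y by (auto simp: Y_def)
  have pz: "prox y = z" using mx_prox zp by simp
  define r where "r = \<rho> / (2 * (1 + M))"
  have up': "f (z + d) \<le> f z + (D\<phi> z + p) \<bullet> d + M / 2 * (norm d)\<^sup>2" if "norm d \<le> r1" for d
    using mx_up[OF zp(1) less_imp_le[OF zp(2)] that] .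
  have e1: "D\<phi> z + p = y - prox y" using zp(3) pz by simp
  have e2: "\<rho> \<le> r1" using \<rho>(2) by simp
  have e3: "\<eta>' \<le> 1 / (4 * (1 + M))" by (simp add: \<eta>'_def)
  obtain B where B: "linear B" "\<And>a b. B a \<bullet> b = a \<bullet> B b" "\<And>a. norm (B a) \<le> (3 + 2 * M) * norm a"
     "\<And>d. norm d \<le> r ==> \<bar>f (z + d) - f z - (D\<phi> z + p) \<bullet> d - B d \<bullet> d / 2\<bar> \<le> \<eta>' * \<rho>\<^sup>2"
    using prox_expansion[OF e1 pz[symmetric] M up' \<rho>(1) e2 T e3] unfolding r_def by blast
  have r\<rho>: "r \<le> \<rho>"
  proof -
    have "\<rho> * 1 \<le> \<rho> * (2 * (1 + M))" using \<rho> M by (intro mult_left_mono) auto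
    then show ?thesis using M by (simp add: r_def divide_simps)
  qed
  have err: "\<eta>' * \<rho>\<^sup>2 \<le> \<eta> * r\<^sup>2"
  proof -
    have "\<eta>' * \<rho>\<^sup>2 \<le> \<eta> / (4 * (1 + M)\<^sup>2) * \<rho>\<^sup>2" by (intro mult_right_mono) (auto simp: \<eta>'_def)
    also have "\<dots> = \<eta> * r\<^sup>2" using M by (simp add: r_def power_divide power_mult_distrib del: distrib_left_numeral)
    finally show ?thesis .
  qed
  show thesis
  proof (rule that[of r p z B])
    show "0 < r" using \<rho> M by (simp add: r_def)
    show "r < \<delta>" using r\<rho> \<rho> by simp
    show "norm p \<le> \<delta>" using zp(2) by (simp add: \<delta>'_def)
    show "cball z r \<subseteq> K" using mx_ball[OF zp(1)] zp(2) r\<rho> \<rho> by (force simp: subset_eq)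
    show "f z - \<phi> z \<ge> f z0 - \<phi> z0 - \<delta>" using mx_val[OF zp(1)] zp(2) by (simp add: g_def)
    show "f z' - \<phi> z' - p \<bullet> z' \<le> f z - \<phi> z - p \<bullet> z" if "z' \<in> K" for z'
      using zp(1) that by (auto simp: mx_def g_def)
    show "\<bar>f (z + d) - f z - (D\<phi> z + p) \<bullet> d - B d \<bullet> d / 2\<bar> \<le> \<eta> * r\<^sup>2" if "norm d \<le> r" for d
      using B(4)[OF that] err by linarith
  qed (use B in auto)
qed

end

section \<open>Second-order jets and doubling of variables\<close>

text \<open>A superjet in exact form: the quadratic lies above \<open>f\<close> on a whole ball
  without a remainder, so it is itself an admissible test function.\<close>

definition touch2 :: "('a::euclidean_space => real) => 'a => 'a => ('a => 'a) => bool" where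
  "touch2 f z \<xi> S \<longleftrightarrow> linear S \<and> (\<forall>a b. S a \<bullet> b = a \<bullet> S b) \<and>
     (\<exists>r>0. \<forall>d. norm d < r --> f (z + d) \<le> f z + \<xi> \<bullet> d + S d \<bullet> d / 2)"

text \<open>The error \<open>\<eta> * r\<^sup>2\<close> is the same throughout the ball and does not
  improve at its centre, so exact touching has to be found nearby. After subtracting
  \<open>4 * \<eta> * |d|^2\<close> the loss on the sphere exceeds what the error allows, hence a
  maximum is interior; the subtracted term adds \<open>8 * \<eta>\<close> to the Hessian.\<close>

lemma touch2_retouch:
  fixes g :: "'a::euclidean_space => real"
  assumes cg: "continuous_on UNIV g" and r: "r > 0" and \<eta>: "\<eta> > 0" and S: "linear S" "\<And>a b. S a \<bullet> b = a \<bullet> S b"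
    and ex: "\<And>d. norm d \<le> r ==> \<bar>g (z + d) - g z - \<xi> \<bullet> d - S d \<bullet> d / 2\<bar> \<le> \<eta> * r\<^sup>2"
  shows "\<exists>d. norm d < r \<and> touch2 g (z + d) (\<xi> + S d + (8 * \<eta>) *\<^sub>R d) (\<lambda>a. S a + (8 * \<eta>) *\<^sub>R a)"
proof -
  define G where "G d = g (z + d) - \<xi> \<bullet> d - S d \<bullet> d / 2 - 4 * \<eta> * (d \<bullet> d)" for d
  have cS: "continuous_on A S" for A using S(1) linear_continuous_on linear_conv_bounded_linear by blast
  have cgz: "continuous_on UNIV (\<lambda>d. g (z + d))"
    using continuous_shift[OF cg, of z] by (simp add: add.commute)
  have co: "continuous_on (cball 0 r) G"
    unfolding G_def using cgz by (intro continuous_intros cS) (auto intro: continuous_on_subset)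
  have ne: "cball (0::'a) r \<noteq> {}" using r by simp
  obtain d where d: "d \<in> cball 0 r" "\<And>d'. d' \<in> cball 0 r ==> G d' \<le> G d"
    using continuous_attains_sup[OF compact_cball ne co] by blast
  have dr: "norm d < r"
  proof (rule ccontr)
    assume "\<not> norm d < r"
    then have nd: "norm d = r" using d(1) by simp
    have "G 0 \<le> G d" using d(2)[of 0] r by simp
    then have "4 * \<eta> * r\<^sup>2 \<le> g (z + d) - g z - \<xi> \<bullet> d - S d \<bullet> d / 2"
      by (simp add: G_def linear_0[OF S(1)] nd[symmetric] power2_norm_eq_inner)
    then have "4 * (\<eta> * r\<^sup>2) \<le> \<eta> * r\<^sup>2" using ex[of d] nd by (simp add: abs_le_iff mult.assoc)
    moreover have "\<eta> * r\<^sup>2 > 0" using \<eta> r by simp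
    ultimately show False by linarith
  qed
  have "touch2 g (z + d) (\<xi> + S d + (8 * \<eta>) *\<^sub>R d) (\<lambda>a. S a + (8 * \<eta>) *\<^sub>R a)"
    unfolding touch2_def
  proof (intro conjI exI allI impI)
    show "linear (\<lambda>a. S a + (8 * \<eta>) *\<^sub>R a)"
      using S(1) by (intro linear_compose_add linear_compose_scale_right linear_ident)
    show "(S a + (8 * \<eta>) *\<^sub>R a) \<bullet> b = a \<bullet> (S b + (8 * \<eta>) *\<^sub>R b)" for a b by (simp add: inner_add S(2))
    show "r - norm d > 0" using dr by simp
    fix e :: 'a assume e: "norm e < r - norm d"
    have "norm (d + e) \<le> r" using norm_triangle_ineq[of d e] e by linarith
    then have "G (d + e) \<le> G d" using d(2) by simp
    then show "g (z + d + e) \<le> g (z + d) + (\<xi> + S d + (8 * \<eta>) *\<^sub>R d) \<bullet> e + (S e + (8 * \<eta>) *\<^sub>R e) \<bullet> e / 2"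
      using S(2)[of e d] by (simp add: G_def add.assoc linear_add[OF S(1)] inner_add inner_commute algebra_simps add_divide_distrib)
  qed
  then show ?thesis using dr by blast
qed

section \<open>Sup-convolutions of bounded continuous functions\<close>

definition supconv_pt :: "real => ('a::euclidean_space => real) => 'a => 'a" where
  "supconv_pt \<rho> w z = (SOME z'. \<forall>z''. w z'' - (norm (z - z''))\<^sup>2 / (2 * \<rho>) \<le> w z' - (norm (z - z'))\<^sup>2 / (2 * \<rho>))"

definition supconv :: "real => ('a::euclidean_space => real) => 'a => real" where
  "supconv \<rho> w z = w (supconv_pt \<rho> w z) - (norm (z - supconv_pt \<rho> w z))\<^sup>2 / (2 * \<rho>)"

locale bounded_cont =
  fixes w :: "'a::euclidean_space => real" and \<rho> Bd :: real
  assumes cont: "continuous_on UNIV w" and bd: "\<And>z. \<bar>w z\<bar> \<le> Bd" and \<rho>: "\<rho> > 0"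
begin

lemma Bd_nonneg: "Bd \<ge> 0" using bd[of 0] by linarith

lemma supconv_ge: "w z' - (norm (z - z'))\<^sup>2 / (2 * \<rho>) \<le> supconv \<rho> w z"
proof -
  define s where "s = sqrt (4 * \<rho> * Bd)"
  have "4 * \<rho> * Bd \<ge> 0" using Bd_nonneg \<rho> by simp
  then have s0: "s \<ge> 0" by (simp add: s_def)
  have co: "continuous_on (cball z s) (\<lambda>z'. w z' - (norm (z - z'))\<^sup>2 / (2 * \<rho>))"
    using \<rho> by (intro continuous_intros continuous_on_subset[OF cont]) auto
  have ne: "cball z s \<noteq> {}" using s0 by simp
  obtain p where p: "p \<in> cball z s" "\<And>z'. z' \<in> cball z s ==> w z' - (norm (z - z'))\<^sup>2 / (2 * \<rho>) \<le> w p - (norm (z - p))\<^sup>2 / (2 * \<rho>)"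
    using continuous_attains_sup[OF compact_cball ne co] by blast
  have "w z' - (norm (z - z'))\<^sup>2 / (2 * \<rho>) \<le> w p - (norm (z - p))\<^sup>2 / (2 * \<rho>)" for z'
  proof (cases "z' \<in> cball z s")
    case False
    then have "s \<le> norm (z - z')" by (simp add: dist_norm)
    then have "s\<^sup>2 \<le> (norm (z - z'))\<^sup>2" using Bd_nonneg \<rho> by (intro power_mono) (auto simp: s_def)
    then have "4 * \<rho> * Bd / (2 * \<rho>) \<le> (norm (z - z'))\<^sup>2 / (2 * \<rho>)"
      using Bd_nonneg \<rho> by (intro divide_right_mono) (auto simp: s_def)
    then have "2 * Bd \<le> (norm (z - z'))\<^sup>2 / (2 * \<rho>)" using \<rho> by simp
    moreover have "w z \<le> w p - (norm (z - p))\<^sup>2 / (2 * \<rho>)" using p(2)[of z] s0 by simp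
    ultimately show ?thesis using bd[of z] bd[of z'] by linarith
  qed (use p in auto)
  then have "\<exists>p. \<forall>z''. w z'' - (norm (z - z''))\<^sup>2 / (2 * \<rho>) \<le> w p - (norm (z - p))\<^sup>2 / (2 * \<rho>)" by blast
  from someI_ex[OF this] show ?thesis unfolding supconv_def supconv_pt_def by blast
qed

lemma supconv_ge_self: "w z \<le> supconv \<rho> w z"
  using supconv_ge[of z z] by simp

lemma supconv_pt_close: "norm (supconv_pt \<rho> w z - z) \<le> sqrt (4 * \<rho> * Bd)"
proof -
  have "(norm (z - supconv_pt \<rho> w z))\<^sup>2 / (2 * \<rho>) \<le> 2 * Bd"
    using supconv_ge_self[of z] bd[of z] bd[of "supconv_pt \<rho> w z"] by (simp add: supconv_def)
  then have "(norm (z - supconv_pt \<rho> w z))\<^sup>2 \<le> 4 * \<rho> * Bd" using \<rho> by (simp add: field_simps)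
  then show ?thesis by (simp add: norm_minus_commute real_le_rsqrt)
qed

text \<open>After adding \<open>|z|^2 / (2 * \<rho>)\<close> every competitor in the sup-convolution
  is affine in \<open>z\<close>; the one attaining the maximum supplies the subgradient.\<close>

lemma supconv_subgradient:
  "supconv \<rho> w z' + (norm z')\<^sup>2 / (2 * \<rho>)
    \<ge> supconv \<rho> w z + (norm z)\<^sup>2 / (2 * \<rho>) + (supconv_pt \<rho> w z /\<^sub>R \<rho>) \<bullet> (z' - z)"
proof -
  define p where "p = supconv_pt \<rho> w z"
  have e: "(norm x)\<^sup>2 / (2 * \<rho>) - (norm (x - p))\<^sup>2 / (2 * \<rho>) = (p /\<^sub>R \<rho>) \<bullet> x - (norm p)\<^sup>2 / (2 * \<rho>)" for x
    using \<rho> by (simp add: power2_norm_eq_inner inner_diff inner_commute field_simps)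
  show ?thesis
    using supconv_ge[of p z'] e[of z] e[of z']
    unfolding supconv_def[of \<rho> w z] p_def[symmetric] by (simp add: inner_diff_right)
qed

text \<open>Moving the point and its maximizer by the same vector leaves the penalty unchanged, so a
  jet of the sup-convolution is a jet of \<open>w\<close> at the maximizer with the same gradient
  and Hessian.\<close>

lemma touch2_supconv:
  assumes "touch2 (supconv \<rho> w) z \<xi> S"
  shows "touch2 w (supconv_pt \<rho> w z) \<xi> S"
proof -
  obtain r where r: "r > 0" "\<And>d. norm d < r ==> supconv \<rho> w (z + d) \<le> supconv \<rho> w z + \<xi> \<bullet> d + S d \<bullet> d / 2"
    using assms by (auto simp: touch2_def)
  define p where "p = supconv_pt \<rho> w z"
  have "w (p + d) \<le> w p + \<xi> \<bullet> d + S d \<bullet> d / 2" if "norm d < r" for d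
    using r(2)[OF that] supconv_ge[of "p + d" "z + d"] unfolding supconv_def[of \<rho> w z] p_def[symmetric] by simp
  then show ?thesis using assms r(1) unfolding touch2_def p_def by blast
qed

lemma continuous_supconv: "continuous_on UNIV (supconv \<rho> w)"
proof -
  interpret subdifferentiable "\<lambda>z. supconv \<rho> w z + (norm z)\<^sup>2 / (2 * \<rho>)"
    using supconv_subgradient by unfold_locales blast
  have "continuous_on UNIV (\<lambda>z. (supconv \<rho> w z + (norm z)\<^sup>2 / (2 * \<rho>)) - (norm z)\<^sup>2 / (2 * \<rho>))"
    using \<rho> by (intro continuous_intros continuous) auto
  then show ?thesis by simp
qed

lemma supconv_le_nearby:
  assumes "\<And>z'. norm (z' - z) \<le> sqrt (4 * \<rho> * Bd) ==> w z' \<le> w z + \<omega>"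
  shows "supconv \<rho> w z \<le> w z + \<omega>"
proof -
  have "(norm (z - supconv_pt \<rho> w z))\<^sup>2 / (2 * \<rho>) \<ge> 0" using \<rho> by simp
  then show ?thesis using assms[OF supconv_pt_close[of z]] unfolding supconv_def by linarith
qed

end

lemma compact_uniform_nearby:
  fixes f :: "'a::euclidean_space => real"
  assumes f: "continuous_on UNIV f" and C: "compact C" and \<omega>: "\<omega> > 0"
  obtains s where "s > 0" "\<And>x y. x \<in> C ==> norm (y - x) \<le> s ==> f y \<le> f x + \<omega>"
proof -
  define C' where "C' = {x + y | x y. x \<in> C \<and> y \<in> cball (0::'a) 1}"
  have "compact C'" unfolding C'_def by (intro compact_sums C compact_cball)
  then have "uniformly_continuous_on C' f"
    using compact_uniformly_continuous continuous_on_subset[OF f] by blast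
  then obtain d where d: "d > 0" "\<And>x y. x \<in> C' ==> y \<in> C' ==> dist y x < d ==> dist (f y) (f x) < \<omega>"
    unfolding uniformly_continuous_on_def using \<omega> by metis
  show thesis
  proof (rule that[of "min 1 (d/2)"])
    show "min 1 (d/2) > 0" using d by simp
    fix x y assume x: "x \<in> C" and y: "norm (y - x) \<le> min 1 (d/2)"
    have "x \<in> C'" unfolding C'_def using x by force
    moreover have "y \<in> C'" unfolding C'_def using x y by (intro CollectI exI[of _ x] exI[of _ "y - x"]) auto
    moreover have "dist y x < d" using y d(1) by (auto simp: dist_norm)
    ultimately have "dist (f y) (f x) < \<omega>" by (rule d(2))
    then show "f y \<le> f x + \<omega>" by (simp add: dist_real_def)
  qed
qed

lemma linear_block:
  fixes B :: "'a::euclidean_space => 'a" and J :: "'b::euclidean_space => 'a"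
  assumes "linear B" "\<And>a b. B a \<bullet> b = a \<bullet> B b" "linear J" "linear Q" "\<And>a b. Q a \<bullet> b = a \<bullet> J b"
  shows "linear (\<lambda>a. Q (B (J a)) + k *\<^sub>R a)"
    "\<And>a b. (Q (B (J a)) + k *\<^sub>R a) \<bullet> b = a \<bullet> (Q (B (J b)) + k *\<^sub>R b)"
proof -
  have "linear (\<lambda>a. Q (B (J a)))"
    using linear_compose[OF linear_compose[OF assms(3,1)] assms(4)] by (simp add: o_def)
  then show "linear (\<lambda>a. Q (B (J a)) + k *\<^sub>R a)" by (intro linear_compose_add linear_compose_scale_right linear_ident)
  show "(Q (B (J a)) + k *\<^sub>R a) \<bullet> b = a \<bullet> (Q (B (J b)) + k *\<^sub>R b)" for a b
    using assms(2)[of "J a" "J b"] assms(5)[of "B (J a)" b] assms(5)[of "B (J b)" a] by (simp add: inner_add inner_commute)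
qed

lemma supconv_block_touch:
  fixes w :: "'a::euclidean_space => real"
  assumes w: "bounded_cont w \<rho> Bd" and r: "r > 0" and \<eta>: "\<eta> > 0"
    and S: "linear S" "\<And>a b. S a \<bullet> b = a \<bullet> S b" "\<And>a. norm (S a) \<le> M * norm a"
    and ex: "\<And>d. norm d \<le> r ==> \<bar>supconv \<rho> w (z + d) - supconv \<rho> w z - \<xi> \<bullet> d - S d \<bullet> d / 2\<bar> \<le> \<eta> * r\<^sup>2"
  obtains z' \<xi>' where "norm (z' - z) \<le> r + sqrt (4 * \<rho> * Bd)" "norm (\<xi>' - \<xi>) \<le> (M + 8 * \<eta>) * r"
    "touch2 w z' \<xi>' (\<lambda>a. S a + (8 * \<eta>) *\<^sub>R a)"
proof -
  interpret bounded_cont w \<rho> Bd by (rule w)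
  obtain d where d: "norm d < r" "touch2 (supconv \<rho> w) (z + d) (\<xi> + S d + (8 * \<eta>) *\<^sub>R d) (\<lambda>a. S a + (8 * \<eta>) *\<^sub>R a)"
    using touch2_retouch[OF continuous_supconv r \<eta> S(1,2) ex] by blast
  show thesis
  proof (rule that[OF _ _ touch2_supconv[OF d(2)]])
    have "norm (supconv_pt \<rho> w (z + d) - z) \<le> norm (supconv_pt \<rho> w (z + d) - (z + d)) + norm d" by norm
    then show "norm (supconv_pt \<rho> w (z + d) - z) \<le> r + sqrt (4 * \<rho> * Bd)"
      using supconv_pt_close[of "z + d"] d(1) by linarith
    have M0: "M * norm d \<ge> 0" using S(3)[of d] norm_ge_zero order_trans by blast
    have "norm (\<xi> + S d + (8 * \<eta>) *\<^sub>R d - \<xi>) \<le> norm (S d) + norm ((8 * \<eta>) *\<^sub>R d)"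
      using norm_triangle_ineq[of "S d" "(8 * \<eta>) *\<^sub>R d"] by (simp add: algebra_simps)
    also have "\<dots> \<le> M * norm d + 8 * \<eta> * norm d" using S(3)[of d] \<eta> by simp
    also have "\<dots> = (M + 8 * \<eta>) * norm d" by (simp add: algebra_simps)
    also have "\<dots> \<le> (M + 8 * \<eta>) * r"
    proof (cases "d = 0")
      case True
      obtain b :: 'a where b: "b \<in> Basis" using nonempty_Basis by blast
      have "0 \<le> M" using order_trans[OF norm_ge_zero S(3)[of b]] b by simp
      then show ?thesis using True \<eta> r by simp
    next
      case False
      then have "M \<ge> 0" using M0 by (simp add: zero_le_mult_iff)
      then show ?thesis using d(1) \<eta> by (intro mult_left_mono) auto
    qed
    finally show "norm (\<xi> + S d + (8 * \<eta>) *\<^sub>R d - \<xi>) \<le> (M + 8 * \<eta>) * r" .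
  qed
qed

text \<open>A theorem on sums for three functions. Sup-convolution makes the sum semiconvex, a
  one-scale expansion is found near its maximum, the diagonal blocks give the three Hessians, and
  retouching turns them into exact jets of the original functions. The matrix inequality is compared
  on one sphere only, which suffices because both sides are homogeneous of degree 2.\<close>

theorem sums_second_order:
  fixes f1 :: "'a::euclidean_space => real" and f2 :: "'b::euclidean_space => real"
    and f3 :: "'c::euclidean_space => real" and \<phi> :: "('a \<times> 'b) \<times> 'c => real"
  defines "W \<equiv> \<lambda>z. f1 (fst (fst z)) + f2 (snd (fst z)) + f3 (snd z)"
  assumes c: "continuous_on UNIV f1" "continuous_on UNIV f2" "continuous_on UNIV f3"
    and bd: "\<And>z. \<bar>f1 z\<bar> \<le> Bd" "\<And>z. \<bar>f2 z\<bar> \<le> Bd" "\<And>z. \<bar>f3 z\<bar> \<le> Bd"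
    and K: "compact K" and z0: "z0 \<in> K"
    and int: "\<And>z. z \<in> K ==> W z - \<phi> z \<ge> W z0 - \<phi> z0 ==> z \<in> interior K"
    and cont: "continuous_on K \<phi>" and M: "M \<ge> 0"
    and Dlip: "\<And>z z'. z \<in> K ==> z' \<in> K ==> norm (D\<phi> z - D\<phi> z') \<le> M * norm (z - z')"
    and up: "\<And>z z'. z \<in> K ==> z' \<in> K ==> \<phi> z' \<le> \<phi> z + D\<phi> z \<bullet> (z' - z) + M / 2 * (norm (z' - z))\<^sup>2"
    and taylor: "\<And>e. e > 0 ==> \<exists>r>0. \<forall>z\<in>K. \<forall>d. norm d \<le> r --> z + d \<in> K -->
           \<phi> (z + d) \<le> \<phi> z + D\<phi> z \<bullet> d + Hq z d / 2 + e * (norm d)\<^sup>2"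
    and Hq: "\<And>z t d. Hq z (t *\<^sub>R d) = t\<^sup>2 * Hq z d"
    and \<eta>: "\<eta> > 0"
  obtains z z1 z2 z3 \<xi>1 \<xi>2 \<xi>3 S1 S2 S3 where "z \<in> K"
    "norm (z1 - fst (fst z)) \<le> \<eta>" "norm (z2 - snd (fst z)) \<le> \<eta>" "norm (z3 - snd z) \<le> \<eta>"
    "norm (\<xi>1 - fst (fst (D\<phi> z))) \<le> \<eta>" "norm (\<xi>2 - snd (fst (D\<phi> z))) \<le> \<eta>" "norm (\<xi>3 - snd (D\<phi> z)) \<le> \<eta>"
    "touch2 f1 z1 \<xi>1 S1" "touch2 f2 z2 \<xi>2 S2" "touch2 f3 z3 \<xi>3 S3"
    "\<And>a b c. S1 a \<bullet> a + S2 b \<bullet> b + S3 c \<bullet> c \<le> Hq z ((a, b), c) + \<eta> * (norm ((a, b), c))\<^sup>2"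
proof -
  have cW: "continuous_on A W" for A unfolding W_def
    by (intro continuous_intros continuous_on_compose2[OF c(1)] continuous_on_compose2[OF c(2)] continuous_on_compose2[OF c(3)]) auto
  have cG: "continuous_on K (\<lambda>z. W z - \<phi> z)" by (intro continuous_intros cW cont)
  obtain \<beta> where \<beta>: "\<beta> > 0" "\<And>z. z \<in> K ==> W z - \<phi> z \<ge> W z0 - \<phi> z0 - \<beta> ==> z \<in> interior K"
    using compact_interior_gap[OF K cG int] by blast
  have Kp: "compact ((\<lambda>z. fst (fst z)) ` K)" "compact ((\<lambda>z. snd (fst z)) ` K)" "compact (snd ` K)"
    using K by (auto intro!: compact_continuous_image continuous_intros)
  have \<beta>3: "\<beta> / 3 > 0" using \<beta>(1) by simp
  obtain s1 where s1: "s1 > 0" "\<And>x y. x \<in> (\<lambda>z. fst (fst z)) ` K ==> norm (y - x) \<le> s1 ==> f1 y \<le> f1 x + \<beta> / 3"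
    using compact_uniform_nearby[OF c(1) Kp(1) \<beta>3] by blast
  obtain s2 where s2: "s2 > 0" "\<And>x y. x \<in> (\<lambda>z. snd (fst z)) ` K ==> norm (y - x) \<le> s2 ==> f2 y \<le> f2 x + \<beta> / 3"
    using compact_uniform_nearby[OF c(2) Kp(2) \<beta>3] by blast
  obtain s3 where s3: "s3 > 0" "\<And>x y. x \<in> snd ` K ==> norm (y - x) \<le> s3 ==> f3 y \<le> f3 x + \<beta> / 3"
    using compact_uniform_nearby[OF c(3) Kp(3) \<beta>3] by blast
  define s where "s = min (min s1 s2) (min s3 (\<eta> / 2))"
  have s: "s > 0" "s \<le> s1" "s \<le> s2" "s \<le> s3" "s \<le> \<eta> / 2" using s1 s2 s3 \<eta> by (auto simp: s_def)
  have Bd0: "Bd \<ge> 0" using bd(1)[of 0] by linarith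
  \<comment> \<open>Makes the displacement \<open>sqrt (4 * \<rho> * Bd)\<close> at most
    \<open>s\<close>, and \<open>s\<close> was chosen so that regularization raises the sum on
    \<open>K\<close> by at most the gap \<beta>. It is fixed before the scale \<delta>, since
    \<open>M'\<close> and \<open>Mb\<close> grow as \<rho> decreases.\<close>
  define \<rho> where "\<rho> = s\<^sup>2 / (4 * (Bd + 1))"
  have \<rho>: "\<rho> > 0" using s Bd0 by (simp add: \<rho>_def)
  have sq: "sqrt (4 * \<rho> * Bd) \<le> s"
  proof (rule real_le_lsqrt)
    have "4 * \<rho> * Bd = s\<^sup>2 * (Bd / (Bd + 1))" using Bd0 by (simp add: \<rho>_def field_simps)
    also have "\<dots> \<le> s\<^sup>2 * 1" using Bd0 by (intro mult_left_mono) auto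
    finally show "4 * \<rho> * Bd \<le> s\<^sup>2" by simp
  qed (use s in auto)
  interpret w1: bounded_cont f1 \<rho> Bd by unfold_locales (use c bd \<rho> in auto)
  interpret w2: bounded_cont f2 \<rho> Bd by unfold_locales (use c bd \<rho> in auto)
  interpret w3: bounded_cont f3 \<rho> Bd by unfold_locales (use c bd \<rho> in auto)
  define V where "V z = supconv \<rho> f1 (fst (fst z)) + supconv \<rho> f2 (snd (fst z)) + supconv \<rho> f3 (snd z)" for z
  have WV: "W z \<le> V z" for z
    unfolding W_def V_def by (intro add_mono w1.supconv_ge_self w2.supconv_ge_self w3.supconv_ge_self)
  have VW: "V z \<le> W z + \<beta>" if "z \<in> K" for z
  proof -
    have "supconv \<rho> f1 (fst (fst z)) \<le> f1 (fst (fst z)) + \<beta> / 3"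
      using s1(2)[of "fst (fst z)"] that sq s by (intro w1.supconv_le_nearby) (auto intro: order_trans)
    moreover have "supconv \<rho> f2 (snd (fst z)) \<le> f2 (snd (fst z)) + \<beta> / 3"
      using s2(2)[of "snd (fst z)"] that sq s by (intro w2.supconv_le_nearby) (auto intro: order_trans)
    moreover have "supconv \<rho> f3 (snd z) \<le> f3 (snd z) + \<beta> / 3"
      using s3(2)[of "snd z"] that sq s by (intro w3.supconv_le_nearby) (auto intro: order_trans)
    ultimately show ?thesis unfolding V_def W_def by linarith
  qed
  define f where "f z = V z + (norm z)\<^sup>2 / (2 * \<rho>)" for z
  have nz: "(norm z)\<^sup>2 = (norm (fst (fst z)))\<^sup>2 + (norm (snd (fst z)))\<^sup>2 + (norm (snd z))\<^sup>2" for z :: "('a \<times> 'b) \<times> 'c"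
    by (cases z) (auto simp: norm_Pair)
  interpret subdifferentiable f
  proof
    fix z :: "('a \<times> 'b) \<times> 'c"
    let ?\<xi> = "((supconv_pt \<rho> f1 (fst (fst z)) /\<^sub>R \<rho>, supconv_pt \<rho> f2 (snd (fst z)) /\<^sub>R \<rho>), supconv_pt \<rho> f3 (snd z) /\<^sub>R \<rho>)"
    have "f z + ?\<xi> \<bullet> (z' - z) \<le> f z'" for z'
      using w1.supconv_subgradient[where z = "fst (fst z)" and z' = "fst (fst z')"]
        w2.supconv_subgradient[where z = "snd (fst z)" and z' = "snd (fst z')"]
        w3.supconv_subgradient[where z = "snd z" and z' = "snd z'"]
      unfolding f_def V_def nz[of z] nz[of z'] add_divide_distrib by (simp add: inner_prod_def)
    then show "\<exists>\<xi>. \<forall>z'. f z + \<xi> \<bullet> (z' - z) \<le> f z'" by blast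
  qed
  define \<phi>' where "\<phi>' z = \<phi> z + (norm z)\<^sup>2 / (2 * \<rho>)" for z
  define D\<phi>' where "D\<phi>' z = D\<phi> z + z /\<^sub>R \<rho>" for z
  define M' where "M' = M + 1 / \<rho>"
  have M': "M' \<ge> 0" using M \<rho> by (simp add: M'_def)
  \<comment> \<open>The three blocks contribute \<open>6 * \<eta>1\<close> and retouching
    \<open>8 * \<eta>1\<close>, together half of \<eta>; the Taylor error of \<phi> takes the other
    half.\<close>
  define \<eta>1 where "\<eta>1 = \<eta> / 28"
  have \<eta>1: "\<eta>1 > 0" using \<eta> by (simp add: \<eta>1_def)
  define Mb where "Mb = (3 + 2 * M') + 1 / \<rho>"
  have Mb: "Mb > 0" using M' \<rho> by (simp add: Mb_def add_pos_pos)
  obtain rt where rt: "rt > 0" "\<And>z d. z \<in> K ==> norm d \<le> rt ==> z + d \<in> K ==>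
           \<phi> (z + d) \<le> \<phi> z + D\<phi> z \<bullet> d + Hq z d / 2 + \<eta> / 4 * (norm d)\<^sup>2"
  proof -
    have "\<eta> / 4 > 0" using \<eta> by simp
    from taylor[OF this] show thesis using that by blast
  qed
  define \<delta> where "\<delta> = min rt (min (\<eta> / 2) (\<eta> / (2 * (Mb + 8 * \<eta>1))))"
  have \<delta>: "\<delta> > 0" using rt \<eta> Mb \<eta>1 by (simp add: \<delta>_def add_pos_pos)
  have \<delta>le: "\<delta> \<le> rt" "\<delta> \<le> \<eta> / 2" unfolding \<delta>_def by linarith+
  have \<delta>Mb: "(Mb + 8 * \<eta>1) * \<delta> \<le> \<eta> / 2"
  proof -
    have "\<delta> \<le> \<eta> / (2 * (Mb + 8 * \<eta>1))" by (simp add: \<delta>_def)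
    then show ?thesis using Mb \<eta>1 by (simp add: pos_le_divide_eq add_pos_pos mult_ac)
  qed
  have f\<phi>: "f z - \<phi>' z = V z - \<phi> z" for z by (simp add: f_def \<phi>'_def)
  have norm_diff: "(norm z')\<^sup>2 = (norm z)\<^sup>2 + 2 * (z \<bullet> (z' - z)) + (norm (z' - z))\<^sup>2" for z z' :: "('a \<times> 'b) \<times> 'c"
    by (simp add: power2_norm_eq_inner inner_diff inner_commute)
  obtain z p r B where H: "0 < r" "r < \<delta>" "norm p \<le> \<delta>" "cball z r \<subseteq> K"
    "\<And>z'. z' \<in> K ==> f z' - \<phi>' z' - p \<bullet> z' \<le> f z - \<phi>' z - p \<bullet> z"
    "linear B" "\<And>a b. B a \<bullet> b = a \<bullet> B b" "\<And>a. norm (B a) \<le> (3 + 2 * M') * norm a"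
    "\<And>d. norm d \<le> r ==> \<bar>f (z + d) - f z - (D\<phi>' z + p) \<bullet> d - B d \<bullet> d / 2\<bar> \<le> \<eta>1 * r\<^sup>2"
  proof (rule jensen_expansion[OF K z0 _ _ M' _ _ \<delta> \<eta>1, of \<phi>' D\<phi>'])
    show "z \<in> interior K" if "z \<in> K" "f z - \<phi>' z \<ge> f z0 - \<phi>' z0" for z
      using \<beta>(2)[OF that(1)] that(2) VW[OF that(1)] WV[of z0] unfolding f\<phi> by linarith
    show "continuous_on K \<phi>'" unfolding \<phi>'_def using \<rho> by (intro continuous_intros cont) auto
    show "norm (D\<phi>' z - D\<phi>' z') \<le> M' * norm (z - z')" if "z \<in> K" "z' \<in> K" for z z'
    proof -
      have "D\<phi>' z - D\<phi>' z' = (D\<phi> z - D\<phi> z') + (z - z') /\<^sub>R \<rho>" by (simp add: D\<phi>'_def algebra_simps)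
      then have "norm (D\<phi>' z - D\<phi>' z') \<le> norm (D\<phi> z - D\<phi> z') + norm ((z - z') /\<^sub>R \<rho>)" by (metis norm_triangle_ineq)
      also have "\<dots> \<le> M * norm (z - z') + norm (z - z') / \<rho>" using Dlip[OF that] \<rho> by (simp add: divide_inverse_commute)
      finally show ?thesis by (simp add: M'_def algebra_simps)
    qed
    show "\<phi>' z' \<le> \<phi>' z + D\<phi>' z \<bullet> (z' - z) + M' / 2 * (norm (z' - z))\<^sup>2" if "z \<in> K" "z' \<in> K" for z z'
    proof -
      define X I where "X = (norm (z' - z))\<^sup>2" and "I = z \<bullet> (z' - z)"
      have "(norm z')\<^sup>2 / (2 * \<rho>) = (norm z)\<^sup>2 / (2 * \<rho>) + I / \<rho> + X / (2 * \<rho>)"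
        using \<rho> unfolding norm_diff[of z' z] X_def I_def by (simp add: add_divide_distrib)
      moreover have "(D\<phi> z + z /\<^sub>R \<rho>) \<bullet> (z' - z) = D\<phi> z \<bullet> (z' - z) + I / \<rho>"
        unfolding inner_add_left I_def by (simp add: divide_inverse mult.commute)
      moreover have "(M + 1 / \<rho>) / 2 * X = M / 2 * X + X / (2 * \<rho>)" by (simp add: field_simps)
      ultimately show ?thesis using up[OF that] unfolding \<phi>'_def D\<phi>'_def M'_def X_def[symmetric] by linarith
    qed
  qed blast
  define \<xi> where "\<xi> = D\<phi> z + p"
  have zK: "z \<in> K" using H(4) H(1) by (meson centre_in_cball less_imp_le subsetD)
  have V2: "\<bar>V (z + d) - V z - \<xi> \<bullet> d - (B d - d /\<^sub>R \<rho>) \<bullet> d / 2\<bar> \<le> \<eta>1 * r\<^sup>2" if "norm d \<le> r" for d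
  proof -
    have "(norm (z + d))\<^sup>2 / (2 * \<rho>) = (norm z)\<^sup>2 / (2 * \<rho>) + (z /\<^sub>R \<rho>) \<bullet> d + (d /\<^sub>R \<rho>) \<bullet> d / 2"
      using norm_diff[of "z + d" z] \<rho> by (simp add: power2_norm_eq_inner inner_add inner_commute field_simps)
    then have "f (z + d) - f z - (D\<phi>' z + p) \<bullet> d - B d \<bullet> d / 2 = V (z + d) - V z - \<xi> \<bullet> d - (B d - d /\<^sub>R \<rho>) \<bullet> d / 2"
      by (simp add: f_def D\<phi>'_def \<xi>_def inner_add_left inner_diff_left diff_divide_distrib)
    then show ?thesis using H(9)[OF that] by simp
  qed
  define J1 where "J1 a = (((a, 0), 0) :: ('a \<times> 'b) \<times> 'c)" for a
  define J2 where "J2 b = (((0, b), 0) :: ('a \<times> 'b) \<times> 'c)" for b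
  define J3 where "J3 c = (((0, 0), c) :: ('a \<times> 'b) \<times> 'c)" for c
  have linJ: "linear J1" "linear J2" "linear J3"
    unfolding J1_def J2_def J3_def by (auto intro!: linearI)
  have linQ: "linear (\<lambda>z::('a \<times> 'b) \<times> 'c. fst (fst z))" "linear (\<lambda>z::('a \<times> 'b) \<times> 'c. snd (fst z))" "linear (\<lambda>z::('a \<times> 'b) \<times> 'c. snd z)"
    by (auto intro!: linearI)
  \<comment> \<open>The diagonal blocks of \<open>B\<close>; the term with \<open>1/\<rho>\<close>
    takes away the quadratic that had been added to make the sum convex.\<close>
  define T1 where "T1 a = fst (fst (B (J1 a))) + (- (1/\<rho>)) *\<^sub>R a" for a
  define T2 where "T2 a = snd (fst (B (J2 a))) + (- (1/\<rho>)) *\<^sub>R a" for a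
  define T3 where "T3 a = snd (B (J3 a)) + (- (1/\<rho>)) *\<^sub>R a" for a
  have T: "linear T1" "linear T2" "linear T3"
    "\<And>a b. T1 a \<bullet> b = a \<bullet> T1 b" "\<And>a b. T2 a \<bullet> b = a \<bullet> T2 b" "\<And>a b. T3 a \<bullet> b = a \<bullet> T3 b"
    unfolding T1_def T2_def T3_def
    by (rule linear_block[OF H(6,7) linJ(1) linQ(1)] linear_block[OF H(6,7) linJ(2) linQ(2)] linear_block[OF H(6,7) linJ(3) linQ(3)];
        simp add: J1_def J2_def J3_def inner_prod_def)+
  have nJ: "norm (J1 a) = norm a" "norm (J2 b) = norm b" "norm (J3 c) = norm c" for a b c by (auto simp: J1_def J2_def J3_def norm_Pair)
  have nT: "norm (T1 a) \<le> Mb * norm a" "norm (T2 b) \<le> Mb * norm b" "norm (T3 c) \<le> Mb * norm c" for a b c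
  proof -
    have n: "norm (x + (- (1/\<rho>)) *\<^sub>R y) \<le> Mb * norm y" if "norm x \<le> (3 + 2 * M') * norm y" for x y :: "'z::real_normed_vector"
    proof -
      have "norm (x + (- (1/\<rho>)) *\<^sub>R y) \<le> norm x + norm ((- (1/\<rho>)) *\<^sub>R y)" by (rule norm_triangle_ineq)
      also have "\<dots> \<le> (3 + 2 * M') * norm y + 1 / \<rho> * norm y" using that \<rho> by simp
      finally show ?thesis by (simp add: Mb_def algebra_simps)
    qed
    show "norm (T1 a) \<le> Mb * norm a" unfolding T1_def
      using H(8)[of "J1 a"] norm_fst_le[of "fst (B (J1 a))" "snd (B (J1 a))"] norm_fst_le[of "fst (fst (B (J1 a)))" "snd (fst (B (J1 a)))"]
      by (intro n) (simp add: nJ)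
    show "norm (T2 b) \<le> Mb * norm b" unfolding T2_def
      using H(8)[of "J2 b"] norm_fst_le[of "fst (B (J2 b))" "snd (B (J2 b))"] norm_snd_le[of "snd (fst (B (J2 b)))" "fst (fst (B (J2 b)))"]
      by (intro n) (simp add: nJ)
    show "norm (T3 c) \<le> Mb * norm c" unfolding T3_def
      using H(8)[of "J3 c"] norm_snd_le[of "snd (B (J3 c))" "fst (B (J3 c))"] by (intro n) (simp add: nJ)
  qed
  have ex1: "\<bar>supconv \<rho> f1 (fst (fst z) + d) - supconv \<rho> f1 (fst (fst z)) - fst (fst \<xi>) \<bullet> d - T1 d \<bullet> d / 2\<bar> \<le> \<eta>1 * r\<^sup>2"
    if "norm d \<le> r" for d
  proof -
    have "(B (J1 d) - J1 d /\<^sub>R \<rho>) \<bullet> J1 d = T1 d \<bullet> d"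
      unfolding T1_def inner_diff_left inner_add_left by (simp add: J1_def inner_prod_def divide_inverse)
    moreover have "\<xi> \<bullet> J1 d = fst (fst \<xi>) \<bullet> d" by (simp add: J1_def inner_prod_def)
    moreover have "V (z + J1 d) - V z = supconv \<rho> f1 ((fst (fst z)) + d) - supconv \<rho> f1 (fst (fst z))" by (simp add: V_def J1_def)
    ultimately show ?thesis using V2[of "J1 d"] that unfolding nJ by simp
  qed
  have ex2: "\<bar>supconv \<rho> f2 (snd (fst z) + d) - supconv \<rho> f2 (snd (fst z)) - snd (fst \<xi>) \<bullet> d - T2 d \<bullet> d / 2\<bar> \<le> \<eta>1 * r\<^sup>2"
    if "norm d \<le> r" for d
  proof -
    have "(B (J2 d) - J2 d /\<^sub>R \<rho>) \<bullet> J2 d = T2 d \<bullet> d"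
      unfolding T2_def inner_diff_left inner_add_left by (simp add: J2_def inner_prod_def divide_inverse)
    moreover have "\<xi> \<bullet> J2 d = snd (fst \<xi>) \<bullet> d" by (simp add: J2_def inner_prod_def)
    moreover have "V (z + J2 d) - V z = supconv \<rho> f2 ((snd (fst z)) + d) - supconv \<rho> f2 (snd (fst z))" by (simp add: V_def J2_def)
    ultimately show ?thesis using V2[of "J2 d"] that unfolding nJ by simp
  qed
  have ex3: "\<bar>supconv \<rho> f3 (snd z + d) - supconv \<rho> f3 (snd z) - snd \<xi> \<bullet> d - T3 d \<bullet> d / 2\<bar> \<le> \<eta>1 * r\<^sup>2"
    if "norm d \<le> r" for d
  proof -
    have "(B (J3 d) - J3 d /\<^sub>R \<rho>) \<bullet> J3 d = T3 d \<bullet> d"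
      unfolding T3_def inner_diff_left inner_add_left by (simp add: J3_def inner_prod_def divide_inverse)
    moreover have "\<xi> \<bullet> J3 d = snd \<xi> \<bullet> d" by (simp add: J3_def inner_prod_def)
    moreover have "V (z + J3 d) - V z = supconv \<rho> f3 ((snd z) + d) - supconv \<rho> f3 (snd z)" by (simp add: V_def J3_def)
    ultimately show ?thesis using V2[of "J3 d"] that unfolding nJ by simp
  qed
  obtain z1 \<xi>1 where b1: "norm (z1 - fst (fst z)) \<le> r + sqrt (4 * \<rho> * Bd)" "norm (\<xi>1 - fst (fst \<xi>)) \<le> (Mb + 8 * \<eta>1) * r"
    "touch2 f1 z1 \<xi>1 (\<lambda>a. T1 a + (8 * \<eta>1) *\<^sub>R a)"
    using supconv_block_touch[OF w1.bounded_cont_axioms H(1) \<eta>1 T(1,4) nT(1) ex1] by blast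
  obtain z2 \<xi>2 where b2: "norm (z2 - snd (fst z)) \<le> r + sqrt (4 * \<rho> * Bd)" "norm (\<xi>2 - snd (fst \<xi>)) \<le> (Mb + 8 * \<eta>1) * r"
    "touch2 f2 z2 \<xi>2 (\<lambda>a. T2 a + (8 * \<eta>1) *\<^sub>R a)"
    using supconv_block_touch[OF w2.bounded_cont_axioms H(1) \<eta>1 T(2,5) nT(2) ex2] by blast
  obtain z3 \<xi>3 where b3: "norm (z3 - snd z) \<le> r + sqrt (4 * \<rho> * Bd)" "norm (\<xi>3 - snd \<xi>) \<le> (Mb + 8 * \<eta>1) * r"
    "touch2 f3 z3 \<xi>3 (\<lambda>a. T3 a + (8 * \<eta>1) *\<^sub>R a)"
    using supconv_block_touch[OF w3.bounded_cont_axioms H(1) \<eta>1 T(3,6) nT(3) ex3] by blast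
  have rs: "r + sqrt (4 * \<rho> * Bd) \<le> \<eta>" using sq s \<delta>le H(2) by linarith
  have "(Mb + 8 * \<eta>1) * r \<le> (Mb + 8 * \<eta>1) * \<delta>"
    using H(2) Mb \<eta>1 by (intro mult_left_mono) auto
  with \<delta>Mb have rM: "(Mb + 8 * \<eta>1) * r \<le> \<eta> / 2" by linarith
  have np: "norm p \<le> \<eta> / 2" using H(3) \<delta>le(2) by linarith
  have np': "norm (fst (fst p)) \<le> \<eta> / 2" "norm (snd (fst p)) \<le> \<eta> / 2" "norm (snd p) \<le> \<eta> / 2"
    using np norm_fst_le[of "fst p" "snd p"] norm_snd_le[of "snd p" "fst p"]
      norm_fst_le[of "fst (fst p)" "snd (fst p)"] norm_snd_le[of "snd (fst p)" "fst (fst p)"] by auto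
  have tri: "norm (x - y) \<le> \<eta>" if "norm (x - (y + q)) \<le> (Mb + 8 * \<eta>1) * r" "norm q \<le> \<eta> / 2" for x y q :: "'z::real_normed_vector"
  proof -
    have "norm (x - y) \<le> norm (x - (y + q)) + norm q" using norm_triangle_ineq[of "x - (y + q)" q] by (simp add: algebra_simps)
    then show ?thesis using that rM by linarith
  qed
  show thesis
  proof (rule that[OF zK _ _ _ _ _ _ b1(3) b2(3) b3(3)])
    show "norm (z1 - fst (fst z)) \<le> \<eta>" "norm (z2 - snd (fst z)) \<le> \<eta>" "norm (z3 - snd z) \<le> \<eta>"
      using b1(1) b2(1) b3(1) rs by linarith+
    show "norm (\<xi>1 - fst (fst (D\<phi> z))) \<le> \<eta>" "norm (\<xi>2 - snd (fst (D\<phi> z))) \<le> \<eta>" "norm (\<xi>3 - snd (D\<phi> z)) \<le> \<eta>"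
      using b1(2) b2(2) b3(2) np' tri unfolding \<xi>_def by auto
    fix a :: 'a and b :: 'b and c :: 'c
    define d where "d = ((a, b), c)"
    have main: "T1 a \<bullet> a + T2 b \<bullet> b + T3 c \<bullet> c \<le> Hq z d + (\<eta> / 2 + 6 * \<eta>1) * (norm d)\<^sup>2"
    proof (cases "d = 0")
      case True
      then have "a = 0" "b = 0" "c = 0" by (auto simp: d_def zero_prod_def)
      moreover have "Hq z (0::('a \<times> 'b) \<times> 'c) = 0" using Hq[of z 0 0] by simp
      ultimately show ?thesis using True T by (simp add: linear_0)
    next
      case False
      define t where "t = r / norm d"
      have t: "t > 0" using False H(1) by (simp add: t_def)
      have nd: "norm (t *\<^sub>R d) = r" using False H(1) by (simp add: t_def)
      have tb: "norm (t *\<^sub>R a) \<le> r" "norm (t *\<^sub>R b) \<le> r" "norm (t *\<^sub>R c) \<le> r"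
        using nd norm_fst_le[of "t *\<^sub>R (a, b)" "t *\<^sub>R c"] norm_snd_le[of "t *\<^sub>R c" "t *\<^sub>R (a, b)"]
          norm_fst_le[of "t *\<^sub>R a" "t *\<^sub>R b"] norm_snd_le[of "t *\<^sub>R b" "t *\<^sub>R a"] unfolding d_def by auto
      have zd: "z + t *\<^sub>R d \<in> K" using H(4) nd by (auto simp: subset_eq dist_norm)
      have "V (z + t *\<^sub>R d) - \<phi> (z + t *\<^sub>R d) - p \<bullet> (z + t *\<^sub>R d) \<le> V z - \<phi> z - p \<bullet> z"
        using H(5)[OF zd] unfolding f\<phi> .
      moreover have "\<phi> (z + t *\<^sub>R d) \<le> \<phi> z + D\<phi> z \<bullet> (t *\<^sub>R d) + Hq z (t *\<^sub>R d) / 2 + \<eta> / 4 * r\<^sup>2"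
        using rt(2)[OF zK _ zd] nd H(2) \<delta>le(1) by simp
      moreover have "p \<bullet> (z + t *\<^sub>R d) = p \<bullet> z + p \<bullet> (t *\<^sub>R d)" by (rule inner_add_right)
      moreover have "\<xi> \<bullet> (t *\<^sub>R d) = D\<phi> z \<bullet> (t *\<^sub>R d) + p \<bullet> (t *\<^sub>R d)"
        unfolding \<xi>_def by (rule inner_add_left)
      ultimately have u: "V (z + t *\<^sub>R d) - V z \<le> \<xi> \<bullet> (t *\<^sub>R d) + Hq z (t *\<^sub>R d) / 2 + \<eta> / 4 * r\<^sup>2"
        by linarith
      have Vd: "V (z + t *\<^sub>R d) = supconv \<rho> f1 (fst (fst z) + t *\<^sub>R a) + supconv \<rho> f2 (snd (fst z) + t *\<^sub>R b) + supconv \<rho> f3 (snd z + t *\<^sub>R c)"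
        by (simp add: V_def d_def)
      have \<xi>d: "\<xi> \<bullet> (t *\<^sub>R d) = fst (fst \<xi>) \<bullet> (t *\<^sub>R a) + snd (fst \<xi>) \<bullet> (t *\<^sub>R b) + snd \<xi> \<bullet> (t *\<^sub>R c)"
        by (simp add: d_def inner_prod_def algebra_simps)
      have "T1 (t *\<^sub>R a) \<bullet> (t *\<^sub>R a) / 2 + T2 (t *\<^sub>R b) \<bullet> (t *\<^sub>R b) / 2 + T3 (t *\<^sub>R c) \<bullet> (t *\<^sub>R c) / 2
          \<le> Hq z (t *\<^sub>R d) / 2 + \<eta> / 4 * r\<^sup>2 + 3 * (\<eta>1 * r\<^sup>2)"
        using u ex1[OF tb(1)] ex2[OF tb(2)] ex3[OF tb(3)] unfolding Vd \<xi>d V_def[of z] by linarith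
      then have "t\<^sup>2 * (T1 a \<bullet> a + T2 b \<bullet> b + T3 c \<bullet> c) \<le> t\<^sup>2 * Hq z d + (\<eta> / 2 + 6 * \<eta>1) * r\<^sup>2"
        unfolding linear_scale[OF T(1)] linear_scale[OF T(2)] linear_scale[OF T(3)] Hq by (simp add: power2_eq_square algebra_simps)
      also have "r\<^sup>2 = t\<^sup>2 * (norm d)\<^sup>2" using nd t by (simp add: power_mult_distrib[symmetric])
      finally have "t\<^sup>2 * (T1 a \<bullet> a + T2 b \<bullet> b + T3 c \<bullet> c) \<le> t\<^sup>2 * (Hq z d + (\<eta> / 2 + 6 * \<eta>1) * (norm d)\<^sup>2)"
        by (simp add: algebra_simps)
      then show ?thesis using t by simp
    qed
    have "(8 * \<eta>1) *\<^sub>R a \<bullet> a + (8 * \<eta>1) *\<^sub>R b \<bullet> b + (8 * \<eta>1) *\<^sub>R c \<bullet> c = 8 * \<eta>1 * (norm d)\<^sup>2"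
      by (simp add: d_def power2_norm_eq_inner algebra_simps)
    moreover have "(\<eta> / 2 + 6 * \<eta>1) * (norm d)\<^sup>2 + 8 * \<eta>1 * (norm d)\<^sup>2 = \<eta> * (norm d)\<^sup>2"
      by (simp add: \<eta>1_def algebra_simps)
    ultimately show "(T1 a + (8 * \<eta>1) *\<^sub>R a) \<bullet> a + (T2 b + (8 * \<eta>1) *\<^sub>R b) \<bullet> b + (T3 c + (8 * \<eta>1) *\<^sub>R c) \<bullet> c
        \<le> Hq z ((a, b), c) + \<eta> * (norm ((a, b), c))\<^sup>2"
      using main unfolding d_def[symmetric] by (simp add: inner_add_left)
  qed
qed

section \<open>Quantitative Taylor estimates for test functions and gradient bounds for jets\<close>

lemma norm_matrix_vector_le: "norm (X *v a) \<le> norm X * norm (a::real^'n)" for X :: "real^'n^'m"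
proof (rule power2_le_imp_le)
  have n2: "(norm (x::'b::real_inner^'k))\<^sup>2 = (\<Sum>i\<in>UNIV. (norm (x $ i))\<^sup>2)" for x
    by (simp add: power2_norm_eq_inner inner_vec_def)
  have "(norm (X *v a))\<^sup>2 = (\<Sum>i\<in>UNIV. (X $ i \<bullet> a)\<^sup>2)" by (simp add: n2 matrix_vector_mul_component)
  also have "\<dots> \<le> (\<Sum>i\<in>UNIV. (norm (X $ i))\<^sup>2 * (norm a)\<^sup>2)"
    by (intro sum_mono) (metis Cauchy_Schwarz_ineq power2_norm_eq_inner)
  also have "\<dots> = (norm X * norm a)\<^sup>2" by (simp add: n2[of X] power_mult_distrib sum_distrib_right)
  finally show "(norm (X *v a))\<^sup>2 \<le> (norm X * norm a)\<^sup>2" .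
qed simp

lemma C2_fun_bounds:
  assumes \<psi>: "C2_fun \<psi> D\<psi> D2\<psi>"
  obtains M where "M \<ge> 0" "\<And>x. norm x \<le> R ==> norm (D2\<psi> x) \<le> M"
    "\<And>x y. norm x \<le> R ==> norm y \<le> R ==> norm (D\<psi> x - D\<psi> y) \<le> M * norm (x - y)"
    "\<And>x y. norm x \<le> R ==> norm y \<le> R ==> \<bar>\<psi> y - \<psi> x - D\<psi> x \<bullet> (y - x)\<bar> \<le> M * (norm (y - x))\<^sup>2"
proof -
  have d1: "(\<psi> has_derivative (\<lambda>h. D\<psi> x \<bullet> h)) (at x within S)" for x S
    using \<psi> has_derivative_at_withinI unfolding C2_fun_def by blast
  have d2: "(D\<psi> has_derivative (\<lambda>h. D2\<psi> x *v h)) (at x within S)" for x S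
    using \<psi> has_derivative_at_withinI unfolding C2_fun_def by blast
  have "compact (D2\<psi> ` cball 0 R)"
    using \<psi> unfolding C2_fun_def by (intro compact_continuous_image) (auto intro: continuous_on_subset)
  then have "bounded (D2\<psi> ` cball 0 R)" by (rule compact_imp_bounded)
  then obtain M0 where M0: "\<And>x. norm x \<le> R ==> norm (D2\<psi> x) \<le> M0" unfolding bounded_iff by force
  define M where "M = max M0 0"
  have M: "M \<ge> 0" "\<And>x. norm x \<le> R ==> norm (D2\<psi> x) \<le> M" using M0 by (auto simp: M_def intro: max.coboundedI1)
  have lip: "norm (D\<psi> x - D\<psi> y) \<le> M * norm (x - y)" if "norm x \<le> R" "norm y \<le> R" for x y
  proof (rule differentiable_bound[of "cball 0 R" D\<psi> "\<lambda>x h. D2\<psi> x *v h" M x y])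
    fix z :: "real^'a" assume z: "z \<in> cball 0 R"
    show "onorm (\<lambda>h. D2\<psi> z *v h) \<le> M"
    proof (rule onorm_le)
      fix h show "norm (D2\<psi> z *v h) \<le> M * norm h"
        using norm_matrix_vector_le[of "D2\<psi> z" h] M(2)[of z] z mult_right_mono[of "norm (D2\<psi> z)" M "norm h"] by simp
    qed
  qed (use d2 that in auto)
  have up: "\<bar>\<psi> y - \<psi> x - D\<psi> x \<bullet> (y - x)\<bar> \<le> M * (norm (y - x))\<^sup>2" if xy: "norm x \<le> R" "norm y \<le> R" for x y
  proof -
    have "norm ((\<psi> y - D\<psi> x \<bullet> y) - (\<psi> x - D\<psi> x \<bullet> x)) \<le> (M * norm (y - x)) * norm (y - x)"
    proof (rule differentiable_bound[of "closed_segment x y" "\<lambda>z. \<psi> z - D\<psi> x \<bullet> z" "\<lambda>z h. D\<psi> z \<bullet> h - D\<psi> x \<bullet> h"])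
      fix z assume z: "z \<in> closed_segment x y"
      show "((\<lambda>z. \<psi> z - D\<psi> x \<bullet> z) has_derivative (\<lambda>h. D\<psi> z \<bullet> h - D\<psi> x \<bullet> h)) (at z within closed_segment x y)"
        by (intro derivative_intros d1)
      have "closed_segment x y \<subseteq> cball 0 R" using xy by (intro closed_segment_subset) auto
      then have zR: "norm z \<le> R" using z by auto
      have "norm (z - x) \<le> norm (y - x)" using segment_bound(1)[OF z] by (simp add: norm_minus_commute)
      then have nz: "norm (D\<psi> z - D\<psi> x) \<le> M * norm (y - x)"
        using lip[OF zR xy(1)] M(1) mult_left_mono[of "norm (z - x)" "norm (y - x)" M] by linarith
      show "onorm (\<lambda>h. D\<psi> z \<bullet> h - D\<psi> x \<bullet> h) \<le> M * norm (y - x)"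
      proof (rule onorm_le)
        fix h show "norm (D\<psi> z \<bullet> h - D\<psi> x \<bullet> h) \<le> M * norm (y - x) * norm h"
          using Cauchy_Schwarz_ineq2[of "D\<psi> z - D\<psi> x" h] nz mult_right_mono[OF nz norm_ge_zero[of h]] by (simp add: inner_diff_left)
      qed
    qed auto
    then show ?thesis by (simp add: inner_diff_right power2_eq_square algebra_simps)
  qed
  show thesis by (rule that[OF M lip up])
qed

lemma C2_fun_taylor:
  assumes \<psi>: "C2_fun \<psi> D\<psi> D2\<psi>" and e: "e > 0"
  obtains r where "r > 0" "\<And>x d. norm x \<le> R ==> norm d \<le> r ==>
      \<bar>\<psi> (x + d) - \<psi> x - D\<psi> x \<bullet> d - (D2\<psi> x *v d) \<bullet> d / 2\<bar> \<le> e * (norm d)\<^sup>2"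
proof -
  have d1: "(\<psi> has_derivative (\<lambda>h. D\<psi> x \<bullet> h)) (at x)" for x
    using \<psi> unfolding C2_fun_def by blast
  have d2: "(D\<psi> has_derivative (\<lambda>h. D2\<psi> x *v h)) (at x within S)" for x S
    using \<psi> has_derivative_at_withinI unfolding C2_fun_def by blast
  have "uniformly_continuous_on (cball 0 (R + 1)) D2\<psi>"
    using \<psi> unfolding C2_fun_def by (intro compact_uniformly_continuous) (auto intro: continuous_on_subset)
  then obtain s where s: "s > 0" "\<And>x y. norm x \<le> R + 1 ==> norm y \<le> R + 1 ==> dist y x < s ==> dist (D2\<psi> y) (D2\<psi> x) < e"
    unfolding uniformly_continuous_on_def using e by (metis mem_cball_0)
  define r where "r = min 1 (s / 2)"
  have main: "\<bar>\<psi> (x + d) - \<psi> x - D\<psi> x \<bullet> d - (D2\<psi> x *v d) \<bullet> d / 2\<bar> \<le> e * (norm d)\<^sup>2"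
    if x: "norm x \<le> R" and d: "norm d \<le> r" for x d
  proof -
    have D: "norm (D\<psi> (x + k) - D\<psi> x - D2\<psi> x *v k) \<le> e * norm d" if k: "norm k \<le> norm d" for k
    proof -
      have "norm ((D\<psi> (x + k) - D2\<psi> x *v (x + k)) - (D\<psi> x - D2\<psi> x *v x)) \<le> e * norm (x + k - x)"
      proof (rule differentiable_bound[of "cball x (norm d)" "\<lambda>z. D\<psi> z - D2\<psi> x *v z" "\<lambda>z h. D2\<psi> z *v h - D2\<psi> x *v h"])
        fix z assume z: "z \<in> cball x (norm d)"
        show "((\<lambda>z. D\<psi> z - D2\<psi> x *v z) has_derivative (\<lambda>h. D2\<psi> z *v h - D2\<psi> x *v h)) (at z within cball x (norm d))"
          by (intro has_derivative_diff d2 bounded_linear_imp_has_derivative matrix_vector_mul_bounded_linear)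
        have dz: "norm (z - x) \<le> r" using z d by (simp add: dist_norm norm_minus_commute)
        then have "norm z \<le> R + 1" using norm_triangle_ineq[of "z - x" x] x by (simp add: r_def)
        moreover have "dist z x < s" using dz s(1) by (simp add: dist_norm r_def)
        ultimately have "norm (D2\<psi> z - D2\<psi> x) < e" using s(2)[of x z] x by (simp add: dist_norm)
        then show "onorm (\<lambda>h. D2\<psi> z *v h - D2\<psi> x *v h) \<le> e"
        proof (intro onorm_le)
          fix h assume n: "norm (D2\<psi> z - D2\<psi> x) < e"
          have "norm (D2\<psi> z *v h - D2\<psi> x *v h) \<le> norm (D2\<psi> z - D2\<psi> x) * norm h"
            using norm_matrix_vector_le[of "D2\<psi> z - D2\<psi> x" h] by (simp add: matrix_vector_mult_diff_rdistrib)
          also have "\<dots> \<le> e * norm h" using n by (intro mult_right_mono) auto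
          finally show "norm (D2\<psi> z *v h - D2\<psi> x *v h) \<le> e * norm h" .
        qed
      qed (use k in \<open>auto simp: dist_norm\<close>)
      also have "e * norm (x + k - x) \<le> e * norm d" using k e by simp
      finally show ?thesis by (simp add: matrix_vector_right_distrib algebra_simps)
    qed
    define g where "g s = \<psi> (x + s *\<^sub>R d) - s * (D\<psi> x \<bullet> d) - s\<^sup>2 / 2 * ((D2\<psi> x *v d) \<bullet> d)" for s :: real
    define g' where "g' s = D\<psi> (x + s *\<^sub>R d) \<bullet> d - D\<psi> x \<bullet> d - s * ((D2\<psi> x *v d) \<bullet> d)" for s :: real
    have der: "(g has_real_derivative g' s) (at s)" for s
    proof -
      have "((\<lambda>s. x + s *\<^sub>R d) has_derivative (\<lambda>h. h *\<^sub>R d)) (at s)" by (auto intro!: derivative_eq_intros)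
      from diff_chain_at[OF this d1]
      have "((\<lambda>s. \<psi> (x + s *\<^sub>R d)) has_real_derivative (D\<psi> (x + s *\<^sub>R d) \<bullet> d)) (at s)"
        by (simp add: o_def has_field_derivative_def mult_commute_abs)
      then show ?thesis unfolding g_def g'_def by (auto intro!: derivative_eq_intros)
    qed
    obtain s where s: "0 < s" "s < 1" "g 1 - g 0 = (1 - 0) * g' s"
      using MVT2[of 0 1 g g'] der by auto
    have "norm (s *\<^sub>R d) \<le> norm d" using s by (simp add: mult_left_le_one_le)
    from D[OF this] have "norm (D\<psi> (x + s *\<^sub>R d) - D\<psi> x - D2\<psi> x *v (s *\<^sub>R d)) * norm d \<le> e * norm d * norm d"
      by (intro mult_right_mono) auto
    moreover have "g' s = (D\<psi> (x + s *\<^sub>R d) - D\<psi> x - D2\<psi> x *v (s *\<^sub>R d)) \<bullet> d"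
      by (simp add: g'_def inner_diff_left matrix_vector_mult_scaleR)
    ultimately have "\<bar>g' s\<bar> \<le> e * (norm d)\<^sup>2"
      using Cauchy_Schwarz_ineq2 order_trans by (fastforce simp: power2_eq_square mult.assoc)
    then show ?thesis using s(3) by (simp add: g_def)
  qed
  show thesis
  proof (rule that[of r])
    show "r > 0" using s by (simp add: r_def)
  qed (rule main)
qed

text \<open>Along a short ray the quadratic part of a jet is negligible, so a lower bound on the
  slope of \<open>f\<close> passes to the gradient. Applied in the direction opposite to the
  gradient this is the source of all gradient bounds for jets of Lipschitz functions.\<close>

lemma touch2_slope:
  assumes t: "touch2 f z \<xi> S" and low: "\<And>s. s > 0 ==> f (z + s *\<^sub>R v) \<ge> f z - s * k"
  shows "\<xi> \<bullet> v \<ge> - k"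
proof -
  obtain r where r: "r > 0" "\<And>d. norm d < r ==> f (z + d) \<le> f z + \<xi> \<bullet> d + S d \<bullet> d / 2"
    using t by (auto simp: touch2_def)
  have linS: "linear S" using t by (simp add: touch2_def)
  define s0 where "s0 = r / (2 * (norm v + 1))"
  have s0: "s0 > 0" unfolding s0_def using r by (intro divide_pos_pos) (auto intro: add_nonneg_pos)
  have s0v: "s0 * norm v < r"
  proof -
    have "s0 * (2 * (norm v + 1)) = r" unfolding s0_def by (simp add: add_nonneg_eq_0_iff)
    moreover have "s0 * (2 * (norm v + 1)) = 2 * (s0 * norm v) + 2 * s0" by (simp add: algebra_simps)
    moreover have "s0 * norm v \<ge> 0" using s0 by simp
    ultimately show ?thesis using s0 by linarith
  qed
  have "0 \<le> (\<xi> \<bullet> v + k) + t * (s0 * (S v \<bullet> v / 2))" if t: "0 < t" "t \<le> 1" for t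
  proof -
    define s where "s = t * s0"
    have s: "s > 0" using t s0 by (simp add: s_def)
    have "s * norm v \<le> 1 * (s0 * norm v)" unfolding s_def mult.assoc using t s0 by (intro mult_right_mono) auto
    then have "norm (s *\<^sub>R v) < r" using s s0v by simp
    from r(2)[OF this] low[OF s]
    have "0 \<le> s * ((\<xi> \<bullet> v + k) + s * (S v \<bullet> v / 2))" by (simp add: linear_scale[OF linS] algebra_simps)
    then have "0 \<le> (\<xi> \<bullet> v + k) + s * (S v \<bullet> v / 2)" using s by (simp only: zero_le_mult_iff) auto
    then show ?thesis by (simp add: s_def mult.assoc)
  qed
  then have "0 \<le> \<xi> \<bullet> v + k" by (rule nonneg_if_eventually_perturbed)
  then show ?thesis by simp
qed

lemma touch2_norm_le:
  assumes "touch2 f z q S" "\<And>y. \<bar>f z - f y\<bar> \<le> L * norm (z - y)"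
  shows "norm q \<le> L"
proof -
  have "q \<bullet> (- q) \<ge> - (L * norm q)"
  proof (rule touch2_slope[OF assms(1)])
    fix s :: real assume "s > 0"
    then show "f z - s * (L * norm q) \<le> f (z + s *\<^sub>R (- q))"
      using assms(2)[of "z + s *\<^sub>R (- q)"] by (simp add: abs_le_iff mult_ac)
  qed
  then have "norm q * norm q \<le> L * norm q" by (simp add: power2_norm_eq_inner[symmetric] power2_eq_square)
  moreover have "L \<ge> 0" if "q = 0"
  proof -
    obtain b :: 'a where b: "b \<in> Basis" using nonempty_Basis by blast
    have "0 \<le> L * norm (z - (z + b))" using assms(2)[of "z + b"] abs_ge_zero order_trans by blast
    then show ?thesis using b by simp
  qed
  ultimately show ?thesis by (cases "q = 0") auto
qed

lemma touch2_norm_fst_le: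
  assumes "touch2 f (x, t) (P, \<tau>) S" "\<And>y. \<bar>f (x, t) - f (y, t)\<bar> \<le> L * norm (x - y)" "L \<ge> 0"
  shows "norm P \<le> L"
proof -
  have "(P, \<tau>) \<bullet> (- P, 0) \<ge> - (L * norm P)"
  proof (rule touch2_slope[OF assms(1)])
    fix s :: real assume "s > 0"
    then show "f (x, t) - s * (L * norm P) \<le> f ((x, t) + s *\<^sub>R (- P, 0))"
      using assms(2)[of "x + s *\<^sub>R (- P)"] by (simp add: abs_le_iff mult_ac)
  qed
  then have "norm P * norm P \<le> L * norm P" by (simp add: power2_norm_eq_inner[symmetric] power2_eq_square)
  then show ?thesis using assms(3) by (cases "P = 0") auto
qed

text \<open>Three copies of \<open>x\<close> are tied together by the weight
  \<open>1 / (2 * ep)\<close>; the times \<open>t\<close> and \<open>s\<close> belong to different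
  functions and are independent from the start. Since jet gradients are bounded by the Lipschitz
  constant, the copies lie within order \<open>ep\<close> of each other, and therefore the squared
  distance divided by \<open>ep\<close> is also of order \<open>ep\<close>.\<close>

lemma doubling:
  fixes f1 f2 :: "(real^'n) \<times> real => real" and f3 \<psi> :: "real^'n => real"
    and x1 :: "real^'n" and \<kappa> \<omega> a b t1 a' b' s1 :: real
  defines "chi \<equiv> \<lambda>x t s. \<kappa> * \<psi> x + \<omega> * (norm (x - x1))\<^sup>2 + a * (t - t1)\<^sup>2 + b * t + a' * (s - s1)\<^sup>2 + b' * s"
  defines "h \<equiv> \<lambda>x t s. f1 (x, t) + f2 (x, s) + f3 x - chi x t s"
  assumes c: "continuous_on UNIV f1" "continuous_on UNIV f2" "continuous_on UNIV f3"
    and bd: "\<And>z. \<bar>f1 z\<bar> \<le> Bd" "\<And>z. \<bar>f2 z\<bar> \<le> Bd" "\<And>z. \<bar>f3 z\<bar> \<le> Bd"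
    and L: "L \<ge> 0"
    and lip: "\<And>x y t. \<bar>f1 (x, t) - f1 (y, t)\<bar> \<le> L * norm (x - y)" "\<And>x y t. \<bar>f2 (x, t) - f2 (y, t)\<bar> \<le> L * norm (x - y)"
      "\<And>x y. \<bar>f3 x - f3 y\<bar> \<le> L * norm (x - y)"
    and \<psi>: "C2_fun \<psi> D\<psi> D2\<psi>" and \<omega>: "\<omega> \<ge> 0" and a: "a \<ge> 0" "a' \<ge> 0"
    and N: "compact N" and n0: "(x0, t0, s0) \<in> N"
    and int: "\<And>x t s. (x, t, s) \<in> N ==> h x t s \<ge> h x0 t0 s0 ==> (x, t, s) \<in> interior N"
    and tol: "tol > 0"
  obtains x t s x' t' y s' z P \<tau>1 Q \<tau>2 q S1 S2 S3 ep \<eta> where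
    "(x, t, s) \<in> N" "norm (x' - x) \<le> tol" "\<bar>t' - t\<bar> \<le> tol" "norm (y - x) \<le> tol" "\<bar>s' - s\<bar> \<le> tol" "norm (z - x) \<le> tol"
    "norm (P + Q + q - (\<kappa> *\<^sub>R D\<psi> x + (2 * \<omega>) *\<^sub>R (x - x1))) \<le> tol"
    "\<bar>\<tau>1 - (2 * a * (t - t1) + b)\<bar> \<le> tol" "\<bar>\<tau>2 - (2 * a' * (s - s1) + b')\<bar> \<le> tol"
    "touch2 f1 (x', t') (P, \<tau>1) S1" "touch2 f2 (y, s') (Q, \<tau>2) S2" "touch2 f3 z q S3"
    "ep > 0" "\<eta> > 0" "\<eta> \<le> tol" "(norm (x' - y))\<^sup>2 + (norm (x' - z))\<^sup>2 \<le> tol * ep"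
    "\<And>\<alpha> \<beta> \<gamma>. S1 (\<alpha>, 0) \<bullet> (\<alpha>, 0) + S2 (\<beta>, 0) \<bullet> (\<beta>, 0) + S3 \<gamma> \<bullet> \<gamma>
       \<le> ((norm (\<alpha> - \<beta>))\<^sup>2 + (norm (\<alpha> - \<gamma>))\<^sup>2) / ep + \<kappa> * ((D2\<psi> x *v \<alpha>) \<bullet> \<alpha>) + 2 * \<omega> * (norm \<alpha>)\<^sup>2
          + \<eta> * ((norm \<alpha>)\<^sup>2 + (norm \<beta>)\<^sup>2 + (norm \<gamma>)\<^sup>2)"
proof -
  have cpsi: "continuous_on A \<psi>" for A
  proof -
    have "\<psi> differentiable (at x)" for x using \<psi> unfolding C2_fun_def differentiable_def by blast
    then show ?thesis by (intro continuous_at_imp_continuous_on ballI differentiable_imp_continuous_within)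
  qed
  have ch: "continuous_on A (\<lambda>(x, t, s). h x t s)" for A
    unfolding h_def chi_def split_def by (intro continuous_intros continuous_on_compose2[OF c(1)] continuous_on_compose2[OF c(2)]
        continuous_on_compose2[OF c(3)] continuous_on_compose2[OF cpsi]) auto
  have "\<exists>\<beta>>0. \<forall>x t s. (x, t, s) \<in> N --> h x t s \<ge> h x0 t0 s0 - \<beta> --> (x, t, s) \<in> interior N"
  proof -
    have "z \<in> interior N" if "z \<in> N" "(\<lambda>(x, t, s). h x t s) z \<ge> h x0 t0 s0" for z
      using int that by (cases z) auto
    from compact_interior_gap[OF N ch this]
    obtain \<beta> where "\<beta> > 0" "\<And>z. z \<in> N ==> (\<lambda>(x, t, s). h x t s) z \<ge> h x0 t0 s0 - \<beta> ==> z \<in> interior N" by blast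
    then show ?thesis by (intro exI[of _ \<beta>]) force
  qed
  then obtain \<beta> where \<beta>: "\<beta> > 0" "\<And>x t s. (x, t, s) \<in> N ==> h x t s \<ge> h x0 t0 s0 - \<beta> ==> (x, t, s) \<in> interior N"
    by blast
  have "bounded ((\<lambda>(x, t, s). h x t s) ` N)" by (intro compact_imp_bounded compact_continuous_image ch N)
  then obtain Hm where Hm: "\<And>x t s. (x, t, s) \<in> N ==> \<bar>h x t s\<bar> \<le> Hm"
    unfolding bounded_iff by force
  \<comment> \<open>The bounds serve in turn to keep \<open>h\<close> within \<beta> of its value at
    the centre, to keep the copies at distance below 1, and to bring first the squared distances
    relative to \<open>ep\<close> and then the distances below the tolerance.\<close>
  define ep where "ep = min (min 1 (\<beta> / (L\<^sup>2 + 1))) (min (1 / (2 * (2 * Hm + L + L\<^sup>2 + 1))) (min (tol / (2 * (L + 3)\<^sup>2)) (tol / (L + 3))))"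
  have Hm0: "Hm \<ge> 0" using Hm[OF n0] by linarith
  have ep: "ep > 0" unfolding ep_def using \<beta> tol L Hm0 by (simp add: add_nonneg_pos add_pos_nonneg)
  have ep1: "ep \<le> 1" unfolding ep_def by linarith
  have "ep \<le> \<beta> / (L\<^sup>2 + 1)" unfolding ep_def by linarith
  then have "ep * (L\<^sup>2 + 1) \<le> \<beta>" by (simp add: pos_le_divide_eq add_nonneg_pos)
  then have ep2: "L\<^sup>2 * ep \<le> \<beta>" using ep by (simp add: algebra_simps)
  have "ep \<le> 1 / (2 * (2 * Hm + L + L\<^sup>2 + 1))" unfolding ep_def by linarith
  moreover have pos: "2 * (2 * Hm + L + L\<^sup>2 + 1) > 0" using Hm0 L by (simp add: add_nonneg_pos)
  ultimately have "2 * (2 * Hm + L + L\<^sup>2 + 1) * ep \<le> 1" by (simp add: pos_le_divide_eq mult.commute)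
  then have "2 * (2 * Hm + L + L\<^sup>2 + 1) \<le> 1 / ep" using ep by (simp add: pos_le_divide_eq)
  then have ep3: "2 * Hm + L + L\<^sup>2 + 1 \<le> 1 / (2 * ep)" by simp
  have "ep \<le> tol / (2 * (L + 3)\<^sup>2)" unfolding ep_def by linarith
  then have ep4: "2 * (L + 3)\<^sup>2 * ep \<le> tol" using L by (simp add: pos_le_divide_eq mult.commute)
  have "ep \<le> tol / (L + 3)" unfolding ep_def by linarith
  then have ep5: "(L + 3) * ep \<le> tol" using L by (simp add: pos_le_divide_eq mult.commute)
  define \<eta> where "\<eta> = min ep (tol / 3)"
  have \<eta>: "\<eta> > 0" "\<eta> \<le> ep" "3 * \<eta> \<le> tol" using ep tol by (auto simp: \<eta>_def)
  define K where "K = {p :: (((real^'n) \<times> real) \<times> ((real^'n) \<times> real)) \<times> (real^'n).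
     (fst (fst (fst p)), snd (fst (fst p)), snd (snd (fst p))) \<in> N \<and> norm (fst (snd (fst p)) - fst (fst (fst p))) \<le> 1
       \<and> norm (snd p - fst (fst (fst p))) \<le> 1}"
  have "K = (\<lambda>((x, t, s), y, z). (((x, t), (x + y, s)), x + z)) ` (N \<times> cball 0 1 \<times> cball 0 1)" (is "_ = ?R")
  proof (intro equalityI subsetI)
    fix p assume "p \<in> K"
    then show "p \<in> ?R" unfolding K_def
      by (intro image_eqI[of _ _ "((fst (fst (fst p)), snd (fst (fst p)), snd (snd (fst p))), fst (snd (fst p)) - fst (fst (fst p)), snd p - fst (fst (fst p)))"]) auto
  qed (auto simp: K_def)
  also have "compact \<dots>" by (intro compact_continuous_image compact_Times N compact_cball) (auto simp: split_def intro!: continuous_intros)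
  finally have cK: "compact K" .
  define \<phi> where "\<phi> p = chi (fst (fst (fst p))) (snd (fst (fst p))) (snd (snd (fst p)))
      + ((norm (fst (fst (fst p)) - fst (snd (fst p))))\<^sup>2 + (norm (fst (fst (fst p)) - snd p))\<^sup>2) / (2 * ep)"
    for p :: "(((real^'n) \<times> real) \<times> ((real^'n) \<times> real)) \<times> (real^'n)"
  define Dq where "Dq p = ((((1/ep) *\<^sub>R ((fst (fst (fst p)) - fst (snd (fst p))) + (fst (fst (fst p)) - snd p)) + (2 * \<omega>) *\<^sub>R (fst (fst (fst p)) - x1),
        2 * a * (snd (fst (fst p)) - t1) + b),
       ((- (1/ep)) *\<^sub>R (fst (fst (fst p)) - fst (snd (fst p))), 2 * a' * (snd (snd (fst p)) - s1) + b')),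
       (- (1/ep)) *\<^sub>R (fst (fst (fst p)) - snd p))" for p :: "(((real^'n) \<times> real) \<times> ((real^'n) \<times> real)) \<times> (real^'n)"
  define D\<phi> where "D\<phi> p = Dq p + (((\<kappa> *\<^sub>R D\<psi> (fst (fst (fst p))), 0), (0, 0)), 0)" for p
  define A where "A d = ((norm (fst (fst (fst d)) - fst (snd (fst d))))\<^sup>2 + (norm (fst (fst (fst d)) - snd d))\<^sup>2) / ep
     + 2 * \<omega> * (norm (fst (fst (fst d))))\<^sup>2 + 2 * a * (snd (fst (fst d)))\<^sup>2 + 2 * a' * (snd (snd (fst d)))\<^sup>2"
    for d :: "(((real^'n) \<times> real) \<times> ((real^'n) \<times> real)) \<times> (real^'n)"
  define Hq where "Hq p d = A d + \<kappa> * ((D2\<psi> (fst (fst (fst p))) *v fst (fst (fst d))) \<bullet> fst (fst (fst d)))"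
    for p d :: "(((real^'n) \<times> real) \<times> ((real^'n) \<times> real)) \<times> (real^'n)"
  \<comment> \<open>All of \<phi> except \<psi> is quadratic, so the expansion is exact and only
    \<psi> carries a Taylor error.\<close>
  have expand: "\<phi> (p + d) = \<phi> p + Dq p \<bullet> d + A d / 2 + \<kappa> * (\<psi> (fst (fst (fst p)) + fst (fst (fst d))) - \<psi> (fst (fst (fst p))))" for p d
  proof -
    obtain x t y s z where p: "p = (((x, t), (y, s)), z)" by (metis prod.collapse)
    obtain dx dt dy ds dz where d: "d = (((dx, dt), (dy, ds)), dz)" by (metis prod.collapse)
    have e1: "(norm (u + v))\<^sup>2 = (norm u)\<^sup>2 + 2 * (u \<bullet> v) + (norm v)\<^sup>2" for u v :: "real^'n"
      by (simp add: power2_norm_eq_inner inner_add inner_commute)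
    have e2: "x + dx - (y + dy) = (x - y) + (dx - dy)" "x + dx - (z + dz) = (x - z) + (dx - dz)" "x + dx - x1 = (x - x1) + dx"
      by (simp_all add: algebra_simps)
    define u v w du dv where "u = x - y" and "v = x - z" and "w = x - x1" and "du = dx - dy" and "dv = dx - dz"
    have 1: "\<phi> (p + d) = \<kappa> * \<psi> (x + dx) + \<omega> * (norm (w + dx))\<^sup>2 + a * (t + dt - t1)\<^sup>2 + b * (t + dt)
        + a' * (s + ds - s1)\<^sup>2 + b' * (s + ds) + ((norm (u + du))\<^sup>2 + (norm (v + dv))\<^sup>2) / (2 * ep)"
      unfolding \<phi>_def chi_def p d u_def v_def w_def du_def dv_def by (simp add: e2)
    have 2: "Dq p \<bullet> d = (u \<bullet> du + v \<bullet> dv) / ep + 2 * \<omega> * (w \<bullet> dx) + (2 * a * (t - t1) + b) * dt + (2 * a' * (s - s1) + b') * ds"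
    proof -
      have "Dq p \<bullet> d = ((1/ep) *\<^sub>R (u + v) + (2 * \<omega>) *\<^sub>R w) \<bullet> dx + (2 * a * (t - t1) + b) * dt
         + ((- (1/ep)) *\<^sub>R u) \<bullet> dy + (2 * a' * (s - s1) + b') * ds + ((- (1/ep)) *\<^sub>R v) \<bullet> dz"
        unfolding Dq_def p d u_def v_def w_def by (simp add: inner_Pair)
      also have "((1/ep) *\<^sub>R (u + v) + (2 * \<omega>) *\<^sub>R w) \<bullet> dx = (u \<bullet> dx) / ep + (v \<bullet> dx) / ep + 2 * \<omega> * (w \<bullet> dx)"
        by (simp add: inner_add_left add_divide_distrib)
      also have "((- (1/ep)) *\<^sub>R u) \<bullet> dy = - (u \<bullet> dy) / ep" by simp
      also have "((- (1/ep)) *\<^sub>R v) \<bullet> dz = - (v \<bullet> dz) / ep" by simp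
      finally show ?thesis by (simp add: du_def dv_def inner_diff_right add_divide_distrib diff_divide_distrib)
    qed
    have 3: "A d = ((norm du)\<^sup>2 + (norm dv)\<^sup>2) / ep + 2 * \<omega> * (norm dx)\<^sup>2 + 2 * a * dt\<^sup>2 + 2 * a' * ds\<^sup>2"
      unfolding A_def d du_def dv_def by simp
    have 4: "\<phi> p = \<kappa> * \<psi> x + \<omega> * (norm w)\<^sup>2 + a * (t - t1)\<^sup>2 + b * t
        + a' * (s - s1)\<^sup>2 + b' * s + ((norm u)\<^sup>2 + (norm v)\<^sup>2) / (2 * ep)"
      unfolding \<phi>_def chi_def p u_def v_def w_def by simp
    have 5: "((norm (u + du))\<^sup>2 + (norm (v + dv))\<^sup>2) / (2 * ep) = ((norm u)\<^sup>2 + (norm v)\<^sup>2) / (2 * ep)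
       + (u \<bullet> du + v \<bullet> dv) / ep + ((norm du)\<^sup>2 + (norm dv)\<^sup>2) / ep / 2"
      unfolding e1 using ep by (simp add: field_simps)
    have 6: "a * (t + dt - t1)\<^sup>2 + b * (t + dt) = a * (t - t1)\<^sup>2 + b * t + (2 * a * (t - t1) + b) * dt + 2 * a * dt\<^sup>2 / 2"
      "a' * (s + ds - s1)\<^sup>2 + b' * (s + ds) = a' * (s - s1)\<^sup>2 + b' * s + (2 * a' * (s - s1) + b') * ds + 2 * a' * ds\<^sup>2 / 2"
      by (simp_all add: power2_eq_square algebra_simps)
    have 7: "\<omega> * (norm (w + dx))\<^sup>2 = \<omega> * (norm w)\<^sup>2 + 2 * \<omega> * (w \<bullet> dx) + 2 * \<omega> * (norm dx)\<^sup>2 / 2"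
      unfolding e1 by (simp add: algebra_simps)
    have 8: "fst (fst (fst p)) = x" "fst (fst (fst d)) = dx" by (simp_all add: p d)
    have 9: "\<kappa> * (\<psi> (x + dx) - \<psi> x) = \<kappa> * \<psi> (x + dx) - \<kappa> * \<psi> x" by (simp add: algebra_simps)
    define n0 n1 n2 where "n0 = ((norm u)\<^sup>2 + (norm v)\<^sup>2) / (2 * ep)" and "n1 = (u \<bullet> du + v \<bullet> dv) / ep"
      and "n2 = ((norm du)\<^sup>2 + (norm dv)\<^sup>2) / ep"
    define w0 w1 w2 where "w0 = \<omega> * (norm w)\<^sup>2" and "w1 = 2 * \<omega> * (w \<bullet> dx)" and "w2 = 2 * \<omega> * (norm dx)\<^sup>2"
    define a0 l0 q0 where "a0 = a * (t - t1)\<^sup>2 + b * t" and "l0 = (2 * a * (t - t1) + b) * dt" and "q0 = 2 * a * dt\<^sup>2"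
    define a1 l1 q1 where "a1 = a' * (s - s1)\<^sup>2 + b' * s" and "l1 = (2 * a' * (s - s1) + b') * ds" and "q1 = 2 * a' * ds\<^sup>2"
    note defs = n0_def n1_def n2_def w0_def w1_def w2_def a0_def l0_def q0_def a1_def l1_def q1_def
    have "\<phi> (p + d) = \<kappa> * \<psi> (x + dx) + (w0 + w1 + w2 / 2) + (a0 + l0 + q0 / 2) + (a1 + l1 + q1 / 2) + (n0 + n1 + n2 / 2)"
      unfolding 1 5 7 defs add.assoc[symmetric] 6[unfolded add.assoc[symmetric], symmetric] by simp
    moreover have "Dq p \<bullet> d = n1 + w1 + l0 + l1" unfolding 2 defs by simp
    moreover have "A d = n2 + w2 + q0 + q1" unfolding 3 defs by simp
    moreover have "\<phi> p = \<kappa> * \<psi> x + w0 + a0 + a1 + n0" unfolding 4 defs by simp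
    ultimately show ?thesis unfolding 8 9 by linarith
  qed
  define Mq where "Mq = 8 / ep + 2 * \<omega> + 2 * a + 2 * a'"
  have comp: "norm (fst (fst (fst d))) \<le> norm d" "\<bar>snd (fst (fst d))\<bar> \<le> norm d" "norm (fst (snd (fst d))) \<le> norm d"
     "\<bar>snd (snd (fst d))\<bar> \<le> norm d" "norm (snd d) \<le> norm d" for d :: "(((real^'n) \<times> real) \<times> ((real^'n) \<times> real)) \<times> (real^'n)"
  proof -
    obtain x t y s z where d: "d = (((x, t), (y, s)), z)" by (metis prod.collapse)
    have "norm ((x, t), (y, s)) \<le> norm d" "norm z \<le> norm d" unfolding d by (rule norm_fst_le norm_snd_le)+
    moreover have "norm (x, t) \<le> norm ((x, t), (y, s))" "norm (y, s) \<le> norm ((x, t), (y, s))" by (rule norm_fst_le norm_snd_le)+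
    moreover have "norm x \<le> norm (x, t)" "norm t \<le> norm (x, t)" "norm y \<le> norm (y, s)" "norm s \<le> norm (y, s)"
      by (rule norm_fst_le norm_snd_le)+
    ultimately show "norm (fst (fst (fst d))) \<le> norm d" "\<bar>snd (fst (fst d))\<bar> \<le> norm d" "norm (fst (snd (fst d))) \<le> norm d"
     "\<bar>snd (snd (fst d))\<bar> \<le> norm d" "norm (snd d) \<le> norm d" by (simp_all add: d)
  qed
  have Mq: "Mq \<ge> 0" using ep \<omega> a by (simp add: Mq_def)
  have A_le: "A d \<le> Mq * (norm d)\<^sup>2" for d
  proof -
    have s2: "(norm (u - v))\<^sup>2 \<le> 4 * (norm d)\<^sup>2" if "norm u \<le> norm d" "norm v \<le> norm d" for u v :: "real^'n"
    proof -
      have "norm (u - v) \<le> 2 * norm d" using norm_triangle_ineq4[of u v] that by linarith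
      then have "(norm (u - v))\<^sup>2 \<le> (2 * norm d)\<^sup>2" by (intro power_mono) auto
      then show ?thesis by (simp add: power_mult_distrib)
    qed
    have p2: "(snd (fst (fst d)))\<^sup>2 \<le> (norm d)\<^sup>2" "(snd (snd (fst d)))\<^sup>2 \<le> (norm d)\<^sup>2" "(norm (fst (fst (fst d))))\<^sup>2 \<le> (norm d)\<^sup>2"
    proof -
      have "r\<^sup>2 \<le> (norm d)\<^sup>2" if "\<bar>r\<bar> \<le> norm d" for r :: real using power_mono[OF that, of 2] by simp
      then show "(snd (fst (fst d)))\<^sup>2 \<le> (norm d)\<^sup>2" "(snd (snd (fst d)))\<^sup>2 \<le> (norm d)\<^sup>2" "(norm (fst (fst (fst d))))\<^sup>2 \<le> (norm d)\<^sup>2"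
        using comp[of d] by simp_all
    qed
    have "A d \<le> (4 * (norm d)\<^sup>2 + 4 * (norm d)\<^sup>2) / ep + 2 * \<omega> * (norm d)\<^sup>2 + 2 * a * (norm d)\<^sup>2 + 2 * a' * (norm d)\<^sup>2"
      unfolding A_def using ep \<omega> a comp[of d] by (intro add_mono divide_right_mono s2 mult_left_mono p2) auto
    then show ?thesis by (simp add: Mq_def algebra_simps)
  qed
  have Dq_lip: "norm (Dq p - Dq p') \<le> Mq * norm (p - p')" for p p'
  proof -
    define d where "d = p - p'"
    have tup: "norm (((u1, r1), (u2, r2)), u3) \<le> norm u1 + \<bar>r1\<bar> + norm u2 + \<bar>r2\<bar> + norm u3" for u1 u2 u3 :: "real^'n" and r1 r2 :: real
      using norm_Pair_le[of "((u1, r1), (u2, r2))" u3] norm_Pair_le[of "(u1, r1)" "(u2, r2)"] norm_Pair_le[of u1 r1] norm_Pair_le[of u2 r2] by simp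
    have eq: "Dq p - Dq p' = ((((1/ep) *\<^sub>R ((fst (fst (fst d)) - fst (snd (fst d))) + (fst (fst (fst d)) - snd d)) + (2 * \<omega>) *\<^sub>R (fst (fst (fst d))),
        2 * a * (snd (fst (fst d)))),
       ((- (1/ep)) *\<^sub>R (fst (fst (fst d)) - fst (snd (fst d))), 2 * a' * (snd (snd (fst d))))),
       (- (1/ep)) *\<^sub>R (fst (fst (fst d)) - snd d))"
      unfolding Dq_def d_def by (simp add: algebra_simps)
    have n2: "norm (u - v) \<le> 2 * norm d" if "norm u \<le> norm d" "norm v \<le> norm d" for u v :: "real^'n"
      using norm_triangle_ineq4[of u v] that by linarith
    have n4: "norm ((1/ep) *\<^sub>R ((fst (fst (fst d)) - fst (snd (fst d))) + (fst (fst (fst d)) - snd d)) + (2 * \<omega>) *\<^sub>R (fst (fst (fst d))))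
        \<le> 1/ep * (4 * norm d) + 2 * \<omega> * norm d"
    proof (rule norm_triangle_mono)
      have "norm ((fst (fst (fst d)) - fst (snd (fst d))) + (fst (fst (fst d)) - snd d)) \<le> 2 * norm d + 2 * norm d"
        by (rule norm_triangle_mono) (intro n2 comp)+
      then have "norm ((fst (fst (fst d)) - fst (snd (fst d))) + (fst (fst (fst d)) - snd d)) \<le> 4 * norm d" by simp
      then have "(1/ep) * norm ((fst (fst (fst d)) - fst (snd (fst d))) + (fst (fst (fst d)) - snd d)) \<le> 1/ep * (4 * norm d)"
        using ep by (intro mult_left_mono) auto
      then show "norm ((1/ep) *\<^sub>R ((fst (fst (fst d)) - fst (snd (fst d))) + (fst (fst (fst d)) - snd d))) \<le> 1/ep * (4 * norm d)"
        unfolding norm_scaleR using ep by simp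
      show "norm ((2 * \<omega>) *\<^sub>R (fst (fst (fst d)))) \<le> 2 * \<omega> * norm d"
        unfolding norm_scaleR using \<omega> comp(1)[of d] by (simp add: mult_left_mono)
    qed
    have n1: "norm ((- (1/ep)) *\<^sub>R (u - v)) \<le> 1/ep * (2 * norm d)" if "norm u \<le> norm d" "norm v \<le> norm d" for u v :: "real^'n"
      using n2[OF that] ep unfolding norm_scaleR by (simp add: divide_right_mono)
    have n3: "\<bar>2 * r * v\<bar> \<le> 2 * r * norm d" if "\<bar>v\<bar> \<le> norm d" "r \<ge> 0" for r v :: real
      using that by (simp add: abs_mult mult_left_mono)
    have "norm (Dq p - Dq p') \<le> (1/ep * (4 * norm d) + 2 * \<omega> * norm d) + 2 * a * norm d + 1/ep * (2 * norm d) + 2 * a' * norm d + 1/ep * (2 * norm d)"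
      unfolding eq by (rule order_trans[OF tup]) (intro add_mono n4 n1 n3 comp a)
    also have "\<dots> = Mq * norm d" by (simp add: Mq_def algebra_simps)
    finally show ?thesis by (simp add: d_def)
  qed
  obtain R where R: "\<And>p. p \<in> K ==> norm p \<le> R" using compact_imp_bounded[OF cK] bounded_iff by blast
  have RK: "norm (fst (fst (fst p))) \<le> R" if "p \<in> K" for p using comp(1)[of p] R[OF that] by linarith
  obtain M\<psi> where M\<psi>: "M\<psi> \<ge> 0" "\<And>x. norm x \<le> R ==> norm (D2\<psi> x) \<le> M\<psi>"
    "\<And>x y. norm x \<le> R ==> norm y \<le> R ==> norm (D\<psi> x - D\<psi> y) \<le> M\<psi> * norm (x - y)"
    "\<And>x y. norm x \<le> R ==> norm y \<le> R ==> \<bar>\<psi> y - \<psi> x - D\<psi> x \<bullet> (y - x)\<bar> \<le> M\<psi> * (norm (y - x))\<^sup>2"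
    using C2_fun_bounds[OF \<psi>] by blast
  define M where "M = Mq + 2 * \<bar>\<kappa>\<bar> * M\<psi>"
  have M: "M \<ge> 0" using Mq M\<psi> by (simp add: M_def)
  define W where "W = (\<lambda>p. f1 (fst (fst p)) + f2 (snd (fst p)) + f3 (snd p))"
  define p0 where "p0 = (((x0, t0), (x0, s0)), x0)"
  have p0K: "p0 \<in> K" using n0 by (simp add: p0_def K_def)
  have Wp0: "W p0 - \<phi> p0 = h x0 t0 s0" by (simp add: W_def \<phi>_def p0_def h_def)
  \<comment> \<open>Separating two copies gains at most \<open>L * d\<close> and costs
    \<open>d\<^sup>2 / (2 * ep)\<close>; the best balance is of order \<open>ep\<close>.\<close>
  have quad: "L * d - d\<^sup>2 / (2 * ep) \<le> L\<^sup>2 * ep / 2" for d :: real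
  proof -
    have "0 \<le> (d - L * ep)\<^sup>2 / (2 * ep)" using ep by simp
    also have "\<dots> = d\<^sup>2 / (2 * ep) - L * d + L\<^sup>2 * ep / 2" using ep by (simp add: power2_eq_square field_simps)
    finally show ?thesis by linarith
  qed
  have intK: "p \<in> interior K" if pK: "p \<in> K" and pv: "W p - \<phi> p \<ge> W p0 - \<phi> p0" for p
  proof -
    obtain x t y s z where p: "p = (((x, t), (y, s)), z)" by (metis prod.collapse)
    define d1 d2 where "d1 = norm (x - y)" and "d2 = norm (x - z)"
    have xN: "(x, t, s) \<in> N" and d: "d1 \<le> 1" "d2 \<le> 1" using pK by (auto simp: p K_def d1_def d2_def norm_minus_commute)
    have "W p - \<phi> p = f1 (x, t) + f2 (y, s) + f3 z - chi x t s - (d1\<^sup>2 + d2\<^sup>2) / (2 * ep)"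
      by (simp add: W_def \<phi>_def p d1_def d2_def)
    moreover have "f2 (y, s) \<le> f2 (x, s) + L * d1" "f3 z \<le> f3 x + L * d2"
      using lip(2)[of x s y] lip(3)[of x z] unfolding d1_def d2_def abs_le_iff by linarith+
    ultimately have v: "h x0 t0 s0 \<le> h x t s + (L * d1 - d1\<^sup>2 / (2 * ep)) + (L * d2 - d2\<^sup>2 / (2 * ep))"
      using pv unfolding Wp0 by (simp add: h_def add_divide_distrib)
    then have "h x t s \<ge> h x0 t0 s0 - \<beta>" using quad[of d1] quad[of d2] ep2 by linarith
    then have iN: "(x, t, s) \<in> interior N" using \<beta>(2) xN by blast
    have hh: "h x t s - h x0 t0 s0 \<le> 2 * Hm" using Hm[OF xN] Hm[OF n0] by linarith
    have "L\<^sup>2 * ep \<le> L\<^sup>2 * 1" using ep1 by (intro mult_left_mono) auto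
    then have qq: "L * e - e\<^sup>2 / (2 * ep) \<le> L\<^sup>2 / 2" for e using quad[of e] by linarith
    have "d1 \<noteq> 1"
    proof
      assume "d1 = 1"
      then have "L * d1 - d1\<^sup>2 / (2 * ep) = L - 1 / (2 * ep)" by simp
      then show False using v hh qq[of d2] ep3 zero_le_power2[of L] by linarith
    qed
    moreover have "d2 \<noteq> 1"
    proof
      assume "d2 = 1"
      then have "L * d2 - d2\<^sup>2 / (2 * ep) = L - 1 / (2 * ep)" by simp
      then show False using v hh qq[of d1] ep3 zero_le_power2[of L] by linarith
    qed
    ultimately have d': "d1 < 1" "d2 < 1" using d by auto
    define O' where "O' = (\<lambda>p. (fst (fst (fst p)), snd (fst (fst p)), snd (snd (fst p)))) -` interior N
       \<inter> {p. norm (fst (snd (fst p)) - fst (fst (fst p))) < 1} \<inter> {p. norm (snd p - fst (fst (fst p))) < 1}"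
    have "open O'" unfolding O'_def by (intro open_Int open_vimage open_interior open_Collect_less continuous_intros)
    moreover have "O' \<subseteq> K" unfolding O'_def K_def using interior_subset[of N] by auto
    moreover have "p \<in> O'" using iN d' by (auto simp: O'_def p d1_def d2_def norm_minus_commute)
    ultimately show ?thesis using interior_maximal by blast
  qed
  have cphi: "continuous_on K \<phi>" unfolding \<phi>_def chi_def using ep by (intro continuous_intros continuous_on_compose2[OF cpsi]) auto
  have Dlip: "norm (D\<phi> p - D\<phi> p') \<le> M * norm (p - p')" if "p \<in> K" "p' \<in> K" for p p'
  proof -
    define x x' where "x = fst (fst (fst p))" and "x' = fst (fst (fst p'))"
    have "D\<phi> p - D\<phi> p' = (Dq p - Dq p') + (((\<kappa> *\<^sub>R (D\<psi> x - D\<psi> x'), 0), (0, 0)), 0)"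
      by (simp add: D\<phi>_def x_def x'_def algebra_simps)
    then have "norm (D\<phi> p - D\<phi> p') \<le> norm (Dq p - Dq p') + norm ((((\<kappa> *\<^sub>R (D\<psi> x - D\<psi> x'), 0::real), (0::real^'n, 0::real)), 0::real^'n))"
      by (simp only: norm_triangle_ineq)
    also have "norm ((((\<kappa> *\<^sub>R (D\<psi> x - D\<psi> x'), 0::real), (0::real^'n, 0::real)), 0::real^'n)) = \<bar>\<kappa>\<bar> * norm (D\<psi> x - D\<psi> x')"
      by (simp add: norm_Pair)
    also have "\<dots> \<le> \<bar>\<kappa>\<bar> * (M\<psi> * norm (p - p'))"
    proof (rule mult_left_mono)
      have "norm (D\<psi> x - D\<psi> x') \<le> M\<psi> * norm (x - x')" unfolding x_def x'_def by (intro M\<psi>(3) RK that)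
      also have "\<dots> \<le> M\<psi> * norm (p - p')" using comp(1)[of "p - p'"] M\<psi>(1) by (intro mult_left_mono) (auto simp: x_def x'_def)
      finally show "norm (D\<psi> x - D\<psi> x') \<le> M\<psi> * norm (p - p')" .
    qed simp
    also have "norm (Dq p - Dq p') + \<bar>\<kappa>\<bar> * (M\<psi> * norm (p - p')) \<le> M * norm (p - p')"
    proof -
      have "0 \<le> \<bar>\<kappa>\<bar> * (M\<psi> * norm (p - p'))" using M\<psi>(1) by simp
      then show ?thesis using Dq_lip[of p p'] by (simp add: M_def algebra_simps)
    qed
    finally show ?thesis by simp
  qed
  have Dd: "D\<phi> p \<bullet> d = Dq p \<bullet> d + \<kappa> * (D\<psi> (fst (fst (fst p))) \<bullet> fst (fst (fst d)))" for p d
    by (simp add: D\<phi>_def inner_add_left inner_prod_def[of _ d] inner_prod_def)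
  have up: "\<phi> p' \<le> \<phi> p + D\<phi> p \<bullet> (p' - p) + M / 2 * (norm (p' - p))\<^sup>2" if pp: "p \<in> K" "p' \<in> K" for p p'
  proof -
    define d where "d = p' - p"
    define x dx where "x = fst (fst (fst p))" and "dx = fst (fst (fst d))"
    have x': "x + dx = fst (fst (fst p'))" by (simp add: x_def dx_def d_def)
    have "\<bar>\<psi> (x + dx) - \<psi> x - D\<psi> x \<bullet> dx\<bar> \<le> M\<psi> * (norm dx)\<^sup>2"
      using M\<psi>(4)[of x "x + dx"] RK[OF pp(1)] RK[OF pp(2)] unfolding x' x_def[symmetric] by (simp add: x'[symmetric])
    also have "\<dots> \<le> M\<psi> * (norm d)\<^sup>2" using M\<psi>(1) comp(1)[of d] by (intro mult_left_mono power_mono) (auto simp: dx_def)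
    finally have "\<bar>\<kappa>\<bar> * \<bar>\<psi> (x + dx) - \<psi> x - D\<psi> x \<bullet> dx\<bar> \<le> \<bar>\<kappa>\<bar> * (M\<psi> * (norm d)\<^sup>2)" by (intro mult_left_mono) auto
    then have "\<kappa> * (\<psi> (x + dx) - \<psi> x) \<le> \<kappa> * (D\<psi> x \<bullet> dx) + \<bar>\<kappa>\<bar> * (M\<psi> * (norm d)\<^sup>2)"
      unfolding abs_mult[symmetric] abs_le_iff by (simp add: algebra_simps)
    moreover have "\<phi> p' = \<phi> p + Dq p \<bullet> d + A d / 2 + \<kappa> * (\<psi> (x + dx) - \<psi> x)"
      using expand[of p d] by (simp add: d_def x_def dx_def)
    moreover have "M / 2 * (norm d)\<^sup>2 = Mq * (norm d)\<^sup>2 / 2 + \<bar>\<kappa>\<bar> * (M\<psi> * (norm d)\<^sup>2)" by (simp add: M_def algebra_simps add_divide_distrib)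
    ultimately show ?thesis using A_le[of d] unfolding d_def[symmetric] Dd x_def[symmetric] dx_def[symmetric] by linarith
  qed
  have taylor: "\<exists>r>0. \<forall>p\<in>K. \<forall>d. norm d \<le> r --> p + d \<in> K -->
           \<phi> (p + d) \<le> \<phi> p + D\<phi> p \<bullet> d + Hq p d / 2 + e * (norm d)\<^sup>2" if e: "e > 0" for e
  proof -
    have e': "e / (\<bar>\<kappa>\<bar> + 1) > 0" using e by simp
    obtain r where r: "r > 0" "\<And>x d. norm x \<le> R ==> norm d \<le> r ==>
      \<bar>\<psi> (x + d) - \<psi> x - D\<psi> x \<bullet> d - (D2\<psi> x *v d) \<bullet> d / 2\<bar> \<le> e / (\<bar>\<kappa>\<bar> + 1) * (norm d)\<^sup>2"
      using C2_fun_taylor[OF \<psi> e'] by blast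
    have "\<phi> (p + d) \<le> \<phi> p + D\<phi> p \<bullet> d + Hq p d / 2 + e * (norm d)\<^sup>2" if p: "p \<in> K" and d: "norm d \<le> r" for p d
    proof -
      define x dx where "x = fst (fst (fst p))" and "dx = fst (fst (fst d))"
      define T where "T = \<psi> (x + dx) - \<psi> x - D\<psi> x \<bullet> dx - (D2\<psi> x *v dx) \<bullet> dx / 2"
      have ndx: "norm dx \<le> norm d" unfolding dx_def by (rule comp)
      have "\<bar>T\<bar> \<le> e / (\<bar>\<kappa>\<bar> + 1) * (norm dx)\<^sup>2"
        unfolding T_def using r(2)[of x dx] RK[OF p] ndx d by (simp add: x_def)
      also have "\<dots> \<le> e / (\<bar>\<kappa>\<bar> + 1) * (norm d)\<^sup>2" using e' ndx by (intro mult_left_mono power_mono) auto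
      finally have "\<bar>\<kappa>\<bar> * \<bar>T\<bar> \<le> (\<bar>\<kappa>\<bar> + 1) * (e / (\<bar>\<kappa>\<bar> + 1) * (norm d)\<^sup>2)" by (intro mult_mono) auto
      moreover have "\<kappa> * T \<le> \<bar>\<kappa>\<bar> * \<bar>T\<bar>" by (metis abs_ge_self abs_mult)
      moreover have "\<bar>\<kappa>\<bar> + 1 \<noteq> 0" by linarith
      ultimately have "\<kappa> * T \<le> e * (norm d)\<^sup>2" by simp
      then show ?thesis
        using expand[of p d] unfolding Dd Hq_def x_def[symmetric] dx_def[symmetric] T_def by (simp add: algebra_simps add_divide_distrib)
    qed
    then show ?thesis using r(1) by blast
  qed
  have Hq2: "Hq p (t *\<^sub>R d) = t\<^sup>2 * Hq p d" for p t d
  proof -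
    have "norm (t *\<^sub>R u - t *\<^sub>R v) = \<bar>t\<bar> * norm (u - v)" for u v :: "real^'n" by (metis norm_scaleR scaleR_diff_right)
    then show ?thesis
      by (simp add: Hq_def A_def power_mult_distrib matrix_vector_mult_scaleR algebra_simps add_divide_distrib) (simp add: power2_eq_square)
  qed
  obtain p z1 z2 z3 \<xi>1 \<xi>2 \<xi>3 S1 S2 S3 where J: "p \<in> K"
    "norm (z1 - fst (fst p)) \<le> \<eta>" "norm (z2 - snd (fst p)) \<le> \<eta>" "norm (z3 - snd p) \<le> \<eta>"
    "norm (\<xi>1 - fst (fst (D\<phi> p))) \<le> \<eta>" "norm (\<xi>2 - snd (fst (D\<phi> p))) \<le> \<eta>" "norm (\<xi>3 - snd (D\<phi> p)) \<le> \<eta>"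
    "touch2 f1 z1 \<xi>1 S1" "touch2 f2 z2 \<xi>2 S2" "touch2 f3 z3 \<xi>3 S3"
    "\<And>a b c. S1 a \<bullet> a + S2 b \<bullet> b + S3 c \<bullet> c \<le> Hq p ((a, b), c) + \<eta> * (norm ((a, b), c))\<^sup>2"
    using sums_second_order[OF c bd cK p0K intK[unfolded W_def] cphi M Dlip up taylor Hq2 \<eta>(1)] by blast
  obtain x t y0 s z0 where p: "p = (((x, t), (y0, s)), z0)" by (metis prod.collapse)
  obtain x' t' where z1: "z1 = (x', t')" by force
  obtain y s' where z2: "z2 = (y, s')" by force
  obtain P \<tau>1 where \<xi>1: "\<xi>1 = (P, \<tau>1)" by force
  obtain Q \<tau>2 where \<xi>2: "\<xi>2 = (Q, \<tau>2)" by force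
  have sp: "norm (u1 - u2) \<le> \<eta>" "\<bar>r1 - r2\<bar> \<le> \<eta>" if "norm ((u1, r1) - (u2, r2)) \<le> \<eta>" for u1 u2 :: "real^'n" and r1 r2 :: real
    using that norm_fst_le[of "u1 - u2" "r1 - r2"] norm_snd_le[of "r1 - r2" "u1 - u2"] by auto
  have xN: "(x, t, s) \<in> N" using J(1) by (simp add: K_def p)
  have n1: "norm (x' - x) \<le> \<eta>" "\<bar>t' - t\<bar> \<le> \<eta>" using sp[of x' t' x t] J(2) by (auto simp: p z1)
  have n2: "norm (y - y0) \<le> \<eta>" "\<bar>s' - s\<bar> \<le> \<eta>" using sp[of y s' y0 s] J(3) by (auto simp: p z2)
  have n3: "norm (z3 - z0) \<le> \<eta>" using J(4) by (simp add: p)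
  have g1: "norm (P - ((1/ep) *\<^sub>R ((x - y0) + (x - z0)) + (2 * \<omega>) *\<^sub>R (x - x1) + \<kappa> *\<^sub>R D\<psi> x)) \<le> \<eta>"
     "\<bar>\<tau>1 - (2 * a * (t - t1) + b)\<bar> \<le> \<eta>"
    using sp[of P \<tau>1 "(1/ep) *\<^sub>R ((x - y0) + (x - z0)) + (2 * \<omega>) *\<^sub>R (x - x1) + \<kappa> *\<^sub>R D\<psi> x" "2 * a * (t - t1) + b"] J(5)
    by (auto simp: p \<xi>1 D\<phi>_def Dq_def)
  have g2: "norm (Q - (- (1/ep)) *\<^sub>R (x - y0)) \<le> \<eta>" "\<bar>\<tau>2 - (2 * a' * (s - s1) + b')\<bar> \<le> \<eta>"
    using sp[of Q \<tau>2 "(- (1/ep)) *\<^sub>R (x - y0)" "2 * a' * (s - s1) + b'"] J(6) by (auto simp: p \<xi>2 D\<phi>_def Dq_def)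
  have g3: "norm (\<xi>3 - (- (1/ep)) *\<^sub>R (x - z0)) \<le> \<eta>" using J(7) by (simp add: p D\<phi>_def Dq_def)
  have LQ: "norm Q \<le> L" using touch2_norm_fst_le[OF J(9)[unfolded z2 \<xi>2] lip(2) L] .
  have Lq: "norm \<xi>3 \<le> L" using touch2_norm_le[OF J(10) lip(3)] .
  have close: "norm (x - w) \<le> ep * (L + 1)" if "norm (G - (- (1/ep)) *\<^sub>R (x - w)) \<le> \<eta>" "norm G \<le> L" for G w
  proof -
    have "norm ((1/ep) *\<^sub>R (x - w)) \<le> norm (G - (- (1/ep)) *\<^sub>R (x - w)) + norm G"
      using norm_triangle_ineq4[of "G - (- (1/ep)) *\<^sub>R (x - w)" G] by simp
    then have "norm (x - w) / ep \<le> L + 1" using that ep \<eta>(2) ep1 by simp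
    then show ?thesis using ep by (simp add: pos_divide_le_eq mult.commute)
  qed
  have cl: "norm (x - y0) \<le> ep * (L + 1)" "norm (x - z0) \<le> ep * (L + 1)" using close g2(1) g3 LQ Lq by blast+
  have e3: "ep * (L + 1) + \<eta> + \<eta> \<le> (L + 3) * ep" using \<eta>(2) by (simp add: algebra_simps)
  have ny: "norm (y - x) \<le> ep * (L + 1) + \<eta>" "norm (z3 - x) \<le> ep * (L + 1) + \<eta>"
    using norm_triangle_ineq[of "y - y0" "y0 - x"] norm_triangle_ineq[of "z3 - z0" "z0 - x"] n2(1) n3 cl by (simp_all add: norm_minus_commute)
  have nxy: "norm (x' - y) \<le> (L + 3) * ep" "norm (x' - z3) \<le> (L + 3) * ep"
    using norm_triangle_ineq[of "x' - x" "x - y"] norm_triangle_ineq[of "x' - x" "x - z3"] n1(1) ny e3 by (simp_all add: norm_minus_commute)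
  have sq: "(norm (x' - y))\<^sup>2 + (norm (x' - z3))\<^sup>2 \<le> tol * ep"
  proof -
    have "(norm (x' - y))\<^sup>2 + (norm (x' - z3))\<^sup>2 \<le> ((L + 3) * ep)\<^sup>2 + ((L + 3) * ep)\<^sup>2"
      using nxy by (intro add_mono power_mono) auto
    also have "\<dots> = (2 * (L + 3)\<^sup>2 * ep) * ep" by (simp add: power2_eq_square algebra_simps)
    also have "\<dots> \<le> tol * ep" using ep4 ep by (intro mult_right_mono) auto
    finally show ?thesis .
  qed
  show thesis
  proof (rule that[OF xN _ _ _ _ _ _ _ _ J(8)[unfolded z1 \<xi>1] J(9)[unfolded z2 \<xi>2] J(10) ep \<eta>(1) _ sq])
    show "norm (x' - x) \<le> tol" "\<bar>t' - t\<bar> \<le> tol" "\<bar>s' - s\<bar> \<le> tol" "\<eta> \<le> tol"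
      "\<bar>\<tau>1 - (2 * a * (t - t1) + b)\<bar> \<le> tol" "\<bar>\<tau>2 - (2 * a' * (s - s1) + b')\<bar> \<le> tol"
      using n1 n2 g1 g2 \<eta> by linarith+
    show "norm (y - x) \<le> tol" "norm (z3 - x) \<le> tol" using ny e3 ep5 \<eta> by linarith+
    have "P + Q + \<xi>3 - (\<kappa> *\<^sub>R D\<psi> x + (2 * \<omega>) *\<^sub>R (x - x1))
       = (P - ((1/ep) *\<^sub>R ((x - y0) + (x - z0)) + (2 * \<omega>) *\<^sub>R (x - x1) + \<kappa> *\<^sub>R D\<psi> x))
         + (Q - (- (1/ep)) *\<^sub>R (x - y0)) + (\<xi>3 - (- (1/ep)) *\<^sub>R (x - z0))" by (simp add: algebra_simps)
    then have "norm (P + Q + \<xi>3 - (\<kappa> *\<^sub>R D\<psi> x + (2 * \<omega>) *\<^sub>R (x - x1))) \<le> \<eta> + \<eta> + \<eta>"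
      using g1(1) g2(1) g3 norm_triangle_mono by metis
    then show "norm (P + Q + \<xi>3 - (\<kappa> *\<^sub>R D\<psi> x + (2 * \<omega>) *\<^sub>R (x - x1))) \<le> tol" using \<eta>(3) by linarith
    fix \<alpha> \<beta> \<gamma> :: "real^'n"
    have "(norm (((\<alpha>, 0::real), (\<beta>, 0::real)), \<gamma>))\<^sup>2 = (norm \<alpha>)\<^sup>2 + (norm \<beta>)\<^sup>2 + (norm \<gamma>)\<^sup>2"
      by (simp add: norm_Pair)
    then show "S1 (\<alpha>, 0) \<bullet> (\<alpha>, 0) + S2 (\<beta>, 0) \<bullet> (\<beta>, 0) + S3 \<gamma> \<bullet> \<gamma>
       \<le> ((norm (\<alpha> - \<beta>))\<^sup>2 + (norm (\<alpha> - \<gamma>))\<^sup>2) / ep + \<kappa> * ((D2\<psi> x *v \<alpha>) \<bullet> \<alpha>) + 2 * \<omega> * (norm \<alpha>)\<^sup>2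
          + \<eta> * ((norm \<alpha>)\<^sup>2 + (norm \<beta>)\<^sup>2 + (norm \<gamma>)\<^sup>2)"
      using J(11)[of "(\<alpha>, 0)" "(\<beta>, 0)" \<gamma>] by (simp add: Hq_def A_def p)
  qed
qed

section \<open>Jets and the Bellman operator\<close>

text \<open>The second-order term as a sum over the columns of \<sigma>. The form \<open>Q\<close>
  is an arbitrary function, so spatial blocks of space-time jets can be inserted directly.\<close>

definition diffusion_form :: "('th => real^'n => real^'n^'n) => 'th => real^'n => (real^'n => real) => real" where
  "diffusion_form \<sigma> \<theta> x Q = (\<Sum>k\<in>UNIV. Q (column k (\<sigma> \<theta> x)))"

lemma trace_diffmat: "trace (diffmat \<sigma> \<theta> x ** X) = diffusion_form \<sigma> \<theta> x (\<lambda>a. (X *v a) \<bullet> a)"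
proof -
  define S where "S = \<sigma> \<theta> x"
  have "trace (diffmat \<sigma> \<theta> x ** X) = (\<Sum>i\<in>UNIV. \<Sum>j\<in>UNIV. \<Sum>k\<in>UNIV. S $ i $ k * S $ j $ k * X $ j $ i)"
    by (simp add: trace_def diffmat_def matrix_matrix_mult_def transpose_def S_def sum_distrib_right)
  also have "\<dots> = (\<Sum>i\<in>UNIV. \<Sum>k\<in>UNIV. \<Sum>j\<in>UNIV. S $ i $ k * S $ j $ k * X $ j $ i)" by (intro sum.cong refl sum.swap)
  also have "\<dots> = (\<Sum>k\<in>UNIV. \<Sum>i\<in>UNIV. \<Sum>j\<in>UNIV. S $ i $ k * S $ j $ k * X $ j $ i)" by (rule sum.swap)
  also have "\<dots> = (\<Sum>k\<in>UNIV. \<Sum>j\<in>UNIV. \<Sum>i\<in>UNIV. S $ i $ k * S $ j $ k * X $ j $ i)" by (intro sum.cong refl sum.swap)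
  also have "\<dots> = diffusion_form \<sigma> \<theta> x (\<lambda>a. (X *v a) \<bullet> a)"
    by (simp add: diffusion_form_def inner_vec_def matrix_vector_mult_def column_def S_def[symmetric] sum_distrib_right sum_distrib_left mult_ac)
  finally show ?thesis .
qed

lemma norm_columns: "(\<Sum>k\<in>UNIV. (norm (column k A))\<^sup>2) = (norm A)\<^sup>2" for A :: "real^'n^'m"
proof -
  have "(\<Sum>k\<in>UNIV. (norm (column k A))\<^sup>2) = (\<Sum>k\<in>UNIV. \<Sum>i\<in>UNIV. A $ i $ k * A $ i $ k)"
    by (simp add: power2_norm_eq_inner inner_vec_def column_def)
  also have "\<dots> = (\<Sum>i\<in>UNIV. \<Sum>k\<in>UNIV. A $ i $ k * A $ i $ k)" by (rule sum.swap)
  also have "\<dots> = (norm A)\<^sup>2" by (simp add: power2_norm_eq_inner inner_vec_def)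
  finally show ?thesis .
qed

lemma column_diff: "column k (A - B) = column k A - column k B" by (simp add: column_def vec_eq_iff)

lemma norm_column_le_norm: "norm (column k A) \<le> norm A" for A :: "real^'n^'m"
proof -
  have "(norm (column k A))\<^sup>2 \<le> (norm A)\<^sup>2"
    unfolding norm_columns[symmetric] by (rule member_le_sum) auto
  then show ?thesis by (rule power2_le_imp_le) simp
qed

lemma quad_has_derivative:
  fixes S :: "'a::euclidean_space => 'a"
  assumes S: "linear S" "\<And>a b. S a \<bullet> b = a \<bullet> S b"
  shows "((\<lambda>p. \<xi> \<bullet> (p - z) + S (p - z) \<bullet> (p - z) / 2) has_derivative (\<lambda>h. (\<xi> + S (p - z)) \<bullet> h)) (at p)"
proof -
  have bS: "bounded_linear S" using S(1) linear_conv_bounded_linear by blast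
  have d: "((\<lambda>p. p - z) has_derivative (\<lambda>h. h - 0)) (at p)" by (intro derivative_intros)
  have "((\<lambda>p. \<xi> \<bullet> (p - z) + S (p - z) \<bullet> (p - z) / 2) has_derivative
     (\<lambda>h. \<xi> \<bullet> (h - 0) + (S (p - z) \<bullet> (h - 0) + S (h - 0) \<bullet> (p - z)) / 2)) (at p)"
    by (intro has_derivative_add bounded_linear.has_derivative[OF bounded_linear_inner_right d]
        bounded_linear.has_derivative[OF bounded_linear_divide]
        bounded_bilinear.FDERIV[OF bounded_bilinear_inner bounded_linear.has_derivative[OF bS d] d])
  moreover have "\<xi> \<bullet> (h - 0) + (S (p - z) \<bullet> (h - 0) + S (h - 0) \<bullet> (p - z)) / 2 = (\<xi> + S (p - z)) \<bullet> h" for h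
    using S(2)[of h "p - z"] by (simp add: inner_add inner_commute)
  ultimately show ?thesis by simp
qed

lemma linear_matrix_works: "linear f ==> matrix f *v x = f x" for f :: "real^'n => real^'m"
  by (rule matrix_works) (simp add: linear_matrix_vector_mul_eq)

lemma C2_fun_quad:
  fixes S :: "real^'n => real^'n"
  assumes S: "linear S" "\<And>a b. S a \<bullet> b = a \<bullet> S b"
  shows "C2_fun (\<lambda>p. \<xi> \<bullet> (p - z) + S (p - z) \<bullet> (p - z) / 2) (\<lambda>p. \<xi> + S (p - z)) (\<lambda>p. matrix S)"
  unfolding C2_fun_def
proof (intro conjI allI)
  fix p
  show "((\<lambda>p. \<xi> \<bullet> (p - z) + S (p - z) \<bullet> (p - z) / 2) has_derivative (\<bullet>) (\<xi> + S (p - z))) (at p)"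
    using quad_has_derivative[OF S] .
  have bS: "bounded_linear S" using S(1) linear_conv_bounded_linear by blast
  have "((\<lambda>p. \<xi> + S (p - z)) has_derivative (\<lambda>h. 0 + S (h - 0))) (at p)"
    by (intro derivative_intros bounded_linear.has_derivative[OF bS])
  then show "((\<lambda>p. \<xi> + S (p - z)) has_derivative (*v) (matrix S)) (at p)"
    using linear_matrix_works[OF S(1)] by (simp add: fun_eq_iff[of "(*v) (matrix S)" S, THEN iffD2])
qed auto

lemma linear_fst_block:
  fixes S :: "(real^'n) \<times> real => (real^'n) \<times> real"
  assumes "linear S" shows "linear (\<lambda>h. fst (S (h, 0)))"
proof (rule linearI)
  show "fst (S (a + b, 0)) = fst (S (a, 0)) + fst (S (b, 0))" for a b
    using linear_add[OF assms, of "(a, 0)" "(b, 0)"] by simp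
  show "fst (S (r *\<^sub>R a, 0)) = r *\<^sub>R fst (S (a, 0))" for r a
    using linear_scale[OF assms, of r "(a, 0)"] by simp
qed

lemma C21_fun_quad:
  fixes S :: "(real^'n) \<times> real => (real^'n) \<times> real"
  assumes S: "linear S" "\<And>a b. S a \<bullet> b = a \<bullet> S b"
  shows "C21_fun (\<lambda>y s. \<xi> \<bullet> ((y, s) - z) + S ((y, s) - z) \<bullet> ((y, s) - z) / 2)
     (\<lambda>y s. snd (\<xi> + S ((y, s) - z))) (\<lambda>y s. fst (\<xi> + S ((y, s) - z))) (\<lambda>y s. matrix (\<lambda>h. fst (S (h, 0))))"
  unfolding C21_fun_def
proof (intro conjI allI)
  have bS: "bounded_linear S" using S(1) linear_conv_bounded_linear by blast
  have cS: "continuous_on UNIV (\<lambda>p. \<xi> + S (p - z))" by (intro continuous_intros bounded_linear.continuous_on[OF bS])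
  fix x :: "real^'n" and t :: real
  have "(\<lambda>h. (\<xi> + S ((x, t) - z)) \<bullet> h) = (\<lambda>(h, r). fst (\<xi> + S ((x, t) - z)) \<bullet> h + snd (\<xi> + S ((x, t) - z)) * r)"
    by (auto simp: fun_eq_iff inner_prod_def)
  with quad_has_derivative[OF S, of \<xi> z "(x, t)"]
  show "((\<lambda>(y, s). \<xi> \<bullet> ((y, s) - z) + S ((y, s) - z) \<bullet> ((y, s) - z) / 2) has_derivative
       (\<lambda>(h, r). fst (\<xi> + S ((x, t) - z)) \<bullet> h + snd (\<xi> + S ((x, t) - z)) * r)) (at (x, t))" by (simp add: split_def)
  show "continuous_on UNIV (\<lambda>(x, t). snd (\<xi> + S ((x, t) - z)))" "continuous_on UNIV (\<lambda>(x, t). fst (\<xi> + S ((x, t) - z)))"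
    using continuous_on_snd[OF cS] continuous_on_fst[OF cS] by (simp_all add: split_def)
  have "((\<lambda>y. (y, t) - z) has_derivative (\<lambda>h. (h, 0) - 0)) (at x)" by (intro derivative_intros)
  from bounded_linear.has_derivative[OF bS this]
  have "((\<lambda>y. fst (\<xi> + S ((y, t) - z))) has_derivative (\<lambda>h. fst (0 + S ((h, 0) - 0)))) (at x)" by (intro derivative_intros)
  then show "((\<lambda>y. fst (\<xi> + S ((y, t) - z))) has_derivative (*v) (matrix (\<lambda>h. fst (S (h, 0))))) (at x)"
    using linear_matrix_works[OF linear_fst_block[OF S(1)]]
    by (simp add: fun_eq_iff[of "(*v) (matrix (\<lambda>h. fst (S (h, 0))))" "\<lambda>h. fst (S (h, 0))", THEN iffD2])
qed auto

locale hjb =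
  fixes \<sigma> :: "'th => real^'n => real^'n^'n"
    and H :: "'th => real^'n => real^'n => real"
    and C :: real and CR :: "real => real"
  assumes C_pos: "C > 0"
    and sigma_bd: "\<And>\<theta> x. norm (\<sigma> \<theta> x) \<le> C"
    and sigma_lip: "\<And>\<theta> x y. norm (\<sigma> \<theta> x - \<sigma> \<theta> y) \<le> C * dist x y"
    and H_zero: "\<And>\<theta> x. \<bar>H \<theta> x 0\<bar> \<le> C"
    and CR_pos: "\<And>R. R > 0 ==> CR R > 0"
    and H_lip: "\<And>R \<theta> x y p q. R > 0 ==> norm p \<le> R ==> norm q \<le> R ==>
                  \<bar>H \<theta> x p - H \<theta> y q\<bar> \<le> CR R * (dist x y + dist p q)"
begin

abbreviation "F \<equiv> bellman \<sigma> H"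
abbreviation "df \<equiv> diffusion_form \<sigma>"

lemma df_le: "(\<And>a. Q a \<le> M * (norm a)\<^sup>2) ==> M \<ge> 0 ==> df \<theta> x Q \<le> M * C\<^sup>2"
proof -
  assume Q: "\<And>a. Q a \<le> M * (norm a)\<^sup>2" and M: "M \<ge> 0"
  have "df \<theta> x Q \<le> (\<Sum>k\<in>UNIV. M * (norm (column k (\<sigma> \<theta> x)))\<^sup>2)"
    unfolding diffusion_form_def by (intro sum_mono Q)
  also have "\<dots> = M * (norm (\<sigma> \<theta> x))\<^sup>2" by (simp add: sum_distrib_left[symmetric] norm_columns)
  also have "\<dots> \<le> M * C\<^sup>2" using M sigma_bd[of \<theta> x] by (intro mult_left_mono power_mono) auto
  finally show ?thesis .
qed

lemma df_minus: "df \<theta> x (\<lambda>a. - Q a) = - df \<theta> x Q" by (simp add: diffusion_form_def sum_negf)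
lemma df_cmult: "df \<theta> x (\<lambda>a. r * Q a) = r * df \<theta> x Q" by (simp add: diffusion_form_def sum_distrib_left)
lemma df_nonneg: "(\<And>a. Q a \<ge> 0) ==> df \<theta> x Q \<ge> 0" by (simp add: diffusion_form_def sum_nonneg)

lemma df_abs_le: "(\<And>a. \<bar>Q a\<bar> \<le> M * (norm a)\<^sup>2) ==> M \<ge> 0 ==> \<bar>df \<theta> x Q\<bar> \<le> M * C\<^sup>2"
  using df_le[of Q M \<theta> x] df_le[of "\<lambda>a. - Q a" M \<theta> x] by (simp add: df_minus abs_le_iff)

lemma matrix_form_bound: "\<bar>(X *v a) \<bullet> a\<bar> \<le> norm X * (norm a)\<^sup>2" for X :: "real^'n^'n"
proof -
  have "\<bar>(X *v a) \<bullet> a\<bar> \<le> norm (X *v a) * norm a" by (rule Cauchy_Schwarz_ineq2)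
  also have "\<dots> \<le> norm X * norm a * norm a" by (intro mult_right_mono norm_matrix_vector_le) auto
  finally show ?thesis by (simp add: power2_eq_square mult.assoc)
qed

lemma df_matrix_lip:
  fixes X :: "real^'n^'n"
  shows "\<bar>df \<theta> x (\<lambda>a. (X *v a) \<bullet> a) - df \<theta> y (\<lambda>a. (X *v a) \<bullet> a)\<bar> \<le> 2 * real CARD('n) * C\<^sup>2 * norm X * dist x y"
proof -
  have "\<bar>df \<theta> x (\<lambda>a. (X *v a) \<bullet> a) - df \<theta> y (\<lambda>a. (X *v a) \<bullet> a)\<bar>
     \<le> (\<Sum>k\<in>(UNIV::'n set). 2 * C\<^sup>2 * norm X * dist x y)"
    unfolding diffusion_form_def sum_subtractf[symmetric]
  proof (rule order_trans[OF sum_abs sum_mono])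
    fix k
    define a b where "a = column k (\<sigma> \<theta> x)" and "b = column k (\<sigma> \<theta> y)"
    have ab: "norm (a - b) \<le> C * dist x y"
      using norm_column_le_norm[of k "\<sigma> \<theta> x - \<sigma> \<theta> y"] sigma_lip[of \<theta> x y] by (simp add: column_diff a_def b_def)
    have na: "norm a \<le> C" "norm b \<le> C"
      using norm_column_le_norm sigma_bd order_trans unfolding a_def b_def by blast+
    have "(X *v a) \<bullet> a - (X *v b) \<bullet> b = (X *v (a - b)) \<bullet> a + (X *v b) \<bullet> (a - b)"
      by (simp add: inner_diff matrix_vector_mult_diff_distrib)
    also have "\<bar>\<dots>\<bar> \<le> norm (X *v (a - b)) * norm a + norm (X *v b) * norm (a - b)"
      by (meson Cauchy_Schwarz_ineq2 abs_triangle_ineq add_mono order_trans)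
    also have "\<dots> \<le> (norm X * (C * dist x y)) * C + (norm X * C) * (C * dist x y)"
    proof (intro add_mono mult_mono)
      show "norm (X *v (a - b)) \<le> norm X * (C * dist x y)"
        using norm_matrix_vector_le[of X "a - b"] ab by (meson mult_left_mono norm_ge_zero order_trans)
      show "norm (X *v b) \<le> norm X * C"
        using norm_matrix_vector_le[of X b] na(2) by (meson mult_left_mono norm_ge_zero order_trans)
    qed (use ab na C_pos in auto)
    also have "\<dots> = 2 * C\<^sup>2 * norm X * dist x y" by (simp add: power2_eq_square)
    finally show "\<bar>(X *v column k (\<sigma> \<theta> x)) \<bullet> column k (\<sigma> \<theta> x) - (X *v column k (\<sigma> \<theta> y)) \<bullet> column k (\<sigma> \<theta> y)\<bar>
      \<le> 2 * C\<^sup>2 * norm X * dist x y" by (simp add: a_def b_def)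
  qed
  then show ?thesis by (simp add: mult_ac)
qed

lemma H_bound: "\<bar>H \<theta> x p\<bar> \<le> C + CR (norm p + 1) * norm p"
proof -
  have "\<bar>H \<theta> x p - H \<theta> x 0\<bar> \<le> CR (norm p + 1) * (dist x x + dist p 0)" by (rule H_lip) (auto intro: add_nonneg_pos)
  then show ?thesis using H_zero[of \<theta> x] by simp
qed

lemma ham_eq: "- trace (diffmat \<sigma> \<theta> x ** X) + H \<theta> x p = - df \<theta> x (\<lambda>a. (X *v a) \<bullet> a) + H \<theta> x p"
  by (simp add: trace_diffmat)

lemma ham_bdd: "bdd_above (range (\<lambda>\<theta>. - df \<theta> x (\<lambda>a. (X *v a) \<bullet> a) + H \<theta> x p))"
proof (rule bdd_aboveI2)
  fix \<theta>
  show "- df \<theta> x (\<lambda>a. (X *v a) \<bullet> a) + H \<theta> x p \<le> norm X * C\<^sup>2 + (C + CR (norm p + 1) * norm p)"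
    using df_abs_le[OF matrix_form_bound, of X \<theta> x] H_bound[of \<theta> x p] by (simp add: abs_le_iff)
qed

lemma bellman_ge: "- df \<theta> x (\<lambda>a. (X *v a) \<bullet> a) + H \<theta> x p \<le> F x p X"
  unfolding bellman_def ham_eq by (rule cSUP_upper[OF _ ham_bdd]) simp

lemma bellman_le: "(\<And>\<theta>. - df \<theta> x (\<lambda>a. (X *v a) \<bullet> a) + H \<theta> x p \<le> r) ==> F x p X \<le> r"
  unfolding bellman_def ham_eq by (rule cSUP_least) auto

lemma bellman_ex:
  assumes "r < F x p X" shows "\<exists>\<theta>. r < - df \<theta> x (\<lambda>a. (X *v a) \<bullet> a) + H \<theta> x p"
  using bellman_le[of x X p r] assms by (meson not_le)

lemma bellman_lip:
  assumes R: "R > 0" "norm p \<le> R" "norm q \<le> R"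
  shows "\<bar>F x p X - F y q Y\<bar> \<le> 2 * real CARD('n) * C\<^sup>2 * norm X * dist x y + norm (X - Y) * C\<^sup>2 + CR R * (dist x y + dist p q)"
    (is "_ \<le> ?e")
proof -
  have d: "\<bar>(- df \<theta> x (\<lambda>a. (X *v a) \<bullet> a) + H \<theta> x p) - (- df \<theta> y (\<lambda>a. (Y *v a) \<bullet> a) + H \<theta> y q)\<bar> \<le> ?e" for \<theta>
  proof -
    have "df \<theta> y (\<lambda>a. (X *v a) \<bullet> a) - df \<theta> y (\<lambda>a. (Y *v a) \<bullet> a) = df \<theta> y (\<lambda>a. ((X - Y) *v a) \<bullet> a)"
      by (simp add: diffusion_form_def sum_subtractf matrix_vector_mult_diff_rdistrib inner_diff_left)
    then show ?thesis
      using df_matrix_lip[of \<theta> x X y] df_abs_le[OF matrix_form_bound, of "X - Y" \<theta> y] H_lip[OF R, of \<theta> x y] by simp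
  qed
  have "F x p X \<le> F y q Y + ?e"
  proof (rule bellman_le)
    fix \<theta> show "- df \<theta> x (\<lambda>a. (X *v a) \<bullet> a) + H \<theta> x p \<le> F y q Y + ?e"
      using d[of \<theta>] bellman_ge[of \<theta> y Y q] by linarith
  qed
  moreover have "F y q Y \<le> F x p X + ?e"
  proof (rule bellman_le)
    fix \<theta> show "- df \<theta> y (\<lambda>a. (Y *v a) \<bullet> a) + H \<theta> y q \<le> F x p X + ?e"
      using d[of \<theta>] bellman_ge[of \<theta> x X p] by linarith
  qed
  ultimately show ?thesis by linarith
qed

text \<open>The factor \<open>k\<close> covers two situations: 1 for the evolution, and 0 for a
  stationary function regarded as constant in an artificial time. The supremum is unfolded into one
  inequality for each \<theta>.\<close>

definition evol_sub :: "real set => real => real => ((real^'n) \<times> real => real) => bool" where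
  "evol_sub I k c W \<longleftrightarrow> (\<forall>x t P \<tau> S \<theta>. t \<in> I --> touch2 W (x, t) (P, \<tau>) S -->
      k * \<tau> - df \<theta> x (\<lambda>a. S (a, 0) \<bullet> (a, 0)) + H \<theta> x P \<le> c)"

text \<open>A supremum need not be attained, so a supersolution provides a suitable \<theta> only up
  to an error \<open>e\<close>. The jets are those of \<open>- W\<close>, which reverses the signs
  of gradient and Hessian.\<close>

definition evol_super :: "real set => real => real => ((real^'n) \<times> real => real) => bool" where
  "evol_super I k c W \<longleftrightarrow> (\<forall>x t P \<tau> S e. t \<in> I --> touch2 (\<lambda>z. - W z) (x, t) (P, \<tau>) S --> e > 0 -->
      (\<exists>\<theta>. - (k * \<tau>) + df \<theta> x (\<lambda>a. S (a, 0) \<bullet> (a, 0)) + H \<theta> x (- P) \<ge> c - e))"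

text \<open>The Hamiltonian is left free because the two structural cases use different ones:
  \<open>H\<close> itself under convexity, the constant \<open>c\<close> in the other case.\<close>

definition stat_sub :: "('th => real^'n => real^'n => real) => real => (real^'n => real) => bool" where
  "stat_sub G c v \<longleftrightarrow> (\<forall>x q Z \<theta>. touch2 v x q Z --> - df \<theta> x (\<lambda>a. Z a \<bullet> a) + G \<theta> x q \<le> c)"

lemma evol_sub_visc:
  assumes u: "visc_sol_evol F u" and I: "open I" "I \<subseteq> {0<..}"
    and W: "\<And>x t. t \<in> I ==> W (x, t) = u x t + c * t"
  shows "evol_sub I 1 c W"
  unfolding evol_sub_def mult_1
proof (intro allI impI)
  fix x t P \<tau> S \<theta> assume t: "t \<in> I" and touch: "touch2 W (x, t) (P, \<tau>) S"
  obtain r where S: "linear S" "\<And>a b. S a \<bullet> b = a \<bullet> S b" and r: "r > 0" "\<And>d. norm d < r ==> W ((x, t) + d) \<le> W (x, t) + (P, \<tau>) \<bullet> d + S d \<bullet> d / 2"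
    using touch unfolding touch2_def by blast
  obtain r' where r': "r' > 0" "\<And>s. \<bar>s - t\<bar> < r' ==> s \<in> I"
    using I(1) t unfolding open_dist dist_real_def by blast
  \<comment> \<open>The time slope is lowered by \<open>c\<close>, since the jet belongs to
    \<open>W\<close>, which contains the additional \<open>c * t\<close>.\<close>
  define phi where "phi = (\<lambda>y s. (P, \<tau> - c) \<bullet> ((y, s) - (x, t)) + S ((y, s) - (x, t)) \<bullet> ((y, s) - (x, t)) / 2)"
  have C21: "C21_fun phi (\<lambda>y s. snd ((P, \<tau> - c) + S ((y, s) - (x, t)))) (\<lambda>y s. fst ((P, \<tau> - c) + S ((y, s) - (x, t)))) (\<lambda>y s. matrix (\<lambda>h. fst (S (h, 0))))"
    unfolding phi_def by (rule C21_fun_quad[OF S])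
  have loc: "\<exists>e>0. \<forall>y s. dist (y, s) (x, t) < e --> s > 0 --> u y s - phi y s \<le> u x t - phi x t"
  proof (intro exI[of _ "min r r'"] conjI allI impI)
    fix y s assume d: "dist (y, s) (x, t) < min r r'"
    then have n: "norm ((y, s) - (x, t)) < r" by (simp add: dist_norm)
    have "\<bar>s - t\<bar> \<le> norm ((y, s) - (x, t))" using norm_snd_le[of "s - t" "y - x"] by simp
    then have sI: "s \<in> I" using d by (intro r'(2)) (simp add: dist_norm)
    have "u y s + c * s \<le> u x t + c * t + (P, \<tau>) \<bullet> ((y, s) - (x, t)) + S ((y, s) - (x, t)) \<bullet> ((y, s) - (x, t)) / 2"
      using r(2)[OF n] W[OF sI] W[OF t] by simp
    then show "u y s - phi y s \<le> u x t - phi x t" by (simp add: phi_def linear_0[OF S(1)] zero_prod_def[symmetric] inner_Pair algebra_simps)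
  qed (use r r' in auto)
  have t0: "t > 0" using I t by auto
  from u C21 loc t0 have "snd ((P, \<tau> - c) + S ((x, t) - (x, t))) + F x (fst ((P, \<tau> - c) + S ((x, t) - (x, t)))) (matrix (\<lambda>h. fst (S (h, 0)))) \<le> 0"
    unfolding visc_sol_evol_def by blast
  then have le: "\<tau> - c + F x P (matrix (\<lambda>h. fst (S (h, 0)))) \<le> 0" by (simp add: linear_0[OF S(1)] zero_prod_def[symmetric])
  have "(matrix (\<lambda>h. fst (S (h, 0))) *v a) \<bullet> a = S (a, 0) \<bullet> (a, 0)" for a
    by (simp add: linear_matrix_works[OF linear_fst_block[OF S(1)]] inner_prod_def)
  then show "\<tau> - df \<theta> x (\<lambda>a. S (a, 0) \<bullet> (a, 0)) + H \<theta> x P \<le> c"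
    using bellman_ge[of \<theta> x "matrix (\<lambda>h. fst (S (h, 0)))" P] le by simp
qed

lemma evol_super_visc:
  assumes u: "visc_sol_evol F u" and I: "open I" "I \<subseteq> {0<..}"
    and W: "\<And>x t. t \<in> I ==> W (x, t) = u x t + c * t"
  shows "evol_super I 1 c W"
  unfolding evol_super_def mult_1
proof (intro allI impI)
  fix x t P \<tau> S and e :: real assume t: "t \<in> I" and touch: "touch2 (\<lambda>z. - W z) (x, t) (P, \<tau>) S" and e: "e > 0"
  obtain r where S: "linear S" "\<And>a b. S a \<bullet> b = a \<bullet> S b" and r: "r > 0" "\<And>d. norm d < r ==> - W ((x, t) + d) \<le> - W (x, t) + (P, \<tau>) \<bullet> d + S d \<bullet> d / 2"
    using touch unfolding touch2_def by blast
  obtain r' where r': "r' > 0" "\<And>s. \<bar>s - t\<bar> < r' ==> s \<in> I"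
    using I(1) t unfolding open_dist dist_real_def by blast
  define S' where "S' a = - S a" for a
  have S': "linear S'" "\<And>a b. S' a \<bullet> b = a \<bullet> S' b"
    unfolding S'_def using S by (auto intro: linear_compose_neg)
  define phi where "phi = (\<lambda>y s. (- P, - \<tau> - c) \<bullet> ((y, s) - (x, t)) + S' ((y, s) - (x, t)) \<bullet> ((y, s) - (x, t)) / 2)"
  have C21: "C21_fun phi (\<lambda>y s. snd ((- P, - \<tau> - c) + S' ((y, s) - (x, t)))) (\<lambda>y s. fst ((- P, - \<tau> - c) + S' ((y, s) - (x, t)))) (\<lambda>y s. matrix (\<lambda>h. fst (S' (h, 0))))"
    unfolding phi_def by (rule C21_fun_quad[OF S'])
  have loc: "\<exists>e>0. \<forall>y s. dist (y, s) (x, t) < e --> s > 0 --> u y s - phi y s \<ge> u x t - phi x t"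
  proof (intro exI[of _ "min r r'"] conjI allI impI)
    fix y s assume d: "dist (y, s) (x, t) < min r r'"
    then have n: "norm ((y, s) - (x, t)) < r" by (simp add: dist_norm)
    have "\<bar>s - t\<bar> \<le> norm ((y, s) - (x, t))" using norm_snd_le[of "s - t" "y - x"] by simp
    then have sI: "s \<in> I" using d by (intro r'(2)) (simp add: dist_norm)
    have "- (u y s + c * s) \<le> - (u x t + c * t) + (P, \<tau>) \<bullet> ((y, s) - (x, t)) + S ((y, s) - (x, t)) \<bullet> ((y, s) - (x, t)) / 2"
      using r(2)[OF n] W[OF sI] W[OF t] by simp
    then show "u y s - phi y s \<ge> u x t - phi x t"
      by (simp add: phi_def S'_def linear_0[OF S(1)] zero_prod_def[symmetric] inner_Pair algebra_simps)
  qed (use r r' in auto)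
  have t0: "t > 0" using I t by auto
  from u C21 loc t0 have "snd ((- P, - \<tau> - c) + S' ((x, t) - (x, t))) + F x (fst ((- P, - \<tau> - c) + S' ((x, t) - (x, t)))) (matrix (\<lambda>h. fst (S' (h, 0)))) \<ge> 0"
    unfolding visc_sol_evol_def by blast
  then have le: "- \<tau> - c + F x (- P) (matrix (\<lambda>h. fst (S' (h, 0)))) \<ge> 0" by (simp add: linear_0[OF S'(1)] zero_prod_def[symmetric])
  then have "c + \<tau> - e < F x (- P) (matrix (\<lambda>h. fst (S' (h, 0))))" using e by linarith
  from bellman_ex[OF this] obtain \<theta> where \<theta>: "c + \<tau> - e < - df \<theta> x (\<lambda>a. (matrix (\<lambda>h. fst (S' (h, 0))) *v a) \<bullet> a) + H \<theta> x (- P)"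
    by blast
  have "(matrix (\<lambda>h. fst (S' (h, 0))) *v a) \<bullet> a = - (S (a, 0) \<bullet> (a, 0))" for a
    by (simp add: linear_matrix_works[OF linear_fst_block[OF S'(1)]] inner_prod_def) (simp add: S'_def)
  then show "\<exists>\<theta>. - \<tau> + df \<theta> x (\<lambda>a. S (a, 0) \<bullet> (a, 0)) + H \<theta> x (- P) \<ge> c - e"
    using \<theta> by (intro exI[of _ \<theta>]) (simp add: df_minus)
qed

text \<open>Stated through the subsolution half of the test-function property, so that it applies
  not only to viscosity solutions but also to the upper limit of \<open>U\<close>.\<close>

lemma stat_sub_of_test:
  assumes test: "\<And>phi Dphi D2phi x e. C2_fun phi Dphi D2phi ==> e > 0 ==> (\<And>y. norm (y - x) < e ==> v y - phi y \<le> v x - phi x) ==>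
    F x (Dphi x) (D2phi x) - c \<le> 0"
  shows "stat_sub H c v"
  unfolding stat_sub_def
proof (intro allI impI)
  fix x q Z \<theta> assume touch: "touch2 v x q Z"
  obtain r where S: "linear Z" "\<And>a b. Z a \<bullet> b = a \<bullet> Z b" and r: "r > 0" "\<And>d. norm d < r ==> v (x + d) \<le> v x + q \<bullet> d + Z d \<bullet> d / 2"
    using touch unfolding touch2_def by blast
  define phi where "phi = (\<lambda>p. q \<bullet> (p - x) + Z (p - x) \<bullet> (p - x) / 2)"
  have C2: "C2_fun phi (\<lambda>p. q + Z (p - x)) (\<lambda>p. matrix Z)" unfolding phi_def by (rule C2_fun_quad[OF S])
  have loc: "v y - phi y \<le> v x - phi x" if "norm (y - x) < r" for y
    using r(2)[of "y - x"] that by (simp add: phi_def linear_0[OF S(1)])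
  have "F x (q + Z (x - x)) (matrix Z) - c \<le> 0" using test[OF C2 r(1) loc] .
  then show "- df \<theta> x (\<lambda>a. Z a \<bullet> a) + H \<theta> x q \<le> c"
    using bellman_ge[of \<theta> x "matrix Z" q] by (simp add: linear_0[OF S(1)] linear_matrix_works[OF S(1)])
qed

lemma stat_sub_visc:
  assumes v: "visc_sol (\<lambda>x r p X. F x p X - c) v"
  shows "stat_sub H c v"
proof (rule stat_sub_of_test)
  fix phi Dphi D2phi x and e :: real
  assume C2: "C2_fun phi Dphi D2phi" and e: "e > 0" and loc: "\<And>y. norm (y - x) < e ==> v y - phi y \<le> v x - phi x"
  have "\<exists>e>0. \<forall>y\<in>ball x e. v y - phi y \<le> v x - phi x"
    using e loc by (intro exI[of _ e]) (simp add: dist_norm norm_minus_commute)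
  with v C2 show "F x (Dphi x) (D2phi x) - c \<le> 0" unfolding visc_sol_def by blast
qed

lemma stat_super_visc:
  assumes v: "visc_sol (\<lambda>x r p X. F x p X - c) v" and touch: "touch2 (\<lambda>z. - v z) x q Z" and e: "e > 0"
  shows "\<exists>\<theta>. df \<theta> x (\<lambda>a. Z a \<bullet> a) + H \<theta> x (- q) \<ge> c - e"
proof -
  obtain r where S: "linear Z" "\<And>a b. Z a \<bullet> b = a \<bullet> Z b" and r: "r > 0" "\<And>d. norm d < r ==> - v (x + d) \<le> - v x + q \<bullet> d + Z d \<bullet> d / 2"
    using touch unfolding touch2_def by blast
  define S' where "S' a = - Z a" for a
  have S': "linear S'" "\<And>a b. S' a \<bullet> b = a \<bullet> S' b"
    unfolding S'_def using S by (auto intro: linear_compose_neg)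
  define phi where "phi = (\<lambda>p. (- q) \<bullet> (p - x) + S' (p - x) \<bullet> (p - x) / 2)"
  have C2: "C2_fun phi (\<lambda>p. - q + S' (p - x)) (\<lambda>p. matrix S')" unfolding phi_def by (rule C2_fun_quad[OF S'])
  have loc: "\<exists>e>0. \<forall>y\<in>ball x e. v y - phi y \<ge> v x - phi x"
  proof (intro exI[of _ r] conjI ballI r(1))
    fix y assume "y \<in> ball x r"
    then show "v y - phi y \<ge> v x - phi x" using r(2)[of "y - x"] by (simp add: phi_def S'_def linear_0[OF S(1)] dist_norm norm_minus_commute)
  qed
  from v C2 loc have "F x (- q + S' (x - x)) (matrix S') - c \<ge> 0" unfolding visc_sol_def by blast
  then have "c - e < F x (- q) (matrix S')" using e by (simp add: linear_0[OF S'(1)])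
  from bellman_ex[OF this] obtain \<theta> where "c - e < - df \<theta> x (\<lambda>a. (matrix S' *v a) \<bullet> a) + H \<theta> x (- q)" by blast
  then show ?thesis by (intro exI[of _ \<theta>]) (simp add: linear_matrix_works[OF S'(1)] S'_def df_minus)
qed

lemma touch2_spatial:
  fixes t :: real and x :: "real^'n"
  assumes "touch2 (\<lambda>(x, t). v x) (x, t) (P, \<tau>) S"
  shows "touch2 v x P (\<lambda>a. fst (S (a, 0)))"
proof -
  obtain r where S: "linear S" "\<And>a b. S a \<bullet> b = a \<bullet> S b" and r: "r > 0"
    "\<And>d. norm d < r ==> v (fst ((x, t) + d)) \<le> v x + (P, \<tau>) \<bullet> d + S d \<bullet> d / 2"
    using assms unfolding touch2_def by (auto simp: split_def)
  have "fst (S (a, 0)) \<bullet> b = a \<bullet> fst (S (b, 0))" for a b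
    using S(2)[of "(a, 0)" "(b, 0)"] by (simp add: inner_prod_def)
  moreover have "v (x + d) \<le> v x + P \<bullet> d + fst (S (d, 0)) \<bullet> d / 2" if "norm d < r" for d
    using r(2)[of "(d, 0)"] that by (simp add: inner_prod_def)
  ultimately show ?thesis unfolding touch2_def using r(1) linear_fst_block[OF S(1)] by blast
qed

lemma evol_sub_stationary:
  assumes "visc_sol (\<lambda>x r p X. F x p X - c) v"
  shows "evol_sub I 0 c (\<lambda>(x, t). v x)"
  unfolding evol_sub_def
proof (intro allI impI)
  fix x and t :: real and P \<tau> S \<theta> assume "touch2 (\<lambda>(x, t). v x) (x, t) (P, \<tau>) S"
  from touch2_spatial[OF this] stat_sub_visc[OF assms]
  have "- df \<theta> x (\<lambda>a. fst (S (a, 0)) \<bullet> a) + H \<theta> x P \<le> c" unfolding stat_sub_def by blast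
  then show "0 * \<tau> - df \<theta> x (\<lambda>a. S (a, 0) \<bullet> (a, 0)) + H \<theta> x P \<le> c" by (simp add: inner_prod_def)
qed

lemma evol_super_stationary:
  assumes "visc_sol (\<lambda>x r p X. F x p X - c) v"
  shows "evol_super I 0 c (\<lambda>(x, t). v x)"
  unfolding evol_super_def
proof (intro allI impI)
  fix x P \<tau> S and t e :: real assume t: "touch2 (\<lambda>z. - (case z of (x, t) => v x)) (x, t) (P, \<tau>) S" and e: "e > 0"
  have "(\<lambda>z. - (case z of (x, t :: real) => v x)) = (\<lambda>(x, t). - v x)" by auto
  with t have "touch2 (\<lambda>(x, t). - v x) (x, t) (P, \<tau>) S" by simp
  from stat_super_visc[OF assms touch2_spatial[OF this] e]
  show "\<exists>\<theta>. - (0 * \<tau>) + df \<theta> x (\<lambda>a. S (a, 0) \<bullet> (a, 0)) + H \<theta> x (- P) \<ge> c - e"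
    by (simp add: inner_prod_def)
qed

text \<open>A quadratic touching a constant from above has zero gradient and a nonnegative Hessian
  form. The zero function later acts as \<open>v\<close> in case (B) and fills the third place of
  the doubling in the comparison proof.\<close>

lemma stat_sub_zero:
  assumes "\<And>\<theta> x. G \<theta> x 0 \<le> c" shows "stat_sub G c (\<lambda>x. 0)"
  unfolding stat_sub_def
proof (intro allI impI)
  fix x q Z \<theta> assume t: "touch2 (\<lambda>x::real^'n. 0::real) x q Z"
  obtain r where S: "linear Z" "r > 0" and r: "\<And>d. norm d < r ==> 0 \<le> q \<bullet> d + Z d \<bullet> d / 2"
    using t unfolding touch2_def by auto
  have q: "q = 0" using touch2_norm_le[OF t, of 0] by simp
  have "Z a \<bullet> a \<ge> 0" for a
  proof -
    define s where "s = r / (2 * (norm a + 1))"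
    have s: "s > 0" unfolding s_def using S(2) by (intro divide_pos_pos) (auto intro: add_nonneg_pos)
    have "s * (2 * (norm a + 1)) = r" unfolding s_def by (simp add: add_nonneg_eq_0_iff)
    moreover have "s * (2 * (norm a + 1)) = 2 * (s * norm a) + 2 * s" by (simp add: algebra_simps)
    moreover have "s * norm a \<ge> 0" using s by simp
    ultimately have "s * norm a < r" using s by linarith
    then have "norm (s *\<^sub>R a) < r" using s by simp
    from r[OF this] have "0 \<le> s * (s * (Z a \<bullet> a))" by (simp add: q linear_scale[OF S(1)])
    then show ?thesis using s by (simp add: zero_le_mult_iff)
  qed
  then have "df \<theta> x (\<lambda>a. Z a \<bullet> a) \<ge> 0" by (intro df_nonneg)
  then show "- df \<theta> x (\<lambda>a. Z a \<bullet> a) + G \<theta> x q \<le> c" using assms[of \<theta> x] q by simp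
qed

end

lemma touch2_scale:
  assumes t: "touch2 (\<lambda>z. k * g z) z \<xi> S" and k: "k > 0"
  shows "touch2 g z ((1/k) *\<^sub>R \<xi>) (\<lambda>a. (1/k) *\<^sub>R S a)"
proof -
  obtain r where S: "linear S" "\<And>a b. S a \<bullet> b = a \<bullet> S b" and r: "r > 0" "\<And>d. norm d < r ==> k * g (z + d) \<le> k * g z + \<xi> \<bullet> d + S d \<bullet> d / 2"
    using t unfolding touch2_def by blast
  have "g (z + d) \<le> g z + ((1/k) *\<^sub>R \<xi>) \<bullet> d + ((1/k) *\<^sub>R S d) \<bullet> d / 2" if "norm d < r" for d
  proof -
    have "k * g (z + d) \<le> k * (g z + ((1/k) *\<^sub>R \<xi>) \<bullet> d + ((1/k) *\<^sub>R S d) \<bullet> d / 2)"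
      using r(2)[OF that] k by (simp add: distrib_left)
    then show ?thesis using k by simp
  qed
  moreover have "linear (\<lambda>a. (1/k) *\<^sub>R S a)" using S(1) by (rule linear_compose_scale_right)
  ultimately show ?thesis unfolding touch2_def using r(1) S(2) by auto
qed

section \<open>Doubling of variables for sub- and supersolutions\<close>

context hjb
begin

text \<open>The supersolution selects one \<theta>; the inequalities for \<open>W1\<close> and
  \<open>v\<close> hold for every \<theta> and are used at that one, so nothing is lost to the
  supremum. Testing the matrix inequality with the columns of \<sigma> at the three points turns the
  penalty into \<open>C\<^sup>2\<close> times the squared distances divided by \<open>ep\<close>,
  which is small.\<close>

lemma doubling_pde:
  fixes W1 W2 :: "(real^'n) \<times> real => real" and v \<psi> :: "real^'n => real"
    and x1 :: "real^'n" and \<kappa> \<omega> a b t1 a' b' s1 \<mu> \<nu> k1 k2 :: real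
  defines "chi \<equiv> \<lambda>x t s. \<kappa> * \<psi> x + \<omega> * (norm (x - x1))\<^sup>2 + a * (t - t1)\<^sup>2 + b * t + a' * (s - s1)\<^sup>2 + b' * s"
  defines "h \<equiv> \<lambda>x t s. W1 (x, t) - \<mu> * W2 (x, s) + \<nu> * v x - chi x t s"
  assumes cont: "continuous_on UNIV W1" "continuous_on UNIV W2" "continuous_on UNIV v"
    and bd: "\<And>z. \<bar>W1 z\<bar> \<le> Bd" "\<And>z. \<bar>W2 z\<bar> \<le> Bd" "\<And>z. \<bar>v z\<bar> \<le> Bd"
    and L: "L \<ge> 0"
    and lip: "\<And>x y t. \<bar>W1 (x, t) - W1 (y, t)\<bar> \<le> L * norm (x - y)" "\<And>x y t. \<bar>W2 (x, t) - W2 (y, t)\<bar> \<le> L * norm (x - y)"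
      "\<And>x y. \<bar>v x - v y\<bar> \<le> L * norm (x - y)"
    and \<psi>: "C2_fun \<psi> D\<psi> D2\<psi>" and \<omega>: "\<omega> \<ge> 0" and a: "a \<ge> 0" "a' \<ge> 0"
    and \<mu>: "\<mu> > 0" and \<nu>: "\<nu> > 0"
    and N: "compact N" and n0: "(x0, t0, s0) \<in> N"
    and int: "\<And>x t s. (x, t, s) \<in> N ==> h x t s \<ge> h x0 t0 s0 ==> (x, t, s) \<in> interior N"
    and r: "r > 0" "\<And>x t s t'. (x, t, s) \<in> N ==> \<bar>t' - t\<bar> \<le> r ==> t' \<in> I1"
      "\<And>x t s s'. (x, t, s) \<in> N ==> \<bar>s' - s\<bar> \<le> r ==> s' \<in> I2"
    and k: "k1 \<ge> 0" "k2 \<ge> 0" and sub: "evol_sub I1 k1 c W1" and super: "evol_super I2 k2 c W2" and stat: "stat_sub G c v"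
    and LG: "LG \<ge> 0" "\<And>\<theta> x y q. norm q \<le> L ==> \<bar>G \<theta> x q - G \<theta> y q\<bar> \<le> LG * norm (x - y)"
    and tol: "tol > 0"
  shows "\<exists>x t s P Q q \<theta> z Z. (x, t, s) \<in> N \<and> norm P \<le> L \<and> norm Q \<le> L \<and> norm q \<le> L \<and> touch2 v z q Z \<and>
    norm (P - (\<mu> *\<^sub>R Q - \<nu> *\<^sub>R q + \<kappa> *\<^sub>R D\<psi> x + (2 * \<omega>) *\<^sub>R (x - x1))) \<le> tol \<and>
    k1 * (2 * a * (t - t1) + b) + k2 * (2 * a' * (s - s1) + b') + H \<theta> x P - \<mu> * H \<theta> x Q + \<nu> * G \<theta> x q
      \<le> c * (1 - \<mu> + \<nu>) + \<kappa> * df \<theta> x (\<lambda>e. (D2\<psi> x *v e) \<bullet> e) + 2 * \<omega> * C\<^sup>2 + tol"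
proof -
  define \<Lambda> where "\<Lambda> = 1 + \<mu> + \<nu>"
  have \<Lambda>: "1 \<le> \<Lambda>" "\<mu> \<le> \<Lambda>" "\<nu> \<le> \<Lambda>" using \<mu> \<nu> by (auto simp: \<Lambda>_def)
  have Bd: "Bd \<ge> 0" using bd(1)[of 0] by linarith
  define R where "R = L + 1"
  have R: "R > 0" "L \<le> R" using L by (auto simp: R_def)
  obtain RN where RN: "\<And>z. z \<in> N ==> norm z \<le> RN" using compact_imp_bounded[OF N] bounded_iff by blast
  obtain M where M: "M \<ge> 0" "\<And>x. norm x \<le> RN ==> norm (D2\<psi> x) \<le> M"
    using that by (rule C2_fun_bounds[OF \<psi>])
  have MN: "norm (D2\<psi> x) \<le> M" if "(x, t, s) \<in> N" for x t s
    using M(2)[of x] RN[OF that] norm_fst_le[of x "(t, s)"] by linarith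
  \<comment> \<open>Collects the coefficients of all errors linear in \<open>e\<close>: the
    diffusion, the change of base point in \<open>H\<close> and \<open>G\<close>, the time
    derivatives, and the slack in the choice of \<theta>.\<close>
  define K where "K = 4 * C\<^sup>2 + \<bar>\<kappa>\<bar> * (2 * real CARD('n) * C\<^sup>2 * M) + CR R * (1 + \<mu>) + \<nu> * LG + k1 + k2 + \<mu>"
  have K: "K > 0"
  proof -
    have "4 * C\<^sup>2 \<ge> 0" "\<bar>\<kappa>\<bar> * (2 * real CARD('n) * C\<^sup>2 * M) \<ge> 0" "CR R * (1 + \<mu>) \<ge> 0" "\<nu> * LG \<ge> 0"
      using M(1) CR_pos[OF R(1)] \<mu> \<nu> LG by auto
    then show ?thesis unfolding K_def using \<mu> k by linarith
  qed
  define e where "e = min (min r tol) (tol / K)"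
  have e: "e > 0" "e \<le> r" "e \<le> tol" using r(1) tol K by (auto simp: e_def)
  have "e \<le> tol / K" by (simp add: e_def)
  then have eK: "e * K \<le> tol" using K by (simp add: pos_le_divide_eq)
  define f2 f3 where "f2 = (\<lambda>z. - (\<mu> * W2 z))" and "f3 = (\<lambda>x. \<nu> * v x)"
  have c2: "continuous_on UNIV f2" "continuous_on UNIV f3" unfolding f2_def f3_def using cont by (auto intro!: continuous_intros)
  have sc: "\<bar>r * x\<bar> \<le> \<Lambda> * y" if "\<bar>x\<bar> \<le> y" "0 < r" "r \<le> \<Lambda>" for r x y :: real
    unfolding abs_mult using that by (intro mult_mono) auto
  have bd': "\<bar>W1 z\<bar> \<le> \<Lambda> * Bd" "\<bar>f2 z\<bar> \<le> \<Lambda> * Bd" "\<bar>f3 x\<bar> \<le> \<Lambda> * Bd" for z x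
    using sc[OF bd(1), of 1] sc[OF bd(2) \<mu> \<Lambda>(2)] sc[OF bd(3) \<nu> \<Lambda>(3)] \<Lambda>(1) by (auto simp: f2_def f3_def)
  have lip': "\<bar>W1 (x, t) - W1 (y, t)\<bar> \<le> (\<Lambda> * L) * norm (x - y)" "\<bar>f2 (x, t) - f2 (y, t)\<bar> \<le> (\<Lambda> * L) * norm (x - y)"
      "\<bar>f3 x - f3 y\<bar> \<le> (\<Lambda> * L) * norm (x - y)" for x y t
  proof -
    have "\<bar>f2 (x, t) - f2 (y, t)\<bar> = \<bar>\<mu> * (W2 (x, t) - W2 (y, t))\<bar>" unfolding f2_def by (simp add: algebra_simps abs_minus_commute)
    then show "\<bar>f2 (x, t) - f2 (y, t)\<bar> \<le> (\<Lambda> * L) * norm (x - y)" using sc[OF lip(2) \<mu> \<Lambda>(2), of x t y] by (simp add: mult.assoc)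
    have "\<bar>f3 x - f3 y\<bar> = \<bar>\<nu> * (v x - v y)\<bar>" unfolding f3_def by (simp add: algebra_simps)
    then show "\<bar>f3 x - f3 y\<bar> \<le> (\<Lambda> * L) * norm (x - y)" using sc[OF lip(3) \<nu> \<Lambda>(3), of x y] by (simp add: mult.assoc)
    show "\<bar>W1 (x, t) - W1 (y, t)\<bar> \<le> (\<Lambda> * L) * norm (x - y)" using sc[OF lip(1), of 1 x t y] \<Lambda>(1) by (simp add: mult.assoc)
  qed
  have \<Lambda>L: "\<Lambda> * L \<ge> 0" using \<Lambda>(1) L by simp
  have hh: "W1 (x, t) + f2 (x, s) + f3 x - chi x t s = h x t s" for x t s by (simp add: h_def f2_def f3_def)
  have int': "(x, t, s) \<in> interior N" if "(x, t, s) \<in> N"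
    "W1 (x, t) + f2 (x, s) + f3 x - chi x t s \<ge> W1 (x0, t0) + f2 (x0, s0) + f3 x0 - chi x0 t0 s0" for x t s
    using int that unfolding hh by blast
  obtain x t s x' t' y s' z P \<tau>1 Q0 \<tau>2 q0 S1 S2 S3 ep \<eta> where J:
    "(x, t, s) \<in> N" "norm (x' - x) \<le> e" "\<bar>t' - t\<bar> \<le> e" "norm (y - x) \<le> e" "\<bar>s' - s\<bar> \<le> e" "norm (z - x) \<le> e"
    "norm (P + Q0 + q0 - (\<kappa> *\<^sub>R D\<psi> x + (2 * \<omega>) *\<^sub>R (x - x1))) \<le> e"
    "\<bar>\<tau>1 - (2 * a * (t - t1) + b)\<bar> \<le> e" "\<bar>\<tau>2 - (2 * a' * (s - s1) + b')\<bar> \<le> e"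
    "touch2 W1 (x', t') (P, \<tau>1) S1" "touch2 f2 (y, s') (Q0, \<tau>2) S2" "touch2 f3 z q0 S3"
    "ep > 0" "\<eta> > 0" "\<eta> \<le> e" "(norm (x' - y))\<^sup>2 + (norm (x' - z))\<^sup>2 \<le> e * ep"
    and form: "\<And>\<alpha> \<beta> \<gamma>. S1 (\<alpha>, 0) \<bullet> (\<alpha>, 0) + S2 (\<beta>, 0) \<bullet> (\<beta>, 0) + S3 \<gamma> \<bullet> \<gamma>
       \<le> ((norm (\<alpha> - \<beta>))\<^sup>2 + (norm (\<alpha> - \<gamma>))\<^sup>2) / ep + \<kappa> * ((D2\<psi> x *v \<alpha>) \<bullet> \<alpha>) + 2 * \<omega> * (norm \<alpha>)\<^sup>2
          + \<eta> * ((norm \<alpha>)\<^sup>2 + (norm \<beta>)\<^sup>2 + (norm \<gamma>)\<^sup>2)"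
    by (rule doubling[where \<kappa> = \<kappa> and b = b and b' = b' and ?x1.0 = x1 and ?t1.0 = t1 and ?s1.0 = s1, OF cont(1) c2 bd' \<Lambda>L lip' \<psi> \<omega> a N n0 int'[unfolded chi_def] e(1)]; (assumption | (rule that; assumption)))
  define Q q where "Q = - ((1/\<mu>) *\<^sub>R Q0)" and "q = (1/\<nu>) *\<^sub>R q0"
  have Q0: "Q0 = - (\<mu> *\<^sub>R Q)" "q0 = \<nu> *\<^sub>R q" using \<mu> \<nu> by (auto simp: Q_def q_def)
  have f2eq: "f2 = (\<lambda>z. \<mu> * (- W2 z))" by (simp add: f2_def)
  have tQ: "touch2 (\<lambda>z. - W2 z) (y, s') (- Q, \<tau>2 / \<mu>) (\<lambda>a. (1/\<mu>) *\<^sub>R S2 a)"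
    using touch2_scale[OF J(11)[unfolded f2eq] \<mu>] by (simp add: Q_def)
  have tq: "touch2 v z q (\<lambda>a. (1/\<nu>) *\<^sub>R S3 a)"
    using touch2_scale[OF J(12)[unfolded f3_def] \<nu>] by (simp add: q_def)
  have nP: "norm P \<le> L" using touch2_norm_fst_le[OF J(10) lip(1) L] .
  have nq: "norm q \<le> L" using touch2_norm_le[OF tq lip(3)] .
  have lipm: "\<bar>- W2 (x, t) - - W2 (y, t)\<bar> \<le> L * norm (x - y)" for x y t using lip(2)[of x t y] by linarith
  have nQ: "norm Q \<le> L" using touch2_norm_fst_le[OF tQ lipm L] by simp
  have t'I: "t' \<in> I1" using r(2)[OF J(1)] J(3) e(2) by (meson order_trans)
  have s'I: "s' \<in> I2" using r(3)[OF J(1)] J(5) e(2) by (meson order_trans)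
  obtain \<theta> where th: "- (k2 * (\<tau>2 / \<mu>)) + df \<theta> y (\<lambda>a. ((1/\<mu>) *\<^sub>R S2 (a, 0)) \<bullet> (a, 0)) + H \<theta> y (- (- Q)) \<ge> c - e"
    using super s'I tQ e(1) unfolding evol_super_def by blast
  define d1 d2 d3 where "d1 = df \<theta> x' (\<lambda>a. S1 (a, 0) \<bullet> (a, 0))" and "d2 = df \<theta> y (\<lambda>a. S2 (a, 0) \<bullet> (a, 0))"
    and "d3 = df \<theta> z (\<lambda>a. S3 a \<bullet> a)"
  have i2: "- (k2 * \<tau>2) + d2 + \<mu> * H \<theta> y Q \<ge> \<mu> * c - \<mu> * e"
  proof -
    have "df \<theta> y (\<lambda>a. ((1/\<mu>) *\<^sub>R S2 (a, 0)) \<bullet> (a, 0)) = d2 / \<mu>"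
      unfolding d2_def using df_cmult[of \<theta> y "1/\<mu>" "\<lambda>a. S2 (a, 0) \<bullet> (a, 0)"] by simp
    then have "\<mu> * (c - e) \<le> \<mu> * (- (k2 * (\<tau>2 / \<mu>)) + d2 / \<mu> + H \<theta> y Q)" using th \<mu> by (intro mult_left_mono) auto
    then show ?thesis using \<mu> by (simp add: algebra_simps)
  qed
  have i1: "k1 * \<tau>1 - d1 + H \<theta> x' P \<le> c"
    using sub t'I J(10) unfolding evol_sub_def d1_def by blast
  have i3: "- d3 + \<nu> * G \<theta> z q \<le> \<nu> * c"
  proof -
    have "- df \<theta> z (\<lambda>a. ((1/\<nu>) *\<^sub>R S3 a) \<bullet> a) + G \<theta> z q \<le> c" using stat tq unfolding stat_sub_def by blast
    moreover have "df \<theta> z (\<lambda>a. ((1/\<nu>) *\<^sub>R S3 a) \<bullet> a) = d3 / \<nu>"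
      unfolding d3_def using df_cmult[of \<theta> z "1/\<nu>" "\<lambda>a. S3 a \<bullet> a"] by simp
    ultimately have "\<nu> * (- (d3 / \<nu>) + G \<theta> z q) \<le> \<nu> * c" using \<nu> by (intro mult_left_mono) auto
    then show ?thesis using \<nu> by (simp add: algebra_simps)
  qed
  have dsum: "d1 + d2 + d3 \<le> 4 * C\<^sup>2 * e + \<kappa> * df \<theta> x' (\<lambda>e. (D2\<psi> x *v e) \<bullet> e) + 2 * \<omega> * C\<^sup>2"
  proof -
    define A1 A2 A3 where "A1 = \<sigma> \<theta> x'" and "A2 = \<sigma> \<theta> y" and "A3 = \<sigma> \<theta> z"
    have "d1 + d2 + d3 = (\<Sum>k\<in>UNIV. S1 (column k A1, 0) \<bullet> (column k A1, 0) + S2 (column k A2, 0) \<bullet> (column k A2, 0) + S3 (column k A3) \<bullet> column k A3)"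
      by (simp add: d1_def d2_def d3_def diffusion_form_def sum.distrib A1_def A2_def A3_def)
    also have "\<dots> \<le> (\<Sum>k\<in>UNIV. ((norm (column k A1 - column k A2))\<^sup>2 + (norm (column k A1 - column k A3))\<^sup>2) / ep
         + \<kappa> * ((D2\<psi> x *v column k A1) \<bullet> column k A1) + 2 * \<omega> * (norm (column k A1))\<^sup>2
         + \<eta> * ((norm (column k A1))\<^sup>2 + (norm (column k A2))\<^sup>2 + (norm (column k A3))\<^sup>2))" by (intro sum_mono form)
    also have "\<dots> = ((norm (A1 - A2))\<^sup>2 + (norm (A1 - A3))\<^sup>2) / ep + \<kappa> * df \<theta> x' (\<lambda>e. (D2\<psi> x *v e) \<bullet> e)
        + 2 * \<omega> * (norm A1)\<^sup>2 + \<eta> * ((norm A1)\<^sup>2 + (norm A2)\<^sup>2 + (norm A3)\<^sup>2)"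
      by (simp add: sum.distrib sum_distrib_left[symmetric] sum_divide_distrib[symmetric] norm_columns column_diff[symmetric]
          diffusion_form_def A1_def)
    also have "\<dots> \<le> C\<^sup>2 * e + \<kappa> * df \<theta> x' (\<lambda>e. (D2\<psi> x *v e) \<bullet> e) + 2 * \<omega> * C\<^sup>2 + e * (C\<^sup>2 + C\<^sup>2 + C\<^sup>2)"
    proof (intro add_mono order_refl)
      have "(norm (A1 - A2))\<^sup>2 \<le> (C * norm (x' - y))\<^sup>2" "(norm (A1 - A3))\<^sup>2 \<le> (C * norm (x' - z))\<^sup>2"
        using sigma_lip[of \<theta> x' y] sigma_lip[of \<theta> x' z] by (auto simp: A1_def A2_def A3_def dist_norm intro: power_mono)
      then have "(norm (A1 - A2))\<^sup>2 + (norm (A1 - A3))\<^sup>2 \<le> C\<^sup>2 * ((norm (x' - y))\<^sup>2 + (norm (x' - z))\<^sup>2)"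
        by (simp add: power_mult_distrib distrib_left)
      also have "\<dots> \<le> C\<^sup>2 * (e * ep)" using J(16) by (intro mult_left_mono) auto
      finally show "((norm (A1 - A2))\<^sup>2 + (norm (A1 - A3))\<^sup>2) / ep \<le> C\<^sup>2 * e"
        using J(13) by (simp add: pos_divide_le_eq mult.assoc)
      have AC: "(norm A1)\<^sup>2 \<le> C\<^sup>2" "(norm A2)\<^sup>2 \<le> C\<^sup>2" "(norm A3)\<^sup>2 \<le> C\<^sup>2"
        unfolding A1_def A2_def A3_def using sigma_bd by (auto intro: power_mono)
      show "2 * \<omega> * (norm A1)\<^sup>2 \<le> 2 * \<omega> * C\<^sup>2" using AC \<omega> by (intro mult_left_mono) auto
      show "\<eta> * ((norm A1)\<^sup>2 + (norm A2)\<^sup>2 + (norm A3)\<^sup>2) \<le> e * (C\<^sup>2 + C\<^sup>2 + C\<^sup>2)"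
        using AC J(14,15) e by (intro mult_mono add_mono) auto
    qed
    finally show ?thesis by (simp add: algebra_simps)
  qed
  have \<kappa>d: "\<kappa> * df \<theta> x' (\<lambda>e. (D2\<psi> x *v e) \<bullet> e) \<le> \<kappa> * df \<theta> x (\<lambda>e. (D2\<psi> x *v e) \<bullet> e) + \<bar>\<kappa>\<bar> * (2 * real CARD('n) * C\<^sup>2 * M) * e"
  proof -
    define A where "A x' = df \<theta> x' (\<lambda>e. (D2\<psi> x *v e) \<bullet> e)" for x'
    have "\<bar>A x' - A x\<bar> \<le> 2 * real CARD('n) * C\<^sup>2 * norm (D2\<psi> x) * dist x' x" unfolding A_def by (rule df_matrix_lip)
    also have "\<dots> \<le> 2 * real CARD('n) * C\<^sup>2 * M * e"
      using MN[OF J(1)] J(2) M(1) by (intro mult_mono) (auto simp: dist_norm)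
    finally have "\<bar>\<kappa>\<bar> * \<bar>A x' - A x\<bar> \<le> \<bar>\<kappa>\<bar> * (2 * real CARD('n) * C\<^sup>2 * M * e)" by (intro mult_left_mono) auto
    moreover have "\<kappa> * (A x' - A x) \<le> \<bar>\<kappa>\<bar> * \<bar>A x' - A x\<bar>" by (metis abs_ge_self abs_mult)
    ultimately show ?thesis unfolding A_def[symmetric] by (simp add: algebra_simps)
  qed
  have HP: "H \<theta> x P \<le> H \<theta> x' P + CR R * e"
  proof -
    have "\<bar>H \<theta> x P - H \<theta> x' P\<bar> \<le> CR R * (dist x x' + dist P P)" using nP R by (intro H_lip) auto
    also have "\<dots> \<le> CR R * e" using J(2) CR_pos[OF R(1)] by (intro mult_left_mono) (auto simp: dist_norm norm_minus_commute)
    finally show ?thesis by linarith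
  qed
  have HQ: "\<mu> * H \<theta> y Q \<le> \<mu> * H \<theta> x Q + \<mu> * (CR R * e)"
  proof -
    have "\<bar>H \<theta> y Q - H \<theta> x Q\<bar> \<le> CR R * (dist y x + dist Q Q)" using nQ R by (intro H_lip) auto
    also have "\<dots> \<le> CR R * e" using J(4) CR_pos[OF R(1)] by (intro mult_left_mono) (auto simp: dist_norm)
    finally have "H \<theta> y Q \<le> H \<theta> x Q + CR R * e" by linarith
    then have "\<mu> * H \<theta> y Q \<le> \<mu> * (H \<theta> x Q + CR R * e)" using \<mu> by (intro mult_left_mono) auto
    then show ?thesis by (simp add: distrib_left)
  qed
  have Gq: "\<nu> * G \<theta> x q \<le> \<nu> * G \<theta> z q + \<nu> * (LG * e)"
  proof -
    have "\<bar>G \<theta> x q - G \<theta> z q\<bar> \<le> LG * norm (x - z)" by (rule LG(2)[OF nq])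
    also have "\<dots> \<le> LG * e" using J(6) LG(1) by (intro mult_left_mono) (auto simp: norm_minus_commute)
    finally have "G \<theta> x q \<le> G \<theta> z q + LG * e" by linarith
    then have "\<nu> * G \<theta> x q \<le> \<nu> * (G \<theta> z q + LG * e)" using \<nu> by (intro mult_left_mono) auto
    then show ?thesis by (simp add: distrib_left)
  qed
  have Ke: "e * K = 4 * C\<^sup>2 * e + \<bar>\<kappa>\<bar> * (2 * real CARD('n) * C\<^sup>2 * M) * e + (CR R * e + \<mu> * (CR R * e)) + \<nu> * (LG * e) + k1 * e + k2 * e + \<mu> * e"
    unfolding K_def by (simp add: algebra_simps)
  have ce: "c * (1 - \<mu> + \<nu>) = c - \<mu> * c + \<nu> * c" by (simp add: algebra_simps)
  have kt: "k1 * (2 * a * (t - t1) + b) \<le> k1 * \<tau>1 + k1 * e" "k2 * (2 * a' * (s - s1) + b') \<le> k2 * \<tau>2 + k2 * e"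
  proof -
    have "k1 * (2 * a * (t - t1) + b) \<le> k1 * (\<tau>1 + e)" using J(8) k by (intro mult_left_mono) auto
    then show "k1 * (2 * a * (t - t1) + b) \<le> k1 * \<tau>1 + k1 * e" by (simp add: distrib_left)
    have "k2 * (2 * a' * (s - s1) + b') \<le> k2 * (\<tau>2 + e)" using J(9) k by (intro mult_left_mono) auto
    then show "k2 * (2 * a' * (s - s1) + b') \<le> k2 * \<tau>2 + k2 * e" by (simp add: distrib_left)
  qed
  have fin: "k1 * (2 * a * (t - t1) + b) + k2 * (2 * a' * (s - s1) + b') + H \<theta> x P - \<mu> * H \<theta> x Q + \<nu> * G \<theta> x q
      \<le> c * (1 - \<mu> + \<nu>) + \<kappa> * df \<theta> x (\<lambda>e. (D2\<psi> x *v e) \<bullet> e) + 2 * \<omega> * C\<^sup>2 + tol"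
    unfolding ce using i1 i2 i3 dsum \<kappa>d HP HQ Gq kt eK[unfolded Ke] by linarith
  have grad: "norm (P - (\<mu> *\<^sub>R Q - \<nu> *\<^sub>R q + \<kappa> *\<^sub>R D\<psi> x + (2 * \<omega>) *\<^sub>R (x - x1))) \<le> tol"
  proof -
    have eq: "P - (\<mu> *\<^sub>R Q - \<nu> *\<^sub>R q + \<kappa> *\<^sub>R D\<psi> x + (2 * \<omega>) *\<^sub>R (x - x1)) = P + Q0 + q0 - (\<kappa> *\<^sub>R D\<psi> x + (2 * \<omega>) *\<^sub>R (x - x1))"
      unfolding Q0 by (simp add: algebra_simps)
    show ?thesis unfolding eq by (rule order_trans[OF J(7) e(3)])
  qed
  show ?thesis using J(1) nP nQ nq tq grad fin by blast
qed

end

text \<open>A loss quadratic in the step length adds up to \<open>K * d\<^sup>2 / n\<close> over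
  \<open>n\<close> equal steps and so disappears. Hence each single step may be proved with a
  quadratic penalty in time.\<close>

lemma subdivision_nonincreasing:
  fixes P :: "real => real => bool"
  assumes step: "\<And>a b m. t1 \<le> a ==> a \<le> b ==> b \<le> t2 ==> b \<le> a + 1 ==> P a m ==> P b (m + K * (b - a)\<^sup>2)"
    and P: "P t1 m" and t: "t1 \<le> t2" and e: "e > 0" and mono: "\<And>t m m'. P t m ==> m \<le> m' ==> P t m'"
  shows "P t2 (m + e)"
proof -
  define d where "d = t2 - t1"
  have d: "d \<ge> 0" using t by (simp add: d_def)
  obtain n :: nat where n: "n \<ge> 1" "real n \<ge> d" "real n \<ge> \<bar>K\<bar> * d\<^sup>2 / e"
  proof -
    obtain n :: nat where "real n \<ge> max 1 (max d (\<bar>K\<bar> * d\<^sup>2 / e))" using real_arch_simple by blast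
    then show thesis using that[of n] by auto
  qed
  have it: "P (t1 + real i * (d / n)) (m + real i * (K * (d / n)\<^sup>2))" if "i \<le> n" for i
    using that
  proof (induction i)
    case 0
    then show ?case using P by simp
  next
    case (Suc i)
    have dn: "d / n \<ge> 0" "d / n \<le> 1" using d n by auto
    have "real (Suc i) * (d / n) \<le> real n * (d / n)" using Suc.prems dn by (intro mult_right_mono) auto
    then have le: "t1 + real (Suc i) * (d / n) \<le> t2" using n by (simp add: d_def)
    have "P (t1 + real (Suc i) * (d / n)) ((m + real i * (K * (d / n)\<^sup>2)) + K * ((t1 + real (Suc i) * (d / n)) - (t1 + real i * (d / n)))\<^sup>2)"
    proof (rule step[OF _ _ le _ Suc.IH])
      show "t1 \<le> t1 + real i * (d / n)" using mult_nonneg_nonneg[OF of_nat_0_le_iff[of i] dn(1)] by linarith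
      show "t1 + real i * (d / n) \<le> t1 + real (Suc i) * (d / n)" using dn by (intro add_left_mono mult_right_mono) auto
      show "t1 + real (Suc i) * (d / n) \<le> t1 + real i * (d / n) + 1" using dn by (simp only: of_nat_Suc distrib_right mult_1)
    qed (use Suc.prems in auto)
    moreover have "(t1 + real (Suc i) * (d / n)) - (t1 + real i * (d / n)) = d / n" by (simp add: distrib_right add_divide_distrib)
    ultimately have "P (t1 + real (Suc i) * (d / n)) ((m + real i * (K * (d / n)\<^sup>2)) + K * (d / n)\<^sup>2)" by simp
    then show ?case by (simp add: distrib_right add_ac)
  qed
  from it[of n] have "P t2 (m + real n * (K * (d / n)\<^sup>2))" using n by (simp add: d_def)
  moreover have "real n * (K * (d / n)\<^sup>2) \<le> e"
  proof -
    have "real n * (K * (d / n)\<^sup>2) = K * d\<^sup>2 / n" using n by (simp add: power2_eq_square field_simps)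
    also have "\<dots> \<le> \<bar>K\<bar> * d\<^sup>2 / n" using n by (intro divide_right_mono mult_right_mono) auto
    also have "\<dots> \<le> e" using n e by (simp add: field_simps)
    finally show ?thesis .
  qed
  ultimately show ?thesis using mono by (meson add_left_mono)
qed

section \<open>Comparison of an evolution with a stationary function\<close>

context hjb
begin

lemma C2_fun_zero: "C2_fun (\<lambda>x. 0) (\<lambda>x. 0) (\<lambda>x. 0 :: real^'n^'n)"
  unfolding C2_fun_def by (auto intro!: derivative_eq_intros)

text \<open>Space is not compact, so \<open>\<omega> * |x - x0|^2\<close> confines the maximum. At
  the radius \<open>R\<close> with \<open>\<omega> * R\<^sup>2 = M\<close> it exceeds every
  oscillation, yet its gradient there is only \<open>2 * sqrt (\<omega> * M)\<close>, which vanishes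
  with \<omega> and so disturbs \<open>H\<close> arbitrarily little compared with the strictness
  \<zeta>.\<close>

lemma comparison_core:
  fixes W1 W2 :: "(real^'n) \<times> real => real"
  assumes cont: "continuous_on UNIV W1" "continuous_on UNIV W2"
    and bd: "\<And>z. \<bar>W1 z\<bar> \<le> Bd" "\<And>z. \<bar>W2 z\<bar> \<le> Bd"
    and L: "L \<ge> 0"
    and lip: "\<And>x y t. \<bar>W1 (x, t) - W1 (y, t)\<bar> \<le> L * norm (x - y)" "\<And>x y t. \<bar>W2 (x, t) - W2 (y, t)\<bar> \<le> L * norm (x - y)"
    and a: "a \<ge> 0" "a' \<ge> 0"
    and r: "r > 0" "\<And>t. p1 - r \<le> t ==> t \<le> p1' + r ==> t \<in> I1" "\<And>t. p2 - r \<le> t ==> t \<le> p2' + r ==> t \<in> I2"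
    and k: "k1 \<ge> 0" "k2 \<ge> 0" and sub: "evol_sub I1 k1 c W1" and super: "evol_super I2 k2 c W2"
    and n0: "p1 \<le> t0" "t0 \<le> p1'" "p2 \<le> s0" "s0 \<le> p2'"
    and bdry: "\<And>x t s. p1 \<le> t ==> t \<le> p1' ==> p2 \<le> s ==> s \<le> p2' ==> t = p1 \<or> t = p1' \<or> s = p2 \<or> s = p2' ==>
       W1 (x, t) - W2 (x, s) - (a * (t - t1)\<^sup>2 + b * t + a' * (s - s1)\<^sup>2 + b' * s)
        < W1 (x0, t0) - W2 (x0, s0) - (a * (t0 - t1)\<^sup>2 + b * t0 + a' * (s0 - s1)\<^sup>2 + b' * s0)"
    and \<zeta>: "\<zeta> > 0" "\<And>t s. p1 \<le> t ==> t \<le> p1' ==> p2 \<le> s ==> s \<le> p2' ==>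
       k1 * (2 * a * (t - t1) + b) + k2 * (2 * a' * (s - s1) + b') \<ge> \<zeta>"
  shows False
proof -
  define q where "q t s = a * (t - t1)\<^sup>2 + b * t + a' * (s - s1)\<^sup>2 + b' * s" for t s
  have "continuous_on ({p1..p1'} \<times> {p2..p2'}) (\<lambda>z. q (fst z) (snd z))" unfolding q_def by (intro continuous_intros)
  then have "compact ((\<lambda>z. q (fst z) (snd z)) ` ({p1..p1'} \<times> {p2..p2'}))" by (intro compact_continuous_image compact_Times compact_Icc)
  then have "bounded ((\<lambda>z. q (fst z) (snd z)) ` ({p1..p1'} \<times> {p2..p2'}))" by (rule compact_imp_bounded)
  then obtain B0 where B0: "\<forall>y\<in>(\<lambda>z. q (fst z) (snd z)) ` ({p1..p1'} \<times> {p2..p2'}). norm y \<le> B0"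
    unfolding bounded_iff by blast
  have qB: "\<bar>q t s\<bar> \<le> B0" if "p1 \<le> t" "t \<le> p1'" "p2 \<le> s" "s \<le> p2'" for t s
    using B0 that by force
  have Bd: "Bd \<ge> 0" using bd(1)[of 0] by linarith
  have B00: "B0 \<ge> 0" using qB[OF n0] by linarith
  define M where "M = 4 * Bd + 2 * B0 + 1"
  have M: "M > 0" using Bd B00 by (simp add: M_def)
  define R' where "R' = L + 1"
  have R': "R' > 0" "L \<le> R'" using L by (auto simp: R'_def)
  define g where "g \<omega> = 2 * \<omega> * C\<^sup>2 + CR R' * (2 * sqrt (\<omega> * M))" for \<omega>
  have "isCont g 0" unfolding g_def by (intro continuous_intros)
  then have "(g \<longlongrightarrow> g 0) (at 0)" by (simp add: isCont_def)
  then have "\<forall>\<^sub>F \<omega> in at 0. g \<omega> < \<zeta> / 2" using order_tendstoD(2)[of g "g 0" "at 0" "\<zeta> / 2"] \<zeta>(1) by (simp add: g_def)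
  then obtain d where d: "d > 0" "\<And>\<omega>. \<omega> \<noteq> 0 ==> \<bar>\<omega>\<bar> < d ==> g \<omega> < \<zeta> / 2"
    unfolding eventually_at by (auto simp: dist_real_def)
  define \<omega> where "\<omega> = d / 2"
  have \<omega>: "\<omega> > 0" "g \<omega> < \<zeta> / 2" using d by (auto simp: \<omega>_def)
  define R where "R = sqrt (M / \<omega>)"
  have R: "R > 0" "\<omega> * R\<^sup>2 = M" using M \<omega> by (auto simp: R_def)
  have \<omega>R: "\<omega> * R = sqrt (\<omega> * M)"
  proof -
    have "(\<omega> * R)\<^sup>2 = \<omega> * (\<omega> * R\<^sup>2)" by (simp add: power2_eq_square)
    then have "(\<omega> * R)\<^sup>2 = \<omega> * M" unfolding R(2) .
    then show ?thesis using \<omega> R by (metis mult_nonneg_nonneg less_imp_le real_sqrt_unique)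
  qed
  define N where "N = cball x0 R \<times> {p1..p1'} \<times> {p2..p2'}"
  have cN: "compact N" unfolding N_def by (intro compact_Times compact_cball compact_Icc)
  have n0N: "(x0, t0, s0) \<in> N" using n0 R by (simp add: N_def)
  define h where "h x t s = W1 (x, t) - 1 * W2 (x, s) + 1 * (0::real) - (0 * 0 + \<omega> * (norm (x - x0))\<^sup>2 + a * (t - t1)\<^sup>2 + b * t + a' * (s - s1)\<^sup>2 + b' * s)" for x t s
  have hq: "h x t s = W1 (x, t) - W2 (x, s) - \<omega> * (norm (x - x0))\<^sup>2 - q t s" for x t s by (simp add: h_def q_def)
  have int: "(x, t, s) \<in> interior N" if xN: "(x, t, s) \<in> N" and hv: "h x t s \<ge> h x0 t0 s0" for x t s
  proof -
    have b: "p1 \<le> t" "t \<le> p1'" "p2 \<le> s" "s \<le> p2'" "norm (x - x0) \<le> R"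
      using xN by (auto simp: N_def dist_norm norm_minus_commute)
    have w: "\<omega> * (norm (x - x0))\<^sup>2 \<ge> 0" using \<omega> by simp
    have "\<not> (t = p1 \<or> t = p1' \<or> s = p2 \<or> s = p2')"
      using bdry[OF b(1-4), of x] hv w unfolding hq q_def by fastforce
    then have ts: "p1 < t" "t < p1'" "p2 < s" "s < p2'" using b by auto
    have "norm (x - x0) \<noteq> R"
    proof
      assume "norm (x - x0) = R"
      then have "h x t s \<le> 2 * Bd - M + B0" using bd(1)[of "(x, t)"] bd(2)[of "(x, s)"] qB[OF b(1-4)] R(2) unfolding hq by simp
      moreover have "h x0 t0 s0 \<ge> - 2 * Bd - B0" using bd(1)[of "(x0, t0)"] bd(2)[of "(x0, s0)"] qB[OF n0] unfolding hq by simp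
      ultimately show False using hv by (simp add: M_def)
    qed
    then have xR: "x \<in> ball x0 R" using b(5) by (simp add: dist_norm norm_minus_commute)
    have "open (ball x0 R \<times> {p1<..<p1'} \<times> {p2<..<p2'})" by (intro open_Times) auto
    moreover have "ball x0 R \<times> {p1<..<p1'} \<times> {p2<..<p2'} \<subseteq> N" by (auto simp: N_def)
    moreover have "(x, t, s) \<in> ball x0 R \<times> {p1<..<p1'} \<times> {p2<..<p2'}" using xR ts by simp
    ultimately show ?thesis using interior_maximal by blast
  qed
  have st0: "stat_sub (\<lambda>\<theta> x q. c) c (\<lambda>x. 0)" by (rule stat_sub_zero) simp
  have CRp: "CR R' > 0" using CR_pos[OF R'(1)] .
  define cp where "cp = CR R' + 1"
  have cp: "cp > 0" using CRp by (simp add: cp_def)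
  define tol where "tol = \<zeta> / (4 * cp)"
  have tol: "tol > 0" using \<zeta>(1) cp by (simp add: tol_def)
  have "\<exists>x t s P Q q \<theta> z Z. (x, t, s) \<in> N \<and> norm P \<le> L \<and> norm Q \<le> L \<and> norm q \<le> L \<and> touch2 (\<lambda>x::real^'n. 0::real) z q Z \<and>
    norm (P - (1 *\<^sub>R Q - 1 *\<^sub>R q + 0 *\<^sub>R (0::real^'n) + (2 * \<omega>) *\<^sub>R (x - x0))) \<le> tol \<and>
    k1 * (2 * a * (t - t1) + b) + k2 * (2 * a' * (s - s1) + b') + H \<theta> x P - 1 * H \<theta> x Q + 1 * c
      \<le> c * (1 - 1 + 1) + 0 * df \<theta> x (\<lambda>e. ((0::real^'n^'n) *v e) \<bullet> e) + 2 * \<omega> * C\<^sup>2 + tol"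
  proof (rule doubling_pde[where \<psi> = "\<lambda>x. 0" and v = "\<lambda>x. 0" and LG = 0 and G = "\<lambda>\<theta> x q. c" and r = r and ?I1.0 = I1 and ?I2.0 = I2
        and ?W1.0 = W1 and ?W2.0 = W2 and Bd = Bd, OF cont _ bd _ L lip _ C2_fun_zero _ a _ _ cN n0N _ r(1) _ _ k sub super st0 _ _ tol])
    show "(x, t, s) \<in> interior N" if "(x, t, s) \<in> N"
      "W1 (x0, t0) - 1 * W2 (x0, s0) + 1 * (0::real) - (0 * 0 + \<omega> * (norm (x0 - x0))\<^sup>2 + a * (t0 - t1)\<^sup>2 + b * t0 + a' * (s0 - s1)\<^sup>2 + b' * s0)
       \<le> W1 (x, t) - 1 * W2 (x, s) + 1 * (0::real) - (0 * 0 + \<omega> * (norm (x - x0))\<^sup>2 + a * (t - t1)\<^sup>2 + b * t + a' * (s - s1)\<^sup>2 + b' * s)" for x t s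
      using int that unfolding h_def by blast
    show "t' \<in> I1" if "(x, t, s) \<in> N" "\<bar>t' - t\<bar> \<le> r" for x t s t' using that r(2)[of t'] by (auto simp: N_def abs_le_iff)
    show "s' \<in> I2" if "(x, t, s) \<in> N" "\<bar>s' - s\<bar> \<le> r" for x t s s' using that r(3)[of s'] by (auto simp: N_def abs_le_iff)
  qed (use \<omega> L Bd in auto)
  then obtain x t s P Q q \<theta> z Z where J: "(x, t, s) \<in> N" "norm P \<le> L" "norm Q \<le> L" "touch2 (\<lambda>x::real^'n. 0::real) z q Z"
    "norm (P - (1 *\<^sub>R Q - 1 *\<^sub>R q + 0 *\<^sub>R (0::real^'n) + (2 * \<omega>) *\<^sub>R (x - x0))) \<le> tol"
    "k1 * (2 * a * (t - t1) + b) + k2 * (2 * a' * (s - s1) + b') + H \<theta> x P - 1 * H \<theta> x Q + 1 * c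
      \<le> c * (1 - 1 + 1) + 0 * df \<theta> x (\<lambda>e. ((0::real^'n^'n) *v e) \<bullet> e) + 2 * \<omega> * C\<^sup>2 + tol" by blast
  have q0: "q = 0" using touch2_norm_le[OF J(4), of 0] by simp
  have "\<zeta> + H \<theta> x P - H \<theta> x Q \<le> 2 * \<omega> * C\<^sup>2 + tol"
    using J(6) \<zeta>(2)[of t s] J(1) by (simp add: N_def)
  moreover have "\<bar>H \<theta> x P - H \<theta> x Q\<bar> \<le> CR R' * (tol + 2 * sqrt (\<omega> * M))"
  proof -
    have "norm (P - Q) \<le> norm (P - (Q + (2 * \<omega>) *\<^sub>R (x - x0))) + norm ((2 * \<omega>) *\<^sub>R (x - x0))"
      using norm_triangle_ineq[of "P - (Q + (2 * \<omega>) *\<^sub>R (x - x0))" "(2 * \<omega>) *\<^sub>R (x - x0)"] by simp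
    also have "norm (P - (Q + (2 * \<omega>) *\<^sub>R (x - x0))) \<le> tol" using J(5) by (simp add: q0)
    also have "norm ((2 * \<omega>) *\<^sub>R (x - x0)) \<le> 2 * (\<omega> * R)"
      using J(1) \<omega> by (simp add: N_def dist_norm norm_minus_commute)
    finally have pq: "norm (P - Q) \<le> tol + 2 * sqrt (\<omega> * M)" unfolding \<omega>R by simp
    have "\<bar>H \<theta> x P - H \<theta> x Q\<bar> \<le> CR R' * (dist x x + dist P Q)" using J(2,3) R' by (intro H_lip) auto
    also have "\<dots> \<le> CR R' * (tol + 2 * sqrt (\<omega> * M))" using pq CRp by (intro mult_left_mono) (auto simp: dist_norm)
    finally show ?thesis .
  qed
  ultimately have "\<zeta> \<le> g \<omega> + cp * tol" by (simp add: g_def cp_def algebra_simps abs_le_iff)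
  also have "cp * tol = \<zeta> / 4" using cp by (simp add: tol_def)
  finally show False using \<omega>(2) \<zeta>(1) by linarith
qed

end

section \<open>Periodicity, and stability of subsolutions under limits\<close>

lemma unit_cube_translate:
  fixes x :: "real^'n"
  obtains k where "int_vec k" "x + k \<in> cbox 0 1"
proof
  define k where "k = (\<chi> i. (- of_int \<lfloor>x $ i\<rfloor> :: real))"
  show "int_vec k" by (simp add: int_vec_def k_def)
  have "0 \<le> (x + k) $ i" "(x + k) $ i \<le> 1" for i unfolding k_def by (simp, simp, linarith)
  then show "x + k \<in> cbox 0 1" by (simp add: mem_box_cart)
qed

lemma periodic_fun_bounded:
  fixes v :: "real^'n => real"
  assumes "periodic_fun v" "continuous_on UNIV v"
  obtains B where "\<And>x. \<bar>v x\<bar> \<le> B"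
proof -
  define Q where "Q = cbox (0::real^'n) 1"
  have "compact (v ` Q)" unfolding Q_def by (intro compact_continuous_image compact_cbox continuous_on_subset[OF assms(2)]) auto
  then have "bounded (v ` Q)" by (rule compact_imp_bounded)
  then obtain B where B: "\<forall>y\<in>v ` Q. norm y \<le> B" unfolding bounded_iff by blast
  have "\<bar>v x\<bar> \<le> B" for x
  proof -
    obtain k where k: "int_vec k" "x + k \<in> cbox 0 1" using unit_cube_translate by blast
    have "v (x + k) = v x" using assms(1) k(1) by (simp add: periodic_fun_def)
    moreover have "x + k \<in> Q" using k by (simp add: Q_def)
    ultimately show ?thesis using B by (metis image_eqI real_norm_def)
  qed
  then show thesis by (rule that)
qed

text \<open>The approximation by \<open>V\<close> holds on a whole time window around
  \<open>tb\<close>, so a time penalty of size \<open>4 * \<gamma>\<close> makes the maximum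
  interior while its derivative stays below \<open>8 * \<gamma>\<close>. The semicontinuity of
  \<open>F'\<close> is required in one direction only, in a form that also covers supersolutions
  after a change of sign.\<close>

lemma visc_limit_sub:
  fixes w :: "real^'n => real => real" and F' :: "real^'n => real^'n => real^'n^'n => real"
  assumes sub: "\<And>phi phit Dphi D2phi x0 t0. C21_fun phi phit Dphi D2phi ==> t0 > 0 ==>
        (\<exists>e>0. \<forall>y s. dist (y, s) (x0, t0) < e --> s > 0 --> w y s - phi y s \<le> w x0 t0 - phi x0 t0) ==>
        phit x0 t0 + F' x0 (Dphi x0 t0) (D2phi x0 t0) \<le> 0"
    and wcont: "continuous_on (UNIV \<times> {0<..}) (\<lambda>(x, t). w x t)"
    and approx: "\<And>\<gamma>. \<gamma> > 0 ==> \<exists>tb>1. w x0 tb \<ge> V x0 - \<gamma> \<and> (\<forall>x t. norm (x - x0) \<le> 1 --> \<bar>t - tb\<bar> \<le> 1 --> w x t \<le> V x + \<gamma>)"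
    and phi: "C2_fun phi Dphi D2phi" and touch: "e > 0" "\<And>y. norm (y - x0) < e ==> V y - phi y \<le> V x0 - phi x0"
    and F': "\<And>e. e > 0 ==> \<exists>d>0. \<forall>x p X. norm (x - x0) < d --> norm (p - Dphi x0) < d --> norm (X - D2phi x0) < d -->
        F' x p X > F' x0 (Dphi x0) (D2phi x0) - e"
  shows "F' x0 (Dphi x0) (D2phi x0) \<le> 0"
proof (rule ccontr)
  define m where "m = F' x0 (Dphi x0) (D2phi x0)"
  assume "\<not> ?thesis"
  then have m: "m > 0" by (simp add: m_def)
  obtain d where d: "d > 0" "\<And>x p X. norm (x - x0) < d ==> norm (p - Dphi x0) < d ==> norm (X - D2phi x0) < d ==>
        F' x p X > m - m / 2"
    using F'[of "m / 2"] m unfolding m_def[symmetric] by (metis half_gt_zero)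
  define nI where "nI = norm (mat 1 :: real^'n^'n) + 1"
  have nI: "nI > 0" by (simp add: nI_def add_nonneg_pos)
  define k where "k = d / (4 * nI)"
  have k: "k > 0" unfolding k_def using d(1) nI by simp
  have kI: "norm ((2 * k) *\<^sub>R (mat 1 :: real^'n^'n)) < d"
  proof -
    have "4 * k * nI = d" using nI by (simp add: k_def)
    then have "4 * (k * norm (mat 1 :: real^'n^'n)) + 4 * k = d" by (simp add: algebra_simps nI_def)
    moreover have "k * norm (mat 1 :: real^'n^'n) \<ge> 0" using k by simp
    ultimately have "2 * (k * norm (mat 1 :: real^'n^'n)) < d" using k by linarith
    then show ?thesis using k by simp
  qed
  have dphi: "(phi has_derivative (\<lambda>h. Dphi x \<bullet> h)) (at x)" "(Dphi has_derivative (\<lambda>h. D2phi x *v h)) (at x)" for x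
    using phi unfolding C2_fun_def by auto
  have cphi: "continuous_on UNIV phi" "continuous_on UNIV Dphi" "continuous_on UNIV D2phi"
    using phi dphi unfolding C2_fun_def
    by (auto intro!: differentiable_imp_continuous_within continuous_at_imp_continuous_on simp: differentiable_def) blast+
  define p where "p x = Dphi x + (2 * k) *\<^sub>R (x - x0)" for x
  define X where "X x = D2phi x + (2 * k) *\<^sub>R mat 1" for x
  have "isCont (\<lambda>x. p x) x0" "isCont (\<lambda>x. X x) x0" unfolding p_def X_def
    using cphi by (auto intro!: continuous_intros simp: continuous_on_eq_continuous_at)
  then have "((\<lambda>x. norm (p x - Dphi x0)) \<longlongrightarrow> norm (p x0 - Dphi x0)) (at x0)" "((\<lambda>x. norm (X x - D2phi x0)) \<longlongrightarrow> norm (X x0 - D2phi x0)) (at x0)"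
    unfolding isCont_def by (auto intro!: tendsto_intros)
  then have ev: "\<forall>\<^sub>F x in at x0. norm (p x - Dphi x0) < d" "\<forall>\<^sub>F x in at x0. norm (X x - D2phi x0) < d"
    using d(1) kI by (auto intro!: order_tendstoD(2) simp: p_def X_def)
  obtain \<rho>1 where \<rho>1: "\<rho>1 > 0" "\<And>x. x \<noteq> x0 ==> norm (x - x0) < \<rho>1 ==> norm (p x - Dphi x0) < d \<and> norm (X x - D2phi x0) < d"
    using eventually_conj[OF ev] unfolding eventually_at dist_norm by blast
  have near: "norm (p x - Dphi x0) < d" "norm (X x - D2phi x0) < d" if "norm (x - x0) < \<rho>1" for x
    using \<rho>1(2)[of x] that d(1) kI by (cases "x = x0"; simp add: p_def X_def)+
  define \<rho> where "\<rho> = min (min (e / 2) 1) (min (\<rho>1 / 2) (d / 2))"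
  have \<rho>: "\<rho> > 0" "\<rho> < e" "\<rho> \<le> 1" "\<rho> < \<rho>1" "\<rho> < d" using touch(1) \<rho>1(1) d(1) by (auto simp: \<rho>_def)
  \<comment> \<open>The first bound keeps the maximum off the sphere of radius \<rho>; the second
    keeps the time derivative of the penalty below \<open>m / 4\<close> in absolute value.\<close>
  define \<gamma> where "\<gamma> = min (k * \<rho>\<^sup>2 / 4) (m / 32)"
  have \<gamma>: "\<gamma> > 0" "4 * \<gamma> \<le> k * \<rho>\<^sup>2" "32 * \<gamma> \<le> m" using k \<rho> m by (auto simp: \<gamma>_def)
  obtain tb where tb: "tb > 1" "w x0 tb \<ge> V x0 - \<gamma>" "\<And>x t. norm (x - x0) \<le> 1 ==> \<bar>t - tb\<bar> \<le> 1 ==> w x t \<le> V x + \<gamma>"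
    using approx[OF \<gamma>(1)] by blast
  define Phi where "Phi = (\<lambda>y s. phi y + k * ((y - x0) \<bullet> (y - x0)) + 4 * \<gamma> * (s - tb)\<^sup>2)"
  have C21: "C21_fun Phi (\<lambda>y s. 8 * \<gamma> * (s - tb)) (\<lambda>y s. p y) (\<lambda>y s. X y)"
    unfolding C21_fun_def
  proof (intro conjI allI)
    fix x :: "real^'n" and t :: real
    have f: "((\<lambda>z. phi (fst z)) has_derivative (\<lambda>h. Dphi x \<bullet> fst h)) (at (x, t))"
      using has_derivative_compose[of fst fst "(x, t)" UNIV phi "\<lambda>h. Dphi x \<bullet> h"] dphi(1)
      by (simp add: has_derivative_fst has_derivative_ident)
    have "((\<lambda>z. phi (fst z) + k * ((fst z - x0) \<bullet> (fst z - x0)) + 4 * \<gamma> * (snd z - tb)\<^sup>2) has_derivative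
       (\<lambda>h. Dphi x \<bullet> fst h + k * ((x - x0) \<bullet> fst h + fst h \<bullet> (x - x0)) + 4 * \<gamma> * (2 * snd h * (t - tb)))) (at (x, t))"
      by (rule derivative_eq_intros f refl | simp)+
    then show "((\<lambda>(y, s). Phi y s) has_derivative (\<lambda>(h, r). p x \<bullet> h + 8 * \<gamma> * (t - tb) * r)) (at (x, t))"
      unfolding Phi_def p_def by (simp add: split_def inner_add_left inner_commute algebra_simps)
    show "continuous_on UNIV (\<lambda>(x::real^'n, t). 8 * \<gamma> * (t - tb))" "continuous_on UNIV (\<lambda>(x, t::real). p x)" "continuous_on UNIV (\<lambda>(x, t::real). X x)"
      unfolding p_def X_def split_def by (auto intro!: continuous_intros continuous_on_compose2[OF cphi(2)] continuous_on_compose2[OF cphi(3)])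
    have "(p has_derivative (\<lambda>h. D2phi x *v h + (2 * k) *\<^sub>R h)) (at x)"
      unfolding p_def by (rule derivative_eq_intros dphi refl | simp)+
    moreover have "(*v) (X x) = (\<lambda>h. D2phi x *v h + (2 * k) *\<^sub>R h)"
      by (rule ext) (simp add: X_def matrix_vector_mult_add_rdistrib scaleR_matrix_vector_assoc[symmetric])
    ultimately show "(p has_derivative (*v) (X x)) (at x)" by simp
  qed
  define N where "N = cball x0 \<rho> \<times> {tb - 1..tb + 1}"
  have "continuous_on N (\<lambda>z. w (fst z) (snd z) - Phi (fst z) (snd z))"
    unfolding Phi_def N_def using tb(1)
    by (intro continuous_intros continuous_on_compose2[OF cphi(1)] continuous_on_subset[OF wcont[unfolded split_def]]) auto
  moreover have "compact N" "N \<noteq> {}" unfolding N_def using \<rho>(1) by (auto intro: compact_Times)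
  ultimately obtain z where z: "z \<in> N" "\<And>z'. z' \<in> N ==> w (fst z') (snd z') - Phi (fst z') (snd z') \<le> w (fst z) (snd z) - Phi (fst z) (snd z)"
    using continuous_attains_sup[of N "\<lambda>z. w (fst z) (snd z) - Phi (fst z) (snd z)"] by blast
  obtain x t where xt: "z = (x, t)" by force
  have xN: "norm (x - x0) \<le> \<rho>" "\<bar>t - tb\<bar> \<le> 1" using z(1) by (auto simp: xt N_def dist_norm norm_minus_commute)
  have "(x0, tb) \<in> N" using \<rho> by (simp add: N_def)
  from z(2)[OF this] have v0: "V x0 - \<gamma> - phi x0 \<le> w x t - Phi x t" using tb(2) by (simp add: xt Phi_def)
  have "w x t \<le> V x + \<gamma>" using tb(3) xN \<rho> by simp
  moreover have "V x - phi x \<le> V x0 - phi x0" using touch(2) xN \<rho> by simp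
  ultimately have small: "k * (norm (x - x0))\<^sup>2 + 4 * \<gamma> * (t - tb)\<^sup>2 \<le> 2 * \<gamma>"
    using v0 by (simp add: Phi_def power2_norm_eq_inner)
  have "norm (x - x0) \<noteq> \<rho>"
  proof
    assume "norm (x - x0) = \<rho>"
    then have "k * \<rho>\<^sup>2 + 4 * \<gamma> * (t - tb)\<^sup>2 \<le> 2 * \<gamma>" using small by simp
    moreover have "4 * \<gamma> * (t - tb)\<^sup>2 \<ge> 0" using \<gamma>(1) by simp
    ultimately show False using \<gamma> by linarith
  qed
  then have x1: "norm (x - x0) < \<rho>" using xN by simp
  have t1: "\<bar>t - tb\<bar> < 1"
  proof (rule ccontr)
    assume "\<not> \<bar>t - tb\<bar> < 1"
    then have "\<bar>t - tb\<bar> = 1" using xN by simp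
    then have "(t - tb)\<^sup>2 = 1" by (metis abs_square_eq_1)
    moreover have "k * (norm (x - x0))\<^sup>2 \<ge> 0" using k by simp
    ultimately show False using small \<gamma> by simp
  qed
  have loc: "\<exists>e>0. \<forall>y s. dist (y, s) (x, t) < e --> s > 0 --> w y s - Phi y s \<le> w x t - Phi x t"
  proof (intro exI[of _ "min (\<rho> - norm (x - x0)) (1 - \<bar>t - tb\<bar>)"] conjI allI impI)
    fix y s assume dd: "dist (y, s) (x, t) < min (\<rho> - norm (x - x0)) (1 - \<bar>t - tb\<bar>)"
    have "norm (y - x) \<le> dist (y, s) (x, t)" "\<bar>s - t\<bar> \<le> dist (y, s) (x, t)"
      using norm_fst_le[of "y - x" "s - t"] norm_snd_le[of "s - t" "y - x"] by (simp_all add: dist_norm)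
    then have "norm (y - x0) \<le> \<rho>" "\<bar>s - tb\<bar> \<le> 1"
      using dd norm_triangle_ineq[of "y - x" "x - x0"] by auto
    then have "(y, s) \<in> N" by (auto simp: N_def dist_norm norm_minus_commute)
    from z(2)[OF this] show "w y s - Phi y s \<le> w x t - Phi x t" by (simp add: xt)
  qed (use x1 t1 in auto)
  have "8 * \<gamma> * (t - tb) + F' x (p x) (X x) \<le> 0"
    using sub[OF C21 _ loc] t1 tb(1) by linarith
  moreover have "F' x (p x) (X x) > m / 2"
    using d(2)[of x "p x" "X x"] near[of x] x1 \<rho> by simp
  moreover have "8 * \<gamma> * (t - tb) \<ge> - (8 * \<gamma>)"
    using \<gamma>(1) t1 mult_left_mono[of "-1" "t - tb" "8 * \<gamma>"] by simp
  ultimately show False using \<gamma> m by linarith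
qed

section \<open>Comparison with stationary solutions\<close>

locale hjb_evol = hjb \<sigma> H C CR
  for \<sigma> :: "'th => real^'n => real^'n^'n" and H C CR +
  fixes u :: "real^'n => real => real" and c :: real
  assumes u_cont: "continuous_on (UNIV \<times> {0..}) (\<lambda>(x, t). u x t)"
    and u_per: "\<And>t. t \<ge> 0 ==> periodic_fun (\<lambda>x. u x t)"
    and u_lip: "\<And>t x y. t \<ge> 0 ==> \<bar>u x t - u y t\<bar> \<le> C * dist x y"
    and u_sol: "visc_sol_evol F u"
begin

definition U :: "real^'n => real => real" where "U x t = u x t + c * t"

lemma U_cont: "continuous_on (UNIV \<times> {0..}) (\<lambda>z. U (fst z) (snd z))"
  unfolding U_def using u_cont by (auto simp: split_def intro!: continuous_intros)

lemma U_per: "t \<ge> 0 ==> periodic_fun (\<lambda>x. U x t)"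
  using u_per by (simp add: U_def periodic_fun_def)

lemma U_lip: "t \<ge> 0 ==> \<bar>U x t - U y t\<bar> \<le> C * norm (x - y)"
  using u_lip by (simp add: U_def dist_norm)

text \<open>Doubling is formulated for functions continuous on all of space-time. Composing time
  with a continuous \<open>g\<close> that is the identity on the open set \<open>I\<close> gives
  such functions, and at times in \<open>I\<close> a jet sees only the original values.\<close>

lemma time_extension:
  assumes g: "continuous_on UNIV g" "\<And>t. g t \<ge> 0" and I: "open I" "I \<subseteq> {0<..}" "\<And>t. t \<in> I ==> g t = t"
  shows "continuous_on UNIV (\<lambda>(x, t). U x (g t))"
    and "\<bar>(\<lambda>(x, t). U x (g t)) (x, t) - (\<lambda>(x, t). U x (g t)) (y, t)\<bar> \<le> C * norm (x - y)"
    and "evol_sub I 1 c (\<lambda>(x, t). U x (g t))" and "evol_super I 1 c (\<lambda>(x, t). U x (g t))"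
proof -
  have "continuous_on UNIV (\<lambda>z::(real^'n) \<times> real. (fst z, g (snd z)))"
    by (intro continuous_intros continuous_on_compose2[OF g(1)]) auto
  from continuous_on_compose2[OF U_cont this] g(2)
  show "continuous_on UNIV (\<lambda>(x, t). U x (g t))" by (simp add: split_def image_subset_iff)
  show "\<bar>(\<lambda>(x, t). U x (g t)) (x, t) - (\<lambda>(x, t). U x (g t)) (y, t)\<bar> \<le> C * norm (x - y)"
    using U_lip[OF g(2)] by simp
  have W: "(\<lambda>(x, t). U x (g t)) (x, t) = u x t + c * t" if "t \<in> I" for x t using I(3)[OF that] by (simp add: U_def)
  show "evol_sub I 1 c (\<lambda>(x, t). U x (g t))" using W by (intro evol_sub_visc[OF u_sol I(1,2)]) auto
  show "evol_super I 1 c (\<lambda>(x, t). U x (g t))" using W by (intro evol_super_visc[OF u_sol I(1,2)]) auto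
qed

lemma U_bounded_on: "\<exists>B. \<forall>x t. 0 \<le> t --> t \<le> T --> \<bar>U x t\<bar> \<le> B"
proof -
  define Q where "Q = cbox (0::real^'n) 1"
  have "compact ((\<lambda>z. U (fst z) (snd z)) ` (Q \<times> {0..T}))" unfolding Q_def
    by (intro compact_continuous_image compact_Times compact_cbox compact_Icc continuous_on_subset[OF U_cont]) auto
  then have "bounded ((\<lambda>z. U (fst z) (snd z)) ` (Q \<times> {0..T}))" by (rule compact_imp_bounded)
  then obtain B where B: "\<forall>y\<in>(\<lambda>z. U (fst z) (snd z)) ` (Q \<times> {0..T}). norm y \<le> B" unfolding bounded_iff by blast
  have "\<bar>U x t\<bar> \<le> B" if t: "0 \<le> t" "t \<le> T" for x t
  proof -
    obtain k where k: "int_vec k" "x + k \<in> cbox 0 1" using unit_cube_translate by blast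
    have "U (x + k) t = U x t" using U_per[OF t(1)] k(1) by (simp add: periodic_fun_def)
    moreover have "(x + k, t) \<in> Q \<times> {0..T}" using k t by (simp add: Q_def)
    ultimately show ?thesis using B by force
  qed
  then show ?thesis by blast
qed

text \<open>The sign \<open>s\<close> treats both one-sided estimates at once. On a short interval
  the penalty \<open>K * (t - a)\<^sup>2\<close> keeps the maximum away from the far end
  \<open>a + 2\<close> and costs \<open>K * (b - a)\<^sup>2\<close> at time \<open>b\<close>;
  subdivision removes this cost. The stationary function receives an artificial time with its own
  quadratic penalty.\<close>

lemma compare_with_stationary:
  assumes v: "visc_sol (\<lambda>x r p X. F x p X - c) v" "\<And>x y. \<bar>v x - v y\<bar> \<le> L * norm (x - y)" "L \<ge> 0" "\<And>x. \<bar>v x\<bar> \<le> Bv"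
    and t: "0 < t1" "t1 \<le> t2" and s: "s = 1 \<or> s = - 1"
    and init: "\<And>x. s * (U x t1 - v x) \<le> m"
  shows "s * (U x t2 - v x) \<le> m"
proof -
  define T where "T = t2 + 4"
  obtain B where B: "\<And>x t. 0 \<le> t ==> t \<le> T ==> \<bar>U x t\<bar> \<le> B" using U_bounded_on by blast
  define Bd where "Bd = max B Bv"
  have Bd: "Bd \<ge> 0" using v(4)[of 0] by (auto simp: Bd_def)
  define g where "g t = max 0 (min T t)" for t
  define W where "W = (\<lambda>(x, t). U x (g t))"
  define V where "V = (\<lambda>(x::real^'n, t::real). v x)"
  have T: "T > 0" using t by (simp add: T_def)
  have g: "continuous_on UNIV g" "\<And>t. g t \<ge> 0" "\<And>t. g t \<le> T" unfolding g_def using T by (auto intro!: continuous_intros)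
  have gI: "g t = t" if "t \<in> {0<..<T}" for t using that by (auto simp: g_def)
  have "{0<..<T} \<subseteq> {0<..}" by auto
  note W = time_extension[OF g(1,2) open_greaterThanLessThan this gI, folded W_def]
  have cv: "continuous_on UNIV v" using v(1) unfolding visc_sol_def by blast
  have V: "continuous_on UNIV V" unfolding V_def split_def by (intro continuous_on_compose2[OF cv] continuous_intros) auto
  define L' where "L' = max C L"
  have L': "L' \<ge> 0" using v(3) by (simp add: L'_def)
  have lip: "\<bar>W (x, t) - W (y, t)\<bar> \<le> L' * norm (x - y)" "\<bar>V (x, t) - V (y, t)\<bar> \<le> L' * norm (x - y)" for x y t
  proof -
    have "C * norm (x - y) \<le> L' * norm (x - y)" "L * norm (x - y) \<le> L' * norm (x - y)" unfolding L'_def by (intro mult_right_mono; simp)+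
    then show "\<bar>W (x, t) - W (y, t)\<bar> \<le> L' * norm (x - y)" "\<bar>V (x, t) - V (y, t)\<bar> \<le> L' * norm (x - y)"
      using W(2)[of x t y] v(2)[of x y] by (auto simp: V_def)
  qed
  have bd: "\<bar>W z\<bar> \<le> Bd" "\<bar>V z\<bar> \<le> Bd" for z
    using B[OF g(2,3), of "fst z" "snd z"] v(4)[of "fst z"] by (auto simp: W_def V_def Bd_def split_def)
  define P where "P t m \<longleftrightarrow> (\<forall>x. s * (U x t - v x) \<le> m)" for t m
  \<comment> \<open>The values \<open>K * 2\<^sup>2\<close> and \<open>A\<close> exceed the
    oscillation \<open>4 * Bd\<close>, so the maximum reaches neither \<open>tt = a + 2\<close> nor
    the ends of the artificial time interval.\<close>
  define K where "K = Bd + 1"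
  define A where "A = 4 * Bd + 1"
  have step: "P b (m + K * (b - a)\<^sup>2)" if ab: "t1 \<le> a" "a \<le> b" "b \<le> t2" "b \<le> a + 1" and Pa: "P a m" for a b m
  proof (rule ccontr)
    assume "\<not> ?thesis"
    then obtain x2 where x2: "s * (U x2 b - v x2) > m + K * (b - a)\<^sup>2" unfolding P_def by (meson not_le)
    have ab': "a < b"
    proof (rule ccontr)
      assume "\<not> a < b"
      then have "a = b" using ab by simp
      then show False using x2 Pa unfolding P_def by (auto simp: not_le[symmetric])
    qed
    define \<gamma> where "\<gamma> = s * (U x2 b - v x2) - m - K * (b - a)\<^sup>2"
    have \<gamma>: "\<gamma> > 0" using x2 by (simp add: \<gamma>_def)
    define dd where "dd = b - a"
    have dd: "dd > 0" using ab' by (simp add: dd_def)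
    \<comment> \<open>A strict slope in time which over the length \<open>b - a\<close> spends half
      of the assumed excess \<gamma>.\<close>
    define \<zeta> where "\<zeta> = \<gamma> / (2 * dd)"
    have "\<zeta> > 0" "\<zeta> * dd = \<gamma> / 2" using \<gamma> dd by (auto simp: \<zeta>_def)
    then have \<zeta>: "\<zeta> > 0" "\<zeta> * (b - a) = \<gamma> / 2" by (simp_all add: dd_def)
    have WU: "W (x, t) = U x t" if "0 < t" "t < T" for x t using gI[of t] that by (simp add: W_def)
    have aT: "0 < a" "a < T" "0 < b" "b < T" using ab ab' t by (auto simp: T_def)
    have sWV: "s * (W (x, t) - V (x, r)) \<le> 2 * Bd" "s * (W (x, t) - V (x, r)) \<ge> - (2 * Bd)" for x t r
      using s bd(1)[of "(x, t)"] bd(2)[of "(x, r)"] by (auto simp: abs_le_iff)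
    have m2: "m \<ge> - (2 * Bd)"
    proof -
      have "s * (W (x2, a) - V (x2, 0)) \<le> m" using Pa WU[OF aT(1,2)] by (simp add: P_def V_def)
      then show ?thesis using sWV(2)[of x2 a 0] by linarith
    qed
    have n0: "s * (W (x2, b) - V (x2, 0)) - K * (b - a)\<^sup>2 - \<zeta> * b = m + \<gamma> / 2 - \<zeta> * a"
    proof -
      have "s * (W (x2, b) - V (x2, 0)) = \<gamma> + m + K * (b - a)\<^sup>2" using WU[OF aT(3,4)] by (simp add: V_def \<gamma>_def)
      moreover have "\<zeta> * (b - a) = \<zeta> * b - \<zeta> * a" by (rule right_diff_distrib)
      ultimately show ?thesis using \<zeta>(2) by linarith
    qed
    have bdry: "s * (W (x, tt) - V (x, r)) - K * (tt - a)\<^sup>2 - \<zeta> * tt - A * r\<^sup>2 < m + \<gamma> / 2 - \<zeta> * a"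
      if tr: "a \<le> tt" "tt \<le> a + 2" "- 1 \<le> r" "r \<le> 1" "tt = a \<or> tt = a + 2 \<or> r = - 1 \<or> r = 1" for x tt r
    proof -
      have k0: "K * (tt - a)\<^sup>2 \<ge> 0" "A * r\<^sup>2 \<ge> 0" using Bd by (auto simp: K_def A_def)
      have z0: "\<zeta> * tt \<ge> \<zeta> * a" using \<zeta>(1) tr by (intro mult_left_mono) auto
      consider "tt = a" | "tt = a + 2" | "r = - 1 \<or> r = 1" using tr by blast
      then show ?thesis
      proof cases
        case 1
        have "s * (W (x, a) - V (x, r)) \<le> m" using Pa WU[OF aT(1,2)] by (simp add: P_def V_def)
        then show ?thesis using 1 k0 \<gamma> by simp
      next
        case 2
        then have "K * (tt - a)\<^sup>2 = 4 * Bd + 4" by (simp add: K_def)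
        then show ?thesis using sWV(1)[of x tt r] k0 z0 m2 \<gamma> Bd by linarith
      next
        case 3
        then have "A * r\<^sup>2 = 4 * Bd + 1" by (auto simp: A_def)
        then show ?thesis using sWV(1)[of x tt r] k0 z0 m2 \<gamma> Bd by linarith
      qed
    qed
    define \<rho> where "\<rho> = min (t1 / 2) (1 / 2)"
    have \<rho>: "\<rho> > 0" "\<rho> \<le> t1 / 2" "\<rho> \<le> 1 / 2" using t by (auto simp: \<rho>_def)
    have rI: "tt \<in> {0<..<T}" if "a - \<rho> \<le> tt" "tt \<le> a + 2 + \<rho>" for tt
      using that \<rho> ab t by (auto simp: T_def)
    have KA: "K \<ge> 0" "A \<ge> 0" using Bd by (auto simp: K_def A_def)
    show False
    proof (cases "s = 1")
      case True
      show False
      proof (rule comparison_core[where ?W1.0 = W and ?W2.0 = V and Bd = Bd and L = L' and a = K and ?t1.0 = a and b = \<zeta> and a' = A and ?s1.0 = 0 and b' = 0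
            and ?p1.0 = a and p1' = "a + 2" and ?p2.0 = "-1" and p2' = 1 and ?k1.0 = 1 and ?k2.0 = 0 and \<zeta> = \<zeta> and ?x0.0 = x2 and ?t0.0 = b and ?s0.0 = 0
            and ?I1.0 = "{0<..<T}" and ?I2.0 = UNIV and r = \<rho> and c = c])
        show "evol_super UNIV 0 c V" unfolding V_def by (rule evol_super_stationary[OF v(1)])
        show "W (x, tt) - V (x, r) - (K * (tt - a)\<^sup>2 + \<zeta> * tt + A * (r - 0)\<^sup>2 + 0 * r)
           < W (x2, b) - V (x2, 0) - (K * (b - a)\<^sup>2 + \<zeta> * b + A * (0 - 0)\<^sup>2 + 0 * 0)"
          if "a \<le> tt" "tt \<le> a + 2" "- 1 \<le> r" "r \<le> 1" "tt = a \<or> tt = a + 2 \<or> r = - 1 \<or> r = 1" for x tt r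
          using bdry[OF that, of x] n0 True by simp
      qed (use W V bd lip L' KA \<rho> rI ab \<zeta> in \<open>auto simp: K_def\<close>)
    next
      case False
      then have s1: "s = - 1" using s by simp
      show False
      proof (rule comparison_core[where ?W1.0 = V and ?W2.0 = W and Bd = Bd and L = L' and a = A and ?t1.0 = 0 and b = 0 and a' = K and ?s1.0 = a and b' = \<zeta>
            and ?p1.0 = "-1" and p1' = 1 and ?p2.0 = a and p2' = "a + 2" and ?k1.0 = 0 and ?k2.0 = 1 and \<zeta> = \<zeta> and ?x0.0 = x2 and ?t0.0 = 0 and ?s0.0 = b
            and ?I1.0 = UNIV and ?I2.0 = "{0<..<T}" and r = \<rho> and c = c])
        show "evol_sub UNIV 0 c V" unfolding V_def by (rule evol_sub_stationary[OF v(1)])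
        show "V (x, r) - W (x, tt) - (A * (r - 0)\<^sup>2 + 0 * r + K * (tt - a)\<^sup>2 + \<zeta> * tt)
           < V (x2, 0) - W (x2, b) - (A * (0 - 0)\<^sup>2 + 0 * 0 + K * (b - a)\<^sup>2 + \<zeta> * b)"
          if "- 1 \<le> r" "r \<le> 1" "a \<le> tt" "tt \<le> a + 2" "r = - 1 \<or> r = 1 \<or> tt = a \<or> tt = a + 2" for x tt r
          using bdry[of tt r x] that n0 s1 by auto
      qed (use W V bd lip L' KA \<rho> rI ab \<zeta> in \<open>auto simp: K_def\<close>)
    qed
  qed
  have "P t2 (m + e)" if "e > 0" for e
  proof (rule subdivision_nonincreasing[where P = P and K = K and ?t1.0 = t1 and ?t2.0 = t2])
    show "P t1 m" using init by (simp add: P_def)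
    show "P t m'" if "P t m" "m \<le> m'" for t m m' using that unfolding P_def by (meson order_trans)
  qed (use step t that in auto)
  then have "s * (U x t2 - v x) \<le> m + e" if "e > 0" for e using that unfolding P_def by blast
  then show ?thesis by (rule field_le_epsilon)
qed

end

section \<open>Upper limits as time tends to infinity\<close>

definition limsup_family :: "(nat => 'i set) => ('a => 'i => real) => 'a => real" where
  "limsup_family A \<Phi> x = (INF n. SUP i\<in>A n. \<Phi> x i)"

locale limsup_setup =
  fixes A :: "nat => 'i set" and \<Phi> :: "'a::euclidean_space => 'i => real" and Lo Hi \<Lambda> :: real
  assumes ne: "\<And>n. A n \<noteq> {}" and dec: "\<And>m n. m \<le> n ==> A n \<subseteq> A m"
    and hi: "\<And>x n i. i \<in> A n ==> \<Phi> x i \<le> Hi" and lo: "\<And>x n. \<exists>i\<in>A n. \<Phi> x i \<ge> Lo"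
    and lip: "\<And>x y n i. i \<in> A n ==> \<Phi> x i \<le> \<Phi> y i + \<Lambda> * norm (x - y)" and \<Lambda>: "\<Lambda> \<ge> 0"
begin

abbreviation "M \<equiv> limsup_family A \<Phi>"

lemma bdd: "bdd_above ((\<lambda>i. \<Phi> x i) ` A n)"
  using hi by (intro bdd_aboveI2)

lemma sup_lo: "(SUP i\<in>A n. \<Phi> x i) \<ge> Lo"
proof -
  obtain i where "i \<in> A n" "\<Phi> x i \<ge> Lo" using lo by blast
  then show ?thesis using cSUP_upper[OF _ bdd, of i n x] by simp
qed

lemma bdd_below: "bdd_below (range (\<lambda>n. SUP i\<in>A n. \<Phi> x i))"
  using sup_lo by (intro bdd_belowI2)

lemma lower:
  assumes "\<gamma> > 0" shows "\<exists>i\<in>A n. \<Phi> x i \<ge> M x - \<gamma>"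
proof -
  have "M x \<le> (SUP i\<in>A n. \<Phi> x i)" unfolding limsup_family_def by (rule cINF_lower[OF bdd_below]) simp
  then have "M x - \<gamma> < (SUP i\<in>A n. \<Phi> x i)" using assms by linarith
  then obtain i where "i \<in> A n" "M x - \<gamma> < \<Phi> x i"
    using less_cSUP_iff[OF ne bdd] by blast
  then show ?thesis by (intro bexI[of _ i]) auto
qed

lemma upper_pointwise:
  assumes "\<gamma> > 0" shows "\<exists>n. \<forall>i\<in>A n. \<Phi> x i \<le> M x + \<gamma>"
proof -
  have "M x < M x + \<gamma>" using assms by simp
  then obtain n where n: "(SUP i\<in>A n. \<Phi> x i) < M x + \<gamma>"
    unfolding limsup_family_def using cINF_less_iff[OF _ bdd_below] by blast
  show ?thesis using cSUP_upper[OF _ bdd, of _ n x] n by (intro exI[of _ n]) force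
qed

lemma M_lip: "M x \<le> M y + \<Lambda> * norm (x - y)"
proof (rule field_le_epsilon)
  fix e :: real assume e: "e > 0"
  obtain n where n: "\<forall>i\<in>A n. \<Phi> y i \<le> M y + e / 2" using upper_pointwise[of "e / 2" y] e by auto
  obtain i where i: "i \<in> A n" "\<Phi> x i \<ge> M x - e / 2" using lower[of "e / 2" n x] e by auto
  show "M x \<le> M y + \<Lambda> * norm (x - y) + e" using n i lip[OF i(1), of x y] by fastforce
qed

lemma M_continuous: "continuous_on S M"
proof -
  have "norm (M x - M y) \<le> \<Lambda> * norm (x - y)" for x y
    using M_lip[of x y] M_lip[of y x] by (simp add: abs_le_iff norm_minus_commute)
  then show ?thesis by (rule lipschitz_bound_continuous)
qed

text \<open>Pointwise bounds become uniform on compact sets through a finite net and the common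
  Lipschitz constant; because the sets \<open>A n\<close> decrease, the largest index serves all
  points of the net.\<close>

lemma upper:
  assumes \<gamma>: "\<gamma> > 0" and S: "compact S"
  shows "\<exists>n. \<forall>x\<in>S. \<forall>i\<in>A n. \<Phi> x i \<le> M x + \<gamma>"
proof -
  define \<Lambda>1 where "\<Lambda>1 = \<Lambda> + 1"
  have \<Lambda>1: "\<Lambda>1 > 0" "\<Lambda> \<le> \<Lambda>1" using \<Lambda> by (auto simp: \<Lambda>1_def)
  define r where "r = \<gamma> / (4 * \<Lambda>1)"
  have r: "r > 0" using \<gamma> \<Lambda>1 by (simp add: r_def)
  have "\<Lambda> * r \<le> \<Lambda>1 * r" using r \<Lambda>1 by (intro mult_right_mono) auto
  also have "\<dots> = \<gamma> / 4" using \<Lambda>1 by (simp add: r_def)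
  finally have \<Lambda>r: "\<Lambda> * r \<le> \<gamma> / 4" .
  obtain T where T: "finite T" "S \<subseteq> (\<Union>t\<in>T. ball t r)"
    using compactE_image[OF S, of S "\<lambda>t. ball t r"] r by (metis (no_types, lifting) UN_I centre_in_ball open_ball subsetI)
  have "\<forall>t. \<exists>n. \<forall>i\<in>A n. \<Phi> t i \<le> M t + \<gamma> / 4" using upper_pointwise \<gamma> by simp
  then obtain n where n: "\<And>t i. i \<in> A (n t) ==> \<Phi> t i \<le> M t + \<gamma> / 4" by metis
  define N where "N = Max (insert 0 (n ` T))"
  have "\<Phi> x i \<le> M x + \<gamma>" if x: "x \<in> S" and i: "i \<in> A N" for x i
  proof -
    obtain t where t: "t \<in> T" "x \<in> ball t r" using T(2) x by blast
    have "n t \<le> N" unfolding N_def using T(1) t(1) by (intro Max_ge) auto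
    then have it: "i \<in> A (n t)" using dec i by blast
    have d: "norm (x - t) \<le> r" using t(2) by (simp add: dist_norm norm_minus_commute)
    then have "\<Lambda> * norm (x - t) \<le> \<gamma> / 4" "\<Lambda> * norm (t - x) \<le> \<gamma> / 4"
      using \<Lambda>r mult_left_mono[OF d \<Lambda>] by (auto simp: norm_minus_commute)
    then show ?thesis using lip[OF i, of x t] M_lip[of t x] n[OF it] \<gamma> by linarith
  qed
  then show ?thesis by blast
qed

end

section \<open>Behaviour of the equation at degenerate points\<close>

lemma diffmat_zero_iff: "diffmat \<sigma> \<theta> x = 0 \<longleftrightarrow> \<sigma> \<theta> x = 0"
proof
  assume "diffmat \<sigma> \<theta> x = 0"
  then have "trace (diffmat \<sigma> \<theta> x ** mat 1) = 0" by (simp add: trace_def)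
  then have "(norm (\<sigma> \<theta> x))\<^sup>2 = 0"
    unfolding trace_diffmat by (simp add: diffusion_form_def power2_norm_eq_inner[symmetric] norm_columns)
  then show "\<sigma> \<theta> x = 0" by simp
next
  assume "\<sigma> \<theta> x = 0" then show "diffmat \<sigma> \<theta> x = 0" by (simp add: diffmat_def)
qed

lemma touch2_of_quadratic_max:
  assumes S: "linear S" "\<And>a b. S a \<bullet> b = a \<bullet> S b" and r: "r > 0"
    and max: "\<And>d. norm d < r ==> w (z + d) - \<chi>1 (z + d) \<le> w z - \<chi>1 z"
    and ex: "\<And>d. \<chi>1 (z + d) = \<chi>1 z + \<xi> \<bullet> d + S d \<bullet> d / 2"
  shows "touch2 w z \<xi> S"
proof -
  have "w (z + d) \<le> w z + \<xi> \<bullet> d + S d \<bullet> d / 2" if "norm d < r" for d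
    using max[OF that] ex[of d] by linarith
  then show ?thesis unfolding touch2_def using S r by blast
qed

context hjb
begin

lemma sigma_degenerate:
  assumes "x0 \<in> degen_set \<sigma>" shows "\<sigma> \<theta> x0 = 0" "norm (\<sigma> \<theta> x) \<le> C * norm (x - x0)"
proof -
  show z: "\<sigma> \<theta> x0 = 0" using assms by (simp add: degen_set_def diffmat_zero_iff)
  show "norm (\<sigma> \<theta> x) \<le> C * norm (x - x0)" using sigma_lip[of \<theta> x x0] z by (simp add: dist_norm)
qed

lemma df_norm_sq: "df \<theta> x (\<lambda>a. k * (norm a)\<^sup>2) = k * (norm (\<sigma> \<theta> x))\<^sup>2"
  by (simp add: diffusion_form_def sum_distrib_left[symmetric] norm_columns)

text \<open>The matrix \<sigma> is Lipschitz and vanishes at \<open>x0\<close>, so the diffusion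
  decays like the square of the distance. This decay competes against the large Hessians of the
  penalizations.\<close>

lemma df_degenerate:
  assumes "x0 \<in> degen_set \<sigma>" "k \<ge> 0" shows "df \<theta> x (\<lambda>a. k * (norm a)\<^sup>2) \<le> k * (C\<^sup>2 * (norm (x - x0))\<^sup>2)"
proof -
  have "(norm (\<sigma> \<theta> x))\<^sup>2 \<le> (C * norm (x - x0))\<^sup>2" using sigma_degenerate(2)[OF assms(1)] by (intro power_mono) auto
  then show ?thesis unfolding df_norm_sq using assms(2) by (intro mult_left_mono) (auto simp: power_mult_distrib)
qed

end

locale hjb_bounded = hjb_evol \<sigma> H C CR u c
  for \<sigma> :: "'th => real^'n => real^'n^'n" and H C CR u c +
  fixes B :: real
  assumes U_bd: "\<And>x t. t \<ge> 0 ==> \<bar>U x t\<bar> \<le> B"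
begin

text \<open>Negative times are sent to 0, which gives a continuous function on all of space-time;
  the equation is asserted only for positive times.\<close>

definition Ue :: "(real^'n) \<times> real => real" where "Ue = (\<lambda>(x, t). U x (max 0 t))"

lemma Ue_facts: "continuous_on UNIV Ue" "\<bar>Ue (x, t) - Ue (y, t)\<bar> \<le> C * norm (x - y)"
  "evol_sub {0<..} 1 c Ue" "evol_super {0<..} 1 c Ue" "\<bar>Ue z\<bar> \<le> B"
proof -
  have g: "continuous_on UNIV (\<lambda>t::real. max 0 t)" by (intro continuous_intros)
  have gI: "max 0 t = t" if "t \<in> {0<..}" for t :: real using that by auto
  note W = time_extension[OF g max.cobounded1 open_greaterThan order_refl gI, folded Ue_def]
  show "continuous_on UNIV Ue" "\<bar>Ue (x, t) - Ue (y, t)\<bar> \<le> C * norm (x - y)"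
    "evol_sub {0<..} 1 c Ue" "evol_super {0<..} 1 c Ue" using W by auto
  show "\<bar>Ue z\<bar> \<le> B" using U_bd[of "max 0 (snd z)" "fst z"] by (simp add: Ue_def split_def)
qed

lemma Ue_eq: "t \<ge> 0 ==> Ue (x, t) = U x t" by (simp add: Ue_def)

lemma B_nonneg: "B \<ge> 0" using U_bd[of 0 0] by linarith

text \<open>On a degenerate point the diffusion seen through the penalization \<open>|x - x0|\<^sup>2 / ep\<close> is of order
  \<open>ep\<close>, so the equation is essentially first order there.\<close>

lemma U_nonincreasing:
  assumes x0: "x0 \<in> degen_set \<sigma>" and Hc: "\<And>\<theta> p. H \<theta> x0 p \<ge> c" and t: "0 < t1" "t1 \<le> t2"
  shows "U x0 t2 \<le> U x0 t1"
proof -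
  define K where "K = B + 1"
  define P where "P t m \<longleftrightarrow> U x0 t \<le> m" for t m
  have step: "P b (m + K * (b - a)\<^sup>2)" if ab: "t1 \<le> a" "a \<le> b" "b \<le> t2" "b \<le> a + 1" and Pa: "P a m" for a b m
  proof (rule ccontr)
    assume "\<not> ?thesis"
    then have x2: "U x0 b > U x0 a + K * (b - a)\<^sup>2" using Pa by (simp add: P_def)
    have ab': "a < b"
    proof (rule ccontr)
      assume "\<not> a < b" then have "a = b" using ab by simp
      then show False using x2 by simp
    qed
    define \<gamma> where "\<gamma> = U x0 b - U x0 a - K * (b - a)\<^sup>2"
    have \<gamma>: "\<gamma> > 0" using x2 by (simp add: \<gamma>_def)
    define dd where "dd = b - a"
    have dd: "dd > 0" using ab' by (simp add: dd_def)
    define \<zeta> where "\<zeta> = \<gamma> / (2 * dd)"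
    have \<zeta>: "\<zeta> > 0" "\<zeta> * dd = \<gamma> / 2" using \<gamma> dd by (auto simp: \<zeta>_def)
    define R where "R = C + 1"
    have R: "R > 0" "C \<le> R" using C_pos by (auto simp: R_def)
    define E where "E = C^4 + CR R * C + C\<^sup>2 + 1"
    have E: "E \<ge> 1" using CR_pos[OF R(1)] C_pos by (simp add: E_def)
    \<comment> \<open>The first bound keeps the maximum within distance 1 of \<open>x0\<close>, the
      second excludes the initial time \<open>a\<close>, and the third makes diffusion and the error
      in \<open>H\<close> smaller than \<zeta>.\<close>
    define ep where "ep = min (min (1 / (2 * B + 1)) (\<gamma> / (2 * E))) (\<zeta> / (2 * E))"
    have ep: "ep > 0" using B_nonneg \<gamma> \<zeta> E by (simp add: ep_def)
    have "ep \<le> 1 / (2 * B + 1)" "ep \<le> \<gamma> / (2 * E)" "ep \<le> \<zeta> / (2 * E)" unfolding ep_def by linarith+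
    then have ep1: "2 * B + 1 \<le> 1 / ep" and ep2: "ep * (2 * E) \<le> \<gamma>" and ep3: "ep * (2 * E) \<le> \<zeta>"
      using ep B_nonneg E by (auto simp: pos_le_divide_eq mult.commute)
    define \<chi>1 where "\<chi>1 z = (1/ep) * ((fst z - x0) \<bullet> (fst z - x0)) + K * (snd z - a)\<^sup>2 + \<zeta> * (snd z - a)" for z :: "(real^'n) \<times> real"
    define N where "N = cball x0 1 \<times> {a..a + 2}"
    have "continuous_on N (\<lambda>z. Ue z - \<chi>1 z)" unfolding \<chi>1_def by (intro continuous_intros continuous_on_subset[OF Ue_facts(1)]) auto
    moreover have "compact N" "N \<noteq> {}" unfolding N_def by (auto intro: compact_Times)
    ultimately obtain z where z: "z \<in> N" "\<And>z'. z' \<in> N ==> Ue z' - \<chi>1 z' \<le> Ue z - \<chi>1 z"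
      using continuous_attains_sup[of N "\<lambda>z. Ue z - \<chi>1 z"] by blast
    obtain x t where xt: "z = (x, t)" by force
    have zN: "norm (x - x0) \<le> 1" "a \<le> t" "t \<le> a + 2" using z(1) by (auto simp: xt N_def dist_norm norm_minus_commute)
    have a0: "a > 0" using ab t by simp
    have UeU: "Ue (x, t) = U x t" "Ue (x0, b) = U x0 b" using a0 ab' zN by (auto intro: Ue_eq)
    have b2: "(x0, b) \<in> N" using ab' ab by (simp add: N_def)
    define n where "n = norm (x - x0)"
    have \<chi>xt: "\<chi>1 (x, t) = n\<^sup>2 / ep + K * (t - a)\<^sup>2 + \<zeta> * (t - a)"
      by (simp add: \<chi>1_def n_def power2_norm_eq_inner)
    have "\<chi>1 (x0, b) = K * (b - a)\<^sup>2 + \<gamma> / 2" using \<zeta>(2) by (simp add: \<chi>1_def dd_def)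
    then have "U x0 b - (K * (b - a)\<^sup>2 + \<gamma> / 2) \<le> U x t - (n\<^sup>2 / ep + K * (t - a)\<^sup>2 + \<zeta> * (t - a))"
      using z(2)[OF b2] UeU unfolding xt \<chi>xt by simp
    then have val: "U x t - (n\<^sup>2 / ep + K * (t - a)\<^sup>2 + \<zeta> * (t - a)) \<ge> U x0 a + \<gamma> / 2"
      using \<gamma>_def by linarith
    have k0: "n\<^sup>2 / ep \<ge> 0" "K * (t - a)\<^sup>2 \<ge> 0" "\<zeta> * (t - a) \<ge> 0" using ep B_nonneg \<zeta> zN by (auto simp: K_def)
    have ub: "U x t \<le> B" "U x0 a \<ge> - B" using U_bd[of t x] U_bd[of a x0] a0 zN by (auto simp: abs_le_iff)
    have n1: "n < 1"
    proof (rule ccontr)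
      assume "\<not> n < 1"
      then have "n = 1" using zN by (simp add: n_def)
      then have "n\<^sup>2 / ep \<ge> 2 * B + 1" using ep1 by simp
      then show False using val k0 ub \<gamma> by linarith
    qed
    have t2': "t < a + 2"
    proof (rule ccontr)
      assume "\<not> t < a + 2"
      then have "t = a + 2" using zN by simp
      then have "K * (t - a)\<^sup>2 = 4 * B + 4" by (simp add: K_def)
      then show False using val k0 ub \<gamma> B_nonneg by linarith
    qed
    have t1': "a < t"
    proof (rule ccontr)
      assume "\<not> a < t"
      then have ta: "t = a" using zN by simp
      have "U x a \<le> U x0 a + C * n" using U_lip[of a x x0] a0 by (simp add: n_def abs_le_iff)
      moreover have "U x a - n\<^sup>2 / ep \<ge> U x0 a + \<gamma> / 2" using val unfolding ta by simp
      ultimately have "C * n - n\<^sup>2 / ep \<ge> \<gamma> / 2" by linarith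
      moreover have "0 \<le> (n - C * ep)\<^sup>2 / ep" using ep by simp
      moreover have "(n - C * ep)\<^sup>2 / ep = n\<^sup>2 / ep - 2 * (C * n) + C\<^sup>2 * ep" using ep by (simp add: power2_eq_square field_simps)
      moreover have "C * n \<ge> 0" using C_pos by (simp add: n_def)
      moreover have "C\<^sup>2 * ep < E * ep" proof (rule mult_strict_right_mono[OF _ ep])
        have "C^4 \<ge> 0" "CR R * C \<ge> 0" using C_pos CR_pos[OF R(1)] by auto
        then show "C\<^sup>2 < E" unfolding E_def by linarith
      qed
      moreover have "ep * (2 * E) = 2 * (E * ep)" by simp
      ultimately show False using ep2 k0 by linarith
    qed
    define S where "S d = ((2/ep) *\<^sub>R fst d, 2 * K * snd d)" for d :: "(real^'n) \<times> real"
    have touch: "touch2 Ue (x, t) ((2/ep) *\<^sub>R (x - x0), 2 * K * (t - a) + \<zeta>) S"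
    proof (rule touch2_of_quadratic_max[where ?\<chi>1.0 = \<chi>1])
      show "linear S" by (rule linearI) (auto simp: S_def algebra_simps)
      show "S p \<bullet> q = p \<bullet> S q" for p q by (simp add: S_def inner_prod_def)
      show "min (1 - n) (min (t - a) (a + 2 - t)) > 0" using n1 t1' t2' by simp
      show "\<chi>1 ((x, t) + d) = \<chi>1 (x, t) + ((2/ep) *\<^sub>R (x - x0), 2 * K * (t - a) + \<zeta>) \<bullet> d + S d \<bullet> d / 2" for d
      proof -
        define w where "w = x - x0"
        have e: "x + fst d - x0 = w + fst d" by (simp add: w_def)
        have e1: "(w + fst d) \<bullet> (w + fst d) = w \<bullet> w + 2 * (w \<bullet> fst d) + fst d \<bullet> fst d"
          by (simp add: inner_add_left inner_add_right inner_commute[of "fst d" w])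
        have e2: "K * (t + snd d - a)\<^sup>2 = K * (t - a)\<^sup>2 + 2 * K * (t - a) * snd d + K * (snd d * snd d)"
          by (simp add: power2_eq_square algebra_simps)
        have e3: "((2/ep) *\<^sub>R w, 2 * K * (t - a) + \<zeta>) \<bullet> d = 2 * (w \<bullet> fst d) / ep + 2 * K * (t - a) * snd d + \<zeta> * snd d"
          by (simp add: inner_prod_def distrib_right)
        have e4: "S d \<bullet> d / 2 = (fst d \<bullet> fst d) / ep + K * (snd d * snd d)"
          by (simp add: S_def inner_prod_def add_divide_distrib)
        have e5: "\<zeta> * (t + snd d - a) = \<zeta> * (t - a) + \<zeta> * snd d" by (simp add: algebra_simps)
        have e6: "(w + fst d) \<bullet> (w + fst d) / ep = w \<bullet> w / ep + 2 * (w \<bullet> fst d) / ep + (fst d \<bullet> fst d) / ep"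
          unfolding e1 by (simp add: add_divide_distrib)
        have x1: "fst ((x, t) + d) - x0 = w + fst d" "snd ((x, t) + d) = t + snd d" "fst (x, t) - x0 = w" "snd (x, t) = t"
          using e by (simp_all add: w_def)
        have x2: "x - x0 = w" by (simp add: w_def)
        show ?thesis unfolding \<chi>1_def x1 x2 e3 e4 e2 e5 using e6 by simp
      qed
      show "Ue ((x, t) + d) - \<chi>1 ((x, t) + d) \<le> Ue (x, t) - \<chi>1 (x, t)" if d: "norm d < min (1 - n) (min (t - a) (a + 2 - t))" for d
      proof -
        have "norm (fst d) \<le> norm d" "\<bar>snd d\<bar> \<le> norm d" using norm_fst_le[of "fst d" "snd d"] norm_snd_le[of "snd d" "fst d"] by auto
        then have "norm (x + fst d - x0) \<le> 1" "a \<le> t + snd d" "t + snd d \<le> a + 2"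
          using d norm_triangle_ineq[of "x - x0" "fst d"] by (auto simp: n_def algebra_simps)
        then have "(x, t) + d \<in> N" by (cases d) (auto simp: N_def dist_norm norm_minus_commute)
        then show ?thesis using z(2) xt by simp
      qed
    qed
    have nP: "norm ((2/ep) *\<^sub>R (x - x0)) \<le> C" using touch2_norm_fst_le[OF touch Ue_facts(2)] C_pos by simp
    then have nep: "2 * n \<le> C * ep" using ep by (simp add: n_def pos_divide_le_eq)
    obtain \<theta> :: 'th where True by blast
    have "(2 * K * (t - a) + \<zeta>) - df \<theta> x (\<lambda>a. S (a, 0) \<bullet> (a, 0)) + H \<theta> x ((2/ep) *\<^sub>R (x - x0)) \<le> c"
    proof -
      have "t \<in> {0<..}" using t1' a0 by simp
      with Ue_facts(3) touch have "1 * (2 * K * (t - a) + \<zeta>) - df \<theta> x (\<lambda>a. S (a, 0) \<bullet> (a, 0)) + H \<theta> x ((2/ep) *\<^sub>R (x - x0)) \<le> c"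
        unfolding evol_sub_def by blast
      then show ?thesis by simp
    qed
    moreover have "df \<theta> x (\<lambda>a. S (a, 0) \<bullet> (a, 0)) \<le> C^4 * ep"
    proof -
      have "df \<theta> x (\<lambda>a. S (a, 0) \<bullet> (a, 0)) = df \<theta> x (\<lambda>a. (2/ep) * (norm a)\<^sup>2)" by (simp add: S_def power2_norm_eq_inner)
      also have "\<dots> \<le> (2/ep) * (C\<^sup>2 * n\<^sup>2)" unfolding n_def using ep by (intro df_degenerate x0) auto
      also have "\<dots> \<le> (2/ep) * (C\<^sup>2 * (C * ep / 2)\<^sup>2)"
        using nep ep by (intro mult_left_mono power_mono) (auto simp: n_def)
      also have "\<dots> = C^4 * ep / 2" using ep by (simp add: power2_eq_square power4_eq_xxxx)
      also have "\<dots> \<le> C^4 * ep" using ep C_pos by simp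
      finally show ?thesis .
    qed
    moreover have "H \<theta> x ((2/ep) *\<^sub>R (x - x0)) \<ge> c - CR R * C * ep"
    proof -
      have "\<bar>H \<theta> x ((2/ep) *\<^sub>R (x - x0)) - H \<theta> x0 ((2/ep) *\<^sub>R (x - x0))\<bar> \<le> CR R * (dist x x0 + dist ((2/ep) *\<^sub>R (x - x0)) ((2/ep) *\<^sub>R (x - x0)))"
        using nP R by (intro H_lip) auto
      also have "\<dots> \<le> CR R * (C * ep)"
      proof (rule mult_left_mono)
        have "n \<ge> 0" by (simp add: n_def)
        then have "n \<le> C * ep" using nep by linarith
        then show "dist x x0 + dist ((2/ep) *\<^sub>R (x - x0)) ((2/ep) *\<^sub>R (x - x0)) \<le> C * ep" by (simp add: n_def dist_norm)
      qed (use CR_pos[OF R(1)] in simp)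
      finally show ?thesis using Hc[of \<theta> "(2/ep) *\<^sub>R (x - x0)"] by (simp add: mult.assoc)
    qed
    moreover have "2 * K * (t - a) \<ge> 0" using zN B_nonneg by (simp add: K_def)
    ultimately have "\<zeta> \<le> (C^4 + CR R * C) * ep" by (simp add: distrib_right)
    also have "\<dots> \<le> E * ep" using ep by (intro mult_right_mono) (auto simp: E_def)
    finally have "\<zeta> \<le> E * ep" .
    moreover have "ep * (2 * E) = 2 * (E * ep)" by simp
    ultimately show False using ep3 \<zeta>(1) by linarith
  qed
  have "P t2 (U x0 t1 + e)" if "e > 0" for e
  proof (rule subdivision_nonincreasing[where P = P and K = K and ?t1.0 = t1 and ?t2.0 = t2])
    show "P t1 (U x0 t1)" by (simp add: P_def)
    show "P t m'" if "P t m" "m \<le> m'" for t m m' using that unfolding P_def by (meson order_trans)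
  qed (use step t that in auto)
  then have "U x0 t2 \<le> U x0 t1 + e" if "e > 0" for e using that unfolding P_def by blast
  then show ?thesis by (rule field_le_epsilon)
qed

text \<open>With \<open>k = - 1\<close> the supersolution property of \<open>u\<close> reads as a
  subsolution property of \<open>- U\<close>, so one stability argument serves both halves.\<close>

lemma U_subsolution_test:
  assumes C21: "C21_fun phi phit Dphi D2phi" and t0: "t0 > 0"
    and loc: "\<exists>e>0. \<forall>y s. dist (y, s) (x0, t0) < e --> s > 0 --> k * U y s - phi y s \<le> k * U x0 t0 - phi x0 t0" and k: "k = 1 \<or> k = - 1"
  shows "phit x0 t0 + k * (F x0 (k *\<^sub>R Dphi x0 t0) (k *\<^sub>R D2phi x0 t0) - c) \<le> 0"
proof -
  define psi where "psi y s = k * phi y s - c * s" for y s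
  have C: "C21_fun psi (\<lambda>y s. k * phit y s - c) (\<lambda>y s. k *\<^sub>R Dphi y s) (\<lambda>y s. k *\<^sub>R D2phi y s)"
    unfolding C21_fun_def
  proof (intro conjI allI)
    fix x :: "real^'n" and t :: real
    have "((\<lambda>(y, s). phi y s) has_derivative (\<lambda>(h, r). Dphi x t \<bullet> h + phit x t * r)) (at (x, t))"
      using C21 unfolding C21_fun_def by blast
    then have "((\<lambda>z. phi (fst z) (snd z)) has_derivative (\<lambda>h. Dphi x t \<bullet> fst h + phit x t * snd h)) (at (x, t))"
      by (simp add: split_def)
    then have "((\<lambda>z. k * phi (fst z) (snd z) - c * snd z) has_derivative (\<lambda>h. k * (Dphi x t \<bullet> fst h + phit x t * snd h) - c * snd h)) (at (x, t))"
      by (intro derivative_intros)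
    then show "((\<lambda>(y, s). psi y s) has_derivative (\<lambda>(h, r). (k *\<^sub>R Dphi x t) \<bullet> h + (k * phit x t - c) * r)) (at (x, t))"
      by (simp add: psi_def split_def algebra_simps)
    show "continuous_on UNIV (\<lambda>(x, t). k * phit x t - c)" "continuous_on UNIV (\<lambda>(x, t). k *\<^sub>R Dphi x t)" "continuous_on UNIV (\<lambda>(x, t). k *\<^sub>R D2phi x t)"
      using C21 unfolding C21_fun_def by (auto simp: split_def intro!: continuous_intros)
    have "((\<lambda>y. Dphi y t) has_derivative (\<lambda>h. D2phi x t *v h)) (at x)" using C21 unfolding C21_fun_def by blast
    then have "((\<lambda>y. k *\<^sub>R Dphi y t) has_derivative (\<lambda>h. k *\<^sub>R (D2phi x t *v h))) (at x)" by (rule has_derivative_scaleR_right)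
    then show "((\<lambda>y. k *\<^sub>R Dphi y t) has_derivative (*v) (k *\<^sub>R D2phi x t)) (at x)" by (simp add: scaleR_matrix_vector_assoc)
  qed
  show ?thesis
  proof (cases "k = 1")
    case True
    have "\<exists>e>0. \<forall>y s. dist (y, s) (x0, t0) < e --> s > 0 --> u y s - psi y s \<le> u x0 t0 - psi x0 t0"
      using loc True by (simp add: U_def psi_def algebra_simps)
    then have "(k * phit x0 t0 - c) + F x0 (k *\<^sub>R Dphi x0 t0) (k *\<^sub>R D2phi x0 t0) \<le> 0"
      using u_sol C t0 unfolding visc_sol_evol_def by blast
    then show ?thesis using True by simp
  next
    case False
    then have k1: "k = - 1" using k by simp
    have "\<exists>e>0. \<forall>y s. dist (y, s) (x0, t0) < e --> s > 0 --> u y s - psi y s \<ge> u x0 t0 - psi x0 t0"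
      using loc k1 by (simp add: U_def psi_def algebra_simps)
    then have "(k * phit x0 t0 - c) + F x0 (k *\<^sub>R Dphi x0 t0) (k *\<^sub>R D2phi x0 t0) \<ge> 0"
      using u_sol C t0 unfolding visc_sol_evol_def by blast
    then show ?thesis using k1 by simp
  qed
qed

lemma bellman_lsc:
  assumes k: "k = 1 \<or> k = - 1" and e: "e > 0"
  shows "\<exists>d>0. \<forall>x p X. norm (x - x0) < d --> norm (p - p0) < d --> norm (X - X0) < d -->
        k * (F x (k *\<^sub>R p) (k *\<^sub>R X) - c) > k * (F x0 (k *\<^sub>R p0) (k *\<^sub>R X0) - c) - e"
proof -
  define R where "R = norm p0 + 1"
  have R: "R > 0" by (simp add: R_def add_nonneg_pos)
  define E where "E = 2 * real CARD('n) * C\<^sup>2 * norm X0 + C\<^sup>2 + 2 * CR R + 1"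
  have E: "E > 0" unfolding E_def using CR_pos[OF R] by (intro add_nonneg_pos add_nonneg_nonneg) auto
  define d where "d = min 1 (e / (2 * E))"
  have d: "d > 0" "d \<le> 1" using e E by (auto simp: d_def)
  have "d \<le> e / (2 * E)" by (simp add: d_def)
  then have dE: "d * (2 * E) \<le> e" using E by (simp add: pos_le_divide_eq)
  have main: "k * (F x (k *\<^sub>R p) (k *\<^sub>R X) - c) > k * (F x0 (k *\<^sub>R p0) (k *\<^sub>R X0) - c) - e"
    if n: "norm (x - x0) < d" "norm (p - p0) < d" "norm (X - X0) < d" for x p X
  proof -
    have nk: "norm (k *\<^sub>R y) = norm y" for y :: "'z::real_normed_vector" using k by auto
    have nk2: "norm (k *\<^sub>R y - k *\<^sub>R z) = norm (y - z)" for y z :: "'z::real_normed_vector" by (metis nk scaleR_diff_right)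
    have "norm p \<le> norm (p - p0) + norm p0" by norm
    then have pR: "norm (k *\<^sub>R p0) \<le> R" "norm (k *\<^sub>R p) \<le> R" using n d unfolding nk R_def by linarith+
    have "\<bar>F x0 (k *\<^sub>R p0) (k *\<^sub>R X0) - F x (k *\<^sub>R p) (k *\<^sub>R X)\<bar> \<le> 2 * real CARD('n) * C\<^sup>2 * norm (k *\<^sub>R X0) * dist x0 x
        + norm (k *\<^sub>R X0 - k *\<^sub>R X) * C\<^sup>2 + CR R * (dist x0 x + dist (k *\<^sub>R p0) (k *\<^sub>R p))"
      by (rule bellman_lip[OF R pR])
    also have "\<dots> \<le> 2 * real CARD('n) * C\<^sup>2 * norm X0 * d + d * C\<^sup>2 + CR R * (d + d)"
      using n CR_pos[OF R] unfolding nk nk2 dist_norm by (intro add_mono mult_left_mono mult_right_mono) (auto simp: norm_minus_commute)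
    also have "\<dots> \<le> d * E" using d by (simp add: E_def algebra_simps)
    also have "d * E < e"
    proof -
      have "d * (2 * E) = 2 * (d * E)" by simp
      then show ?thesis using dE mult_pos_pos[OF d(1) E] by linarith
    qed
    finally have "\<bar>F x0 (k *\<^sub>R p0) (k *\<^sub>R X0) - F x (k *\<^sub>R p) (k *\<^sub>R X)\<bar> < e" .
    then show ?thesis using k by (auto simp: abs_less_iff)
  qed
  then show ?thesis using d(1) by blast
qed

lemma limit_test:
  assumes k: "k = 1 \<or> k = - 1"
    and approx: "\<And>\<gamma>. \<gamma> > 0 ==> \<exists>tb>1. k * U x0 tb \<ge> V x0 - \<gamma> \<and> (\<forall>x t. norm (x - x0) \<le> 1 --> \<bar>t - tb\<bar> \<le> 1 --> k * U x t \<le> V x + \<gamma>)"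
    and phi: "C2_fun phi Dphi D2phi" and touch: "e > 0" "\<And>y. norm (y - x0) < e ==> V y - phi y \<le> V x0 - phi x0"
  shows "k * (F x0 (k *\<^sub>R Dphi x0) (k *\<^sub>R D2phi x0) - c) \<le> 0"
proof (rule visc_limit_sub[where w = "\<lambda>x t. k * U x t" and F' = "\<lambda>x p X. k * (F x (k *\<^sub>R p) (k *\<^sub>R X) - c)", OF _ _ approx phi touch bellman_lsc[OF k]])
  show "phit x0 t0 + k * (F x0 (k *\<^sub>R Dphi x0 t0) (k *\<^sub>R D2phi x0 t0) - c) \<le> 0"
    if "C21_fun phi phit Dphi D2phi" "t0 > 0"
      "\<exists>e>0. \<forall>y s. dist (y, s) (x0, t0) < e --> s > 0 --> k * U y s - phi y s \<le> k * U x0 t0 - phi x0 t0"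
    for phi phit Dphi D2phi x0 t0
    using U_subsolution_test[OF that k] .
  show "continuous_on (UNIV \<times> {0<..}) (\<lambda>(x, t). k * U x t)"
    unfolding split_def by (intro continuous_intros continuous_on_subset[OF U_cont]) auto
qed auto

end

section \<open>Almost monotonicity in time\<close>

text \<open>The common setting of (A) and (B). In (A) \<open>v\<close> is the upper limit of
  \<open>U\<close>, \<open>G = H\<close>, \<open>QS = UNIV\<close> and \<open>K = {}\<close>; in (B)
  \<open>v = 0\<close>, \<open>G\<close> is the constant \<open>c\<close> and
  \<open>QS = {0}\<close>. The set \<open>QS\<close> records which gradients the jets of
  \<open>v\<close> can have, so that (B) has to supply the structural inequality only for
  \<open>q = 0\<close>; it is closed in order to survive limits.\<close>

locale hjb_key = hjb_bounded \<sigma> H C CR u c B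
  for \<sigma> :: "'th => real^'n => real^'n^'n" and H C CR u c B +
  fixes v :: "real^'n => real" and G :: "'th => real^'n => real^'n => real" and QS K :: "(real^'n) set" and LG \<mu> \<eta> \<kappa> :: real
  assumes sigma_per: "\<And>\<theta>. periodic_fun (\<sigma> \<theta>)"
    and v_per: "periodic_fun v" and v_lip: "\<And>x y. \<bar>v x - v y\<bar> \<le> C * norm (x - y)" and v_bd: "\<And>x. \<bar>v x\<bar> \<le> B"
    and v_sub: "stat_sub H c v" and v_subG: "stat_sub G c v"
    and QS: "\<And>z q Z. touch2 v z q Z ==> q \<in> QS" "closed QS"
    and LG: "LG \<ge> 0" and G_lip: "\<And>\<theta> x y p q. norm p \<le> C ==> norm q \<le> C ==> \<bar>G \<theta> x p - G \<theta> y q\<bar> \<le> LG * (dist x y + dist p q)"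
    and mu: "1 < \<mu>" "\<mu> \<le> 3/2"
    and struct: "\<And>\<theta> x Q q. q \<in> QS ==> norm Q \<le> C ==> norm q \<le> C ==>
       0 \<le> H \<theta> x (\<mu> *\<^sub>R Q - (\<mu> - 1) *\<^sub>R q) - \<mu> * H \<theta> x Q + (\<mu> - 1) * G \<theta> x q"
    and strict: "\<And>x Q q. x \<in> degen_set \<sigma> ==> x \<notin> K ==> q \<in> QS ==> norm Q \<le> C ==> norm q \<le> C ==> Q \<noteq> q ==>
       \<exists>d>0. \<forall>\<theta>. d \<le> H \<theta> x (\<mu> *\<^sub>R Q - (\<mu> - 1) *\<^sub>R q) - \<mu> * H \<theta> x Q + (\<mu> - 1) * G \<theta> x q"
    and K: "\<And>x. x \<in> K ==> x \<in> degen_set \<sigma>" "\<And>x \<theta> p. x \<in> K ==> H \<theta> x p \<ge> c"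
    and SS: "SS_cond \<sigma> \<kappa>" and kappa: "CR (2 * C) \<le> \<kappa>"
    and eta: "\<eta> > 0"
begin

definition \<Phi> :: "real^'n => real \<times> real => real" where
  "\<Phi> x = (\<lambda>(t, s). U x t - \<mu> * U x s + (\<mu> - 1) * v x - \<eta> * (s - t))"

definition A :: "nat => (real \<times> real) set" where
  "A n = {(t, s). real n \<le> t \<and> t \<le> s}"

text \<open>The bound for \<Phi> on the diagonal \<open>s = t\<close>, which belongs to the boundary
  of the time domain and is therefore out of reach of the equations; only larger maxima have to be
  excluded.\<close>

definition thr :: real where "thr = (\<mu> - 1) * (2 * B)"

lemma thr_nonneg: "thr \<ge> 0" using mu B_nonneg by (simp add: thr_def)

lemma \<Phi>_diag: "t \<ge> 0 ==> \<bar>\<Phi> x (t, t)\<bar> \<le> thr"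
proof -
  assume t: "t \<ge> 0"
  have e: "\<Phi> x (t, t) = (\<mu> - 1) * (v x - U x t)" by (simp add: \<Phi>_def algebra_simps)
  have "\<bar>v x - U x t\<bar> \<le> 2 * B" using v_bd[of x] U_bd[OF t, of x] by linarith
  then have "(\<mu> - 1) * \<bar>v x - U x t\<bar> \<le> (\<mu> - 1) * (2 * B)" using mu by (intro mult_left_mono) auto
  then show ?thesis unfolding e thr_def abs_mult using mu by simp
qed

text \<open>The term with \<eta> drives \<Phi> down as \<open>s - t\<close> grows, which confines
  the second time to a compact interval.\<close>

lemma \<Phi>_upper: "t \<ge> 0 ==> s \<ge> 0 ==> \<Phi> x (t, s) \<le> 3 * B - \<eta> * (s - t)"
proof -
  assume ts: "t \<ge> 0" "s \<ge> 0"
  have "- U x s \<le> B" using U_bd[OF ts(2), of x] by (simp add: abs_le_iff)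
  then have "\<mu> * (- U x s) \<le> \<mu> * B" using mu by (intro mult_left_mono) auto
  moreover have "(\<mu> - 1) * v x \<le> (\<mu> - 1) * B" using v_bd[of x] mu by (intro mult_left_mono) (auto simp: abs_le_iff)
  moreover have "2 * \<mu> * B \<le> 3 * B" using mu B_nonneg by (intro mult_right_mono) auto
  moreover have "U x t \<le> B" using U_bd[OF ts(1), of x] by (simp add: abs_le_iff)
  ultimately show ?thesis by (simp add: \<Phi>_def algebra_simps)
qed

lemma \<Phi>_lip:
  assumes ts: "t \<ge> 0" "s \<ge> 0"
  shows "U x t - \<mu> * U y s + (\<mu> - 1) * v z - \<eta> * (s - t) \<le> \<Phi> x (t, s) + 2 * C * norm (x - y) + C * norm (x - z)"
proof -
  have "\<mu> * (U x s - U y s) \<le> \<mu> * (C * norm (x - y))" using U_lip[OF ts(2), of x y] mu by (intro mult_left_mono) (auto simp: abs_le_iff)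
  also have "\<dots> \<le> 2 * (C * norm (x - y))" using mu C_pos by (intro mult_right_mono) auto
  finally have 1: "\<mu> * (U x s - U y s) \<le> 2 * C * norm (x - y)" by simp
  have "(\<mu> - 1) * (v z - v x) \<le> (\<mu> - 1) * (C * norm (x - z))" using v_lip[of z x] mu by (intro mult_left_mono) (auto simp: abs_le_iff norm_minus_commute)
  also have "\<dots> \<le> 1 * (C * norm (x - z))" using mu C_pos by (intro mult_right_mono) auto
  finally have 2: "(\<mu> - 1) * (v z - v x) \<le> C * norm (x - z)" by simp
  show ?thesis using 1 2 by (simp add: \<Phi>_def algebra_simps)
qed

text \<open>The Lipschitz constant \<open>4 * C\<close> adds \<open>C\<close> for the first term,
  \<open>2 * C\<close> for the one multiplied by \<mu>, and \<open>C\<close> for the one with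
  \<open>v\<close>.\<close>

sublocale ls: limsup_setup A \<Phi> "- thr" "3 * B" "4 * C"
proof
  show "A n \<noteq> {}" for n unfolding A_def by (auto intro: exI[of _ "real n"])
  show "A n \<subseteq> A m" if "m \<le> n" for m n using that unfolding A_def by auto
  show "\<Phi> x i \<le> 3 * B" if "i \<in> A n" for x n i
  proof -
    obtain t s where i: "i = (t, s)" by force
    have "0 \<le> t" "t \<le> s" using that by (auto simp: A_def i)
    then have "0 \<le> \<eta> * (s - t)" using eta by simp
    then show ?thesis using \<Phi>_upper[of t s x] \<open>0 \<le> t\<close> \<open>t \<le> s\<close> by (simp add: i)
  qed
  show "\<exists>i\<in>A n. - thr \<le> \<Phi> x i" for x n
    using \<Phi>_diag[of "real n" x] by (intro bexI[of _ "(real n, real n)"]) (auto simp: A_def)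
  show "\<Phi> x i \<le> \<Phi> y i + 4 * C * norm (x - y)" if "i \<in> A n" for x y n i
  proof -
    obtain t s where i: "i = (t, s)" by force
    have ts: "0 \<le> t" "0 \<le> s" using that by (auto simp: A_def i)
    have "\<Phi> x (t, s) \<le> \<Phi> y (t, s) + (U x t - U y t) + \<mu> * (U y s - U x s) + (\<mu> - 1) * (v x - v y)"
      by (simp add: \<Phi>_def algebra_simps)
    moreover have "U x t - U y t \<le> C * norm (x - y)" using U_lip[OF ts(1), of x y] by (simp add: abs_le_iff)
    moreover have "\<mu> * (U y s - U x s) \<le> 2 * (C * norm (x - y))"
    proof -
      have "\<mu> * (U y s - U x s) \<le> \<mu> * (C * norm (x - y))" using U_lip[OF ts(2), of y x] mu by (intro mult_left_mono) (auto simp: abs_le_iff norm_minus_commute)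
      also have "\<dots> \<le> 2 * (C * norm (x - y))" using mu C_pos by (intro mult_right_mono) auto
      finally show ?thesis .
    qed
    moreover have "(\<mu> - 1) * (v x - v y) \<le> 1 * (C * norm (x - y))"
    proof -
      have "(\<mu> - 1) * (v x - v y) \<le> (\<mu> - 1) * (C * norm (x - y))" using v_lip[of x y] mu by (intro mult_left_mono) (auto simp: abs_le_iff)
      also have "\<dots> \<le> 1 * (C * norm (x - y))" using mu C_pos by (intro mult_right_mono) auto
      finally show ?thesis .
    qed
    ultimately show ?thesis by (simp add: i)
  qed
  show "0 \<le> 4 * C" using C_pos by simp
qed

abbreviation "M \<equiv> limsup_family A \<Phi>"

lemma M_per: "int_vec k ==> M (x + k) = M x"
proof -
  assume k: "int_vec k"
  have "\<Phi> (x + k) i = \<Phi> x i" if "i \<in> A n" for i n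
  proof -
    obtain t s where i: "i = (t, s)" by force
    have ts: "0 \<le> t" "0 \<le> s" using that by (auto simp: A_def i)
    show ?thesis using U_per[OF ts(1)] U_per[OF ts(2)] v_per k by (simp add: \<Phi>_def i periodic_fun_def)
  qed
  then show ?thesis unfolding limsup_family_def by (intro INF_cong SUP_cong refl) simp
qed

lemma degen_per: "int_vec k ==> x + k \<in> degen_set \<sigma> \<longleftrightarrow> x \<in> degen_set \<sigma>"
  using sigma_per by (simp add: degen_set_def diffmat_zero_iff periodic_fun_def)

lemma degen_closed: "closed (degen_set \<sigma>)"
proof -
  have c: "continuous_on UNIV (\<sigma> \<theta>)" for \<theta>
  proof (rule lipschitz_bound_continuous)
    show "norm (\<sigma> \<theta> x - \<sigma> \<theta> y) \<le> C * norm (x - y)" for x y using sigma_lip[of \<theta> x y] by (simp add: dist_norm)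
  qed
  have "degen_set \<sigma> = (\<Inter>\<theta>. {x. \<sigma> \<theta> x = 0})" by (auto simp: degen_set_def diffmat_zero_iff)
  then show ?thesis using c by (auto intro!: closed_INT closed_Collect_eq)
qed

lemma M_max: obtains xm where "xm \<in> cbox 0 1" "\<And>x. M x \<le> M xm"
proof -
  define Q where "Q = cbox (0::real^'n) 1"
  have "compact Q" unfolding Q_def by (rule compact_cbox)
  moreover have "0 \<in> Q" by (simp add: Q_def mem_box_cart)
  ultimately obtain xm where xm: "xm \<in> Q" "\<And>x. x \<in> Q ==> M x \<le> M xm"
    using continuous_attains_sup[of Q M] ls.M_continuous by blast
  show thesis
  proof (rule that[of xm])
    show "M x \<le> M xm" for x
    proof -
      obtain k where k: "int_vec k" "x + k \<in> cbox 0 1" using unit_cube_translate by blast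
      then show ?thesis using xm(2)[of "x + k"] M_per[OF k(1), of x] by (simp add: Q_def)
    qed
  qed (use xm in \<open>simp add: Q_def\<close>)
qed

text \<open>Finite times that realize the upper limit at \<open>x0\<close> up to \<alpha>. The
  margin \<open>T + 1 \<le> tb\<close> leaves room for a time window of radius 1 on which the
  uniform upper bound still holds.\<close>

lemma near_limsup:
  assumes S: "compact S" and \<alpha>: "\<alpha> > 0"
  obtains T tb sb where "T \<ge> 1" "\<And>x t s. x \<in> S ==> T \<le> t ==> t \<le> s ==> \<Phi> x (t, s) \<le> M x + \<alpha>"
    "T + 1 \<le> tb" "tb \<le> sb" "\<Phi> x0 (tb, sb) \<ge> M x0 - \<alpha>"
proof -
  obtain n where n: "\<forall>x\<in>S. \<forall>i\<in>A n. \<Phi> x i \<le> M x + \<alpha>" using ls.upper[OF \<alpha> S] by blast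
  obtain i where i: "i \<in> A (n + 2)" "\<Phi> x0 i \<ge> M x0 - \<alpha>" using ls.lower[OF \<alpha>] by blast
  obtain tb sb where tb: "i = (tb, sb)" by force
  show thesis by (rule that[of "real n + 1" tb sb]) (use n i in \<open>auto simp: A_def tb\<close>)
qed

text \<open>The doubled inequality at a maximum of \<open>M - ep1 * \<psi>\<close> contains
  \<open>ep1\<close> times the strict inequality for \<psi>. The additional gradient
  \<open>ep1 * D\<psi>\<close> changes \<open>H\<close> by at most \<open>CR (2 * C)\<close> times
  its norm, which \<kappa> absorbs; the opposite slopes of \<eta> in the two times cancel, and all
  other errors are small compared with \<open>ep1 * \<nu>\<close>.\<close>

lemma strict_supersolution_point:
  assumes \<psi>: "C2_fun \<psi> D\<psi> D2\<psi>" and ep1: "0 < ep1" and \<psi>b: "\<And>x. norm (x - xs) \<le> 1 ==> ep1 * \<bar>\<psi> x\<bar> \<le> 1 \<and> ep1 * \<bar>\<psi> x\<bar> \<le> (f - thr) / 2"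
    and f: "f > thr" "M xs - ep1 * \<psi> xs \<ge> f" and maxi: "\<And>x. norm (x - xs) \<le> 1 ==> M x - ep1 * \<psi> x \<le> M xs - ep1 * \<psi> xs"
    and strictp: "\<And>\<theta>. - trace (diffmat \<sigma> \<theta> xs ** D2\<psi> xs) - \<kappa> * norm (D\<psi> xs) \<ge> \<nu>" and \<nu>: "\<nu> > 0"
  shows False
proof -
  define R where "R = 2 * C"
  have R: "R > 0" "C \<le> R" using C_pos by (auto simp: R_def)
  have CRp: "CR R > 0" using CR_pos[OF R(1)] .
  have \<kappa>0: "\<kappa> > 0" using kappa CRp by (simp add: R_def)
  \<comment> \<open>A modulus, independent of \<theta>, for the change of the strict inequality
    between \<open>x\<close> and \<open>xs\<close>. It leaves at least \<open>\<nu> / 2\<close> on a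
    small ball.\<close>
  define e where "e x = 2 * real CARD('n) * C\<^sup>2 * norm (D2\<psi> x) * norm (x - xs) + C\<^sup>2 * norm (D2\<psi> x - D2\<psi> xs) + \<kappa> * norm (D\<psi> x - D\<psi> xs)" for x
  have cD: "continuous_on UNIV D\<psi>" "continuous_on UNIV D2\<psi>"
    using \<psi> unfolding C2_fun_def
    by (auto intro!: differentiable_imp_continuous_within continuous_at_imp_continuous_on simp: differentiable_def) blast
  have "isCont e xs" unfolding e_def using cD by (auto intro!: continuous_intros simp: continuous_on_eq_continuous_at)
  then have "(e \<longlongrightarrow> e xs) (at xs)" by (simp add: isCont_def)
  moreover have e0: "e xs = 0" by (simp add: e_def)
  ultimately have "\<forall>\<^sub>F x in at xs. e x < \<nu> / 2" using order_tendstoD(2)[of e 0 "at xs" "\<nu> / 2"] \<nu> by simp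
  then obtain \<rho>0 where \<rho>0: "\<rho>0 > 0" "\<And>x. x \<noteq> xs ==> norm (x - xs) < \<rho>0 ==> e x < \<nu> / 2"
    unfolding eventually_at dist_norm by blast
  define \<rho> where "\<rho> = min 1 (\<rho>0 / 2)"
  have \<rho>: "\<rho> > 0" "\<rho> \<le> 1" "\<rho> < \<rho>0" using \<rho>0(1) by (auto simp: \<rho>_def)
  have e\<rho>: "e x \<le> \<nu> / 2" if "norm (x - xs) \<le> \<rho>" for x
    using \<rho>0(2)[of x] that \<rho> e0 \<nu> by (cases "x = xs") auto
  define E where "E = 2 * CR R + 2 * C\<^sup>2 + 1"
  have E: "E > 0" using CRp by (simp add: E_def add_pos_nonneg add_nonneg_pos)
  \<comment> \<open>The parameters \<omega>, \<open>tol\<close> and \<alpha> each use up a sixteenth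
    of \<open>ep1 * \<nu>\<close>, in total less than the half that remains after the change of
    point.\<close>
  define \<omega> where "\<omega> = ep1 * \<nu> / (16 * E)"
  have \<omega>: "\<omega> > 0" "\<omega> * E = ep1 * \<nu> / 16" using ep1 \<nu> E by (auto simp: \<omega>_def)
  define E' where "E' = CR R + 1"
  have E': "E' > 0" using CRp by (simp add: E'_def)
  define tol where "tol = ep1 * \<nu> / (16 * E')"
  have tol: "tol > 0" "tol * E' = ep1 * \<nu> / 16" using ep1 \<nu> E' by (auto simp: tol_def)
  define \<alpha> where "\<alpha> = min (min (\<omega> * \<rho>\<^sup>2 / 4) (ep1 * \<nu> / 128)) (min (1/2) ((f - thr) / 8))"
  have \<alpha>: "\<alpha> > 0" using \<omega> \<rho> ep1 \<nu> f by (simp add: \<alpha>_def)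
  have "\<alpha> \<le> \<omega> * \<rho>\<^sup>2 / 4" "\<alpha> \<le> ep1 * \<nu> / 128" "\<alpha> \<le> 1/2" "\<alpha> \<le> (f - thr) / 8" unfolding \<alpha>_def by linarith+
  then have \<alpha>': "4 * \<alpha> \<le> \<omega> * \<rho>\<^sup>2" "8 * \<alpha> \<le> ep1 * \<nu> / 16" "\<alpha> \<le> 1/2" "8 * \<alpha> \<le> f - thr" by simp_all
  obtain T tb sb where T: "T \<ge> 1" "\<And>x t s. x \<in> cball xs 1 ==> T \<le> t ==> t \<le> s ==> \<Phi> x (t, s) \<le> M x + \<alpha>"
    and tb: "T + 1 \<le> tb" "tb \<le> sb" "\<Phi> xs (tb, sb) \<ge> M xs - \<alpha>"
    using near_limsup[OF compact_cball \<alpha>] by blast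
  \<comment> \<open>At this time difference \<Phi> is at most -4, whereas the maximum is above -3
    even after the correction by \<psi>.\<close>
  define S0 where "S0 = (3 * B + 4) / \<eta>"
  have S0: "S0 > 0" "\<eta> * S0 = 3 * B + 4" using B_nonneg eta by (auto simp: S0_def)
  define f' where "f' = M xs - ep1 * \<psi> xs"
  have f': "f' \<ge> f" using f by (simp add: f'_def)
  define N where "N = cball xs \<rho> \<times> {p. tb - 1 \<le> fst p \<and> fst p \<le> tb + 1 \<and> fst p \<le> snd p \<and> snd p \<le> fst p + S0}"
  have Nx: "(x, t, s) \<in> N \<longleftrightarrow> norm (x - xs) \<le> \<rho> \<and> tb - 1 \<le> t \<and> t \<le> tb + 1 \<and> t \<le> s \<and> s \<le> t + S0" for x t s
    by (auto simp: N_def dist_norm norm_minus_commute)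
  have cN: "compact N"
  proof -
    have "closed {p::real\<times>real. tb - 1 \<le> fst p \<and> fst p \<le> tb + 1 \<and> fst p \<le> snd p \<and> snd p \<le> fst p + S0}"
      by (intro closed_Collect_conj closed_Collect_le continuous_intros)
    moreover have "{p::real\<times>real. tb - 1 \<le> fst p \<and> fst p \<le> tb + 1 \<and> fst p \<le> snd p \<and> snd p \<le> fst p + S0} \<subseteq> {tb - 1..tb + 1} \<times> {tb - 1..tb + 1 + S0}"
      by auto
    moreover have "bounded ({tb - 1..tb + 1} \<times> {tb - 1..tb + 1 + S0})" by (intro bounded_Times bounded_closed_interval)
    ultimately have "compact {p::real\<times>real. tb - 1 \<le> fst p \<and> fst p \<le> tb + 1 \<and> fst p \<le> snd p \<and> snd p \<le> fst p + S0}"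
      using bounded_subset compact_eq_bounded_closed by blast
    then show ?thesis unfolding N_def by (intro compact_Times compact_cball)
  qed
  define h where "h x t s = Ue (x, t) - \<mu> * Ue (x, s) + (\<mu> - 1) * v x
     - (ep1 * \<psi> x + \<omega> * (norm (x - xs))\<^sup>2 + (4 * \<alpha>) * (t - tb)\<^sup>2 + (- \<eta>) * t + 0 * (s - 0)\<^sup>2 + \<eta> * s)" for x t s
  have h\<Phi>: "h x t s = \<Phi> x (t, s) - ep1 * \<psi> x - \<omega> * (norm (x - xs))\<^sup>2 - 4 * \<alpha> * (t - tb)\<^sup>2" if "t \<ge> 0" "s \<ge> 0" for x t s
    using that by (simp add: h_def \<Phi>_def Ue_eq algebra_simps)
  have tb0: "tb \<ge> 2" using tb(1) T(1) by linarith
  have h0: "h xs tb sb \<ge> f' - \<alpha>" using h\<Phi>[of tb sb xs] tb tb0 by (simp add: f'_def)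
  have \<psi>xs: "ep1 * \<bar>\<psi> x\<bar> \<le> 1" "ep1 * \<psi> x \<ge> - (f - thr) / 2" "- 1 \<le> ep1 * \<psi> x" if "norm (x - xs) \<le> \<rho>" for x
  proof -
    have b: "ep1 * \<bar>\<psi> x\<bar> \<le> 1" "ep1 * \<bar>\<psi> x\<bar> \<le> (f - thr) / 2" using \<psi>b[of x] that \<rho>(2) by auto
    have "\<bar>ep1 * \<psi> x\<bar> = ep1 * \<bar>\<psi> x\<bar>" using ep1 by (simp add: abs_mult)
    then show "ep1 * \<bar>\<psi> x\<bar> \<le> 1" "ep1 * \<psi> x \<ge> - (f - thr) / 2" "- 1 \<le> ep1 * \<psi> x" using b by linarith+
  qed
  have n0: "(xs, tb, sb) \<in> N"
  proof -
    have "- 1 - \<alpha> \<le> \<Phi> xs (tb, sb)"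
      using tb(3) f(2) f(1) thr_nonneg \<psi>xs(3)[of xs] \<rho>(1) by simp
    also have "\<dots> \<le> 3 * B - \<eta> * (sb - tb)" using \<Phi>_upper[of tb sb xs] tb tb0 by simp
    finally have "\<eta> * (sb - tb) \<le> \<eta> * S0" using S0(2) \<alpha>'(3) by linarith
    then have "sb - tb \<le> S0" using eta by simp
    then show ?thesis using tb \<rho> by (simp add: Nx)
  qed
  have int: "(x, t, s) \<in> interior N" if xN: "(x, t, s) \<in> N" and hv: "h x t s \<ge> h xs tb sb" for x t s
  proof -
    have b: "norm (x - xs) \<le> \<rho>" "tb - 1 \<le> t" "t \<le> tb + 1" "t \<le> s" "s \<le> t + S0" using xN unfolding Nx by auto
    have ts: "t \<ge> 0" "s \<ge> 0" "T \<le> t" using b tb tb0 T by auto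
    have x1: "norm (x - xs) \<le> 1" using b \<rho> by simp
    then have "\<Phi> x (t, s) \<le> M x + \<alpha>" using T(2)[of x t s] ts b by (simp add: dist_norm norm_minus_commute)
    moreover have "M x - ep1 * \<psi> x \<le> f'" using maxi[OF x1] by (simp add: f'_def)
    ultimately have hle: "h x t s \<le> f' + \<alpha> - \<omega> * (norm (x - xs))\<^sup>2 - 4 * \<alpha> * (t - tb)\<^sup>2" using h\<Phi>[OF ts(1,2), of x] by linarith
    have k0: "\<omega> * (norm (x - xs))\<^sup>2 \<ge> 0" "4 * \<alpha> * (t - tb)\<^sup>2 \<ge> 0" using \<omega> \<alpha> by auto
    have v1: "f' - \<alpha> \<le> h x t s" using hv h0 by linarith
    have "norm (x - xs) \<noteq> \<rho>"
    proof
      assume "norm (x - xs) = \<rho>"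
      then have "4 * \<alpha> \<le> \<omega> * (norm (x - xs))\<^sup>2" using \<alpha>'(1) by simp
      then show False using hle v1 k0 \<alpha> by linarith
    qed
    moreover have "\<bar>t - tb\<bar> \<noteq> 1"
    proof
      assume "\<bar>t - tb\<bar> = 1"
      then have "(t - tb)\<^sup>2 = 1" by (metis abs_square_eq_1)
      then have "4 * \<alpha> * (t - tb)\<^sup>2 = 4 * \<alpha>" by simp
      then show False using hle v1 k0 \<alpha> by linarith
    qed
    \<comment> \<open>Here the threshold enters: on the diagonal \<Phi> is at most
      \<open>thr\<close>, and the correction by \<psi> recovers only half of the difference to
      \<open>f\<close>.\<close>
    moreover have "s \<noteq> t"
    proof
      assume st: "s = t"
      have "\<Phi> x (t, t) \<le> thr" using \<Phi>_diag[OF ts(1), of x] by (simp add: abs_le_iff)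
      then have "h x t t \<le> thr + (f - thr) / 2" using h\<Phi>[OF ts(1,1), of x] k0 \<psi>xs(2)[OF b(1)] by linarith
      then have "h x t s \<le> thr + (f - thr) / 2" using st by simp
      moreover have False if "a \<le> th + (f - th) / 2" "f' - \<alpha> \<le> a" "f \<le> f'" "8 * \<alpha> \<le> f - th" "th < f" "0 < \<alpha>" for a th :: real
        using that by argo
      ultimately show False using v1 f' \<alpha>'(4) f(1) \<alpha> by blast
    qed
    moreover have "s \<noteq> t + S0"
    proof
      assume st: "s = t + S0"
      have "\<Phi> x (t, s) \<le> - 4" using \<Phi>_upper[OF ts(1,2), of x] S0(2) st by simp
      then have "h x t s \<le> - 3" using h\<Phi>[OF ts(1,2), of x] k0 \<psi>xs(3)[OF b(1)] by linarith
      then show False using v1 f' \<alpha>'(3) f(1) thr_nonneg by linarith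
    qed
    ultimately have st: "norm (x - xs) < \<rho>" "tb - 1 < t" "t < tb + 1" "t < s" "s < t + S0" using b by auto
    define O' where "O' = {z :: (real^'n) \<times> real \<times> real. norm (fst z - xs) < \<rho> \<and> tb - 1 < fst (snd z) \<and> fst (snd z) < tb + 1 \<and> fst (snd z) < snd (snd z) \<and> snd (snd z) < fst (snd z) + S0}"
    have "open O'" unfolding O'_def by (intro open_Collect_conj open_Collect_less continuous_intros)
    moreover have "O' \<subseteq> N"
    proof
      fix z assume "z \<in> O'"
      then show "z \<in> N" using Nx[of "fst z" "fst (snd z)" "snd (snd z)"] by (simp add: O'_def)
    qed
    moreover have "(x, t, s) \<in> O'" using st by (simp add: O'_def)
    ultimately show ?thesis using interior_maximal by blast
  qed
  have cv: "continuous_on UNIV v" by (rule lipschitz_bound_continuous[where L = C]) (use v_lip in auto)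
  have "\<exists>x t s P Q q \<theta> z Z. (x, t, s) \<in> N \<and> norm P \<le> C \<and> norm Q \<le> C \<and> norm q \<le> C \<and> touch2 v z q Z \<and>
    norm (P - (\<mu> *\<^sub>R Q - (\<mu> - 1) *\<^sub>R q + ep1 *\<^sub>R D\<psi> x + (2 * \<omega>) *\<^sub>R (x - xs))) \<le> tol \<and>
    1 * (2 * (4 * \<alpha>) * (t - tb) + (- \<eta>)) + 1 * (2 * 0 * (s - 0) + \<eta>) + H \<theta> x P - \<mu> * H \<theta> x Q + (\<mu> - 1) * G \<theta> x q
      \<le> c * (1 - \<mu> + (\<mu> - 1)) + ep1 * df \<theta> x (\<lambda>e. (D2\<psi> x *v e) \<bullet> e) + 2 * \<omega> * C\<^sup>2 + tol"
  proof (rule doubling_pde[where LG = LG and G = G and r = "1/2" and ?I1.0 = "{0<..}" and ?I2.0 = "{0<..}"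
        and ?W1.0 = Ue and ?W2.0 = Ue and Bd = B and ?k1.0 = 1 and ?k2.0 = 1 and c = c and \<psi> = \<psi>, OF Ue_facts(1) Ue_facts(1) cv Ue_facts(5) Ue_facts(5) v_bd _ Ue_facts(2) Ue_facts(2) v_lip \<psi> _ _ _ _ _ cN n0 _ _ _ _ _ _ Ue_facts(3,4) v_subG LG _ tol(1)])
    show "(x, t, s) \<in> interior N" if "(x, t, s) \<in> N"
      "Ue (xs, tb) - \<mu> * Ue (xs, sb) + (\<mu> - 1) * v xs - (ep1 * \<psi> xs + \<omega> * (norm (xs - xs))\<^sup>2 + (4 * \<alpha>) * (tb - tb)\<^sup>2 + (- \<eta>) * tb + 0 * (sb - 0)\<^sup>2 + \<eta> * sb)
      \<le> Ue (x, t) - \<mu> * Ue (x, s) + (\<mu> - 1) * v x - (ep1 * \<psi> x + \<omega> * (norm (x - xs))\<^sup>2 + (4 * \<alpha>) * (t - tb)\<^sup>2 + (- \<eta>) * t + 0 * (s - 0)\<^sup>2 + \<eta> * s)" for x t s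
      using int that unfolding h_def by blast
    show "t' \<in> {0<..}" if "(x, t, s) \<in> N" "\<bar>t' - t\<bar> \<le> 1/2" for x t s t'
    proof -
      have "t - 1/2 \<le> t'" using that(2) unfolding abs_le_iff by linarith
      moreover have "tb - 1 \<le> t" using that(1) unfolding Nx by simp
      ultimately show ?thesis using tb0 by simp
    qed
    show "s' \<in> {0<..}" if "(x, t, s) \<in> N" "\<bar>s' - s\<bar> \<le> 1/2" for x t s s'
    proof -
      have "s - 1/2 \<le> s'" using that(2) unfolding abs_le_iff by linarith
      moreover have "tb - 1 \<le> t" "t \<le> s" using that(1) unfolding Nx by simp_all
      ultimately show ?thesis using tb0 by simp
    qed
    show "\<bar>G \<theta> x q - G \<theta> y q\<bar> \<le> LG * norm (x - y)" if "norm q \<le> C" for \<theta> x y q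
      using G_lip[OF that that, of \<theta> x y] by (simp add: dist_norm)
  qed (use C_pos \<omega> \<alpha> mu in auto)
  then obtain x t s P Q q \<theta> z Z where J: "(x, t, s) \<in> N" "norm P \<le> C" "norm Q \<le> C" "norm q \<le> C" "touch2 v z q Z"
    "norm (P - (\<mu> *\<^sub>R Q - (\<mu> - 1) *\<^sub>R q + ep1 *\<^sub>R D\<psi> x + (2 * \<omega>) *\<^sub>R (x - xs))) \<le> tol"
    "1 * (2 * (4 * \<alpha>) * (t - tb) + (- \<eta>)) + 1 * (2 * 0 * (s - 0) + \<eta>) + H \<theta> x P - \<mu> * H \<theta> x Q + (\<mu> - 1) * G \<theta> x q
      \<le> c * (1 - \<mu> + (\<mu> - 1)) + ep1 * df \<theta> x (\<lambda>e. (D2\<psi> x *v e) \<bullet> e) + 2 * \<omega> * C\<^sup>2 + tol" by blast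
  have xs: "norm (x - xs) \<le> \<rho>" "\<bar>t - tb\<bar> \<le> 1" using J(1) unfolding Nx by auto
  define P' where "P' = \<mu> *\<^sub>R Q - (\<mu> - 1) *\<^sub>R q"
  have nP': "norm P' \<le> R"
  proof -
    have "norm P' \<le> norm (\<mu> *\<^sub>R Q) + norm ((\<mu> - 1) *\<^sub>R q)" unfolding P'_def by (rule norm_triangle_ineq4)
    also have "\<dots> \<le> \<mu> * C + (\<mu> - 1) * C" using J(3,4) mu by (intro add_mono) (auto intro: mult_left_mono)
    also have "\<dots> = (2 * \<mu> - 1) * C" by (simp add: algebra_simps)
    \<comment> \<open>The restriction \<open>\<mu> \<le> 3/2\<close> gives exactly the radius
      \<open>2 * C\<close> to which \<kappa> refers.\<close>
    also have "\<dots> \<le> 2 * C" using mu C_pos by (intro mult_right_mono) auto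
    finally show ?thesis by (simp add: R_def)
  qed
  have PP': "norm (P - P') \<le> tol + ep1 * norm (D\<psi> x) + 2 * \<omega>"
  proof -
    have "P - P' = (P - (P' + ep1 *\<^sub>R D\<psi> x + (2 * \<omega>) *\<^sub>R (x - xs))) + ep1 *\<^sub>R D\<psi> x + (2 * \<omega>) *\<^sub>R (x - xs)" by simp
    then have "norm (P - P') \<le> norm (P - (P' + ep1 *\<^sub>R D\<psi> x + (2 * \<omega>) *\<^sub>R (x - xs))) + norm (ep1 *\<^sub>R D\<psi> x) + norm ((2 * \<omega>) *\<^sub>R (x - xs))"
      by (metis norm_triangle_mono norm_triangle_ineq order_refl)
    moreover have "norm ((2 * \<omega>) *\<^sub>R (x - xs)) \<le> 2 * \<omega> * 1" using xs \<rho> \<omega> by simp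
    ultimately show ?thesis using J(6) ep1 by (simp add: P'_def)
  qed
  have "\<bar>H \<theta> x P - H \<theta> x P'\<bar> \<le> CR R * (dist x x + dist P P')" using J(2) nP' R by (intro H_lip) auto
  also have "\<dots> \<le> CR R * (tol + ep1 * norm (D\<psi> x) + 2 * \<omega>)" using PP' CRp by (intro mult_left_mono) (auto simp: dist_norm)
  finally have HP: "H \<theta> x P \<ge> H \<theta> x P' - CR R * (tol + ep1 * norm (D\<psi> x) + 2 * \<omega>)" by linarith
  have st: "0 \<le> H \<theta> x P' - \<mu> * H \<theta> x Q + (\<mu> - 1) * G \<theta> x q"
    unfolding P'_def by (rule struct[OF QS(1)[OF J(5)] J(3,4)])
  have "- (8 * \<alpha>) \<le> 8 * \<alpha> * (t - tb)" using xs(2) \<alpha> mult_left_mono[of "- 1" "t - tb" "8 * \<alpha>"] by simp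
  then have main: "- (8 * \<alpha>) - CR R * (tol + ep1 * norm (D\<psi> x) + 2 * \<omega>) \<le> ep1 * df \<theta> x (\<lambda>e. (D2\<psi> x *v e) \<bullet> e) + 2 * \<omega> * C\<^sup>2 + tol"
    using J(7) HP st by simp
  have "CR R * (ep1 * norm (D\<psi> x)) \<le> \<kappa> * (ep1 * norm (D\<psi> x))" using kappa ep1 by (intro mult_right_mono) (auto simp: R_def)
  then have "ep1 * (- df \<theta> x (\<lambda>e. (D2\<psi> x *v e) \<bullet> e) - \<kappa> * norm (D\<psi> x)) \<le> 8 * \<alpha> + tol * E' + \<omega> * E"
    using main \<omega>(1) by (simp add: E_def E'_def algebra_simps)
  also have "\<dots> \<le> 3 * (ep1 * \<nu> / 16)" using \<alpha>'(2) tol(2) \<omega>(2) by linarith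
  finally have up: "ep1 * (- df \<theta> x (\<lambda>e. (D2\<psi> x *v e) \<bullet> e) - \<kappa> * norm (D\<psi> x)) \<le> 3 * (ep1 * \<nu> / 16)" .
  have "- df \<theta> x (\<lambda>e. (D2\<psi> x *v e) \<bullet> e) - \<kappa> * norm (D\<psi> x) \<ge> \<nu> - e x"
  proof -
    have "\<nu> \<le> - df \<theta> xs (\<lambda>e. (D2\<psi> xs *v e) \<bullet> e) - \<kappa> * norm (D\<psi> xs)" using strictp[of \<theta>] by (simp add: trace_diffmat)
    moreover have "\<bar>df \<theta> x (\<lambda>e. (D2\<psi> x *v e) \<bullet> e) - df \<theta> xs (\<lambda>e. (D2\<psi> x *v e) \<bullet> e)\<bar> \<le> 2 * real CARD('n) * C\<^sup>2 * norm (D2\<psi> x) * norm (x - xs)"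
      using df_matrix_lip[of \<theta> x "D2\<psi> x" xs] by (simp add: dist_norm)
    moreover have "\<bar>df \<theta> xs (\<lambda>e. (D2\<psi> x *v e) \<bullet> e) - df \<theta> xs (\<lambda>e. (D2\<psi> xs *v e) \<bullet> e)\<bar> \<le> C\<^sup>2 * norm (D2\<psi> x - D2\<psi> xs)"
    proof -
      have "df \<theta> xs (\<lambda>e. (D2\<psi> x *v e) \<bullet> e) - df \<theta> xs (\<lambda>e. (D2\<psi> xs *v e) \<bullet> e) = df \<theta> xs (\<lambda>e. ((D2\<psi> x - D2\<psi> xs) *v e) \<bullet> e)"
        by (simp add: diffusion_form_def sum_subtractf matrix_vector_mult_diff_rdistrib inner_diff_left)
      then show ?thesis using df_abs_le[OF matrix_form_bound, of "D2\<psi> x - D2\<psi> xs" \<theta> xs] by (simp add: mult.commute)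
    qed
    moreover have "\<kappa> * norm (D\<psi> x) \<le> \<kappa> * norm (D\<psi> xs) + \<kappa> * norm (D\<psi> x - D\<psi> xs)"
    proof -
      have "norm (D\<psi> x) \<le> norm (D\<psi> xs) + norm (D\<psi> x - D\<psi> xs)" by norm
      then show ?thesis unfolding distrib_left[symmetric] using \<kappa>0 by (intro mult_left_mono) auto
    qed
    ultimately show ?thesis unfolding e_def by linarith
  qed
  then have "\<nu> / 2 \<le> - df \<theta> x (\<lambda>e. (D2\<psi> x *v e) \<bullet> e) - \<kappa> * norm (D\<psi> x)" using e\<rho>[OF xs(1)] by linarith
  then have "ep1 * (\<nu> / 2) \<le> ep1 * (- df \<theta> x (\<lambda>e. (D2\<psi> x *v e) \<bullet> e) - \<kappa> * norm (D\<psi> x))" using ep1 by (intro mult_left_mono) auto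
  moreover have "ep1 * (\<nu> / 2) = ep1 * \<nu> / 2" by simp
  ultimately have "ep1 * \<nu> / 2 \<le> 3 * (ep1 * \<nu> / 16)" using up by linarith
  moreover have "ep1 * \<nu> > 0" using ep1 \<nu> by simp
  ultimately show False by linarith
qed

end

section \<open>A large maximum of the upper limit lies on the degenerate set\<close>

context hjb_key
begin

lemma strict_lower:
  assumes "(INF \<theta>. - trace (diffmat \<sigma> \<theta> x ** X)) - \<kappa> * p > 0"
  obtains \<nu> where "\<nu> > 0" "\<And>\<theta>. - trace (diffmat \<sigma> \<theta> x ** X) - \<kappa> * p \<ge> \<nu>"
proof (rule that[OF assms])
  fix \<theta>
  have "- trace (diffmat \<sigma> \<theta>' x ** X) \<ge> - (norm X * C\<^sup>2)" for \<theta>'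
    using df_abs_le[OF matrix_form_bound, of X \<theta>' x] by (simp add: trace_diffmat abs_le_iff)
  then have "bdd_below (range (\<lambda>\<theta>. - trace (diffmat \<sigma> \<theta> x ** X)))" by (intro bdd_belowI2)
  then have "(INF \<theta>. - trace (diffmat \<sigma> \<theta> x ** X)) \<le> - trace (diffmat \<sigma> \<theta> x ** X)" by (rule cINF_lower) simp
  then show "- trace (diffmat \<sigma> \<theta> x ** X) - \<kappa> * p \<ge> (INF \<theta>. - trace (diffmat \<sigma> \<theta> x ** X)) - \<kappa> * p" by simp
qed

text \<open>Maximize \<open>M - ep1 * \<psi>\<close> over a compact set containing \<Omega>. As
  \<psi> is nonpositive inside and nonnegative outside, \<open>xm\<close> does at least as well as
  any point outside, so the maximum is attained in \<Omega>. There strictness of \<psi> leaves only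
  the \<delta>-neighbourhood, and smallness of \<open>ep1\<close> keeps the value of
  \<open>M\<close> near its maximum.\<close>

lemma near_max_near_degenerate:
  assumes xm: "xm \<in> cbox 0 1" "\<And>x. M x \<le> M xm" and gt: "M xm > thr"
    and d: "\<delta> > 0" "\<gamma> > 0"
  obtains x where "x \<in> degen_nbhd \<sigma> \<delta>" "M x \<ge> M xm - \<gamma>"
proof -
  obtain \<psi> D\<psi> D2\<psi> and \<Omega> :: "(real^'n) set" where \<psi>: "C2_fun \<psi> D\<psi> D2\<psi>" and \<Omega>: "open \<Omega>" "bounded \<Omega>"
      "{x. \<forall>i. 0 \<le> x $ i \<and> x $ i \<le> 1} \<subseteq> \<Omega>"
    and neg: "\<And>x. x \<in> \<Omega> ==> \<psi> x \<le> 0" and pos: "\<And>x. x \<notin> \<Omega> ==> \<psi> x \<ge> 0"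
    and st: "\<And>x. x \<notin> degen_nbhd \<sigma> \<delta> ==> x \<in> \<Omega> ==> (INF \<theta>. - trace (diffmat \<sigma> \<theta> x ** D2\<psi> x)) - \<kappa> * norm (D\<psi> x) > 0"
  proof -
    obtain \<psi> D\<psi> D2\<psi> and \<Omega> :: "(real^'n) set" where *: "C2_fun \<psi> D\<psi> D2\<psi> \<and> open \<Omega> \<and> bounded \<Omega> \<and>
      {x. \<forall>i. 0 \<le> x $ i \<and> x $ i \<le> 1} \<subseteq> \<Omega> \<and>
      (\<forall>x\<in>\<Omega>. \<psi> x \<le> 0) \<and> (\<forall>x\<in>- \<Omega>. \<psi> x \<ge> 0) \<and>
      (\<forall>x\<in>- degen_nbhd \<sigma> \<delta> \<inter> \<Omega>.
         (INF \<theta>. - trace (diffmat \<sigma> \<theta> x ** D2\<psi> x)) - \<kappa> * norm (D\<psi> x) > 0)"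
      using mp[OF spec[OF SS[unfolded SS_cond_def]] d(1)] by (elim exE) (rule that)
    note r1 = conjunct2[OF *] note r2 = conjunct2[OF r1] note r3 = conjunct2[OF r2] note r4 = conjunct2[OF r3] note r5 = conjunct2[OF r4]
    note 1 = conjunct1[OF *] and 2 = conjunct1[OF r1] and 3 = conjunct1[OF r2] and 4 = conjunct1[OF r3]
      and 5 = conjunct1[OF r4] and 6 = conjunct1[OF r5] and 7 = conjunct2[OF r5]
    show thesis
    proof (rule that[OF 1 2 3 4])
      show "\<psi> x \<le> 0" if "x \<in> \<Omega>" for x using 5 that by (rule bspec)
      show "\<psi> x \<ge> 0" if "x \<notin> \<Omega>" for x by (rule bspec[OF 6]) (use that in simp)
      show "(INF \<theta>. - trace (diffmat \<sigma> \<theta> x ** D2\<psi> x)) - \<kappa> * norm (D\<psi> x) > 0" if "x \<notin> degen_nbhd \<sigma> \<delta>" "x \<in> \<Omega>" for x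
        by (rule bspec[OF 7]) (use that in simp)
    qed
  qed
  have xm\<Omega>: "xm \<in> \<Omega>" using xm(1) \<Omega>(3) by (auto simp: mem_box_cart)
  obtain \<rho>0 where \<rho>0: "\<And>x. x \<in> \<Omega> ==> norm x \<le> \<rho>0" using \<Omega>(2) by (auto simp: bounded_iff)
  \<comment> \<open>The margin 1 makes room for the unit ball around the maximum point on which the
    local argument takes place.\<close>
  define D where "D = cball (0::real^'n) (\<rho>0 + 1)"
  have D: "compact D" "\<And>x y. x \<in> \<Omega> ==> norm (y - x) \<le> 1 ==> y \<in> D"
  proof -
    show "compact D" unfolding D_def by (rule compact_cball)
    fix x y :: "real^'n" assume "x \<in> \<Omega>" "norm (y - x) \<le> 1"
    then show "y \<in> D" using \<rho>0[of x] norm_triangle_sub[of y x] by (simp add: D_def)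
  qed
  have c\<psi>: "continuous_on S \<psi>" for S
  proof -
    have "\<psi> differentiable (at x)" for x using \<psi> unfolding C2_fun_def differentiable_def by blast
    then show ?thesis by (intro continuous_at_imp_continuous_on) (auto intro: differentiable_imp_continuous_within)
  qed
  obtain b where b: "b > 0" "\<And>x. x \<in> D ==> \<bar>\<psi> x\<bar> \<le> b"
  proof -
    have "bounded (\<psi> ` D)" using compact_continuous_image[OF c\<psi> D(1)] by (rule compact_imp_bounded)
    then obtain b where "b > 0" "\<forall>y\<in>\<psi> ` D. norm y \<le> b" unfolding bounded_pos by blast
    then show thesis by (intro that[of b]) auto
  qed
  define g0 where "g0 = (M xm - thr) / 2"
  have g0: "g0 > 0" using gt by (simp add: g0_def)
  define ep1 where "ep1 = min (1 / b) (min (g0 / b) (\<gamma> / b))"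
  have ep1: "ep1 > 0" using b g0 d by (simp add: ep1_def)
  have "ep1 \<le> 1 / b" "ep1 \<le> g0 / b" "ep1 \<le> \<gamma> / b" unfolding ep1_def by linarith+
  then have eb: "ep1 * b \<le> 1" "ep1 * b \<le> g0" "ep1 * b \<le> \<gamma>" using b(1) by (simp_all add: pos_le_divide_eq)
  have e\<psi>: "ep1 * \<bar>\<psi> x\<bar> \<le> ep1 * b" if "x \<in> D" for x using b(2)[OF that] ep1 by (intro mult_left_mono) auto
  define g where "g x = M x - ep1 * \<psi> x" for x
  have gxm: "g xm \<ge> M xm" using neg[OF xm\<Omega>] ep1 by (simp add: g_def mult_nonneg_nonpos)
  have xmD: "xm \<in> D" using D(2)[OF xm\<Omega>, of xm] by simp
  have "continuous_on D g" unfolding g_def by (intro continuous_intros ls.M_continuous c\<psi>)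
  then obtain y where y: "y \<in> D" "\<And>x. x \<in> D ==> g x \<le> g y"
    using continuous_attains_sup[OF D(1), of g] xmD by blast
  obtain xs where xs: "xs \<in> \<Omega>" "g xs \<ge> M xm" "\<And>x. x \<in> D ==> g x \<le> g xs"
  proof (cases "y \<in> \<Omega>")
    case True
    show thesis using y(2)[OF xmD] gxm by (intro that[OF True _ y(2)]) auto
  next
    case False
    then have "g y \<le> M y" using pos[OF False] ep1 by (simp add: g_def)
    then have "g y \<le> g xm" using xm(2)[of y] gxm by linarith
    then show thesis using y(2) gxm by (intro that[OF xm\<Omega>]) (blast intro: order_trans)+
  qed
  have "xs \<in> degen_nbhd \<sigma> \<delta>"
  proof (rule ccontr)
    assume "xs \<notin> degen_nbhd \<sigma> \<delta>"
    from strict_lower[OF st[OF this xs(1)]]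
    obtain \<nu> where \<nu>: "\<nu> > 0" "\<And>\<theta>. - trace (diffmat \<sigma> \<theta> xs ** D2\<psi> xs) - \<kappa> * norm (D\<psi> xs) \<ge> \<nu>" by blast
    show False
    proof (rule strict_supersolution_point[where f = "M xm", OF \<psi> ep1 _ gt _ _ \<nu>(2) \<nu>(1)])
      show "ep1 * \<bar>\<psi> x\<bar> \<le> 1 \<and> ep1 * \<bar>\<psi> x\<bar> \<le> (M xm - thr) / 2" if "norm (x - xs) \<le> 1" for x
        using e\<psi>[OF D(2)[OF xs(1) that]] eb unfolding g0_def by linarith
      show "M xm \<le> M xs - ep1 * \<psi> xs" using xs(2) by (simp add: g_def)
      show "M x - ep1 * \<psi> x \<le> M xs - ep1 * \<psi> xs" if "norm (x - xs) \<le> 1" for x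
        using xs(3)[OF D(2)[OF xs(1) that]] by (simp add: g_def)
    qed
  qed
  moreover have "M xs \<ge> M xm - \<gamma>"
  proof -
    have "xs \<in> D" using D(2)[OF xs(1), of xs] by simp
    have "ep1 * \<bar>\<psi> xs\<bar> \<le> \<gamma>" using e\<psi>[OF \<open>xs \<in> D\<close>] eb(3) by linarith
    moreover have "- (ep1 * \<bar>\<psi> xs\<bar>) \<le> ep1 * \<psi> xs" using ep1 unfolding mult_minus_right[symmetric] by (intro mult_left_mono) auto
    ultimately show ?thesis using xs(2) by (simp add: g_def)
  qed
  ultimately show thesis by (rule that)
qed

text \<open>As \<delta> tends to 0 the near-maximal points approach the degenerate set, and the
  Lipschitz bound on \<open>M\<close> transfers their values to it; periodicity supplies
  compactness. A point in the neighbourhood with \<delta> = 1 already shows that the degenerate set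
  is nonempty.\<close>

lemma max_attained_degenerate:
  assumes gt: "M y > thr"
  obtains x0 where "x0 \<in> degen_set \<sigma>" "\<And>x. M x \<le> M x0"
proof -
  obtain xm where xm: "xm \<in> cbox 0 1" "\<And>x. M x \<le> M xm" using M_max by blast
  have gt': "M xm > thr" using gt xm(2)[of y] by linarith
  define Q where "Q = cbox (0::real^'n) 1"
  have cQ: "compact (degen_set \<sigma> \<inter> Q)" unfolding Q_def using closed_Int_compact[OF degen_closed compact_cbox] .
  have tr: "\<exists>x'\<in>degen_set \<sigma> \<inter> Q. M x' = M x" if "x \<in> degen_set \<sigma>" for x
  proof -
    obtain k where k: "int_vec k" "x + k \<in> cbox 0 1" using unit_cube_translate by blast
    show ?thesis by (rule bexI[of _ "x + k"]) (use k that M_per[OF k(1), of x] degen_per[OF k(1), of x] in \<open>auto simp: Q_def\<close>)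
  qed
  obtain z0 where "z0 \<in> degen_nbhd \<sigma> 1" using near_max_near_degenerate[OF xm gt', of 1 1] by auto
  then have ne: "degen_set \<sigma> \<noteq> {}" by (simp add: degen_nbhd_def)
  then have "degen_set \<sigma> \<inter> Q \<noteq> {}" using tr by blast
  then obtain x0 where x0: "x0 \<in> degen_set \<sigma>" "\<And>x. x \<in> degen_set \<sigma> \<inter> Q ==> M x \<le> M x0"
    using continuous_attains_sup[OF cQ _ ls.M_continuous] by blast
  have x0': "M x \<le> M x0" if "x \<in> degen_set \<sigma>" for x
  proof -
    from tr[OF that] obtain x' where "x' \<in> degen_set \<sigma> \<inter> Q" "M x' = M x" by blast
    then show ?thesis using x0(2)[of x'] by simp
  qed
  have "M xm \<le> M x0"
  proof (rule field_le_epsilon)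
    fix e :: real assume e: "e > 0"
    define \<delta> where "\<delta> = e / (8 * C)"
    have \<delta>: "\<delta> > 0" "4 * C * \<delta> = e / 2" using e C_pos by (auto simp: \<delta>_def)
    obtain x where x: "x \<in> degen_nbhd \<sigma> \<delta>" "M x \<ge> M xm - e / 2"
      using near_max_near_degenerate[OF xm gt' \<delta>(1), of "e / 2"] e by auto
    obtain y where y: "y \<in> degen_set \<sigma>" "infdist x (degen_set \<sigma>) = dist x y"
      using infdist_attains_inf[OF degen_closed ne] by blast
    have "norm (x - y) \<le> \<delta>" using x(1) y(2) by (simp add: degen_nbhd_def dist_norm)
    then have "4 * C * norm (x - y) \<le> 4 * C * \<delta>" using C_pos by (intro mult_left_mono) auto
    then show "M xm \<le> M x0 + e" using ls.M_lip[of x y] x0'[OF y(1)] x(2) \<delta>(2) by linarith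
  qed
  then show thesis using that[OF x0(1)] xm(2) by (blast intro: order_trans)
qed

text \<open>On \<open>K\<close> the function \<open>U x0\<close> is bounded and nonincreasing in
  time, so between late times it drops by little; what remains of \<Phi> is at most the diagonal
  bound.\<close>

lemma M_le_thr_on_K:
  assumes x0: "x0 \<in> K"
  shows "M x0 \<le> thr"
proof (rule field_le_epsilon)
  fix e :: real assume e: "e > 0"
  have bb: "bdd_below ((\<lambda>t. U x0 t) ` {1..})"
    using U_bd[of _ x0] by (intro bdd_belowI2[of _ "- B"]) (auto simp: abs_le_iff minus_le_iff)
  define I where "I = (INF t\<in>{1..}. U x0 t)"
  have "I < I + e / 2" using e by simp
  then obtain T where T: "T \<ge> 1" "U x0 T < I + e / 2"
    unfolding I_def using cINF_less_iff[OF _ bb, of "I + e / 2"] I_def by auto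
  obtain n :: nat where n: "T \<le> real n" using real_arch_simple by blast
  obtain i where i: "i \<in> A n" "\<Phi> x0 i \<ge> M x0 - e / 2" using ls.lower[of "e / 2" n x0] e by auto
  obtain t s where ts: "i = (t, s)" "T \<le> t" "t \<le> s" using i(1) n by (auto simp: A_def)
  have "U x0 t \<le> U x0 T" using U_nonincreasing[OF K(1)[OF x0] K(2)[OF x0], of T t] ts T by simp
  moreover have "I \<le> U x0 s" unfolding I_def using ts T by (intro cINF_lower bb) auto
  moreover have "(\<mu> - 1) * (v x0 - U x0 s) \<le> thr"
  proof -
    have "v x0 - U x0 s \<le> 2 * B" using v_bd[of x0] U_bd[of s x0] ts T by (simp add: abs_le_iff)
    then show ?thesis unfolding thr_def using mu by (intro mult_left_mono) auto
  qed
  moreover have "\<eta> * (s - t) \<ge> 0" using ts eta by simp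
  moreover have "\<Phi> x0 (t, s) = (U x0 t - U x0 s) + (\<mu> - 1) * (v x0 - U x0 s) - \<eta> * (s - t)" by (simp add: \<Phi>_def algebra_simps)
  ultimately show "M x0 \<le> thr + e" using i(2) T(2) unfolding ts(1) by linarith
qed

end

lemma norm_square_expansion:
  fixes x :: "'a::real_inner"
  shows "(norm (x + e - y))\<^sup>2 = (norm (x - y))\<^sup>2 + 2 * ((x - y) \<bullet> e) + e \<bullet> e"
proof -
  have "x + e - y = (x - y) + e" by simp
  then show ?thesis by (simp only: power2_norm_eq_inner inner_add_left inner_add_right inner_commute[of e "x - y"])
qed

lemma touch2_of_separated_quadratic_max:
  fixes x :: "real^'n"
  assumes r: "r > 0" and loc: "\<And>d. norm d < r ==> W ((x, t) + d) - g (x + fst d) - h (t + snd d) \<le> W (x, t) - g x - h t"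
    and g: "\<And>e. g (x + e) = g x + \<xi> \<bullet> e + k * (e \<bullet> e) / 2" and h: "\<And>e. h (t + e) = h t + \<tau> * e + l * (e * e) / 2"
  shows "touch2 W (x, t) (\<xi>, \<tau>) (\<lambda>d. (k *\<^sub>R fst d, l * snd d))"
proof (rule touch2_of_quadratic_max[where ?\<chi>1.0 = "\<lambda>z. g (fst z) + h (snd z)", OF _ _ r])
  show "linear (\<lambda>d. (k *\<^sub>R fst d, l * snd d))" by (rule linearI) (auto simp: algebra_simps)
  show "(k *\<^sub>R fst a, l * snd a) \<bullet> b = a \<bullet> (k *\<^sub>R fst b, l * snd b)" for a b :: "(real^'n) \<times> real" by (simp add: inner_prod_def)
  show "W ((x, t) + d) - (g (fst ((x, t) + d)) + h (snd ((x, t) + d))) \<le> W (x, t) - (g (fst (x, t)) + h (snd (x, t)))" if "norm d < r" for d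
    using loc[OF that] by (simp add: algebra_simps)
  show "g (fst ((x, t) + d)) + h (snd ((x, t) + d)) = g (fst (x, t)) + h (snd (x, t)) + (\<xi>, \<tau>) \<bullet> d + (k *\<^sub>R fst d, l * snd d) \<bullet> d / 2" for d
    using g[of "fst d"] h[of "snd d"] by (simp add: inner_prod_def add_divide_distrib mult.assoc)
qed

section \<open>Localized penalization at a degenerate point\<close>

context hjb_key
begin

text \<open>The weight \<open>k\<close> ties the three points together, \<open>l\<close> ties the
  first one to the degenerate point, and \<open>m\<close> keeps the first time near
  \<open>tb\<close>.\<close>

definition penal :: "real => real => real => real^'n => real => real^'n => real^'n => real^'n => real => real => real" where
  "penal k l m x0 tb x y w t s = Ue (x, t) - \<mu> * Ue (y, s) + (\<mu> - 1) * v w - \<eta> * (s - t)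
     - k / 2 * ((norm (x - y))\<^sup>2 + (norm (x - w))\<^sup>2) - l / 2 * (norm (x - x0))\<^sup>2 - m * (t - tb)\<^sup>2"

text \<open>Maximality in one block of variables at a time. With the other blocks frozen the penalty
  is an explicit quadratic, so each condition yields a jet of a single function.\<close>

definition penal_max :: "real => real => real => real^'n => real => real => real^'n => real^'n => real^'n => real => real => bool" where
  "penal_max k l m x0 tb r x y w t s \<longleftrightarrow> (let p = penal k l m x0 tb in
     (\<forall>d. norm d < r --> p (x + fst d) y w (t + snd d) s \<le> p x y w t s) \<and>
     (\<forall>d. norm d < r --> p x (y + fst d) w t (s + snd d) \<le> p x y w t s) \<and>
     (\<forall>d. norm d < r --> p x y (w + d) t s \<le> p x y w t s))"

text \<open>The spatial Hessians are multiples of the identity, so the diffusion terms are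
  \<open>k\<close>, \<open>l\<close> or their rescalings times the squared distance to
  \<open>x0\<close>. The point \<open>x\<close> is tied to both \<open>y\<close> and
  \<open>w\<close>, hence the weight \<open>2 * k + l\<close>; the slope \<eta> appears divided by
  \<mu> because the jet of \<open>\<mu> * Ue\<close> is rescaled.\<close>

lemma degenerate_jets:
  assumes x0: "x0 \<in> degen_set \<sigma>" and ts: "t > 0" "s > 0" and pos: "k > 0" "l \<ge> 0" "m \<ge> 0" "r > 0" "e > 0"
    and loc: "penal_max k l m x0 tb r x y w t s"
    and P: "P = k *\<^sub>R (x - y) + k *\<^sub>R (x - w) + l *\<^sub>R (x - x0)" and Q: "Q = (k / \<mu>) *\<^sub>R (x - y)" and q: "q = (k / (\<mu> - 1)) *\<^sub>R (w - x)"
  shows "norm P \<le> C" "norm Q \<le> C" "norm q \<le> C" "q \<in> QS"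
    "\<And>\<theta>. H \<theta> x P \<le> c + \<eta> - 2 * m * (t - tb) + (2 * k + l) * (C\<^sup>2 * (norm (x - x0))\<^sup>2)"
    "\<exists>\<theta>. H \<theta> y Q \<ge> c + \<eta> / \<mu> - k * (C\<^sup>2 * (norm (y - x0))\<^sup>2) - e"
    "\<And>\<theta>. H \<theta> w q \<le> c + k / (\<mu> - 1) * (C\<^sup>2 * (norm (w - x0))\<^sup>2)"
    "\<And>\<theta>. G \<theta> w q \<le> c + k / (\<mu> - 1) * (C\<^sup>2 * (norm (w - x0))\<^sup>2)"
proof -
  note loc' = loc[unfolded penal_max_def Let_def]
  note loc1 = loc'[THEN conjunct1, rule_format]
    and loc2 = loc'[THEN conjunct2, THEN conjunct1, rule_format]
    and loc3 = loc'[THEN conjunct2, THEN conjunct2, rule_format]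
  have mu1: "\<mu> > 0" "\<mu> - 1 > 0" using mu by auto
  define g1 where "g1 p = k / 2 * ((norm (p - y))\<^sup>2 + (norm (p - w))\<^sup>2) + l / 2 * (norm (p - x0))\<^sup>2" for p
  define h1 where "h1 \<tau> = m * (\<tau> - tb)\<^sup>2 - \<eta> * \<tau>" for \<tau> :: real
  have T1: "touch2 Ue (x, t) (P, 2 * m * (t - tb) - \<eta>) (\<lambda>d. ((2 * k + l) *\<^sub>R fst d, (2 * m) * snd d))"
  proof (rule touch2_of_separated_quadratic_max[OF pos(4), where g = g1 and h = h1])
    show "Ue ((x, t) + d) - g1 (x + fst d) - h1 (t + snd d) \<le> Ue (x, t) - g1 x - h1 t" if "norm d < r" for d
    proof -
      have "(x, t) + d = (x + fst d, t + snd d)" by (cases d) simp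
      moreover have "\<eta> * (s - (t + snd d)) = \<eta> * s - \<eta> * (t + snd d)" "\<eta> * (s - t) = \<eta> * s - \<eta> * t" by (simp_all add: right_diff_distrib)
      ultimately show ?thesis using loc1[OF that] by (simp add: penal_def g1_def h1_def)
    qed
    show "g1 (x + a) = g1 x + P \<bullet> a + (2 * k + l) * (a \<bullet> a) / 2" for a
    proof -
      have "P \<bullet> a = k * ((x - y) \<bullet> a) + k * ((x - w) \<bullet> a) + l * ((x - x0) \<bullet> a)" by (simp only: P inner_add_left inner_scaleR_left)
      moreover have "k / 2 * (n + 2 * b + aa + (n' + 2 * b' + aa)) + l / 2 * (n'' + 2 * b'' + aa)
        = k / 2 * (n + n') + l / 2 * n'' + (k * b + k * b' + l * b'') + (2 * k + l) * aa / 2" for n n' n'' b b' b'' aa :: real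
        by (simp add: field_simps)
      ultimately show ?thesis unfolding g1_def norm_square_expansion by simp
    qed
    show "h1 (t + a) = h1 t + (2 * m * (t - tb) - \<eta>) * a + (2 * m) * (a * a) / 2" for a by (simp add: h1_def power2_eq_square algebra_simps)
  qed
  define g2 where "g2 p = k / 2 * (norm (p - x))\<^sup>2" for p
  have T2: "touch2 (\<lambda>z. \<mu> * - Ue z) (y, s) (k *\<^sub>R (y - x), \<eta>) (\<lambda>d. (k *\<^sub>R fst d, 0 * snd d))"
  proof (rule touch2_of_separated_quadratic_max[OF pos(4), where g = g2 and h = "\<lambda>\<tau>. \<eta> * \<tau>"])
    show "\<mu> * - Ue ((y, s) + d) - g2 (y + fst d) - \<eta> * (s + snd d) \<le> \<mu> * - Ue (y, s) - g2 y - \<eta> * s" if "norm d < r" for d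
    proof -
      have "(y, s) + d = (y + fst d, s + snd d)" by (cases d) simp
      moreover have "\<eta> * (s + snd d - t) = \<eta> * (s + snd d) - \<eta> * t" "\<eta> * (s - t) = \<eta> * s - \<eta> * t" by (simp_all add: right_diff_distrib)
      moreover have "k / 2 * ((norm (x - z))\<^sup>2 + (norm (x - w))\<^sup>2) = k / 2 * (norm (z - x))\<^sup>2 + k / 2 * (norm (x - w))\<^sup>2" for z
        by (simp add: norm_minus_commute[of x z] distrib_left)
      ultimately show ?thesis using loc2[OF that] by (simp add: penal_def g2_def add_divide_distrib)
    qed
    show "g2 (y + a) = g2 y + k *\<^sub>R (y - x) \<bullet> a + k * (a \<bullet> a) / 2" for a
      unfolding g2_def norm_square_expansion inner_scaleR_left by (simp add: distrib_left add_divide_distrib)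
    show "\<eta> * (s + a) = \<eta> * s + \<eta> * a + 0 * (a * a) / 2" for a by (simp add: distrib_left)
  qed
  have T3: "touch2 (\<lambda>z. (\<mu> - 1) * v z) w (k *\<^sub>R (w - x)) (\<lambda>d. k *\<^sub>R d)"
  proof (rule touch2_of_quadratic_max[OF _ _ pos(4), where ?\<chi>1.0 = g2])
    show "(\<mu> - 1) * v (w + d) - g2 (w + d) \<le> (\<mu> - 1) * v w - g2 w" if "norm d < r" for d
    proof -
      have "k / 2 * ((norm (x - y))\<^sup>2 + (norm (x - z))\<^sup>2) = k / 2 * (norm (x - y))\<^sup>2 + k / 2 * (norm (z - x))\<^sup>2" for z
        by (simp add: norm_minus_commute[of x z] distrib_left)
      then show ?thesis using loc3[OF that] by (simp add: penal_def g2_def add_divide_distrib)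
    qed
    show "g2 (w + d) = g2 w + k *\<^sub>R (w - x) \<bullet> d + k *\<^sub>R d \<bullet> d / 2" for d
      unfolding g2_def norm_square_expansion inner_scaleR_left by (simp add: distrib_left add_divide_distrib)
  qed (auto intro: linearI simp: algebra_simps)
  have T2': "touch2 (\<lambda>z. - Ue z) (y, s) (- Q, \<eta> / \<mu>) (\<lambda>d. ((k / \<mu>) *\<^sub>R fst d, 0))"
  proof -
    have "(1 / \<mu>) *\<^sub>R (k *\<^sub>R (y - x), \<eta>) = (- Q, \<eta> / \<mu>)" by (simp add: Q algebra_simps)
    moreover have "(\<lambda>a. (1 / \<mu>) *\<^sub>R (k *\<^sub>R fst a, 0 * snd a)) = (\<lambda>d::(real^'n) \<times> real. ((k / \<mu>) *\<^sub>R fst d, 0::real))" by (rule ext) simp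
    ultimately show ?thesis using touch2_scale[OF T2 mu1(1)] by (simp only:)
  qed
  have T3': "touch2 v w q (\<lambda>a. (k / (\<mu> - 1)) *\<^sub>R a)"
    using touch2_scale[OF T3 mu1(2)] by (simp add: q)
  show "norm P \<le> C" using touch2_norm_fst_le[OF T1 Ue_facts(2)] C_pos by simp
  have "norm (- Q) \<le> C"
  proof (rule touch2_norm_fst_le[OF T2'])
    show "\<bar>- Ue (y, s) - - Ue (y', s)\<bar> \<le> C * norm (y - y')" for y' using Ue_facts(2)[of y s y'] by (simp add: abs_minus_commute)
  qed (use C_pos in simp)
  then show "norm Q \<le> C" by simp
  show "norm q \<le> C" using touch2_norm_le[OF T3' v_lip] .
  show "q \<in> QS" using QS(1)[OF T3'] .
  have kk: "k / (\<mu> - 1) \<ge> 0" "k / \<mu> \<ge> 0" using pos mu1 by auto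
  show "H \<theta> x P \<le> c + \<eta> - 2 * m * (t - tb) + (2 * k + l) * (C\<^sup>2 * (norm (x - x0))\<^sup>2)" for \<theta>
  proof -
    have "t \<in> {0<..}" using ts by simp
    from Ue_facts(3)[unfolded evol_sub_def, rule_format, OF this T1] have "1 * (2 * m * (t - tb) - \<eta>) - df \<theta> x (\<lambda>a. ((2 * k + l) *\<^sub>R fst (a, 0::real), 2 * m * snd (a, 0::real)) \<bullet> (a, 0)) + H \<theta> x P \<le> c" .
    moreover have "df \<theta> x (\<lambda>a. ((2 * k + l) *\<^sub>R fst (a, 0::real), 2 * m * snd (a, 0::real)) \<bullet> (a, 0)) = df \<theta> x (\<lambda>a. (2 * k + l) * (norm a)\<^sup>2)"
      by (simp add: power2_norm_eq_inner)
    moreover have "df \<theta> x (\<lambda>a. (2 * k + l) * (norm a)\<^sup>2) \<le> (2 * k + l) * (C\<^sup>2 * (norm (x - x0))\<^sup>2)"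
      by (rule df_degenerate[OF x0]) (use pos in simp)
    ultimately show ?thesis by simp
  qed
  show "\<exists>\<theta>. H \<theta> y Q \<ge> c + \<eta> / \<mu> - k * (C\<^sup>2 * (norm (y - x0))\<^sup>2) - e"
  proof -
    have sI: "s \<in> {0<..}" using ts by simp
    obtain \<theta> where \<theta>: "- (1 * (\<eta> / \<mu>)) + df \<theta> y (\<lambda>a. ((k / \<mu>) *\<^sub>R fst (a, 0::real), 0::real) \<bullet> (a, 0)) + H \<theta> y (- (- Q)) \<ge> c - e"
      using Ue_facts(4)[unfolded evol_super_def, rule_format, OF sI T2' pos(5)] by (elim exE) (rule that)
    have "df \<theta> y (\<lambda>a. ((k / \<mu>) *\<^sub>R fst (a, 0::real), 0::real) \<bullet> (a, 0)) = df \<theta> y (\<lambda>a. (k / \<mu>) * (norm a)\<^sup>2)"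
      by (simp add: power2_norm_eq_inner)
    moreover have "df \<theta> y (\<lambda>a. (k / \<mu>) * (norm a)\<^sup>2) \<le> k / \<mu> * (C\<^sup>2 * (norm (y - x0))\<^sup>2)"
      by (rule df_degenerate[OF x0 kk(2)])
    moreover have "k / \<mu> * (C\<^sup>2 * (norm (y - x0))\<^sup>2) \<le> k * (C\<^sup>2 * (norm (y - x0))\<^sup>2)"
    proof (rule mult_right_mono)
      have "k * 1 \<le> k * \<mu>" using pos mu by (intro mult_left_mono) auto
      then show "k / \<mu> \<le> k" using mu1 by (simp add: pos_divide_le_eq)
    qed simp
    ultimately show ?thesis using \<theta> by (intro exI[of _ \<theta>]) simp
  qed
  have dfw: "df \<theta> w (\<lambda>a. (k / (\<mu> - 1)) *\<^sub>R a \<bullet> a) \<le> k / (\<mu> - 1) * (C\<^sup>2 * (norm (w - x0))\<^sup>2)" for \<theta>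
    using df_degenerate[OF x0 kk(1), of \<theta> w] by (simp add: power2_norm_eq_inner)
  show "H \<theta> w q \<le> c + k / (\<mu> - 1) * (C\<^sup>2 * (norm (w - x0))\<^sup>2)" for \<theta>
  proof -
    have "- df \<theta> w (\<lambda>a. (k / (\<mu> - 1)) *\<^sub>R a \<bullet> a) + H \<theta> w q \<le> c" using v_sub T3' unfolding stat_sub_def by blast
    then show ?thesis using dfw[of \<theta>] by linarith
  qed
  show "G \<theta> w q \<le> c + k / (\<mu> - 1) * (C\<^sup>2 * (norm (w - x0))\<^sup>2)" for \<theta>
  proof -
    have "- df \<theta> w (\<lambda>a. (k / (\<mu> - 1)) *\<^sub>R a \<bullet> a) + G \<theta> w q \<le> c" using v_subG T3' unfolding stat_sub_def by blast
    then show ?thesis using dfw[of \<theta>] by linarith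
  qed
qed

lemma penal_compact_domain:
  fixes x0 :: "real^'n" and S0 :: real
  shows "compact {z :: (real^'n) \<times> (real^'n) \<times> (real^'n) \<times> real \<times> real.
     norm (fst z - x0) \<le> 1 \<and> norm (fst z - fst (snd z)) \<le> 1 \<and> norm (fst z - fst (snd (snd z))) \<le> 1 \<and>
     tb - 1 \<le> fst (snd (snd (snd z))) \<and> fst (snd (snd (snd z))) \<le> tb + 1 \<and>
     fst (snd (snd (snd z))) \<le> snd (snd (snd (snd z))) \<and> snd (snd (snd (snd z))) \<le> fst (snd (snd (snd z))) + S0}" (is "compact ?N")
proof -
  have "closed ?N" by (intro closed_Collect_conj closed_Collect_le continuous_intros)
  moreover have "?N \<subseteq> cball x0 1 \<times> cball x0 2 \<times> cball x0 2 \<times> {tb - 1..tb + 1} \<times> {tb - 1..tb + 1 + S0}"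
  proof
    fix z assume "z \<in> ?N"
    moreover obtain x y w t s where z: "z = (x, y, w, t, s)" by (cases z) auto
    ultimately have N: "norm (x - x0) \<le> 1" "norm (x - y) \<le> 1" "norm (x - w) \<le> 1" "tb - 1 \<le> t" "t \<le> tb + 1" "t \<le> s" "s \<le> t + S0" by simp_all
    have "norm (x0 - y) \<le> 2" "norm (x0 - w) \<le> 2"
      using norm_triangle_ineq[of "x0 - x" "x - y"] norm_triangle_ineq[of "x0 - x" "x - w"] N by (simp_all add: norm_minus_commute[of x0 x])
    then show "z \<in> cball x0 1 \<times> cball x0 2 \<times> cball x0 2 \<times> {tb - 1..tb + 1} \<times> {tb - 1..tb + 1 + S0}"
      using N by (simp add: z dist_norm norm_minus_commute[of x0 x])
  qed
  moreover have "bounded (cball x0 1 \<times> cball x0 2 \<times> cball x0 2 \<times> {tb - 1..tb + 1} \<times> {tb - 1..tb + 1 + S0})"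
    by (intro bounded_Times bounded_closed_interval bounded_cball)
  ultimately show ?thesis using bounded_subset compact_eq_bounded_closed by blast
qed

lemma penal_continuous:
  "continuous_on S (\<lambda>z. penal k l m x0 tb (fst z) (fst (snd z)) (fst (snd (snd z))) (fst (snd (snd (snd z)))) (snd (snd (snd (snd z)))))"
proof -
  have cv: "continuous_on UNIV v" by (rule lipschitz_bound_continuous[where L = C]) (use v_lip in auto)
  show ?thesis unfolding penal_def by (intro continuous_intros continuous_on_compose2[OF Ue_facts(1)] continuous_on_compose2[OF cv]) auto
qed

lemma square_completion:
  fixes a b k ep :: real
  assumes "k * ep = 1" "ep > 0"
  shows "k / 2 * a\<^sup>2 - b * a \<ge> - (b\<^sup>2 * ep / 2)"
proof -
  have k: "k = 1 / ep" using assms by (simp add: field_simps)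
  have "0 \<le> (a - b * ep)\<^sup>2 / (2 * ep)" using assms by simp
  also have "\<dots> = k / 2 * a\<^sup>2 - b * a + b\<^sup>2 * ep / 2" using assms unfolding k by (simp add: power2_eq_square field_simps)
  finally show ?thesis by simp
qed

text \<open>The maximum is compared with the value at \<open>x0, x0, x0\<close>. With
  \<open>\<beta> = C\<^sup>2 * ep\<close>, approximating the upper limit from both sides costs
  \<open>2 * \<beta>\<close> twice, and separating the points gains at most
  \<open>2 * \<beta>\<close> and \<open>\<beta> / 2\<close> by completing squares. The sum, 13/2 of
  \<beta>, bounds the remaining penalties; the weight 8 in time exceeds it and so keeps the maximum
  off the ends of the window.\<close>

lemma penal_local_max:
  assumes maxM: "\<And>x. M x \<le> M x0" and gt: "M x0 > thr"
    and ep: "ep > 0" "k * ep = 1" "ep \<le> 1" "C * ep \<le> 1/32" "C\<^sup>2 * ep \<le> 1/32" "32 * (C\<^sup>2 * ep) \<le> M x0 - thr"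
    and l: "l \<ge> 0" "13 * (C\<^sup>2 * ep) < l"
  obtains x y w t s tb r where "t > 0" "s > 0" "\<bar>t - tb\<bar> \<le> 1" "l * (norm (x - x0))\<^sup>2 \<le> 13 * (C\<^sup>2 * ep)" "r > 0"
    "penal_max k l (8 * (C\<^sup>2 * ep)) x0 tb r x y w t s"
proof -
  obtain \<beta> where \<beta>: "C\<^sup>2 * ep = \<beta>" by simp
  have \<beta>0: "\<beta> > 0" using ep C_pos \<beta> by auto
  note ep' = ep[unfolded \<beta>]
  have b2: "2 * \<beta> > 0" using \<beta>0 by simp
  obtain T tb sb where T: "T \<ge> 1" "\<And>x t s. x \<in> cball x0 1 ==> T \<le> t ==> t \<le> s ==> \<Phi> x (t, s) \<le> M x + 2 * \<beta>"
    and tb: "T + 1 \<le> tb" "tb \<le> sb" "\<Phi> x0 (tb, sb) \<ge> M x0 - 2 * \<beta>"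
    using near_limsup[OF compact_cball b2] by blast
  define S0 where "S0 = (3 * B + 4) / \<eta>"
  have S0: "S0 > 0" "\<eta> * S0 = 3 * B + 4" using B_nonneg eta by (auto simp: S0_def)
  define p where "p = penal k l (8 * \<beta>) x0 tb"
  define N where "N = {z :: (real^'n) \<times> (real^'n) \<times> (real^'n) \<times> real \<times> real.
     norm (fst z - x0) \<le> 1 \<and> norm (fst z - fst (snd z)) \<le> 1 \<and> norm (fst z - fst (snd (snd z))) \<le> 1 \<and>
     tb - 1 \<le> fst (snd (snd (snd z))) \<and> fst (snd (snd (snd z))) \<le> tb + 1 \<and>
     fst (snd (snd (snd z))) \<le> snd (snd (snd (snd z))) \<and> snd (snd (snd (snd z))) \<le> fst (snd (snd (snd z))) + S0}"
  have cN: "compact N" unfolding N_def by (rule penal_compact_domain)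
  have M0: "M x0 > 0" using gt thr_nonneg by linarith
  have sb: "sb \<le> tb + S0"
  proof -
    have "\<Phi> x0 (tb, sb) \<le> 3 * B - \<eta> * (sb - tb)" using \<Phi>_upper[of tb sb x0] tb T(1) by simp
    then have "\<eta> * (sb - tb) \<le> \<eta> * S0" using tb(3) S0(2) M0 ep'(5) by linarith
    then show ?thesis using eta by simp
  qed
  have z0: "(x0, x0, x0, tb, sb) \<in> N" using tb sb by (simp add: N_def)
  have p0: "p x0 x0 x0 tb sb \<ge> M x0 - 2 * \<beta>"
    using tb T(1) by (simp add: p_def penal_def \<Phi>_def Ue_eq)
  obtain z where z: "z \<in> N" "\<And>z'. z' \<in> N ==> p (fst z') (fst (snd z')) (fst (snd (snd z'))) (fst (snd (snd (snd z')))) (snd (snd (snd (snd z'))))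
     \<le> p (fst z) (fst (snd z)) (fst (snd (snd z))) (fst (snd (snd (snd z)))) (snd (snd (snd (snd z))))"
    using continuous_attains_sup[OF cN _ penal_continuous[of N k l "8 * \<beta>" x0 tb]] z0 unfolding p_def by blast
  obtain x y w t s where zz: "z = (x, y, w, t, s)" by (cases z) auto
  have pmax: "p x' y' w' t' s' \<le> p x y w t s" if "(x', y', w', t', s') \<in> N" for x' y' w' t' s'
    using z(2)[OF that] by (simp add: zz)
  have N: "norm (x - x0) \<le> 1" "norm (x - y) \<le> 1" "norm (x - w) \<le> 1" "tb - 1 \<le> t" "t \<le> tb + 1" "t \<le> s" "s \<le> t + S0"
    using z(1) unfolding zz by (simp_all add: N_def)
  have ts: "t \<ge> T" "t \<ge> 0" "s \<ge> 0" "t > 0" "s > 0" using N tb T(1) by linarith+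
  define a b d where "a = norm (x - y)" and "b = norm (x - w)" and "d = norm (x - x0)"
  have pup: "p x y w t s \<le> \<Phi> x (t, s) + 2 * C * a + C * b - k / 2 * a\<^sup>2 - k / 2 * b\<^sup>2 - l / 2 * d\<^sup>2 - 8 * \<beta> * (t - tb)\<^sup>2"
    using \<Phi>_lip[OF ts(2,3), of x y w] ts by (simp add: p_def penal_def Ue_eq a_def b_def d_def distrib_left)
  have plow: "p x y w t s \<ge> M x0 - 2 * \<beta>" using pmax[OF z0] p0 by linarith
  have sq: "k / 2 * a\<^sup>2 - 2 * C * a \<ge> - (2 * \<beta>)" "k / 2 * b\<^sup>2 - C * b \<ge> - (\<beta> / 2)"
    using square_completion[OF ep(2,1), where a = a and b = "2 * C"] square_completion[OF ep(2,1), where a = b and b = C] by (simp_all add: power_mult_distrib \<beta>[symmetric] mult.commute[of ep])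
  have nn: "l / 2 * d\<^sup>2 \<ge> 0" "8 * \<beta> * (t - tb)\<^sup>2 \<ge> 0" using l \<beta>0 by auto
  have \<Phi>1: "\<Phi> x (t, s) \<le> M x0 + 2 * \<beta>" using T(2)[of x t s] N(1,6) ts(1) maxM[of x] by (simp add: dist_norm norm_minus_commute)
  have ab01: "0 \<le> a" "a \<le> 1" "0 \<le> b" "b \<le> 1" "d \<le> 1" "0 \<le> d" using N by (auto simp: a_def b_def d_def)
  have ld: "l / 2 * d\<^sup>2 + 8 * \<beta> * (t - tb)\<^sup>2 \<le> 13 / 2 * \<beta>" using pup plow sq \<Phi>1 by linarith
  have kb: "k / 2 - D \<ge> 7 * \<beta>" if "D = C \<or> D = 2 * C" for D
  proof -
    have "D * ep \<le> 1/16" using that ep'(4) C_pos ep(1) by auto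
    moreover have "\<beta> * ep \<le> \<beta> * 1" using \<beta>0 ep(3) by (intro mult_left_mono) auto
    ultimately have "(7 * \<beta> + D) * ep \<le> 1 / 2" using ep'(5) by (simp add: distrib_right)
    also have "\<dots> = (k / 2) * ep" using ep(2) by simp
    finally show ?thesis using ep(1) by simp
  qed
  have d1: "d < 1"
  proof (rule ccontr)
    assume "\<not> d < 1"
    then have "d = 1" using ab01 by simp
    then show False using ld nn l \<beta> by simp
  qed
  have t1: "\<bar>t - tb\<bar> < 1"
  proof (rule ccontr)
    assume "\<not> \<bar>t - tb\<bar> < 1"
    then have "\<bar>t - tb\<bar> = 1" using N by linarith
    then have "(t - tb)\<^sup>2 = 1" by (metis abs_square_eq_1)
    then show False using ld nn \<beta>0 by simp
  qed
  have a1: "a < 1"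
  proof (rule ccontr)
    assume "\<not> a < 1"
    then have "a = 1" using ab01 by simp
    then have "k / 2 - 2 * C \<le> 9 / 2 * \<beta>" using pup plow sq(2) \<Phi>1 nn by simp
    then show False using kb[of "2 * C"] \<beta>0 by simp
  qed
  have b1: "b < 1"
  proof (rule ccontr)
    assume "\<not> b < 1"
    then have "b = 1" using ab01 by simp
    then have "k / 2 - C \<le> 6 * \<beta>" using pup plow sq(1) \<Phi>1 nn by simp
    then show False using kb[of C] \<beta>0 by simp
  qed
  have s1: "t < s"
  proof (rule ccontr)
    assume "\<not> t < s"
    then have "s = t" using N by simp
    then have "\<Phi> x (t, s) \<le> thr" using \<Phi>_diag[OF ts(2), of x] by (simp add: abs_le_iff)
    then show False using pup plow sq nn ep'(6) \<beta>0 by linarith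
  qed
  have s2: "s < t + S0"
  proof (rule ccontr)
    assume "\<not> s < t + S0"
    then have "s - t = S0" using N by simp
    then have "\<Phi> x (t, s) \<le> - 4" using \<Phi>_upper[OF ts(2,3), of x] S0(2) by simp
    then show False using pup plow sq nn ep'(5) \<beta>0 M0 by linarith
  qed
  define O' where "O' = {z :: (real^'n) \<times> (real^'n) \<times> (real^'n) \<times> real \<times> real.
     norm (fst z - x0) < 1 \<and> norm (fst z - fst (snd z)) < 1 \<and> norm (fst z - fst (snd (snd z))) < 1 \<and>
     tb - 1 < fst (snd (snd (snd z))) \<and> fst (snd (snd (snd z))) < tb + 1 \<and>
     fst (snd (snd (snd z))) < snd (snd (snd (snd z))) \<and> snd (snd (snd (snd z))) < fst (snd (snd (snd z))) + S0}"
  have "open O'" unfolding O'_def by (intro open_Collect_conj open_Collect_less continuous_intros)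
  moreover have "(x, y, w, t, s) \<in> O'" using d1 t1 a1 b1 s1 s2 by (simp add: O'_def a_def b_def d_def abs_less_iff)
  ultimately obtain r where r: "r > 0" "ball (x, y, w, t, s) r \<subseteq> O'" using open_contains_ball by blast
  have rN: "z' \<in> N" if "dist (x, y, w, t, s) z' < r" for z'
  proof -
    have "z' \<in> O'" using r(2) that by auto
    then show ?thesis unfolding O'_def N_def by auto
  qed
  show thesis
  proof (rule that[of t s tb x r y w])
    show "\<bar>t - tb\<bar> \<le> 1" using t1 by simp
    show "l * (norm (x - x0))\<^sup>2 \<le> 13 * (C\<^sup>2 * ep)" using ld nn by (simp add: d_def \<beta>)
    have "p (x + fst e) y w (t + snd e) s \<le> p x y w t s" if "norm e < r" for e
    proof (intro pmax rN)
      show "dist (x, y, w, t, s) (x + fst e, y, w, t + snd e, s) < r" using that by (simp add: dist_prod_def norm_prod_def dist_norm)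
    qed
    moreover have "p x (y + fst e) w t (s + snd e) \<le> p x y w t s" if "norm e < r" for e
    proof (intro pmax rN)
      show "dist (x, y, w, t, s) (x, y + fst e, w, t, s + snd e) < r" using that by (simp add: dist_prod_def norm_prod_def dist_norm)
    qed
    moreover have "p x y (w + e) t s \<le> p x y w t s" if "norm e < r" for e
    proof (intro pmax rN)
      show "dist (x, y, w, t, s) (x, y, w + e, t, s) < r" using that by (simp add: dist_prod_def norm_prod_def dist_norm)
    qed
    ultimately show "penal_max k l (8 * (C\<^sup>2 * ep)) x0 tb r x y w t s" unfolding penal_max_def Let_def p_def \<beta> by blast
  qed (use ts r in auto)
qed

end

section \<open>Exclusion of large maxima at degenerate points\<close>

context hjb_key
begin

text \<open>Localization forces \<open>|x - x0|^2\<close> down to order \<open>1 / (k * l)\<close>.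
  The diffusion \<open>k * |x - x0|^2\<close> is then of order \<open>1 / l\<close> and the
  additional gradient \<open>l * |x - x0|\<close> of order \<open>sqrt (l / k)\<close>, so both
  vanish when \<open>l\<close> tends to infinity more slowly than \<open>k\<close>. The weights
  \<open>r^-4\<close> and \<open>r^-2\<close> realize this.\<close>

lemma degenerate_doubling:
  assumes x0: "x0 \<in> degen_set \<sigma>" and maxM: "\<And>x. M x \<le> M x0" and gt: "M x0 > thr" and tol: "tol > 0"
  obtains P Q q \<theta> where "norm P \<le> C" "norm Q \<le> C" "norm q \<le> C" "q \<in> QS"
    "norm (P - (\<mu> *\<^sub>R Q - (\<mu> - 1) *\<^sub>R q)) \<le> tol" "\<And>\<theta>'. H \<theta>' x0 P \<le> c + \<eta> + tol"
    "H \<theta> x0 Q \<ge> c + \<eta> / \<mu> - tol" "\<And>\<theta>'. H \<theta>' x0 q \<le> c + tol" "\<And>\<theta>'. G \<theta>' x0 q \<le> c + tol"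
proof -
  have mu1: "\<mu> > 0" "\<mu> - 1 > 0" using mu by auto
  define L where "L = CR C + LG"
  have CRp: "CR C > 0" using CR_pos[OF C_pos] .
  have L: "L > 0" "CR C \<le> L" "LG \<le> L" using CRp LG by (auto simp: L_def)
  define c4 where "c4 = C\<^sup>2 * (36 * C\<^sup>2)"
  have c4: "c4 \<ge> 0" by (simp add: c4_def)
  define E where "E = 4 * C + 16 * C\<^sup>2 + 3 * c4 + L * (6 * C) + c4 / (\<mu> - 1) + 1"
  have c4mu: "c4 / (\<mu> - 1) \<ge> 0" using c4 mu1 by simp
  have E: "E \<ge> 1" "4 * C \<le> E" "16 * C\<^sup>2 + 3 * c4 + L * (6 * C) \<le> E" "c4 + L * (6 * C) + 1 \<le> E" "c4 / (\<mu> - 1) + L * (6 * C) \<le> E"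
  proof -
    have "L * (6 * C) \<ge> 0" "C\<^sup>2 \<ge> 0" using L C_pos by auto
    then show "E \<ge> 1" "4 * C \<le> E" "16 * C\<^sup>2 + 3 * c4 + L * (6 * C) \<le> E" "c4 + L * (6 * C) + 1 \<le> E" "c4 / (\<mu> - 1) + L * (6 * C) \<le> E"
      unfolding E_def using c4 c4mu C_pos by linarith+
  qed
  define g where "g = M x0 - thr"
  have g: "g > 0" using gt by (simp add: g_def)
  define c1 where "c1 = (C + 1)\<^sup>2"
  have c1: "c1 > 0" "C \<le> c1" "C\<^sup>2 \<le> c1"
    using C_pos by (auto simp: c1_def power2_eq_square algebra_simps add_pos_pos)
  define r where "r = min 1 (min (1 / (32 * c1)) (min (g / (32 * c1)) (tol / E)))"
  have r: "r > 0" using c1 g tol E by (simp add: r_def)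
  have "r \<le> 1" "r \<le> 1 / (32 * c1)" "r \<le> g / (32 * c1)" "r \<le> tol / E" unfolding r_def by linarith+
  then have r1: "r \<le> 1" "32 * (c1 * r) \<le> 1" "32 * (c1 * r) \<le> g" "r * E \<le> tol"
    using c1 E by (simp_all add: pos_le_divide_eq mult.commute mult.left_commute)
  define ep where "ep = r^4"
  define k where "k = 1 / r^4"
  define l where "l = 1 / r\<^sup>2"
  have kl: "k > 0" "l > 0" "k * ep = 1" "ep > 0" using r by (auto simp: k_def l_def ep_def)
  have rp: "r^4 \<le> r" "r^3 \<le> r" "r\<^sup>2 \<le> r" "r^4 \<le> r^3"
    using r r1(1) power_decreasing[of 1 4 r] power_decreasing[of 1 3 r] power_decreasing[of 1 2 r] power_decreasing[of 3 4 r] by simp_all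
  have Ce: "C * ep \<le> c1 * r" "C\<^sup>2 * ep \<le> c1 * r"
    unfolding ep_def using c1 rp r C_pos by (auto intro!: mult_mono)
  have e1: "ep \<le> 1" using rp r1 by (simp add: ep_def)
  have l1: "l \<ge> 1" using rp r r1 by (simp add: l_def)
  obtain x y w t s tb r0 where J: "t > 0" "s > 0" "\<bar>t - tb\<bar> \<le> 1" "l * (norm (x - x0))\<^sup>2 \<le> 13 * (C\<^sup>2 * ep)" "r0 > 0"
    "penal_max k l (8 * (C\<^sup>2 * ep)) x0 tb r0 x y w t s"
  proof (rule penal_local_max[OF maxM gt kl(4) kl(3) e1])
    show "C * ep \<le> 1/32" "C\<^sup>2 * ep \<le> 1/32" "32 * (C\<^sup>2 * ep) \<le> M x0 - thr" using Ce r1 by (auto simp: g_def)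
    show "0 \<le> l" using kl by simp
    show "13 * (C\<^sup>2 * ep) < l" using Ce r1 l1 by linarith
  qed (rule that)
  have m0: "8 * (C\<^sup>2 * ep) \<ge> 0" using kl by simp
  define P where "P = k *\<^sub>R (x - y) + k *\<^sub>R (x - w) + l *\<^sub>R (x - x0)"
  define Q where "Q = (k / \<mu>) *\<^sub>R (x - y)"
  define q where "q = (k / (\<mu> - 1)) *\<^sub>R (w - x)"
  note jets = degenerate_jets[OF x0 J(1,2) kl(1) less_imp_le[OF kl(2)] m0 J(5) r J(6) P_def Q_def q_def]
  \<comment> \<open>A common bound for the distances of \<open>x\<close>, \<open>y\<close> and
    \<open>w\<close> to \<open>x0\<close>: \<open>4 * C * r^3\<close> from the localization of
    \<open>x\<close>, and at most \<open>2 * C * r^3\<close> more for the other two.\<close>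
  define D where "D = 6 * C * r^3"
  have D2: "D\<^sup>2 = 36 * C\<^sup>2 * r^6" by (simp add: D_def power_mult_distrib)
  have dx: "norm (x - x0) \<le> 4 * C * r^3"
  proof (rule power2_le_imp_le)
    have "(norm (x - x0))\<^sup>2 \<le> 13 * (C\<^sup>2 * ep) * r\<^sup>2" using J(4) r by (simp add: l_def pos_divide_le_eq)
    also have "\<dots> = 13 * C\<^sup>2 * r^6" by (simp add: ep_def power_add[symmetric] mult.assoc)
    also have "\<dots> \<le> 16 * C\<^sup>2 * r^6" using r by (intro mult_right_mono) auto
    finally show "(norm (x - x0))\<^sup>2 \<le> (4 * C * r^3)\<^sup>2" by (simp add: power_mult_distrib)
  qed (use C_pos r in simp)
  have Cr: "C * r^4 \<le> C * r^3" "C * r^3 \<ge> 0" using rp C_pos r by simp_all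
  have ax: "norm (x - y) \<le> 2 * (C * r^3)"
  proof -
    have "x - y = (\<mu> * ep) *\<^sub>R Q" using kl mu1 by (simp add: Q_def field_simps)
    then have "norm (x - y) = \<mu> * ep * norm Q" using kl mu1 by simp
    also have "\<dots> \<le> 2 * ep * C" using jets(2) mu kl by (intro mult_mono) auto
    finally show ?thesis using Cr by (simp add: ep_def mult.commute)
  qed
  have bx: "norm (w - x) \<le> C * r^3"
  proof -
    have "w - x = ((\<mu> - 1) * ep) *\<^sub>R q" using kl mu1 by (simp add: q_def field_simps)
    then have "norm (w - x) = (\<mu> - 1) * ep * norm q" using kl mu1 by simp
    also have "\<dots> \<le> 1 * ep * C" using jets(3) mu kl by (intro mult_mono) auto
    finally show ?thesis using Cr by (simp add: ep_def mult.commute)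
  qed
  have xD: "norm (x - x0) \<le> D" using dx Cr by (simp add: D_def)
  have yD: "norm (y - x0) \<le> D"
    using norm_triangle_ineq[of "y - x" "x - x0"] dx ax Cr by (simp add: D_def norm_minus_commute[of y x])
  have wD: "norm (w - x0) \<le> D"
    using norm_triangle_ineq[of "w - x" "x - x0"] dx bx Cr by (simp add: D_def)
  have Dr: "D \<le> 6 * C * r" using rp C_pos by (simp add: D_def)
  have kD: "k * (C\<^sup>2 * (norm z)\<^sup>2) \<le> c4 * r" if "norm z \<le> D" for z :: "real^'n"
  proof -
    have "(norm z)\<^sup>2 \<le> D\<^sup>2" using that by (intro power_mono) auto
    then have "k * (C\<^sup>2 * (norm z)\<^sup>2) \<le> k * (C\<^sup>2 * D\<^sup>2)" using kl by (intro mult_left_mono) auto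
    also have "\<dots> = c4 * r\<^sup>2"
    proof -
      have e6: "r^6 = r^4 * r\<^sup>2" by (simp add: power_add[symmetric])
      have "k * r^4 = 1" using r by (simp add: k_def)
      then have "k * r^6 = r\<^sup>2" unfolding e6 mult.assoc[symmetric] by simp
      then show ?thesis unfolding D2 c4_def by (simp add: mult.assoc mult.left_commute)
    qed
    also have "\<dots> \<le> c4 * r" using c4 rp by (intro mult_left_mono) auto
    finally show ?thesis .
  qed
  have lk: "l \<le> k"
  proof -
    have "r^4 \<le> r\<^sup>2" using r r1 by (intro power_decreasing) auto
    then show ?thesis using r by (simp add: l_def k_def frac_le)
  qed
  have HL: "\<bar>H \<theta> z p - H \<theta> x0 p\<bar> \<le> L * (6 * C) * r" if "norm p \<le> C" "norm (z - x0) \<le> D" for \<theta> z p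
  proof -
    have "\<bar>H \<theta> z p - H \<theta> x0 p\<bar> \<le> CR C * (dist z x0 + dist p p)" using that C_pos by (intro H_lip) auto
    also have "\<dots> \<le> L * (6 * C * r)" using that L Dr C_pos r CRp by (intro mult_mono) (auto simp: dist_norm)
    finally show ?thesis by (simp add: mult.assoc)
  qed
  have GL: "\<bar>G \<theta> z p - G \<theta> x0 p\<bar> \<le> L * (6 * C) * r" if "norm p \<le> C" "norm (z - x0) \<le> D" for \<theta> z p
  proof -
    have "\<bar>G \<theta> z p - G \<theta> x0 p\<bar> \<le> LG * (dist z x0 + dist p p)" using that by (intro G_lip) auto
    also have "\<dots> \<le> L * (6 * C * r)" using that L Dr C_pos r LG by (intro mult_mono) (auto simp: dist_norm)
    finally show ?thesis by (simp add: mult.assoc)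
  qed
  have rE: "a * r \<le> tol" if "a \<le> E" for a
  proof -
    have "a * r \<le> E * r" using that r by (intro mult_right_mono) auto
    then show ?thesis using r1(4) by (simp add: mult.commute)
  qed
  obtain \<theta> where \<theta>: "H \<theta> y Q \<ge> c + \<eta> / \<mu> - k * (C\<^sup>2 * (norm (y - x0))\<^sup>2) - r" using jets(6) by blast
  show thesis
  proof (rule that[OF jets(1-4)])
    have "\<mu> *\<^sub>R Q = k *\<^sub>R (x - y)" "(\<mu> - 1) *\<^sub>R q = k *\<^sub>R (w - x)" using mu1 by (simp_all add: Q_def q_def)
    then have "P - (\<mu> *\<^sub>R Q - (\<mu> - 1) *\<^sub>R q) = l *\<^sub>R (x - x0)" by (simp add: P_def scaleR_diff_right)
    then have "norm (P - (\<mu> *\<^sub>R Q - (\<mu> - 1) *\<^sub>R q)) = l * norm (x - x0)" using kl by simp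
    also have "\<dots> \<le> l * (4 * C * r^3)" using dx kl by (intro mult_left_mono) auto
    also have "\<dots> = 4 * C * r" using r by (simp add: l_def power2_eq_square power3_eq_cube)
    also have "\<dots> \<le> tol" by (rule rE[OF E(2)])
    finally show "norm (P - (\<mu> *\<^sub>R Q - (\<mu> - 1) *\<^sub>R q)) \<le> tol" .
    show "H \<theta>' x0 P \<le> c + \<eta> + tol" for \<theta>'
    proof -
      have "- (2 * (8 * (C\<^sup>2 * ep)) * (t - tb)) \<le> 2 * (8 * (C\<^sup>2 * ep)) * 1"
        unfolding mult_minus_right[symmetric] using J(3) m0 by (intro mult_left_mono) auto
      moreover have "C\<^sup>2 * ep \<le> C\<^sup>2 * r" using rp by (simp add: ep_def mult_left_mono)
      moreover have "l * (C\<^sup>2 * (norm (x - x0))\<^sup>2) \<le> k * (C\<^sup>2 * (norm (x - x0))\<^sup>2)" using lk by (intro mult_right_mono) auto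
      moreover have "(2 * k + l) * (C\<^sup>2 * (norm (x - x0))\<^sup>2) = 2 * (k * (C\<^sup>2 * (norm (x - x0))\<^sup>2)) + l * (C\<^sup>2 * (norm (x - x0))\<^sup>2)"
        by (simp add: distrib_right)
      moreover note kD[OF xD] jets(5)[of \<theta>']
      moreover have "H \<theta>' x0 P \<le> H \<theta>' x P + L * (6 * C) * r" using HL[OF jets(1) xD, of \<theta>'] by (simp add: abs_le_iff)
      moreover have "(16 * C\<^sup>2 + 3 * c4 + L * (6 * C)) * r \<le> tol" by (rule rE[OF E(3)])
      moreover have "(16 * C\<^sup>2 + 3 * c4 + L * (6 * C)) * r = 16 * (C\<^sup>2 * r) + 3 * (c4 * r) + L * (6 * C) * r" by (simp add: distrib_right)
      ultimately show ?thesis by linarith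
    qed
    show "H \<theta> x0 Q \<ge> c + \<eta> / \<mu> - tol"
    proof -
      have "H \<theta> x0 Q \<ge> H \<theta> y Q - L * (6 * C) * r" using HL[OF jets(2) yD, of \<theta>] by (simp add: abs_le_iff)
      moreover have "(c4 + L * (6 * C) + 1) * r \<le> tol" by (rule rE[OF E(4)])
      moreover have "(c4 + L * (6 * C) + 1) * r = c4 * r + L * (6 * C) * r + r" by (simp add: distrib_right)
      ultimately show ?thesis using \<theta> kD[OF yD] by linarith
    qed
    have wb: "k / (\<mu> - 1) * (C\<^sup>2 * (norm (w - x0))\<^sup>2) + L * (6 * C) * r \<le> tol"
    proof -
      have "k / (\<mu> - 1) * (C\<^sup>2 * (norm (w - x0))\<^sup>2) = k * (C\<^sup>2 * (norm (w - x0))\<^sup>2) / (\<mu> - 1)" by simp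
      also have "\<dots> \<le> c4 * r / (\<mu> - 1)" using kD[OF wD] mu1 by (intro divide_right_mono) auto
      finally have "k / (\<mu> - 1) * (C\<^sup>2 * (norm (w - x0))\<^sup>2) + L * (6 * C) * r \<le> (c4 / (\<mu> - 1) + L * (6 * C)) * r"
        by (simp add: distrib_right)
      also have "\<dots> \<le> tol" by (rule rE[OF E(5)])
      finally show ?thesis .
    qed
    show "H \<theta>' x0 q \<le> c + tol" for \<theta>'
      using HL[OF jets(3) wD, of \<theta>'] jets(7)[of \<theta>'] wb unfolding abs_le_iff by linarith
    show "G \<theta>' x0 q \<le> c + tol" for \<theta>'
      using GL[OF jets(3) wD, of \<theta>'] jets(8)[of \<theta>'] wb unfolding abs_le_iff by linarith
  qed
qed

text \<open>Letting the tolerance tend to 0 gives limits with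
  \<open>P0 = \<mu> Q0 - (\<mu> - 1) q0\<close> at \<open>x0\<close> itself. If
  \<open>Q0 = q0\<close>, the supersolution inequality with its surplus
  \<open>\<eta> / \<mu>\<close> contradicts the subsolution \<open>v\<close>. Otherwise, in the
  combination of the three inequalities the terms with \<eta> cancel and the strict structural
  inequality is violated. The indices \<theta> along the sequence need not converge, which is why
  strictness is used uniformly in \<theta>.\<close>

lemma no_degenerate_max:
  assumes x0: "x0 \<in> degen_set \<sigma>" and maxM: "\<And>x. M x \<le> M x0"
  shows "M x0 \<le> thr"
proof (rule ccontr)
  assume "\<not> M x0 \<le> thr"
  then have gt: "M x0 > thr" by simp
  have x0K: "x0 \<notin> K" using M_le_thr_on_K[of x0] gt by auto
  have mu1: "\<mu> > 0" "\<mu> - 1 > 0" using mu by auto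
  define g where "g n P Q q \<theta> \<longleftrightarrow> norm P \<le> C \<and> norm Q \<le> C \<and> norm q \<le> C \<and> q \<in> QS \<and>
    norm (P - (\<mu> *\<^sub>R Q - (\<mu> - 1) *\<^sub>R q)) \<le> inverse (real (Suc n)) \<and> (\<forall>\<theta>'. H \<theta>' x0 P \<le> c + \<eta> + inverse (real (Suc n))) \<and>
    H \<theta> x0 Q \<ge> c + \<eta> / \<mu> - inverse (real (Suc n)) \<and> (\<forall>\<theta>'. H \<theta>' x0 q \<le> c + inverse (real (Suc n))) \<and>
    (\<forall>\<theta>'. G \<theta>' x0 q \<le> c + inverse (real (Suc n)))" for n P Q q \<theta>
  have "\<exists>P Q q \<theta>. g n P Q q \<theta>" for n
  proof -
    have tol: "inverse (real (Suc n)) > 0" by simp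
    show ?thesis by (rule degenerate_doubling[OF x0 maxM gt tol]) (unfold g_def, blast)
  qed
  then obtain P Q q \<theta> where g: "\<And>n. g n (P n) (Q n) (q n) (\<theta> n)" by metis
  note J = g[unfolded g_def]
  define z where "z n = (Q n, q n)" for n
  have "compact (cball (0::real^'n) C \<times> cball (0::real^'n) C)" by (intro compact_Times compact_cball)
  moreover have "z n \<in> cball 0 C \<times> cball 0 C" for n using J[of n] by (simp add: z_def)
  ultimately obtain zz \<rho> where zz: "zz \<in> cball (0::real^'n) C \<times> cball (0::real^'n) C" and \<rho>: "strict_mono \<rho>" "(z \<circ> \<rho>) \<longlonglongrightarrow> zz"
    unfolding compact_def by blast
  obtain Q0 q0 where Qq: "zz = (Q0, q0)" by force
  have nQ: "norm Q0 \<le> C" "norm q0 \<le> C" using zz Qq by auto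
  have limQ: "(\<lambda>n. Q (\<rho> n)) \<longlonglongrightarrow> Q0" using tendsto_fst[OF \<rho>(2)] by (simp add: z_def Qq o_def)
  have limq: "(\<lambda>n. q (\<rho> n)) \<longlonglongrightarrow> q0" using tendsto_snd[OF \<rho>(2)] by (simp add: z_def Qq o_def)
  have q0: "q0 \<in> QS" using closed_sequentially[OF QS(2) _ limq] J by blast
  define P0 where "P0 = \<mu> *\<^sub>R Q0 - (\<mu> - 1) *\<^sub>R q0"
  have tol0: "(\<lambda>n. inverse (real (Suc (\<rho> n)))) \<longlonglongrightarrow> 0"
    using LIMSEQ_subseq_LIMSEQ[OF LIMSEQ_inverse_real_of_nat \<rho>(1)] by (simp add: o_def)
  have "(\<lambda>n. P (\<rho> n) - (\<mu> *\<^sub>R Q (\<rho> n) - (\<mu> - 1) *\<^sub>R q (\<rho> n))) \<longlonglongrightarrow> 0"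
    by (rule Lim_null_comparison[OF _ tol0]) (use J in simp)
  from tendsto_add[OF this tendsto_diff[OF tendsto_scaleR[OF tendsto_const limQ] tendsto_scaleR[OF tendsto_const limq], of \<mu> "\<mu> - 1"]]
  have limP: "(\<lambda>n. P (\<rho> n)) \<longlonglongrightarrow> P0" by (simp add: P0_def)
  have nP: "norm P0 \<le> 2 * C"
  proof (rule LIMSEQ_le_const2[OF tendsto_norm[OF limP]])
    have "norm (P (\<rho> n)) \<le> 2 * C" for n using J[of "\<rho> n"] C_pos by auto
    then show "\<exists>N. \<forall>n\<ge>N. norm (P (\<rho> n)) \<le> 2 * C" by blast
  qed
  have C2: "2 * C > 0" using C_pos by simp
  \<comment> \<open>One null sequence dominating all errors made in passing to the limit
    gradients.\<close>
  define tl where "tl n = inverse (real (Suc (\<rho> n))) + CR (2 * C) * norm (P (\<rho> n) - P0) + CR (2 * C) * \<mu> * norm (Q (\<rho> n) - Q0)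
    + (CR (2 * C) + LG) * norm (q (\<rho> n) - q0)" for n
  have tl: "tl \<longlonglongrightarrow> 0 + CR (2 * C) * norm (P0 - P0) + CR (2 * C) * \<mu> * norm (Q0 - Q0) + (CR (2 * C) + LG) * norm (q0 - q0)"
    unfolding tl_def by (intro tendsto_intros tol0 limP limQ limq)
  have small: "\<exists>n. tl n < e" if "e > 0" for e
  proof -
    have "\<forall>\<^sub>F n in sequentially. tl n < e" using order_tendstoD(2)[OF tl, of e] that by simp
    then show ?thesis by (rule eventually_happens'[OF sequentially_bot])
  qed
  have CRp: "CR (2 * C) > 0" by (rule CR_pos[OF C2])
  have parts: "0 \<le> CR (2 * C) * norm (P (\<rho> n) - P0)" "0 \<le> CR (2 * C) * \<mu> * norm (Q (\<rho> n) - Q0)" "0 \<le> CR (2 * C) * norm (q (\<rho> n) - q0)"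
     "0 \<le> LG * norm (q (\<rho> n) - q0)" "inverse (real (Suc (\<rho> n))) \<ge> 0" "CR (2 * C) * norm (Q (\<rho> n) - Q0) \<le> CR (2 * C) * \<mu> * norm (Q (\<rho> n) - Q0)" for n
  proof -
    show "0 \<le> CR (2 * C) * norm (P (\<rho> n) - P0)" "0 \<le> CR (2 * C) * \<mu> * norm (Q (\<rho> n) - Q0)" "0 \<le> CR (2 * C) * norm (q (\<rho> n) - q0)"
     "0 \<le> LG * norm (q (\<rho> n) - q0)" "inverse (real (Suc (\<rho> n))) \<ge> 0" using CRp mu1 LG by auto
    have "CR (2 * C) * 1 \<le> CR (2 * C) * \<mu>" using CRp mu by (intro mult_left_mono) auto
    then show "CR (2 * C) * norm (Q (\<rho> n) - Q0) \<le> CR (2 * C) * \<mu> * norm (Q (\<rho> n) - Q0)" by (intro mult_right_mono) auto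
  qed
  have HH: "\<bar>H \<theta>' x0 p - H \<theta>' x0 p'\<bar> \<le> CR (2 * C) * norm (p - p')" if "norm p \<le> 2 * C" "norm p' \<le> 2 * C" for \<theta>' p p'
    using H_lip[OF C2 that, of \<theta>' x0 x0] by (simp add: dist_norm)
  have two: "norm p \<le> C ==> norm p \<le> 2 * C" for p :: "real^'n" using C_pos by linarith
  have tl_eq: "tl n = inverse (real (Suc (\<rho> n))) + CR (2 * C) * norm (P (\<rho> n) - P0) + CR (2 * C) * \<mu> * norm (Q (\<rho> n) - Q0)
    + CR (2 * C) * norm (q (\<rho> n) - q0) + LG * norm (q (\<rho> n) - q0)" for n by (simp add: tl_def distrib_right)
  have HP: "H \<theta>' x0 P0 \<le> c + \<eta> + tl n" for \<theta>' n
  proof -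
    have "H \<theta>' x0 P0 \<le> H \<theta>' x0 (P (\<rho> n)) + CR (2 * C) * norm (P (\<rho> n) - P0)"
      using HH[of "P (\<rho> n)" P0 \<theta>'] two[of "P (\<rho> n)"] J[of "\<rho> n"] nP by (simp add: abs_le_iff)
    moreover have "H \<theta>' x0 (P (\<rho> n)) \<le> c + \<eta> + inverse (real (Suc (\<rho> n)))" using J[of "\<rho> n"] by blast
    ultimately show ?thesis using parts[of n] unfolding tl_eq by linarith
  qed
  have HQ: "H (\<theta> (\<rho> n)) x0 Q0 \<ge> c + \<eta> / \<mu> - inverse (real (Suc (\<rho> n))) - CR (2 * C) * norm (Q (\<rho> n) - Q0)" for n
  proof -
    have "H (\<theta> (\<rho> n)) x0 Q0 \<ge> H (\<theta> (\<rho> n)) x0 (Q (\<rho> n)) - CR (2 * C) * norm (Q (\<rho> n) - Q0)"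
      using HH[of "Q (\<rho> n)" Q0 "\<theta> (\<rho> n)"] two[of "Q (\<rho> n)"] two[of Q0] J[of "\<rho> n"] nQ by (simp add: abs_le_iff)
    moreover have "H (\<theta> (\<rho> n)) x0 (Q (\<rho> n)) \<ge> c + \<eta> / \<mu> - inverse (real (Suc (\<rho> n)))" using J[of "\<rho> n"] by blast
    ultimately show ?thesis by linarith
  qed
  have Hq: "H \<theta>' x0 q0 \<le> c + tl n" for \<theta>' n
  proof -
    have "H \<theta>' x0 q0 \<le> H \<theta>' x0 (q (\<rho> n)) + CR (2 * C) * norm (q (\<rho> n) - q0)"
      using HH[of "q (\<rho> n)" q0 \<theta>'] two[of "q (\<rho> n)"] two[of q0] J[of "\<rho> n"] nQ by (simp add: abs_le_iff)
    moreover have "H \<theta>' x0 (q (\<rho> n)) \<le> c + inverse (real (Suc (\<rho> n)))" using J[of "\<rho> n"] by blast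
    ultimately show ?thesis using parts[of n] unfolding tl_eq by linarith
  qed
  have Gq: "G \<theta>' x0 q0 \<le> c + tl n" for \<theta>' n
  proof -
    have nq: "norm (q (\<rho> n)) \<le> C" using J[of "\<rho> n"] by blast
    have "G \<theta>' x0 q0 \<le> G \<theta>' x0 (q (\<rho> n)) + LG * norm (q (\<rho> n) - q0)"
      using G_lip[OF nq nQ(2), of \<theta>' x0 x0] by (simp add: dist_norm abs_le_iff)
    moreover have "G \<theta>' x0 (q (\<rho> n)) \<le> c + inverse (real (Suc (\<rho> n)))" using J[of "\<rho> n"] by blast
    ultimately show ?thesis using parts[of n] unfolding tl_eq by linarith
  qed
  have em: "\<eta> / \<mu> > 0" using eta mu1 by simp
  show False
  proof (cases "Q0 = q0")
    case True
    obtain h where h: "\<eta> / \<mu> = h" by simp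
    obtain n where n: "tl n < h / 2" using small[of "h / 2"] em h by auto
    have "c + \<eta> / \<mu> - inverse (real (Suc (\<rho> n))) - CR (2 * C) * norm (Q (\<rho> n) - Q0) \<le> c + tl n"
      using HQ[of n] Hq[of "\<theta> (\<rho> n)" n] True by simp
    moreover have "inverse (real (Suc (\<rho> n))) + CR (2 * C) * norm (Q (\<rho> n) - Q0) \<le> tl n" using parts[of n] unfolding tl_eq by linarith
    ultimately show False using n unfolding h by linarith
  next
    case False
    obtain d where d: "d > 0" "\<And>\<theta>. d \<le> H \<theta> x0 P0 - \<mu> * H \<theta> x0 Q0 + (\<mu> - 1) * G \<theta> x0 q0"
      using strict[OF x0 x0K q0 nQ False] unfolding P0_def by blast
    \<comment> \<open>The three inequalities lose 1, \<open>\<mu> \<le> 3/2\<close> and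
      \<open>\<mu> - 1 \<le> 1/2\<close> times this error, so at most three quarters of
      \<open>d\<close>.\<close>
    obtain n where n: "tl n < d / 4" using small[of "d / 4"] d by auto
    define \<tau> where "\<tau> = tl n"
    define e1 where "e1 = inverse (real (Suc (\<rho> n))) + CR (2 * C) * norm (Q (\<rho> n) - Q0)"
    have e1: "e1 \<ge> 0" "e1 \<le> \<tau>" unfolding e1_def \<tau>_def using parts[of n] CRp unfolding tl_eq by (simp, linarith)
    have "\<mu> * (c + \<eta> / \<mu> - e1) \<le> \<mu> * H (\<theta> (\<rho> n)) x0 Q0" using HQ[of n] mu1 unfolding e1_def by (intro mult_left_mono) auto
    moreover have "\<mu> * (c + \<eta> / \<mu> - e1) = \<mu> * c + \<eta> - \<mu> * e1" using mu1 by (simp add: algebra_simps)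
    moreover have "\<mu> * e1 \<le> 3/2 * \<tau>" using mu e1 by (intro mult_mono) auto
    moreover have "(\<mu> - 1) * G (\<theta> (\<rho> n)) x0 q0 \<le> (\<mu> - 1) * (c + \<tau>)" using Gq mu1 unfolding \<tau>_def by (intro mult_left_mono) auto
    moreover have "(\<mu> - 1) * (c + \<tau>) = \<mu> * c - c + (\<mu> - 1) * \<tau>" by (simp add: algebra_simps)
    moreover have "(\<mu> - 1) * \<tau> \<le> 1/2 * \<tau>" using mu e1 by (intro mult_right_mono) auto
    ultimately have "d \<le> 3 * \<tau>" using d(2)[of "\<theta> (\<rho> n)"] HP[of "\<theta> (\<rho> n)" n] unfolding \<tau>_def[symmetric] by linarith
    then show False using n d(1) unfolding \<tau>_def by linarith
  qed
qed

theorem nearly_nonincreasing_gap: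
  assumes \<alpha>: "\<alpha> > 0"
  shows "\<exists>T\<ge>1. \<forall>x t s. T \<le> t --> t \<le> s --> \<Phi> x (t, s) \<le> thr + \<alpha>"
proof -
  have Mle: "M y \<le> thr" for y
  proof (rule ccontr)
    assume "\<not> M y \<le> thr"
    then have gt: "M y > thr" by simp
    obtain x0 where x0: "x0 \<in> degen_set \<sigma>" "\<And>x. M x \<le> M x0" using max_attained_degenerate[OF gt] by blast
    show False using no_degenerate_max[OF x0] x0(2)[of y] gt by linarith
  qed
  obtain n where n: "\<forall>x\<in>cbox 0 1. \<forall>i\<in>A n. \<Phi> x i \<le> M x + \<alpha>"
    using ls.upper[OF \<alpha> compact_cbox] by blast
  show ?thesis
  proof (intro exI[of _ "real n + 1"] conjI allI impI)
    fix x :: "real^'n" and t s assume ts: "real n + 1 \<le> t" "t \<le> s"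
    obtain k where k: "int_vec k" "x + k \<in> cbox 0 1" using unit_cube_translate by blast
    have "(t, s) \<in> A n" using ts by (simp add: A_def)
    then have "\<Phi> (x + k) (t, s) \<le> M (x + k) + \<alpha>" using n k(2) by blast
    moreover have "\<Phi> (x + k) (t, s) = \<Phi> x (t, s)"
      using U_per[of t] U_per[of s] v_per k(1) ts by (simp add: \<Phi>_def periodic_fun_def)
    ultimately show "\<Phi> x (t, s) \<le> thr + \<alpha>" using Mle[of "x + k"] by linarith
  qed simp
qed

end

section \<open>From almost monotonicity to convergence\<close>

context hjb_bounded
begin

text \<open>The inequality limits how far \<open>U\<close> may drop over a window of length \<tau>;
  it leaves growth free, and growth is limited afterwards by boundedness.\<close>

definition almost_nonincreasing :: bool where
  "almost_nonincreasing \<longleftrightarrow> (\<forall>\<alpha>>0. \<forall>\<tau>>0. \<exists>T\<ge>1. \<forall>x t s. T \<le> t --> t \<le> s --> s \<le> t + \<tau> --> U x t - U x s \<le> \<alpha>)"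

text \<open>Replacing \<open>\<mu> = 1 + h\<close> by 1 changes the estimate by terms of size
  \<open>h * B\<close>, and the drift costs \<open>\<eta> * \<tau>\<close> over the window. Both
  parameters are fixed before the time \<open>T\<close>, so that these two errors and the one in the
  estimate itself take a third of \<alpha> each.\<close>

lemma almost_monotone:
  assumes v: "\<And>x. \<bar>v x\<bar> \<le> B" and \<mu>1: "\<mu>1 > 1"
    and key: "\<And>\<mu> \<eta> \<alpha>. 1 < \<mu> ==> \<mu> \<le> \<mu>1 ==> \<eta> > 0 ==> \<alpha> > 0 ==>
      \<exists>T\<ge>1. \<forall>x t s. T \<le> t --> t \<le> s --> U x t - \<mu> * U x s + (\<mu> - 1) * v x - \<eta> * (s - t) \<le> (\<mu> - 1) * (2 * B) + \<alpha>"
  shows almost_nonincreasing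
  unfolding almost_nonincreasing_def
proof (intro allI impI)
  fix \<alpha> \<tau> :: real assume \<alpha>: "\<alpha> > 0" and \<tau>: "\<tau> > 0"
  define B1 where "B1 = 4 * B + 1"
  have B1: "B1 > 0" "4 * B \<le> B1" using B_nonneg by (auto simp: B1_def)
  define h where "h = min (\<mu>1 - 1) (\<alpha> / (3 * B1))"
  have h: "h > 0" "h \<le> \<mu>1 - 1" using \<mu>1 \<alpha> B1 by (auto simp: h_def)
  have "h \<le> \<alpha> / (3 * B1)" by (simp add: h_def)
  then have hB: "3 * (h * B1) \<le> \<alpha>" using B1 by (simp add: pos_le_divide_eq mult.left_commute mult.commute)
  define \<eta> where "\<eta> = \<alpha> / (3 * \<tau>)"
  have \<eta>: "\<eta> > 0" "\<eta> * \<tau> = \<alpha> / 3" using \<alpha> \<tau> by (auto simp: \<eta>_def)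
  obtain T where T: "T \<ge> 1" "\<And>x t s. T \<le> t ==> t \<le> s ==> U x t - (1 + h) * U x s + h * v x - \<eta> * (s - t) \<le> h * (2 * B) + \<alpha> / 3"
    using key[of "1 + h" \<eta> "\<alpha> / 3"] h \<eta> \<alpha> by auto
  show "\<exists>T\<ge>1. \<forall>x t s. T \<le> t --> t \<le> s --> s \<le> t + \<tau> --> U x t - U x s \<le> \<alpha>"
  proof (intro exI[of _ T] conjI allI impI T(1))
    fix x t s assume ts: "T \<le> t" "t \<le> s" "s \<le> t + \<tau>"
    have "U x s - v x \<le> 2 * B" using U_bd[of s x] v[of x] ts T(1) unfolding abs_le_iff by linarith
    then have "h * (U x s - v x) \<le> h * (2 * B)" using h by (intro mult_left_mono) auto
    moreover have "h * (4 * B) \<le> h * B1" using B1 h by (intro mult_left_mono) auto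
    moreover have "\<eta> * (s - t) \<le> \<eta> * \<tau>" using \<eta> ts by (intro mult_left_mono) auto
    moreover have "h * (4 * B) = 2 * (h * (2 * B))" by simp
    moreover have "U x t - U x s = (U x t - (1 + h) * U x s + h * v x - \<eta> * (s - t)) + h * (U x s - v x) + \<eta> * (s - t)"
      by (simp add: algebra_simps)
    moreover have "d \<le> \<alpha>" if "d = e + p + q" "e \<le> z + \<alpha> / 3" "p \<le> z" "w = 2 * z" "w \<le> y" "3 * y \<le> \<alpha>" "q \<le> qq" "qq = \<alpha> / 3"
      for d e p q z w y qq :: real using that by argo
    ultimately show "U x t - U x s \<le> \<alpha>" using T(2)[OF ts(1,2), of x] \<eta>(2) hB by blast
  qed
qed

text \<open>A window on which \<open>U\<close> grows by a fixed amount somewhere increases the sum of \<open>U\<close> over a finite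
  net by a fixed amount, up to the small decrease allowed by almost monotonicity; since \<open>U\<close> is bounded,
  this cannot happen on too many consecutive windows.\<close>

lemma nearly_stationary_window:
  assumes mono: almost_nonincreasing
    and \<gamma>: "\<gamma> > 0" and \<tau>: "\<tau> > 0"
  shows "\<exists>t\<ge>T0. \<forall>x s. 0 \<le> s --> s \<le> \<tau> --> \<bar>U x (t + s) - U x t\<bar> \<le> \<gamma>"
proof (rule ccontr)
  assume no: "\<not> ?thesis"
  define Q where "Q = cbox (0::real^'n) 1"
  have cQ: "compact Q" unfolding Q_def by (rule compact_cbox)
  define r where "r = \<gamma> / (8 * C)"
  have r: "r > 0" "C * r = \<gamma> / 8" using \<gamma> C_pos by (auto simp: r_def)
  have "\<forall>e>0. \<exists>k. finite k \<and> Q \<subseteq> (\<Union>x\<in>k. ball x e)"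
    using cQ unfolding compact_eq_totally_bounded by (rule conjunct2)
  then have "\<exists>k. finite k \<and> Q \<subseteq> (\<Union>x\<in>k. ball x r)" using r(1) by (elim allE impE)
  then obtain N where N: "finite N" "Q \<subseteq> (\<Union>x\<in>N. ball x r)" by (elim exE conjE) (rule that)
  have "0 \<in> Q" by (simp add: Q_def mem_box_cart)
  then have "N \<noteq> {}" using N by auto
  then have cN: "real (card N) \<ge> 1" using N(1) by (simp add: Suc_le_eq card_gt_0_iff)
  \<comment> \<open>Drops of at most \<alpha> at all points of the net cost at most
    \<open>\<gamma> / 4\<close> in the sum, against a gain of \<open>\<gamma> / 2\<close> at the net
    point near \<open>x\<close>.\<close>
  define \<alpha> where "\<alpha> = \<gamma> / (4 * real (card N))"
  have \<alpha>: "\<alpha> > 0" "\<alpha> * real (card N) = \<gamma> / 4" using \<gamma> cN by (auto simp: \<alpha>_def)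
  have "\<alpha> * 1 \<le> \<alpha> * real (card N)" using \<alpha>(1) cN by (intro mult_left_mono) auto
  then have \<alpha>1: "\<alpha> \<le> \<gamma> / 4" using \<alpha>(2) by simp
  obtain T where T: "T \<ge> 1" "\<And>x t s. T \<le> t ==> t \<le> s ==> s \<le> t + \<tau> ==> U x t - U x s \<le> \<alpha>"
    using mono[unfolded almost_nonincreasing_def, rule_format, OF \<alpha>(1) \<tau>] by blast
  define tt where "tt j = max T T0 + real j * \<tau>" for j :: nat
  have tt: "tt j \<ge> T" "tt j \<ge> T0" "tt j \<ge> 0" "tt (Suc j) = tt j + \<tau>" for j
  proof -
    have "real j * \<tau> \<ge> 0" using \<tau> by simp
    then show "tt j \<ge> T" "tt j \<ge> T0" "tt j \<ge> 0" using T(1) unfolding tt_def by linarith+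
    show "tt (Suc j) = tt j + \<tau>" by (simp add: tt_def algebra_simps)
  qed
  define S where "S j = (\<Sum>z\<in>N. U z (tt j))" for j
  have step: "S (Suc j) \<ge> S j + \<gamma> / 4" for j
  proof -
    obtain x s where xs: "0 \<le> s" "s \<le> \<tau>" "\<bar>U x (tt j + s) - U x (tt j)\<bar> > \<gamma>"
      using no tt(2)[of j] by (meson not_le)
    have "U x (tt j) - U x (tt j + s) \<le> \<alpha>" using T(2)[of "tt j" "tt j + s" x] xs tt by simp
    \<comment> \<open>A drop larger than \<gamma> is excluded because \<alpha> is at most a quarter
      of it, so the change is a rise; the rest of the window can undo only \<alpha> of it.\<close>
    then have up: "U x (tt j + s) \<ge> U x (tt j) + \<gamma>" using xs(3) \<alpha>1 \<gamma> by linarith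
    have "U x (tt j + s) - U x (tt (Suc j)) \<le> \<alpha>" using T(2)[of "tt j + s" "tt (Suc j)" x] xs tt(1)[of j] tt(4)[of j] by simp
    then have up2: "U x (tt (Suc j)) \<ge> U x (tt j) + 3 / 4 * \<gamma>" using up \<alpha>1 by linarith
    obtain k where k: "int_vec k" "x + k \<in> cbox 0 1" using unit_cube_translate by blast
    have per: "U (x + k) (tt i) = U x (tt i)" for i using U_per[OF tt(3)[of i]] k(1) by (simp add: periodic_fun_def)
    have "x + k \<in> Q" using k by (simp add: Q_def)
    then obtain z where z: "z \<in> N" "norm (z - (x + k)) \<le> r" using N(2) by (force simp: dist_norm)
    have Cz: "C * norm (z - (x + k)) \<le> \<gamma> / 8" using mult_left_mono[OF z(2) less_imp_le[OF C_pos]] r(2) by linarith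
    have "U z (tt (Suc j)) \<ge> U z (tt j) + \<gamma> / 2"
      using U_lip[OF tt(3)[of j], of z "x + k"] U_lip[OF tt(3)[of "Suc j"], of z "x + k"] Cz up2
      unfolding per abs_le_iff by linarith
    moreover have "U y (tt (Suc j)) - U y (tt j) \<ge> - \<alpha>" for y using T(2)[of "tt j" "tt (Suc j)" y] tt(1)[of j] tt(4)[of j] \<tau> by simp
    then have "(\<Sum>y\<in>N - {z}. U y (tt (Suc j)) - U y (tt j)) \<ge> (\<Sum>y\<in>N - {z}. - \<alpha>)" by (intro sum_mono)
    moreover have "(\<Sum>y\<in>N - {z}. - \<alpha>) \<ge> - (\<gamma> / 4)"
    proof -
      have "real (card (N - {z})) * \<alpha> \<le> real (card N) * \<alpha>" using N(1) \<alpha>(1) by (intro mult_right_mono) (auto intro: card_mono)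
      then show ?thesis using \<alpha>(2) by (simp add: mult.commute)
    qed
    moreover have "S (Suc j) - S j = (U z (tt (Suc j)) - U z (tt j)) + (\<Sum>y\<in>N - {z}. U y (tt (Suc j)) - U y (tt j))"
      unfolding S_def sum_subtractf[symmetric] by (rule sum.remove[OF N(1) z(1)])
    ultimately show ?thesis by linarith
  qed
  have grow: "S j \<ge> S 0 + real j * (\<gamma> / 4)" for j
  proof (induction j)
    case (Suc j)
    have "real (Suc j) * (\<gamma> / 4) = real j * (\<gamma> / 4) + \<gamma> / 4" by (simp add: algebra_simps)
    then show ?case using Suc step[of j] by linarith
  qed simp
  have Sb: "\<bar>S j\<bar> \<le> real (card N) * B" for j
  proof -
    have "\<bar>S j\<bar> \<le> (\<Sum>z\<in>N. B)" unfolding S_def by (rule order_trans[OF sum_abs sum_mono]) (use U_bd tt in auto)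
    then show ?thesis by simp
  qed
  have "\<gamma> / 4 > 0" using \<gamma> by simp
  from reals_Archimedean3[OF this] obtain j where "real j * (\<gamma> / 4) > 2 * (real (card N) * B)" by blast
  then show False using grow[of j] Sb[of 0] Sb[of j] unfolding abs_le_iff by linarith
qed

text \<open>A window of length 2 starting at \<open>t\<close> is the interval of radius 1 around
  \<open>t + 1\<close>, the form that stability uses. It is applied to \<open>U\<close> for the
  subsolution half and to \<open>- U\<close> for the other.\<close>

lemma limit_solution:
  assumes V: "\<And>x y. \<bar>V x - V y\<bar> \<le> C * norm (x - y)"
    and conv: "\<And>\<gamma>. \<gamma> > 0 ==> \<exists>t>0. \<forall>x s. 0 \<le> s --> s \<le> 2 --> \<bar>U x (t + s) - V x\<bar> \<le> \<gamma>"
  shows "visc_sol (\<lambda>x r p X. F x p X - c) V"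
proof -
  have approx: "\<exists>tb>1. k * U x0 tb \<ge> k * V x0 - \<gamma> \<and> (\<forall>x t. norm (x - x0) \<le> 1 --> \<bar>t - tb\<bar> \<le> 1 --> k * U x t \<le> k * V x + \<gamma>)"
    if g0: "\<gamma> > 0" and k: "k = 1 \<or> k = - 1" for \<gamma> k x0
  proof -
    obtain t where t: "t > 0" "\<And>x s. 0 \<le> s ==> s \<le> 2 ==> \<bar>U x (t + s) - V x\<bar> \<le> \<gamma>" using conv[OF g0] by blast
    have b: "\<bar>k * U x s - k * V x\<bar> \<le> \<gamma>" if "\<bar>s - (t + 1)\<bar> \<le> 1" for x s
    proof -
      have "\<bar>U x (t + (s - t)) - V x\<bar> \<le> \<gamma>" using that by (intro t(2)) (auto simp: abs_le_iff)
      moreover have "\<bar>k * U x s - k * V x\<bar> = \<bar>U x s - V x\<bar>" using k by auto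
      ultimately show ?thesis by simp
    qed
    show ?thesis
    proof (intro exI[of _ "t + 1"] conjI allI impI)
      show "k * V x0 - \<gamma> \<le> k * U x0 (t + 1)" using b[of "t + 1" x0] unfolding abs_le_iff by simp
      show "k * U x s \<le> k * V x + \<gamma>" if "\<bar>s - (t + 1)\<bar> \<le> 1" for x s using b[OF that, of x] unfolding abs_le_iff by simp
    qed (use t in simp)
  qed
  show ?thesis unfolding visc_sol_def
  proof (intro conjI allI impI)
    show "continuous_on UNIV V" by (rule lipschitz_bound_continuous[where L = C]) (use V in simp)
  next
    fix phi Dphi D2phi x0
    assume C2: "C2_fun phi Dphi D2phi" and "\<exists>e>0. \<forall>y\<in>ball x0 e. V y - phi y \<le> V x0 - phi x0"
    then obtain e where e: "e > 0" "\<forall>y\<in>ball x0 e. V y - phi y \<le> V x0 - phi x0" by blast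
    have "1 * (F x0 (1 *\<^sub>R Dphi x0) (1 *\<^sub>R D2phi x0) - c) \<le> 0"
    proof (rule limit_test[where V = "\<lambda>x. 1 * V x", OF _ approx C2 e(1)])
      show "1 * V y - phi y \<le> 1 * V x0 - phi x0" if "norm (y - x0) < e" for y
        using e(2) that by (simp add: dist_norm norm_minus_commute)
    qed auto
    then show "F x0 (Dphi x0) (D2phi x0) - c \<le> 0" by simp
  next
    fix phi Dphi D2phi x0
    assume C2: "C2_fun phi Dphi D2phi" and "\<exists>e>0. \<forall>y\<in>ball x0 e. V y - phi y \<ge> V x0 - phi x0"
    then obtain e where e: "e > 0" "\<forall>y\<in>ball x0 e. V y - phi y \<ge> V x0 - phi x0" by blast
    have C2': "C2_fun (\<lambda>x. - phi x) (\<lambda>x. - Dphi x) (\<lambda>x. - D2phi x)"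
    proof -
      have m: "(\<lambda>h. - D2phi x *v h) = (\<lambda>h. - (D2phi x *v h))" "(\<lambda>h. - Dphi x \<bullet> h) = (\<lambda>h. - (Dphi x \<bullet> h))" for x
        by (auto simp: matrix_vector_mult_def vec_eq_iff sum_negf)
      show ?thesis using C2 unfolding C2_fun_def m by (intro conjI allI has_derivative_minus continuous_on_minus) auto
    qed
    have "- 1 * (F x0 (- 1 *\<^sub>R - Dphi x0) (- 1 *\<^sub>R - D2phi x0) - c) \<le> 0"
    proof (rule limit_test[where V = "\<lambda>x. - 1 * V x", OF _ approx C2' e(1)])
      show "- 1 * V y - - phi y \<le> - 1 * V x0 - - phi x0" if "norm (y - x0) < e" for y
      proof -
        have "y \<in> ball x0 e" using that by (simp add: dist_norm norm_minus_commute)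
        then have "V x0 - phi x0 \<le> V y - phi y" using e(2) by blast
        then show ?thesis by simp
      qed
    qed auto
    then show "0 \<le> F x0 (Dphi x0) (D2phi x0) - c" by simp
  qed
qed

theorem convergence_of_almost_monotone:
  assumes mono: almost_nonincreasing
  shows "\<exists>w. periodic_fun w \<and> visc_sol (\<lambda>x r p X. F x p X - c) w \<and> uniform_limit UNIV (\<lambda>t x. U x t) w at_top"
proof -
  define Q where "Q = cbox (0::real^'n) 1"
  have cQ: "compact Q" unfolding Q_def by (rule compact_cbox)
  have "\<exists>t\<ge>real n + 1. \<forall>x s. 0 \<le> s --> s \<le> 2 --> \<bar>U x (t + s) - U x t\<bar> \<le> inverse (real (Suc n))" for n
    by (rule nearly_stationary_window[OF mono]) auto
  then have "\<exists>tn. \<forall>n. tn n \<ge> real n + 1 \<and> (\<forall>x s. 0 \<le> s --> s \<le> 2 --> \<bar>U x (tn n + s) - U x (tn n)\<bar> \<le> inverse (real (Suc n)))"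
    by (intro choice allI)
  then obtain tn where tn: "\<And>n. tn n \<ge> real n + 1" "\<And>n x s. 0 \<le> s ==> s \<le> 2 ==> \<bar>U x (tn n + s) - U x (tn n)\<bar> \<le> inverse (real (Suc n))"
    by blast
  have tn0: "tn n \<ge> 0" "tn n > 0" for n using tn(1)[of n] by linarith+
  have Ub: "norm (U x (tn n)) \<le> B" for n x using U_bd[OF tn0(1)] by simp
  have equi: "\<exists>d>0. \<forall>n y. y \<in> Q \<and> norm (x - y) < d --> norm (U x (tn n) - U y (tn n)) < e" if "e > 0" for x e
  proof (intro exI[of _ "e / C"] conjI allI impI)
    show "e / C > 0" using that C_pos by simp
    fix n y assume "y \<in> Q \<and> norm (x - y) < e / C"
    then have "C * norm (x - y) < e" using C_pos by (simp add: pos_less_divide_eq mult.commute)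
    then show "norm (U x (tn n) - U y (tn n)) < e" using U_lip[OF tn0(1)[of n], of x y] by simp
  qed
  obtain g k where k: "strict_mono (k :: nat => nat)" and g: "\<And>e. 0 < e ==> \<exists>N. \<forall>n x. n \<ge> N \<and> x \<in> Q --> norm (U x (tn (k n)) - g x) < e"
  proof (rule Arzela_Ascoli[of Q "\<lambda>n x. U x (tn n)" B, OF cQ Ub])
    show "\<exists>d. 0 < d \<and> (\<forall>n y. y \<in> Q \<and> norm (x - y) < d --> norm (U x (tn n) - U y (tn n)) < e)" if "e > 0" for x e
      using equi[OF that] .
  qed (rule that)
  \<comment> \<open>Taking the limit at every point makes periodicity immediate; on the cube it
    agrees with the limit \<open>g\<close> supplied by compactness, and periodicity spreads the
    uniform convergence.\<close>
  define V where "V x = lim (\<lambda>n. U x (tn (k n)))" for x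
  have perU: "U (x + j) (tn n) = U x (tn n)" if "int_vec j" for x j n
    using U_per[OF tn0(1)[of n]] that by (simp add: periodic_fun_def)
  have Vper: "V (x + j) = V x" if "int_vec j" for x j unfolding V_def perU[OF that] ..
  have VQ: "V x = g x" if "x \<in> Q" for x
  proof -
    have "(\<lambda>n. U x (tn (k n))) \<longlonglongrightarrow> g x"
    proof (rule LIMSEQ_I)
      fix e :: real assume "e > 0"
      from g[OF this] that show "\<exists>N. \<forall>n\<ge>N. norm (U x (tn (k n)) - g x) < e" by blast
    qed
    then show ?thesis unfolding V_def by (rule limI)
  qed
  have unif: "\<exists>N. \<forall>n\<ge>N. \<forall>x. \<bar>U x (tn (k n)) - V x\<bar> \<le> e" if e: "e > 0" for e
  proof -
    obtain N where N: "\<And>n x. n \<ge> N ==> x \<in> Q ==> norm (U x (tn (k n)) - g x) < e" using g[OF e] by blast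
    have "\<bar>U x (tn (k n)) - V x\<bar> \<le> e" if n: "n \<ge> N" for n x
    proof -
      obtain j where j: "int_vec j" "x + j \<in> cbox 0 1" using unit_cube_translate by blast
      then have "x + j \<in> Q" by (simp add: Q_def)
      then show ?thesis using N[OF n, of "x + j"] VQ[of "x + j"] perU[OF j(1), of x "k n"] Vper[OF j(1), of x] by simp
    qed
    then show ?thesis by blast
  qed
  have Vlip: "\<bar>V x - V y\<bar> \<le> C * norm (x - y)" for x y
  proof (rule field_le_epsilon)
    fix e :: real assume e: "e > 0"
    obtain N where N: "\<And>x. \<bar>U x (tn (k N)) - V x\<bar> \<le> e / 2" using unif[of "e / 2"] e by auto
    show "\<bar>V x - V y\<bar> \<le> C * norm (x - y) + e"
      using N[of x] N[of y] U_lip[OF tn0(1)[of "k N"], of x y] by linarith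
  qed
  have near: "\<exists>t>0. (\<forall>x s. 0 \<le> s --> s \<le> 2 --> \<bar>U x (t + s) - V x\<bar> \<le> \<gamma>)" if \<gamma>: "\<gamma> > 0" for \<gamma>
  proof -
    obtain N where N: "\<And>n x. n \<ge> N ==> \<bar>U x (tn (k n)) - V x\<bar> \<le> \<gamma> / 2" using unif[of "\<gamma> / 2"] \<gamma> by auto
    obtain m where m: "inverse (real (Suc m)) < \<gamma> / 2" using reals_Archimedean[of "\<gamma> / 2"] \<gamma> by auto
    define n where "n = max N m"
    have "m \<le> k n" using seq_suble[OF k, of n] by (simp add: n_def)
    then have "inverse (real (Suc (k n))) \<le> inverse (real (Suc m))" by (intro le_imp_inverse_le) auto
    then have i: "inverse (real (Suc (k n))) \<le> \<gamma> / 2" using m by linarith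
    show ?thesis
    proof (intro exI[of _ "tn (k n)"] conjI allI impI tn0)
      fix x s :: real and x' assume "0 \<le> s" "s \<le> 2"
      then have "\<bar>U x' (tn (k n) + s) - U x' (tn (k n))\<bar> \<le> \<gamma> / 2" using order_trans[OF tn(2) i] by blast
      moreover have "\<bar>U x' (tn (k n)) - V x'\<bar> \<le> \<gamma> / 2" by (rule N) (simp add: n_def)
      ultimately show "\<bar>U x' (tn (k n) + s) - V x'\<bar> \<le> \<gamma>" by linarith
    qed
  qed
  have sol: "visc_sol (\<lambda>x r p X. F x p X - c) V" by (rule limit_solution[OF Vlip near])
  have Vbd: "\<bar>V x\<bar> \<le> B + 1" for x
  proof -
    obtain N where N: "\<And>x. \<bar>U x (tn (k N)) - V x\<bar> \<le> 1" using unif[of 1] by auto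
    show ?thesis using N[of x] Ub[of x "k N"] by simp
  qed
  have "uniform_limit UNIV (\<lambda>t x. U x t) V at_top"
  proof (rule uniform_limitI)
    fix e :: real assume e: "e > 0"
    obtain t where t: "t > 0" "\<And>x s. 0 \<le> s ==> s \<le> 2 ==> \<bar>U x (t + s) - V x\<bar> \<le> e / 2" using near[of "e / 2"] e by auto
    have t0: "\<bar>U x t - V x\<bar> \<le> e / 2" for x using t(2)[of 0 x] by simp
    show "\<forall>\<^sub>F t in at_top. \<forall>x\<in>UNIV. dist (U x t) (V x) < e"
    proof (rule eventually_at_top_linorderI[of t], intro ballI)
      fix t' x assume t': "t \<le> t'"
      have "s * (U x t' - V x) \<le> e / 2" if s: "s = 1 \<or> s = - 1" for s
      proof (rule compare_with_stationary[OF sol Vlip less_imp_le[OF C_pos] Vbd t(1) t' s])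
        show "s * (U y t - V y) \<le> e / 2" for y using t0[of y] s unfolding abs_le_iff by auto
      qed
      from this[of 1] this[of "- 1"] have "\<bar>U x t' - V x\<bar> \<le> e / 2" unfolding abs_le_iff by simp
      then show "dist (U x t') (V x) < e" using e by (simp add: dist_real_def)
    qed
  qed
  then show ?thesis using sol Vper unfolding periodic_fun_def by blast
qed

end

section \<open>Boundedness of the normalized solution\<close>

context hjb_evol
begin

text \<open>Comparison starts from a positive time, here 1; earlier times are covered by continuity
  on a compact set and periodicity.\<close>

lemma U_bounded:
  assumes v: "periodic_fun v" "visc_sol (\<lambda>x r p X. F x p X - c) v" "\<And>x y. \<bar>v x - v y\<bar> \<le> L * norm (x - y)"
  shows "\<exists>B. \<forall>x t. 0 \<le> t --> \<bar>U x t\<bar> \<le> B"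
proof -
  have vL: "\<bar>v x - v y\<bar> \<le> \<bar>L\<bar> * norm (x - y)" for x y
    using v(3)[of x y] mult_right_mono[OF abs_ge_self[of L] norm_ge_zero[of "x - y"]] by linarith
  have "continuous_on UNIV v" using v(2) unfolding visc_sol_def by (rule conjunct1)
  then obtain Bv where Bv: "\<And>x. \<bar>v x\<bar> \<le> Bv" using periodic_fun_bounded[OF v(1)] by blast
  obtain B1 where B1: "\<And>x t. 0 \<le> t ==> t \<le> 1 ==> \<bar>U x t\<bar> \<le> B1" using U_bounded_on[of 1] by blast
  show ?thesis
  proof (intro exI[of _ "B1 + 2 * Bv"] allI impI)
    fix x t assume t: "(0::real) \<le> t"
    have Bv0: "Bv \<ge> 0" using Bv[of 0] by linarith
    show "\<bar>U x t\<bar> \<le> B1 + 2 * Bv"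
    proof (cases "t \<le> 1")
      case True
      then show ?thesis using B1[OF t True, of x] Bv0 by linarith
    next
      case False
      have "s * (U x t - v x) \<le> B1 + Bv" if s: "s = 1 \<or> s = - 1" for s
      proof (rule compare_with_stationary[where ?t1.0 = 1, OF v(2) vL abs_ge_zero Bv _ _ s])
        show "s * (U y 1 - v y) \<le> B1 + Bv" for y
          using s B1[of 1 y] Bv[of y] unfolding abs_le_iff by auto
      qed (use False in auto)
      from this[of 1] this[of "- 1"] show ?thesis using Bv[of x] unfolding abs_le_iff by simp
    qed
  qed
qed

end

context hjb_key
begin

lemma gap:
  assumes "\<alpha> > 0"
  shows "\<exists>T\<ge>1. \<forall>x t s. T \<le> t --> t \<le> s --> U x t - \<mu> * U x s + (\<mu> - 1) * v x - \<eta> * (s - t) \<le> (\<mu> - 1) * (2 * B) + \<alpha>"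
  using nearly_nonincreasing_gap[OF assms] by (simp add: \<Phi>_def thr_def)

end

section \<open>The two structural cases\<close>

context hjb_bounded
begin

text \<open>The subsolution acting as \<open>v\<close> in the convex case. It inherits from
  \<open>U\<close> the bound \<open>B\<close> and the Lipschitz constant \<open>C\<close>, to which
  \<kappa> is adapted, whereas a given ergodic solution comes with a Lipschitz constant that may be
  larger.\<close>

definition U_sup :: "real^'n => real" where
  "U_sup = limsup_family (\<lambda>n. {t. real n \<le> t}) U"

lemma U_limsup_setup: "limsup_setup (\<lambda>n. {t. real n \<le> t}) U (- B) B C"
proof
  have pos: "0 \<le> t" if "t \<in> {t. real n \<le> t}" for t n using that by simp
  show "{t. real n \<le> t} \<noteq> {}" for n by (auto intro: exI[of _ "real n"])
  show "{t. real n \<le> t} \<subseteq> {t. real m \<le> t}" if "m \<le> n" for m n using that by auto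
  show "U x t \<le> B" if "t \<in> {t. real n \<le> t}" for x t n using U_bd[OF pos[OF that], of x] by simp
  show "\<exists>t\<in>{t. real n \<le> t}. - B \<le> U x t" for x n
    using U_bd[of "real n" x] by (intro bexI[of _ "real n"]) (auto simp: abs_le_iff)
  show "U x t \<le> U y t + C * norm (x - y)" if "t \<in> {t. real n \<le> t}" for x y t n
    using U_lip[OF pos[OF that], of x y] unfolding abs_le_iff by linarith
  show "0 \<le> C" using C_pos by simp
qed

lemma U_sup_facts:
  "periodic_fun U_sup" "\<bar>U_sup x - U_sup y\<bar> \<le> C * norm (x - y)" "\<bar>U_sup x\<bar> \<le> B" "stat_sub H c U_sup"
proof -
  interpret ls: limsup_setup "\<lambda>n. {t. real n \<le> t}" U "- B" B C by (rule U_limsup_setup)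
  have lip: "U_sup x \<le> U_sup y + C * norm (x - y)" for x y unfolding U_sup_def by (rule ls.M_lip)
  have lower: "\<exists>t\<ge>real n. U x t \<ge> U_sup x - \<gamma>" if "\<gamma> > 0" for \<gamma> n x
    using ls.lower[OF that, of n x] unfolding U_sup_def by auto
  show "\<bar>U_sup x - U_sup y\<bar> \<le> C * norm (x - y)"
    using lip[of x y] lip[of y x] by (simp add: abs_le_iff norm_minus_commute)
  have "U_sup (x + k) = U_sup x" if k: "int_vec k" for x k
  proof -
    have "(SUP t\<in>{t. real n \<le> t}. U (x + k) t) = (SUP t\<in>{t. real n \<le> t}. U x t)" for n
    proof (rule SUP_cong[OF refl])
      fix t assume "t \<in> {t. real n \<le> t}"
      then have "0 \<le> t" by simp
      then show "U (x + k) t = U x t" using U_per[of t] k by (simp add: periodic_fun_def)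
    qed
    then show ?thesis by (simp add: U_sup_def limsup_family_def)
  qed
  then show "periodic_fun U_sup" by (simp add: periodic_fun_def)
  show "\<bar>U_sup x\<bar> \<le> B"
  proof (rule field_le_epsilon)
    fix e :: real assume e: "e > 0"
    obtain t where t: "t \<ge> real 0" "U x t \<ge> U_sup x - e" using lower[OF e] by blast
    obtain n where n: "\<forall>t\<in>{t. real n \<le> t}. U x t \<le> U_sup x + e"
      using ls.upper_pointwise[OF e, of x] unfolding U_sup_def by blast
    have "U x (real n) \<le> U_sup x + e" using n by simp
    then show "\<bar>U_sup x\<bar> \<le> B + e" using t U_bd[of t x] U_bd[of "real n" x] unfolding abs_le_iff by simp
  qed
  show "stat_sub H c U_sup"
  proof (rule stat_sub_of_test)
    fix phi Dphi D2phi x0 and e :: real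
    assume C2: "C2_fun phi Dphi D2phi" and e: "e > 0" and touch: "\<And>y. norm (y - x0) < e ==> U_sup y - phi y \<le> U_sup x0 - phi x0"
    have "1 * (F x0 (1 *\<^sub>R Dphi x0) (1 *\<^sub>R D2phi x0) - c) \<le> 0"
    proof (rule limit_test[OF _ _ C2 e touch])
      fix \<gamma> :: real assume \<gamma>: "\<gamma> > 0"
      obtain n where n: "\<forall>x\<in>cball x0 1. \<forall>t\<in>{t. real n \<le> t}. U x t \<le> U_sup x + \<gamma>"
        using ls.upper[OF \<gamma> compact_cball] unfolding U_sup_def by blast
      obtain tb where tb: "tb \<ge> real (n + 2)" "U x0 tb \<ge> U_sup x0 - \<gamma>" using lower[OF \<gamma>] by blast
      show "\<exists>tb>1. 1 * U x0 tb \<ge> U_sup x0 - \<gamma> \<and> (\<forall>x t. norm (x - x0) \<le> 1 --> \<bar>t - tb\<bar> \<le> 1 --> 1 * U x t \<le> U_sup x + \<gamma>)"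
      proof (intro exI[of _ tb] conjI allI impI)
        show "1 < tb" "1 * U x0 tb \<ge> U_sup x0 - \<gamma>" using tb by simp_all
        fix x t assume "norm (x - x0) \<le> 1" "\<bar>t - tb\<bar> \<le> 1"
        then have "x \<in> cball x0 1" "t \<in> {t. real n \<le> t}" using tb(1) unfolding abs_le_iff by (simp_all add: dist_norm norm_minus_commute)
        then show "1 * U x t \<le> U_sup x + \<gamma>" using n by simp
      qed
    qed simp_all
    then show "F x0 (Dphi x0) (D2phi x0) - c \<le> 0" by simp
  qed
qed

text \<open>The structural expression is \<mu> times the convexity defect of \<open>H\<close> at
  \<open>Q\<close>, written as the combination of \<open>P\<close> and \<open>q\<close> with weights
  \<open>1 / \<mu>\<close> and \<open>1 - 1 / \<mu>\<close>. Since
  \<open>P - q = \<mu> (Q - q)\<close>, different gradients \<open>Q\<close> and \<open>q\<close>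
  give different endpoints, and strict convexity applies.\<close>

lemma almost_monotone_convex:
  assumes sigma_per: "\<And>\<theta>. periodic_fun (\<sigma> \<theta>)" and SS: "SS_cond \<sigma> \<kappa>" and kappa: "CR (2 * C) \<le> \<kappa>"
    and convex: "\<And>\<theta> x. convex_on UNIV (H \<theta> x)"
    and strict: "\<And>x lam p q. x \<in> degen_set \<sigma> ==> 0 < lam ==> lam < 1 ==> p \<noteq> q ==>
       (INF \<theta>. lam * H \<theta> x p + (1 - lam) * H \<theta> x q - H \<theta> x (lam *\<^sub>R p + (1 - lam) *\<^sub>R q)) > 0"
  shows almost_nonincreasing
proof (rule almost_monotone[where v = U_sup and ?\<mu>1.0 = "3/2", OF U_sup_facts(3)])
  fix \<mu> \<eta> \<alpha>' :: real assume mu: "1 < \<mu>" "\<mu> \<le> 3/2" and eta: "\<eta> > 0" and \<alpha>': "\<alpha>' > 0"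
  have cv: "lam * H \<theta> x p + (1 - lam) * H \<theta> x q - H \<theta> x (lam *\<^sub>R p + (1 - lam) *\<^sub>R q) \<ge> 0" if "0 < lam" "lam < 1" for lam \<theta> x p q
    using convex[of \<theta> x] that unfolding convex_on_def by simp
  have eq: "H \<theta> x P - \<mu> * H \<theta> x Q + (\<mu> - 1) * H \<theta> x q
      = \<mu> * (1 / \<mu> * H \<theta> x P + (1 - 1 / \<mu>) * H \<theta> x q - H \<theta> x ((1 / \<mu>) *\<^sub>R P + (1 - 1 / \<mu>) *\<^sub>R q))"
    if P: "P = \<mu> *\<^sub>R Q - (\<mu> - 1) *\<^sub>R q" for \<theta> x P Q q
  proof -
    have "(1 / \<mu>) *\<^sub>R P + (1 - 1 / \<mu>) *\<^sub>R q = Q"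
    proof -
      have "(1 / \<mu>) *\<^sub>R P = Q - ((\<mu> - 1) / \<mu>) *\<^sub>R q" using mu by (simp add: P scaleR_diff_right)
      moreover have "(\<mu> - 1) / \<mu> = 1 - 1 / \<mu>" using mu by (simp add: diff_divide_distrib)
      ultimately show ?thesis by simp
    qed
    moreover have "\<mu> * (1 / \<mu> * a + (1 - 1 / \<mu>) * b - d) = a - \<mu> * d + (\<mu> - 1) * b" for a b d :: real
      using mu by (simp add: field_simps)
    ultimately show ?thesis by simp
  qed
  have lam: "0 < 1 / \<mu>" "1 / \<mu> < 1" using mu by simp_all
  interpret key: hjb_key \<sigma> H C CR u c B U_sup H UNIV "{}" "CR C" \<mu> \<eta> \<kappa>
  proof
    show "\<exists>d>0. \<forall>\<theta>. d \<le> H \<theta> x (\<mu> *\<^sub>R Q - (\<mu> - 1) *\<^sub>R q) - \<mu> * H \<theta> x Q + (\<mu> - 1) * H \<theta> x q"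
      if x: "x \<in> degen_set \<sigma>" and Qq: "Q \<noteq> q" for x Q q
    proof -
      define P where "P = \<mu> *\<^sub>R Q - (\<mu> - 1) *\<^sub>R q"
      have "P - q = \<mu> *\<^sub>R (Q - q)" by (simp add: P_def algebra_simps)
      then have Pq: "P \<noteq> q" using Qq mu by auto
      let ?f = "\<lambda>\<theta>. 1 / \<mu> * H \<theta> x P + (1 - 1 / \<mu>) * H \<theta> x q - H \<theta> x ((1 / \<mu>) *\<^sub>R P + (1 - 1 / \<mu>) *\<^sub>R q)"
      have i0: "(INF \<theta>. ?f \<theta>) > 0" by (rule strict[OF x lam Pq])
      have "(INF \<theta>. ?f \<theta>) \<le> ?f \<theta>" for \<theta> by (rule cINF_lower[OF bdd_belowI2[of _ 0]]) (use cv[OF lam] in auto)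
      then have "\<mu> * (INF \<theta>. ?f \<theta>) \<le> \<mu> * ?f \<theta>" for \<theta> using mu by (intro mult_left_mono) auto
      then show ?thesis using i0 mu unfolding eq[OF P_def, symmetric] P_def[symmetric] by (intro exI[of _ "\<mu> * (INF \<theta>. ?f \<theta>)"]) auto
    qed
    show "0 \<le> H \<theta> x (\<mu> *\<^sub>R Q - (\<mu> - 1) *\<^sub>R q) - \<mu> * H \<theta> x Q + (\<mu> - 1) * H \<theta> x q" for \<theta> x Q q
      unfolding eq[OF refl] using cv[OF lam] mu by (intro mult_nonneg_nonneg) auto
    show "\<bar>H \<theta> x p - H \<theta> y q\<bar> \<le> CR C * (dist x y + dist p q)" if "norm p \<le> C" "norm q \<le> C" for \<theta> x y p q
      using H_lip[OF C_pos that] .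
  qed (use sigma_per U_sup_facts mu SS kappa eta CR_pos[OF C_pos] in auto)
  show "\<exists>T\<ge>1. \<forall>x t s. T \<le> t --> t \<le> s --> U x t - \<mu> * U x s + (\<mu> - 1) * U_sup x - \<eta> * (s - t) \<le> (\<mu> - 1) * (2 * B) + \<alpha>'"
    by (rule key.gap[OF \<alpha>'])
qed simp

text \<open>At \<open>p = 0\<close> the structural condition gives
  \<open>H \<theta> x 0 \<le> c\<close>, so the zero function is a stationary subsolution and can
  take the place of \<open>v\<close>.\<close>

lemma almost_monotone_nonconvex:
  assumes sigma_per: "\<And>\<theta>. periodic_fun (\<sigma> \<theta>)" and SS: "SS_cond \<sigma> \<kappa>" and kappa: "CR (2 * C) \<le> \<kappa>"
    and \<mu>0: "\<mu>0 > 1" and struct: "\<And>\<theta> x p \<mu>. 1 < \<mu> ==> \<mu> < \<mu>0 ==> H \<theta> x (\<mu> *\<^sub>R p) - \<mu> * H \<theta> x p \<ge> (1 - \<mu>) * c"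
    and K: "closed K" "K \<subseteq> degen_set \<sigma>" "\<And>\<theta> x p. x \<in> K ==> H \<theta> x p \<ge> c"
    and strict: "\<And>x p \<mu>. x \<in> degen_set \<sigma> ==> K = {} \<or> infdist x K \<noteq> 0 ==> p \<noteq> 0 ==> 1 < \<mu> ==> \<mu> \<le> \<mu>0 ==>
       (INF \<theta>. H \<theta> x (\<mu> *\<^sub>R p) - \<mu> * H \<theta> x p) > (1 - \<mu>) * c"
  shows almost_nonincreasing
proof -
  \<comment> \<open>Strictly below \<mu>0, because the nonstrict condition is available only for
    \<open>\<mu> < \<mu>0\<close>, and at most 3/2 as the common setting demands.\<close>
  define \<mu>1 where "\<mu>1 = (1 + min \<mu>0 (3/2)) / 2"
  have \<mu>1: "\<mu>1 > 1" "\<mu>1 < \<mu>0" "\<mu>1 \<le> 3/2" using \<mu>0 by (auto simp: \<mu>1_def min_def)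
  have H0: "H \<theta> x 0 \<le> c" for \<theta> x
  proof -
    have "(\<mu>1 - 1) * H \<theta> x 0 \<le> (\<mu>1 - 1) * c" using struct[OF \<mu>1(1,2), of \<theta> x 0] by (simp add: algebra_simps)
    then show ?thesis using \<mu>1(1) by simp
  qed
  show ?thesis
  proof (rule almost_monotone[where v = "\<lambda>x. 0" and ?\<mu>1.0 = \<mu>1, OF _ \<mu>1(1)])
    fix \<mu> \<eta> \<alpha>' :: real assume mu: "1 < \<mu>" "\<mu> \<le> \<mu>1" and eta: "\<eta> > 0" and \<alpha>': "\<alpha>' > 0"
    have mu': "\<mu> \<le> 3/2" "\<mu> < \<mu>0" using mu \<mu>1 by linarith+
    interpret key: hjb_key \<sigma> H C CR u c B "\<lambda>x. 0" "\<lambda>\<theta> x p. c" "{0}" K 0 \<mu> \<eta> \<kappa>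
    proof
      show "\<exists>d>0. \<forall>\<theta>. d \<le> H \<theta> x (\<mu> *\<^sub>R Q - (\<mu> - 1) *\<^sub>R q) - \<mu> * H \<theta> x Q + (\<mu> - 1) * c"
        if x: "x \<in> degen_set \<sigma>" "x \<notin> K" and q: "q \<in> {0}" and Qq: "Q \<noteq> q" for x Q q
      proof -
        have Q: "Q \<noteq> 0" using q Qq by auto
        \<comment> \<open>The distance to the empty set is 0 by convention, hence the separate
          alternative \<open>K = {}\<close>.\<close>
        have K0: "K = {} \<or> infdist x K \<noteq> 0" using x(2) in_closed_iff_infdist_zero[OF K(1)] by blast
        let ?f = "\<lambda>\<theta>. H \<theta> x (\<mu> *\<^sub>R Q) - \<mu> * H \<theta> x Q"
        have i0: "(INF \<theta>. ?f \<theta>) > (1 - \<mu>) * c" using strict[OF x(1) K0 Q mu(1)] mu'(2) by simp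
        have "(INF \<theta>. ?f \<theta>) \<le> ?f \<theta>" for \<theta>
          by (rule cINF_lower[OF bdd_belowI2[of _ "(1 - \<mu>) * c"]]) (use struct[OF mu(1) mu'(2)] in auto)
        then have "(INF \<theta>. ?f \<theta>) - (1 - \<mu>) * c \<le> ?f \<theta> + (\<mu> - 1) * c" for \<theta> by (simp add: algebra_simps)
        then show ?thesis using i0 q by (intro exI[of _ "(INF \<theta>. ?f \<theta>) - (1 - \<mu>) * c"]) auto
      qed
      show "0 \<le> H \<theta> x (\<mu> *\<^sub>R Q - (\<mu> - 1) *\<^sub>R q) - \<mu> * H \<theta> x Q + (\<mu> - 1) * c" if "q \<in> {0}" for \<theta> x Q q
        using struct[OF mu(1) mu'(2), of \<theta> x Q] that by (simp add: algebra_simps)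
      show "q \<in> {0}" if "touch2 (\<lambda>x. 0) z q Z" for z q :: "real^'n" and Z
        using touch2_norm_le[OF that, of 0] by simp
      show "stat_sub H c (\<lambda>x. 0)" "stat_sub (\<lambda>\<theta> x p. c) c (\<lambda>x. 0)" by (rule stat_sub_zero, simp add: H0)+
      show "periodic_fun (\<lambda>x. 0)" by (simp add: periodic_fun_def)
      show "x \<in> degen_set \<sigma>" if "x \<in> K" for x using K(2) that by blast
      show "H \<theta> x p \<ge> c" if "x \<in> K" for \<theta> x p using K(3)[OF that] .
    qed (use sigma_per mu mu' SS kappa eta C_pos B_nonneg in auto)
    show "\<exists>T\<ge>1. \<forall>x t s. T \<le> t --> t \<le> s --> U x t - \<mu> * U x s + (\<mu> - 1) * 0 - \<eta> * (s - t) \<le> (\<mu> - 1) * (2 * B) + \<alpha>'"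
      by (rule key.gap[OF \<alpha>'])
  qed (use B_nonneg in simp)
qed

end

theorem theorem2p4:
  fixes \<sigma> :: "'th::metric_space \<Rightarrow> real^'n \<Rightarrow> real^'n^'n"
    and H :: "'th \<Rightarrow> real^'n \<Rightarrow> real^'n \<Rightarrow> real"
    and C :: real and CR :: "real \<Rightarrow> real"
    and u :: "real^'n \<Rightarrow> real \<Rightarrow> real"
    and c \<kappa> :: real
  assumes C_pos: "C > 0"
    and sigma_per: "\<forall>\<theta>. periodic_fun (\<sigma> \<theta>)"
    and sigma_bd: "\<forall>\<theta> x. norm (\<sigma> \<theta> x) \<le> C"
    and sigma_lip: "\<forall>\<theta> x y. norm (\<sigma> \<theta> x - \<sigma> \<theta> y) \<le> C * dist x y"
    and H_per: "\<forall>\<theta> p. periodic_fun (\<lambda>x. H \<theta> x p)"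
    and H_zero: "\<forall>\<theta> x. \<bar>H \<theta> x 0\<bar> \<le> C"
    and H_lip: "\<forall>R>0. CR R > 0 \<and> (\<forall>\<theta> x y p q. norm p \<le> R \<longrightarrow> norm q \<le> R \<longrightarrow>
                  \<bar>H \<theta> x p - H \<theta> y q\<bar> \<le> CR R * (dist x y + dist p q))"
    and u_cont: "continuous_on (UNIV \<times> {0..}) (\<lambda>(x, t). u x t)"
    and u_per: "\<forall>t\<ge>0. periodic_fun (\<lambda>x. u x t)"
    and u_lip: "\<forall>t\<ge>0. \<forall>x y. \<bar>u x t - u y t\<bar> \<le> C * dist x y"
    and u_sol: "visc_sol_evol (bellman \<sigma> H) u"
    and v_lambda: "\<forall>lam>0. \<exists>v. periodic_fun v \<and> (\<forall>x y. \<bar>v x - v y\<bar> \<le> C * dist x y) \<and>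
                     visc_sol (\<lambda>x r p X. lam * r + bellman \<sigma> H x p X) v"
    and ergodic: "\<exists>v L. periodic_fun v \<and> (\<forall>x y. \<bar>v x - v y\<bar> \<le> L * dist x y) \<and>
                     visc_sol (\<lambda>x r p X. bellman \<sigma> H x p X - c) v"
    and kappa: "\<kappa> \<ge> CR (2 * C)"
    and SS: "SS_cond \<sigma> \<kappa>"
    and AB: "((\<forall>\<theta> x. convex_on UNIV (H \<theta> x)) \<and>
              (\<forall>x\<in>degen_set \<sigma>. \<forall>lam p q. 0 < lam \<longrightarrow> lam < 1 \<longrightarrow> p \<noteq> q \<longrightarrow>
                 (INF \<theta>. lam * H \<theta> x p + (1 - lam) * H \<theta> x q - H \<theta> x (lam *\<^sub>R p + (1 - lam) *\<^sub>R q)) > 0))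
           \<or>
             (\<exists>\<mu>0>1.
               (\<forall>\<theta> x p \<mu>. 1 < \<mu> \<longrightarrow> \<mu> < \<mu>0 \<longrightarrow> H \<theta> x (\<mu> *\<^sub>R p) - \<mu> * H \<theta> x p \<ge> (1 - \<mu>) * c) \<and>
               (\<exists>K. closed K \<and> periodic_set K \<and> K \<subseteq> degen_set \<sigma> \<and>
                  (\<forall>\<theta>. \<forall>x\<in>K. \<forall>p. H \<theta> x p \<ge> c) \<and>
                  (\<forall>x\<in>degen_set \<sigma>. (K = {} \<or> infdist x K \<noteq> 0) \<longrightarrow>
                     (\<forall>p \<mu>. p \<noteq> 0 \<longrightarrow> 1 < \<mu> \<longrightarrow> \<mu> \<le> \<mu>0 \<longrightarrow>
                        (INF \<theta>. H \<theta> x (\<mu> *\<^sub>R p) - \<mu> * H \<theta> x p) > (1 - \<mu>) * c))))"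
  shows "\<exists>w. periodic_fun w \<and> visc_sol (\<lambda>x r p X. bellman \<sigma> H x p X - c) w \<and>
             uniform_limit UNIV (\<lambda>t x. u x t + c * t) w at_top"
proof -
  interpret evol: hjb_evol \<sigma> H C CR u c
  proof
    show "C > 0" by (rule C_pos)
    show "norm (\<sigma> \<theta> x) \<le> C" for \<theta> x using sigma_bd by blast
    show "norm (\<sigma> \<theta> x - \<sigma> \<theta> y) \<le> C * dist x y" for \<theta> x y using sigma_lip by blast
    show "\<bar>H \<theta> x 0\<bar> \<le> C" for \<theta> x using H_zero by blast
    show "CR R > 0" if "R > 0" for R using H_lip that by blast
    show "\<bar>H \<theta> x p - H \<theta> y q\<bar> \<le> CR R * (dist x y + dist p q)" if "R > 0" "norm p \<le> R" "norm q \<le> R" for R \<theta> x y p q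
      using H_lip that by blast
    show "continuous_on (UNIV \<times> {0..}) (\<lambda>(x, t). u x t)" by (rule u_cont)
    show "periodic_fun (\<lambda>x. u x t)" if "t \<ge> 0" for t using u_per that by blast
    show "\<bar>u x t - u y t\<bar> \<le> C * dist x y" if "t \<ge> 0" for t x y using u_lip that by blast
    show "visc_sol_evol (bellman \<sigma> H) u" by (rule u_sol)
  qed
  obtain v L where v: "periodic_fun v" "\<And>x y. \<bar>v x - v y\<bar> \<le> L * dist x y" "visc_sol (\<lambda>x r p X. bellman \<sigma> H x p X - c) v"
    using ergodic by blast
  obtain B where B: "\<And>x t. 0 \<le> t \<Longrightarrow> \<bar>evol.U x t\<bar> \<le> B"
    using evol.U_bounded[OF v(1,3) v(2)[unfolded dist_norm]] by blast
  interpret bdd: hjb_bounded \<sigma> H C CR u c B by unfold_locales (rule B)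
  have per: "periodic_fun (\<sigma> \<theta>)" for \<theta> using sigma_per by blast
  have mono: bdd.almost_nonincreasing
    using AB
  proof
    assume A: "(\<forall>\<theta> x. convex_on UNIV (H \<theta> x)) \<and>
      (\<forall>x\<in>degen_set \<sigma>. \<forall>lam p q. 0 < lam \<longrightarrow> lam < 1 \<longrightarrow> p \<noteq> q \<longrightarrow>
         (INF \<theta>. lam * H \<theta> x p + (1 - lam) * H \<theta> x q - H \<theta> x (lam *\<^sub>R p + (1 - lam) *\<^sub>R q)) > 0)"
    show ?thesis by (rule bdd.almost_monotone_convex[OF per SS kappa]) (use A in auto)
  next
    assume "\<exists>\<mu>0>1.
       (\<forall>\<theta> x p \<mu>. 1 < \<mu> \<longrightarrow> \<mu> < \<mu>0 \<longrightarrow> H \<theta> x (\<mu> *\<^sub>R p) - \<mu> * H \<theta> x p \<ge> (1 - \<mu>) * c) \<and>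
       (\<exists>K. closed K \<and> periodic_set K \<and> K \<subseteq> degen_set \<sigma> \<and> (\<forall>\<theta>. \<forall>x\<in>K. \<forall>p. H \<theta> x p \<ge> c) \<and>
          (\<forall>x\<in>degen_set \<sigma>. (K = {} \<or> infdist x K \<noteq> 0) \<longrightarrow>
             (\<forall>p \<mu>. p \<noteq> 0 \<longrightarrow> 1 < \<mu> \<longrightarrow> \<mu> \<le> \<mu>0 \<longrightarrow> (INF \<theta>. H \<theta> x (\<mu> *\<^sub>R p) - \<mu> * H \<theta> x p) > (1 - \<mu>) * c)))"
    then obtain \<mu>0 K where Bc: "\<mu>0 > 1"
      "\<forall>\<theta> x p \<mu>. 1 < \<mu> \<longrightarrow> \<mu> < \<mu>0 \<longrightarrow> H \<theta> x (\<mu> *\<^sub>R p) - \<mu> * H \<theta> x p \<ge> (1 - \<mu>) * c"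
      "closed K" "K \<subseteq> degen_set \<sigma>" "\<forall>\<theta>. \<forall>x\<in>K. \<forall>p. H \<theta> x p \<ge> c"
      "\<forall>x\<in>degen_set \<sigma>. (K = {} \<or> infdist x K \<noteq> 0) \<longrightarrow>
             (\<forall>p \<mu>. p \<noteq> 0 \<longrightarrow> 1 < \<mu> \<longrightarrow> \<mu> \<le> \<mu>0 \<longrightarrow> (INF \<theta>. H \<theta> x (\<mu> *\<^sub>R p) - \<mu> * H \<theta> x p) > (1 - \<mu>) * c)"
      by (elim exE conjE) (rule that)
    show ?thesis by (rule bdd.almost_monotone_nonconvex[OF per SS kappa Bc(1) _ Bc(3,4)])
        (rule Bc(2)[rule_format] Bc(5)[rule_format] Bc(6)[rule_format]; assumption)+
  qed
  have "(\<lambda>t x. evol.U x t) = (\<lambda>t x. u x t + c * t)" by (intro ext) (simp add: evol.U_def)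
  with bdd.convergence_of_almost_monotone[OF mono] show ?thesis by simp
qed

end
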